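(* Let $\mathbb{K}$ be an algebraically closed field of characteristic $p>0$, and let $X$ be a normal toric surface over $\mathbb{K}$. Then the iteration of normalized Nash blowups desingularizes $X$: setting $X_0=X$ and, for $i\ge 0$, letting $X_{i+1}$ be the normalization of the Nash blowup $X_i^*$ of $X_i$, there exists $m\ge 0$ such that $X_m$ is nonsingular.
   Context: Toric variety: given a semigroup $\Gamma\subseteq\mathbb{Z}^d$ generated (over $\mathbb{N}$, including $0$) by $\{\gamma_1,\ldots,\gamma_n\}$ and generating $\mathbb{Z}^d$ as a group, consider the $\mathbb{K}$-algebra homomorphism $\pi_\Gamma:\mathbb{K}[x_1,\ldots,x_n]\to\mathbb{K}[t_1^{\pm},\ldots,t_d^{\pm}]$, $x_i\mapsto t^{\gamma_i}$, and let $I_\Gamma=\ker\pi_\Gamma$. The toric variety defined by $\Gamma$ is $X_\Gamma=\mathbf{V}(I_\Gamma)\subseteq\mathbb{K}^n$. A normal toric surface is such an $X_\Gamma$ with $d=2$ that is normal; equivalently $\Gamma=\check\sigma\cap\mathbb{Z}^2$, where $\sigma\subseteq\mathbb{R}^2$ is a strongly convex rational polyhedral cone and $\check\sigma\subseteq\mathbb{R}^2$ is its dual cone. (The singular case is the one where $\sigma$ is 2-dimensional and nonregular, i.e. not generated by a $\mathbb{Z}$-basis of $\mathbb{Z}^2$.) Nash blowup: for an equidimensional algebraic variety $X\subseteq\mathbb{K}^n$ of dimension $d$, consider the Gauss map $G:X\setminus\mathrm{Sing}(X)\to\mathrm{Gr}(d,n)$, $x\mapsto T_xX$, where $\mathrm{Gr}(d,n)$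 is the Grassmannian of $d$-dimensional vector subspaces of $\mathbb{K}^n$ and $T_xX$ is the tangent space to $X$ at $x$. Let $X^*$ be the Zariski closure of the graph of $G$ in $X\times\mathrm{Gr}(d,n)$, and let $\nu:X^*\to X$ be the restriction of the projection to $X$. The pair $(X^*,\nu)$ is the Nash blowup of $X$. This construction does not depend on the affine embedding and is compatible with restriction to open subsets, so for a non-affine variety the Nash blowup is obtained by gluing the Nash blowups of the members of an affine open cover. The normalized Nash blowup of $X$ is the normalization of $X^*$, with its natural morphism to $X$. *)

theory Defs
  imports
    "HOL-Analysis.Analysis"
    "HOL-Library.Poly_Mapping"
    "HOL-Library.Function_Algebras"
begin

text \<open>
  A polynomial in \<open>x\<^sub>0, x\<^sub>1, \<dots>\<close> is a finitely supported map from exponent vectors to coefficients.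
\<close>

type_synonym 'k pol = "(nat \<Rightarrow>\<^sub>0 nat) \<Rightarrow>\<^sub>0 'k"

definition pols :: "nat \<Rightarrow> ('k::comm_ring_1) pol set" where
  "pols n = {f. \<forall>m\<in>Poly_Mapping.keys f. Poly_Mapping.keys m \<subseteq> {..<n}}"

definition pol_eval :: "('k::comm_ring_1) pol \<Rightarrow> (nat \<Rightarrow> 'k) \<Rightarrow> 'k" where
  "pol_eval f x = (\<Sum>m\<in>Poly_Mapping.keys f. Poly_Mapping.lookup f m *
     (\<Prod>i\<in>Poly_Mapping.keys m. x i ^ Poly_Mapping.lookup m i))"

definition pol_deriv :: "nat \<Rightarrow> ('k::comm_ring_1) pol \<Rightarrow> 'k pol" where
  "pol_deriv i f = (\<Sum>m\<in>Poly_Mapping.keys f. Poly_Mapping.single (m - Poly_Mapping.single i 1)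
     (of_nat (Poly_Mapping.lookup m i) * Poly_Mapping.lookup f m))"

text \<open>\<open>K\<^sup>n\<close> is realised as the sequences supported on \<open>{..<n}\<close>, so that \<open>n\<close> can vary.\<close>

definition Kn :: "nat \<Rightarrow> (nat \<Rightarrow> 'k::zero) set" where
  "Kn n = {x. \<forall>i\<ge>n. x i = 0}"

definition vscale :: "'k::field \<Rightarrow> (nat \<Rightarrow> 'k) \<Rightarrow> (nat \<Rightarrow> 'k)" where
  "vscale c v = (\<lambda>i. c * v i)"

interpretation kvec: vector_space "vscale :: 'k::field \<Rightarrow> (nat \<Rightarrow> 'k) \<Rightarrow> (nat \<Rightarrow> 'k)"
  by unfold_locales (auto simp: vscale_def fun_eq_iff algebra_simps)

text \<open>The principal open sets form a base of the Zariski topology.\<close>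

definition zariski :: "nat \<Rightarrow> (nat \<Rightarrow> 'k::field) topology" where
  "zariski n = topology_generated_by {{x \<in> Kn n. pol_eval f x \<noteq> 0} | f. f \<in> pols n}"

definition zero_locus :: "nat \<Rightarrow> ('k::field) pol set \<Rightarrow> (nat \<Rightarrow> 'k) set" where
  "zero_locus n S = {x \<in> Kn n. \<forall>f\<in>S. pol_eval f x = 0}"

definition vanishing_ideal :: "nat \<Rightarrow> (nat \<Rightarrow> 'k::field) set \<Rightarrow> 'k pol set" where
  "vanishing_ideal n V = {f \<in> pols n. \<forall>x\<in>V. pol_eval f x = 0}"

text \<open>
  Varieties over an algebraically closed field are taken in the classical sense, as topological
  spaces of closed points with a sheaf of \<open>K\<close>-valued functions: \<open>kreg X U f\<close> says that \<open>U\<close> is open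
  and that the restriction of \<open>f\<close> to \<open>U\<close> is regular.  The values of \<open>f\<close> outside \<open>U\<close> are irrelevant.
\<close>

record ('a, 'k) kspace =
  ktop :: "'a topology"
  kreg :: "'a set \<Rightarrow> ('a \<Rightarrow> 'k) \<Rightarrow> bool"

abbreviation pts :: "('a, 'k) kspace \<Rightarrow> 'a set" where
  "pts X \<equiv> topspace (ktop X)"

definition preim :: "('a, 'k) kspace \<Rightarrow> ('a \<Rightarrow> 'b) \<Rightarrow> 'b set \<Rightarrow> 'a set" where
  "preim X \<phi> U = {x \<in> pts X. \<phi> x \<in> U}"

definition function_sheaf :: "('a, 'k) kspace \<Rightarrow> bool" where
  "function_sheaf X \<longleftrightarrow>
     (\<forall>U f g. kreg X U f \<longrightarrow> (\<forall>x\<in>U. f x = g x) \<longrightarrow> kreg X U g) \<and>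
     (\<forall>U f. kreg X U f \<longleftrightarrow>
        openin (ktop X) U \<and> (\<forall>x\<in>U. \<exists>W. x \<in> W \<and> W \<subseteq> U \<and> kreg X W f))"

definition induced :: "('a, 'k) kspace \<Rightarrow> 'a set \<Rightarrow> ('a, 'k) kspace" where
  "induced X S = \<lparr>ktop = subtopology (ktop X) S,
     kreg = (\<lambda>U f. openin (subtopology (ktop X) S) U \<and>
       (\<forall>x\<in>U. \<exists>W g. x \<in> W \<and> kreg X W g \<and> (\<forall>y\<in>W \<inter> U. f y = g y)))\<rparr>"

definition morphism :: "('a, 'k) kspace \<Rightarrow> ('b, 'k) kspace \<Rightarrow> ('a \<Rightarrow> 'b) \<Rightarrow> bool" where
  "morphism X Y \<phi> \<longleftrightarrow> continuous_map (ktop X) (ktop Y) \<phi> \<and>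
     (\<forall>U f. kreg Y U f \<longrightarrow> kreg X (preim X \<phi> U) (f \<circ> \<phi>))"

definition isomorphism :: "('a, 'k) kspace \<Rightarrow> ('b, 'k) kspace \<Rightarrow> ('a \<Rightarrow> 'b) \<Rightarrow> bool" where
  "isomorphism X Y \<phi> \<longleftrightarrow> homeomorphic_map (ktop X) (ktop Y) \<phi> \<and>
     (\<forall>U f. openin (ktop Y) U \<longrightarrow> (kreg Y U f \<longleftrightarrow> kreg X (preim X \<phi> U) (f \<circ> \<phi>)))"

definition isomorphic :: "('a, 'k) kspace \<Rightarrow> ('b, 'k) kspace \<Rightarrow> bool" where
  "isomorphic X Y \<longleftrightarrow> (\<exists>\<phi>. isomorphism X Y \<phi>)"

definition affine_space :: "nat \<Rightarrow> (nat \<Rightarrow> 'k, 'k::field) kspace" where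
  "affine_space n = \<lparr>ktop = zariski n,
     kreg = (\<lambda>U f. openin (zariski n) U \<and>
       (\<forall>x\<in>U. \<exists>g\<in>pols n. \<exists>h\<in>pols n. pol_eval h x \<noteq> 0 \<and>
          (\<forall>y\<in>U. pol_eval h y \<noteq> 0 \<longrightarrow> f y = pol_eval g y / pol_eval h y)))\<rparr>"

definition affine_variety :: "nat \<Rightarrow> (nat \<Rightarrow> 'k::field) set \<Rightarrow> (nat \<Rightarrow> 'k, 'k) kspace" where
  "affine_variety n V = induced (affine_space n) V"

definition affine_chart ::
    "('a, 'k::field) kspace \<Rightarrow> 'a set \<Rightarrow> nat \<Rightarrow> (nat \<Rightarrow> 'k) set \<Rightarrow> ('a \<Rightarrow> nat \<Rightarrow> 'k) \<Rightarrow> bool" where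
  "affine_chart X U n V \<phi> \<longleftrightarrow> openin (ktop X) U \<and> closedin (zariski n) V \<and>
     isomorphism (induced X U) (affine_variety n V) \<phi>"

definition affine_open :: "('a, 'k::field) kspace \<Rightarrow> 'a set \<Rightarrow> bool" where
  "affine_open X U \<longleftrightarrow> (\<exists>n V \<phi>. affine_chart X U n V \<phi>)"

text \<open>
  Separatedness is not part of the definition.  It holds automatically for the spaces obtained from
  an affine variety by Nash blowups and normalizations, whose structure maps are separated.
\<close>

definition variety :: "('a, 'k::field) kspace \<Rightarrow> bool" where
  "variety X \<longleftrightarrow> function_sheaf X \<and> (\<exists>\<U>. finite \<U> \<and> (\<forall>U\<in>\<U>. affine_open X U) \<and> \<Union>\<U> = pts X)"

definition irreducible_in :: "'a topology \<Rightarrow> 'a set \<Rightarrow> bool" where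
  "irreducible_in T S \<longleftrightarrow> S \<subseteq> topspace T \<and> S \<noteq> {} \<and>
     (\<forall>A B. closedin T A \<longrightarrow> closedin T B \<longrightarrow> S \<subseteq> A \<union> B \<longrightarrow> S \<subseteq> A \<or> S \<subseteq> B)"

definition irreducible_component :: "'a topology \<Rightarrow> 'a set \<Rightarrow> bool" where
  "irreducible_component T S \<longleftrightarrow> irreducible_in T S \<and> (\<forall>S'. irreducible_in T S' \<longrightarrow> S \<subseteq> S' \<longrightarrow> S' = S)"

definition irreducible_chain :: "'a topology \<Rightarrow> nat \<Rightarrow> bool" where
  "irreducible_chain T d \<longleftrightarrow> (\<exists>C :: nat \<Rightarrow> 'a set.
     (\<forall>i\<le>d. closedin T (C i) \<and> irreducible_in T (C i)) \<and> (\<forall>i<d. C i \<subset> C (Suc i)))"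

definition krull_dim_eq :: "'a topology \<Rightarrow> nat \<Rightarrow> bool" where
  "krull_dim_eq T d \<longleftrightarrow> irreducible_chain T d \<and> \<not> irreducible_chain T (Suc d)"

definition equidimensional :: "nat \<Rightarrow> ('a, 'k) kspace \<Rightarrow> bool" where
  "equidimensional d X \<longleftrightarrow>
     (\<forall>S. irreducible_component (ktop X) S \<longrightarrow> krull_dim_eq (subtopology (ktop X) S) d)"

definition tangent_space :: "nat \<Rightarrow> (nat \<Rightarrow> 'k::field) set \<Rightarrow> (nat \<Rightarrow> 'k) \<Rightarrow> (nat \<Rightarrow> 'k) set" where
  "tangent_space n V x =
     {v \<in> Kn n. \<forall>f\<in>vanishing_ideal n V. (\<Sum>i<n. pol_eval (pol_deriv i f) x * v i) = 0}"

text \<open>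
  This is the singular locus only if \<open>V\<close> is closed in \<open>K\<^sup>n\<close> and equidimensional of dimension \<open>d\<close>;
  equidimensionality is required wherever \<open>Sing\<close> is used below.
\<close>

definition Sing :: "nat \<Rightarrow> nat \<Rightarrow> (nat \<Rightarrow> 'k::field) set \<Rightarrow> (nat \<Rightarrow> 'k) set" where
  "Sing d n V = {x \<in> V. kvec.dim (tangent_space n V x) \<noteq> d}"

definition nonsingular_variety :: "nat \<Rightarrow> ('a, 'k::field) kspace \<Rightarrow> bool" where
  "nonsingular_variety d X \<longleftrightarrow> variety X \<and> equidimensional d X \<and>
     (\<forall>x\<in>pts X. \<exists>U n V \<phi>. x \<in> U \<and> affine_chart X U n V \<phi> \<and> \<phi> x \<notin> Sing d n V)"

definition Gr :: "nat \<Rightarrow> nat \<Rightarrow> (nat \<Rightarrow> 'k::field) set set" where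
  "Gr d n = {W. kvec.subspace W \<and> W \<subseteq> Kn n \<and> kvec.dim W = d}"

text \<open>
  \<open>Gr d n\<close> is the quotient of the variety of \<open>d\<close>-frames in \<open>K\<^sup>n\<close> (the \<open>d \<times> n\<close> matrices of rank \<open>d\<close>)
  by \<open>GL\<^sub>d\<close>, a frame being sent to its span.  This quotient is a principal bundle that is trivial
  over the standard affine charts of the Grassmannian, so that also the product
  \<open>K\<^sup>n \<times> Gr d n\<close> carries the quotient structure of \<open>K\<^sup>n \<times> {frames}\<close>: a set is open, and a function is
  regular, iff its pullback is.  A pair of a point and a frame is stored as
  a point \<open>z\<close> of \<open>K\<^bsup>n + dn\<^esup>\<close>; vector number \<open>j\<close> occupies the coordinates \<open>n + jn, \<dots>, n + jn + n - 1\<close>.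
\<close>

definition frame_point :: "nat \<Rightarrow> (nat \<Rightarrow> 'k::field) \<Rightarrow> nat \<Rightarrow> 'k" where
  "frame_point n z = (\<lambda>i. if i < n then z i else 0)"

definition frame_vec :: "nat \<Rightarrow> (nat \<Rightarrow> 'k::field) \<Rightarrow> nat \<Rightarrow> nat \<Rightarrow> 'k" where
  "frame_vec n z j = (\<lambda>i. if i < n then z (n + j * n + i) else 0)"

definition frame_span :: "nat \<Rightarrow> nat \<Rightarrow> (nat \<Rightarrow> 'k::field) \<Rightarrow> (nat \<Rightarrow> 'k) set" where
  "frame_span d n z = kvec.span (frame_vec n z ` {..<d})"

definition frames :: "nat \<Rightarrow> nat \<Rightarrow> (nat \<Rightarrow> 'k, 'k::field) kspace" where
  "frames d n = induced (affine_space (n + d * n)) {z \<in> Kn (n + d * n). frame_span d n z \<in> Gr d n}"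

definition frame_proj :: "nat \<Rightarrow> nat \<Rightarrow> (nat \<Rightarrow> 'k::field) \<Rightarrow> (nat \<Rightarrow> 'k) \<times> (nat \<Rightarrow> 'k) set" where
  "frame_proj d n z = (frame_point n z, frame_span d n z)"

definition Kn_Gr :: "nat \<Rightarrow> nat \<Rightarrow> ((nat \<Rightarrow> 'k) \<times> (nat \<Rightarrow> 'k) set, 'k::field) kspace" where
  "Kn_Gr d n = (let op = (\<lambda>U. U \<subseteq> Kn n \<times> Gr d n \<and>
         openin (ktop (frames d n)) (preim (frames d n) (frame_proj d n) U))
     in \<lparr>ktop = topology op,
         kreg = (\<lambda>U f. op U \<and>
           kreg (frames d n) (preim (frames d n) (frame_proj d n) U) (f \<circ> frame_proj d n))\<rparr>)"

lemma openin_Kn_Gr: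
  fixes U :: "((nat \<Rightarrow> 'k::field) \<times> (nat \<Rightarrow> 'k) set) set"
  shows "openin (ktop (Kn_Gr d n)) U \<longleftrightarrow> U \<subseteq> Kn n \<times> Gr d n \<and>
     openin (ktop (frames d n)) (preim (frames d n) (frame_proj d n) U)"
proof -
  let ?op = "\<lambda>U :: ((nat \<Rightarrow> 'k) \<times> (nat \<Rightarrow> 'k) set) set. U \<subseteq> Kn n \<times> Gr d n \<and>
     openin (ktop (frames d n)) (preim (frames d n) (frame_proj d n) U)"
  have I: "preim X \<phi> (S \<inter> T) = preim X \<phi> S \<inter> preim X \<phi> T"
    and Un: "preim X \<phi> (\<Union>\<K>) = (\<Union>S\<in>\<K>. preim X \<phi> S)"
    for X :: "('x, 'y) kspace" and \<phi> :: "'x \<Rightarrow> 'z" and S T \<K>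
    by (auto simp: preim_def)
  have "istopology ?op"
    unfolding istopology_def by (auto simp: I Un intro!: openin_Int)
  from topology_inverse'[OF this] show ?thesis
    by (simp add: Kn_Gr_def Let_def)
qed

definition gauss_graph :: "nat \<Rightarrow> nat \<Rightarrow> (nat \<Rightarrow> 'k::field) set \<Rightarrow> ((nat \<Rightarrow> 'k) \<times> (nat \<Rightarrow> 'k) set) set" where
  "gauss_graph d n V = {(x, tangent_space n V x) | x. x \<in> V - Sing d n V}"

definition affine_nash ::
    "nat \<Rightarrow> nat \<Rightarrow> (nat \<Rightarrow> 'k::field) set \<Rightarrow> ((nat \<Rightarrow> 'k) \<times> (nat \<Rightarrow> 'k) set, 'k) kspace" where
  "affine_nash d n V = induced (Kn_Gr d n) (ktop (Kn_Gr d n) closure_of gauss_graph d n V)"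

text \<open>
  \<open>(Z, \<nu>)\<close> is a Nash blowup of \<open>X\<close> if it is glued from the Nash blowups of the members of
  some affine open cover.  As those are compatible with restriction to open subsets, this
  determines \<open>(Z, \<nu>)\<close> up to unique isomorphism over \<open>X\<close>.
\<close>

definition nash_blowup :: "nat \<Rightarrow> ('a, 'k::field) kspace \<Rightarrow> ('b, 'k) kspace \<Rightarrow> ('b \<Rightarrow> 'a) \<Rightarrow> bool" where
  "nash_blowup d X Z \<nu> \<longleftrightarrow> variety X \<and> equidimensional d X \<and> variety Z \<and> morphism Z X \<nu> \<and>
     (\<exists>\<U>. \<Union>\<U> = pts X \<and>
        (\<forall>U\<in>\<U>. \<exists>n V \<phi> \<psi>. affine_chart X U n V \<phi> \<and>
           isomorphism (induced Z (preim Z \<nu> U)) (affine_nash d n V) \<psi> \<and>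
           (\<forall>z\<in>preim Z \<nu> U. fst (\<psi> z) = \<phi> (\<nu> z))))"

definition germ_zero :: "('a, 'k::field) kspace \<Rightarrow> 'a \<Rightarrow> ('a \<Rightarrow> 'k) \<Rightarrow> bool" where
  "germ_zero X x f \<longleftrightarrow> (\<exists>W. openin (ktop X) W \<and> x \<in> W \<and> (\<forall>y\<in>W. f y = 0))"

text \<open>
  The local ring of germs at \<open>x\<close> is an integrally closed domain, written out on representatives
  over a common neighbourhood: it has no zero divisors, and whenever a quotient \<open>f/g\<close> of germs
  with \<open>g \<noteq> 0\<close> satisfies \<open>(f/g)\<^sup>k + \<Sum>\<^bsub>i<k\<^esub> a\<^sub>i (f/g)\<^sup>i = 0\<close>, then \<open>f/g\<close> is a germ.
\<close>

definition normal_at :: "('a, 'k::field) kspace \<Rightarrow> 'a \<Rightarrow> bool" where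
  "normal_at X x \<longleftrightarrow>
     (\<forall>U f g. x \<in> U \<and> kreg X U f \<and> kreg X U g \<and> (\<forall>y\<in>U. f y * g y = 0) \<longrightarrow>
        germ_zero X x f \<or> germ_zero X x g) \<and>
     (\<forall>U f g k a. x \<in> U \<and> kreg X U f \<and> kreg X U g \<and> \<not> germ_zero X x g \<and>
        (\<forall>i<k. kreg X U (a i)) \<and>
        (\<forall>y\<in>U. f y ^ k + (\<Sum>i<k. a i y * f y ^ i * g y ^ (k - i)) = 0) \<longrightarrow>
        (\<exists>W h. x \<in> W \<and> W \<subseteq> U \<and> kreg X W h \<and> (\<forall>y\<in>W. f y = h y * g y)))"

definition normal_variety :: "('a, 'k::field) kspace \<Rightarrow> bool" where
  "normal_variety X \<longleftrightarrow> variety X \<and> (\<forall>x\<in>pts X. normal_at X x)"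

definition finite_morphism :: "('a, 'k::field) kspace \<Rightarrow> ('b, 'k) kspace \<Rightarrow> ('a \<Rightarrow> 'b) \<Rightarrow> bool" where
  "finite_morphism Y Z \<eta> \<longleftrightarrow> morphism Y Z \<eta> \<and>
     (\<forall>U. affine_open Z U \<longrightarrow> affine_open Y (preim Y \<eta> U) \<and>
        (\<exists>B. finite B \<and> (\<forall>b\<in>B. kreg Y (preim Y \<eta> U) b) \<and>
           (\<forall>f. kreg Y (preim Y \<eta> U) f \<longrightarrow>
              (\<exists>a. (\<forall>b\<in>B. kreg Z U (a b)) \<and>
                 (\<forall>y\<in>preim Y \<eta> U. f y = (\<Sum>b\<in>B. a b (\<eta> y) * b y))))))"

definition birational_morphism :: "('a, 'k::field) kspace \<Rightarrow> ('b, 'k) kspace \<Rightarrow> ('a \<Rightarrow> 'b) \<Rightarrow> bool" where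
  "birational_morphism Y Z \<eta> \<longleftrightarrow> morphism Y Z \<eta> \<and>
     (\<exists>U. openin (ktop Z) U \<and> ktop Z closure_of U = pts Z \<and>
        ktop Y closure_of preim Y \<eta> U = pts Y \<and>
        isomorphism (induced Y (preim Y \<eta> U)) (induced Z U) \<eta>)"

definition normalization :: "('b, 'k::field) kspace \<Rightarrow> ('a, 'k) kspace \<Rightarrow> ('a \<Rightarrow> 'b) \<Rightarrow> bool" where
  "normalization Z Y \<eta> \<longleftrightarrow> variety Z \<and> normal_variety Y \<and>
     finite_morphism Y Z \<eta> \<and> birational_morphism Y Z \<eta>"

definition lattice_comb :: "nat \<Rightarrow> (nat \<Rightarrow> int \<times> int) \<Rightarrow> (nat \<Rightarrow> int) \<Rightarrow> int \<times> int" where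
  "lattice_comb n \<gamma> c = (\<Sum>i<n. (c i * fst (\<gamma> i), c i * snd (\<gamma> i)))"

definition generates_lattice :: "nat \<Rightarrow> (nat \<Rightarrow> int \<times> int) \<Rightarrow> bool" where
  "generates_lattice n \<gamma> \<longleftrightarrow> (\<forall>v. \<exists>c. v = lattice_comb n \<gamma> c)"

text \<open>
  The Laurent polynomial ring in two variables is the group ring of \<open>\<int>\<^sup>2\<close>; the homomorphism
  \<open>x\<^sub>i \<mapsto> t\<^bsup>\<gamma> i\<^esup>\<close> sends the monomial with exponent vector \<open>m\<close> to \<open>t\<close> to the power \<open>\<Sum>i. m\<^sub>i \<gamma>\<^sub>i\<close>.
\<close>

definition toric_hom ::
    "nat \<Rightarrow> (nat \<Rightarrow> int \<times> int) \<Rightarrow> ('k::comm_ring_1) pol \<Rightarrow> (int \<times> int) \<Rightarrow>\<^sub>0 'k" where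
  "toric_hom n \<gamma> f = (\<Sum>m\<in>Poly_Mapping.keys f. Poly_Mapping.single
     (lattice_comb n \<gamma> (\<lambda>i. int (Poly_Mapping.lookup m i))) (Poly_Mapping.lookup f m))"

definition toric_ideal :: "nat \<Rightarrow> (nat \<Rightarrow> int \<times> int) \<Rightarrow> ('k::comm_ring_1) pol set" where
  "toric_ideal n \<gamma> = {f \<in> pols n. toric_hom n \<gamma> f = 0}"

definition toric_surface :: "nat \<Rightarrow> (nat \<Rightarrow> int \<times> int) \<Rightarrow> (nat \<Rightarrow> 'k, 'k::field) kspace" where
  "toric_surface n \<gamma> = affine_variety n (zero_locus n (toric_ideal n \<gamma>))"

end

theory Submission
  imports Defs "HOL-Computational_Algebra.Computational_Algebra"
begin

text \<open>
  Points of the varieties in question are identified with places of \<open>K(s, t)\<close>. By induction, the local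
  ring of every point is the localization of the semigroup ring of a cone \<open>\<sigma>\<close> at the functions not
  vanishing there. The tangent planes have the Pluecker coordinates \<open>D\<^sub>1 f D\<^sub>2 g - D\<^sub>2 f D\<^sub>1 g\<close> with the
  logarithmic derivations \<open>D\<^sub>1, D\<^sub>2\<close>, and ratios of these generate the local rings of the Nash blowup. The
  monomials \<open>t\<^sup>a, t\<^sup>b\<close> contribute \<open>det (a, b) t\<^bsup>a + b\<^esup>\<close>, and the minimal exponent \<open>a + b\<close> is attained by
  neighbours in the Hilbert basis, whose determinant is 1 in any characteristic. Hence the cone of a
  point of the normalization is spanned by explicit vectors; \<open>2 det \<sigma>\<close>, increased by 1 if \<open>det \<sigma>\<close>
  divides the sum of the primitive generators, decreases until \<open>det \<sigma> = 1\<close>.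
\<close>

text \<open>In characteristic p the determinant of two independent exponents may vanish in K. A
  least exponent found among the pairs that survive must be traded for a sum of neighbours, and the
  exchange uses only that the exponents regular at a point form a saturated semigroup. The
  determinant of the cone alone is not a measure: if the Hilbert basis has one interior element and
  the determinant is odd, the next cone can have the same determinant, but then the sum of its
  generators is not divisible by it; hence the increment 1. A second obstacle is the sheaf axiom,
  which glues but does not restrict: normality and finiteness are stated for functions on a given
  open set and can be applied only to elements of the function field whose largest domain is exactly
  that set. Such elements are produced by generic combinations of powers of coordinates, using that
  K is infinite. All function fields are read inside K(s, t), so that local rings are compared by
  inclusion, and complete integral closedness of the semigroup rings replaces a computation of
  normalizations.\<close>

abbreviation (input) iff_ascii (infixr "<->" 25) where "A <-> B == A = B"
abbreviation "keys == Poly_Mapping.keys"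
abbreviation "lookup == Poly_Mapping.lookup"
abbreviation "single == Poly_Mapping.single"
abbreviation "pev == pol_eval"
abbreviation "tsp == tangent_space"
abbreviation "opn X == openin (ktop X)"
abbreviation "zopn n == openin (zariski n)"

subsection \<open>Polynomials\<close>

definition pconst :: "'k::comm_ring_1 => 'k pol" where "pconst a = single 0 a"

definition pvar :: "nat => 'k::comm_ring_1 pol" where "pvar i = single (single i 1) 1"

lemma poly_mapping_sum_singles: "(SUM m:keys f. single m (lookup f m)) = f"
proof (rule poly_mapping_eqI)
 fix k
 show "lookup (SUM m:keys f. single m (lookup f m)) k = lookup f k"
  by (simp add: lookup_sum lookup_single when_def sum.delta' in_keys_iff)
qed

lemma poly_mapping_single_induct [case_names zero single add]:
 fixes f :: "'a \<Rightarrow>\<^sub>0 'b::comm_monoid_add"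
 assumes "P 0" "!!m a. P (single m a)" "!!f g. P f ==> P g ==> P (f + g)"
 shows "P f"
proof -
 have "P (SUM m:M. single m (lookup f m))" if "finite M" for M using that by induction (auto intro: assms)
 from this[of "keys f"] show ?thesis by (simp add: poly_mapping_sum_singles)
qed

lemma single_in_pols: "keys m <= {..<n} ==> single m a : pols n" by (auto simp: pols_def split: if_splits)

lemma pols_0 [simp]: "0 : pols n" by (simp add: pols_def)

lemma pols_add [simp]: "f : pols n ==> g : pols n ==> f + g : pols n" unfolding pols_def using keys_add[of f g] by blast

lemma pols_sum: "(!!i. i : I ==> f i : pols n) ==> sum f I : pols n" by (induction I rule: infinite_finite_induct) auto

lemma pols_mult [simp]:
 assumes "f : pols n" "g : pols n"
 shows "f * g : pols n"
proof -
 have "keys m <= {..<n}" if "m : keys (f * g)" for m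
 proof -
  from that obtain a b where "m = a + b" "a : keys f" "b : keys g" using keys_mult[of f g] by blast
  thus ?thesis using keys_add[of a b] assms by (fastforce simp: pols_def)
 qed
 thus ?thesis by (auto simp: pols_def)
qed

lemma pols_uminus [simp]: "f : pols n ==> - f : pols n" by (simp add: pols_def)

lemma pols_diff [simp]: "f : pols n ==> g : pols n ==> f - g : pols n" using pols_add[of f n "- g"] by simp

lemma pols_pconst [simp]: "pconst a : pols n" unfolding pconst_def by (rule single_in_pols) simp

lemma pols_pvar [simp]: "i < n ==> pvar i : pols n" unfolding pvar_def by (rule single_in_pols) simp

lemma single_decompose:
 assumes "i : keys m"
 shows "m = single i (1::nat) + (m - single i 1)" by (rule poly_mapping_eqI)
  (insert assms, auto simp: lookup_add lookup_minus lookup_single when_def in_keys_iff)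

text \<open>Monomials are peeled off one variable at a time, by induction on their total degree; the
  polynomial is then rebuilt as the sum over \<open>keys f\<close>.\<close>

lemma pols_induct [consumes 1, case_names const var add]:
 fixes f :: "'k::comm_ring_1 pol"
 assumes f: "f : pols n"
  and c: "!!a. P (pconst a)"
  and v: "!!i f. i < n ==> f : pols n ==> P f ==> P (pvar i * f)"
  and s: "!!f g. f : pols n ==> g : pols n ==> P f ==> P g ==> P (f + g)"
 shows "P f"
proof -
 have P1: "P (single m a)" if "(SUM i<n. lookup m i) = d" "keys m <= {..<n}" for m a d using that
 proof (induction d arbitrary: m)
  case 0
  have "m = 0"
  proof (rule poly_mapping_eqI)
   fix k
   show "lookup m k = lookup 0 k" using 0 by (cases "k < n") (auto simp: in_keys_iff subset_iff)
  qed
  thus ?case using c[of a] by (simp add: pconst_def)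
 next
  case (Suc d)
  have "EX i<n. lookup m i ~= 0"
  proof (rule ccontr)
   assume "~ ?thesis"
   hence "(SUM i<n. lookup m i) = 0" by simp
   with Suc.prems show False by simp
  qed
  then obtain i where i: "i < n" "i : keys m" by (auto simp: in_keys_iff)
  define m' where "m' = m - single i 1"
  have m: "m = single i 1 + m'" unfolding m'_def by (rule single_decompose[OF i(2)])
  have k: "keys m' <= {..<n}"
  proof
   fix j assume "j : keys m'"
   hence "j : keys m" unfolding m'_def by (simp add: in_keys_iff lookup_minus)
   thus "j : {..<n}" using Suc.prems(2) by blast
  qed
  have "lookup m j = (if j = i then 1 else 0) + lookup m' j" for j
   using arg_cong[OF m, of "%m. lookup m j"] by (simp add: lookup_add lookup_single)
  hence "(SUM j<n. lookup m j) = (SUM j<n. (if j = i then 1 else 0) + lookup m' j)" by simp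
  also have "... = Suc (SUM j<n. lookup m' j)" using i(1) by (simp add: sum.distrib)
  finally have "(SUM j<n. lookup m' j) = d" using Suc.prems(1) by simp
  hence "P (single m' a)" using Suc.IH k by blast
  hence "P (pvar i * single m' a)" using v[OF i(1)] single_in_pols[OF k] by blast
  thus ?case by (subst m) (simp add: pvar_def mult_single)
 qed
 have "P (SUM m:M. single m (lookup f m)) & (SUM m:M. single m (lookup f m)) : pols n" if "finite M" "M <= keys f" for M
  using that
 proof induction
  case empty
  show ?case using c[of 0] by (simp add: pconst_def)
 next
  case (insert m M)
  have k: "keys m <= {..<n}" using insert.prems f by (auto simp: pols_def)
  show ?case using insert single_in_pols[OF k] P1[OF refl k] by (auto intro!: s)
 qed
 from this[of "keys f"] show ?thesis by (simp add: poly_mapping_sum_singles)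
qed

section \<open>Evaluation of polynomials in a K-algebra with structure map \<open>e\<close>\<close>

definition peval :: "('k::comm_ring_1 => 'r::comm_ring_1) => 'k pol => (nat => 'r) => 'r" where
 "peval e f x = (SUM m:keys f. e (lookup f m) * (PROD i:keys m. x i ^ lookup m i))"

lemma pol_eval_peval: "pev f x = peval id f x" by (simp add: pol_eval_def peval_def)

locale uring_hom =
 fixes e :: "'k::comm_ring_1 => 'r::comm_ring_1"
 assumes e_add: "e (a + b) = e a + e b" and e_mult: "e (a * b) = e a * e b" and e_1 [simp]: "e 1 = 1"
begin

lemma e_0 [simp]: "e 0 = 0" using e_add[of 0 0] by simp

lemma e_uminus: "e (- a) = - e a" using e_add[of a "- a"] by (simp add: eq_neg_iff_add_eq_0 add.commute)

lemma e_of_nat [simp]: "e (of_nat m) = of_nat m" by (induction m) (auto simp: e_add)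

lemma e_of_int [simp]: "e (of_int m) = of_int m" by (cases m rule: int_cases2) (auto simp: e_uminus)

lemma peval_superset:
 assumes "finite M" "keys f <= M"
 shows "peval e f x = (SUM m:M. e (lookup f m) * (PROD i:keys m. x i ^ lookup m i))"
 unfolding peval_def by (rule sum.mono_neutral_left) (insert assms, auto simp: in_keys_iff)

lemma peval_add [simp]: "peval e (f + g) x = peval e f x + peval e g x"
proof -
 let ?M = "keys f Un keys g"
 have "keys (f + g) <= ?M" by (rule keys_add)
 thus ?thesis by (simp add: peval_superset[of ?M] lookup_add e_add algebra_simps sum.distrib)
qed

lemma peval_0 [simp]: "peval e 0 x = 0" by (simp add: peval_def)

lemma peval_single: "peval e (single m a) x = e a * (PROD i:keys m. x i ^ lookup m i)" by (simp add: peval_def)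

lemma monomial_value_add:
 fixes m m' :: "nat \<Rightarrow>\<^sub>0 nat" and x :: "nat => 'r"
 shows "(PROD i:keys (m + m'). x i ^ lookup (m + m') i) = (PROD i:keys m. x i ^ lookup m i) *
  (PROD i:keys m'. x i ^ lookup m' i)"
proof -
 let ?M = "keys m Un keys m'"
 have sup: "(PROD i:keys k. x i ^ lookup k i) = (PROD i:?M. x i ^ lookup k i)" if "keys k <= ?M" for k
  by (rule prod.mono_neutral_left) (insert that, auto simp: in_keys_iff)
 have *: "keys (m + m') <= ?M" by (rule keys_add)
 have "(PROD i:keys (m + m'). x i ^ lookup (m + m') i) = (PROD i:?M. x i ^ lookup m i * x i ^ lookup m' i)"
  unfolding sup[OF *] by (simp add: lookup_add power_add)
 also have "... = (PROD i:?M. x i ^ lookup m i) * (PROD i:?M. x i ^ lookup m' i)" by (rule prod.distrib)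
 finally show ?thesis by (simp add: sup)
qed

lemma peval_mult [simp]: "peval e (f * g) x = peval e f x * peval e g x"
proof (induction f rule: poly_mapping_single_induct)
 case (single m a)
 show ?case
 proof (induction g rule: poly_mapping_single_induct)
  case (single m' b)
  show ?case by (simp add: mult_single peval_single monomial_value_add e_mult)
 qed (simp_all add: algebra_simps)
qed (simp_all add: algebra_simps)

lemma peval_pconst [simp]: "peval e (pconst a) x = e a" by (simp add: pconst_def peval_single)

lemma peval_pvar [simp]: "peval e (pvar i) x = x i" by (simp add: pvar_def peval_single)

lemma peval_uminus [simp]: "peval e (- f) x = - peval e f x"
 using peval_add[of f "- f" x] by (simp add: eq_neg_iff_add_eq_0 add.commute)

lemma peval_diff [simp]: "peval e (f - g) x = peval e f x - peval e g x" using peval_add[of f "- g" x] by simp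

end

interpretation pol_eval: uring_hom "id :: 'k::comm_ring_1 => 'k" rewrites "peval (id :: 'k => 'k) = pev"
 by unfold_locales (auto simp: fun_eq_iff pol_eval_peval)

lemmas pol_eval_simps [simp] = pol_eval.peval_add pol_eval.peval_mult pol_eval.peval_0
 pol_eval.peval_pconst[unfolded id_apply] pol_eval.peval_pvar pol_eval.peval_uminus pol_eval.peval_diff

section \<open>Partial derivatives and differentials of polynomials\<close>

lemma pol_deriv_superset:
 assumes "finite M" "keys f <= M"
 shows "pol_deriv i f = (SUM m:M. single (m - single i 1) (of_nat (lookup m i) * lookup f m))"
 unfolding pol_deriv_def by (rule sum.mono_neutral_left) (insert assms, auto simp: in_keys_iff)

lemma pol_deriv_add: "pol_deriv i (f + g) = pol_deriv i f + pol_deriv i g"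
proof -
 let ?M = "keys f Un keys g"
 have "keys (f + g) <= ?M" by (rule keys_add)
 thus ?thesis by (simp add: pol_deriv_superset[of ?M] lookup_add algebra_simps single_add sum.distrib)
qed

lemma pol_deriv_0 [simp]: "pol_deriv i 0 = 0" by (simp add: pol_deriv_def)

lemma pol_deriv_single: "pol_deriv i (single m a) = single (m - single i 1) (of_nat (lookup m i) * a)"
 by (simp add: pol_deriv_def)

lemma pol_deriv_pconst [simp]: "pol_deriv i (pconst a) = 0" by (simp add: pconst_def pol_deriv_single)

lemma pol_deriv_pvar_mult: "pol_deriv i (pvar j * f) = pvar j * pol_deriv i f + (if i = j then f else 0)"
proof (induction f rule: poly_mapping_single_induct)
 case (single m a)
 let ?e = "%i. single i (1::nat)"
 show ?case
 proof (cases "i : keys m")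
  case True
  have 1: "?e j + m - ?e i = ?e j + (m - ?e i)" by (rule poly_mapping_eqI)
    (insert True, auto simp: lookup_add lookup_minus lookup_single when_def in_keys_iff)
  have 2: "?e i + (m - ?e i) = m" using single_decompose[OF True] by simp
  show ?thesis using 1 2
   by (cases "i = j") (simp_all add: pvar_def mult_single pol_deriv_single lookup_add lookup_single
    distrib_right single_add add.commute[of a] del: One_nat_def)
 next
  case False
  have 1: "?e j + m - ?e i = m" if "i = j" by (rule poly_mapping_eqI)
    (insert that, auto simp: lookup_add lookup_minus lookup_single when_def in_keys_iff)
  have 2: "lookup m i = 0" using False by (simp add: in_keys_iff)
  show ?thesis using 1 2 by (simp add: pvar_def mult_single pol_deriv_single lookup_add lookup_single)
 qed
qed (auto simp: algebra_simps pol_deriv_add)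

lemma pols_pol_deriv [simp]: "f : pols n ==> pol_deriv i f : pols n"
 by (induction rule: pols_induct) (auto simp: pol_deriv_pvar_mult pol_deriv_add)

lemma pol_deriv_mult:
 assumes "f : pols n"
 shows "pol_deriv i (f * g) = pol_deriv i f * g + f * pol_deriv i g" using assms
proof (induction rule: pols_induct)
 case (const a)
 show ?case
 proof (induction g rule: poly_mapping_single_induct)
  case (single m b)
  show ?case by (simp add: pconst_def mult_single pol_deriv_single algebra_simps)
 qed (auto simp: algebra_simps pol_deriv_add)
next
 case (var j f)
 have "pol_deriv i (pvar j * f * g) = pol_deriv i (pvar j * (f * g))" by (simp add: mult.assoc)
 also have "... = pol_deriv i (pvar j * f) * g + pvar j * f * pol_deriv i g"
  unfolding pol_deriv_pvar_mult var.IH by (simp add: algebra_simps)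
 finally show ?case .
qed (auto simp: algebra_simps pol_deriv_add)

text \<open>The chain rule for derivations that kill constants. It turns an algebraic relation among
  coordinates into a linear equation for tangent vectors.\<close>

lemma (in uring_hom) dern_peval:
 assumes f: "f : pols n"
  and D: "!!a b. D (a + b) = D a + D b" "!!a b. D (a * b) = D a * b + a * D b" "!!a. D (e a) = 0"
 shows "D (peval e f x) = (SUM i<n. peval e (pol_deriv i f) x * D (x i))" using f
proof (induction rule: pols_induct)
 case (var j f)
 have "(SUM i<n. peval e (pol_deriv i (pvar j * f)) x * D (x i)) =
  (SUM i<n. x j * (peval e (pol_deriv i f) x * D (x i)) + (if i = j then peval e f x * D (x i) else 0))"
  unfolding pol_deriv_pvar_mult by (intro sum.cong) (auto simp: algebra_simps)
 also have "... = x j * D (peval e f x) + peval e f x * D (x j)"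
  using var.hyps(1) by (simp add: sum.distrib var.IH sum_distrib_left)
 finally show ?case by (simp add: D)
qed (auto simp: D pol_deriv_add algebra_simps sum.distrib)

definition dpol :: "nat => 'k::comm_ring_1 pol => (nat => 'k) => (nat => 'k) => 'k" where
 "dpol n f x v = (SUM i<n. pev (pol_deriv i f) x * v i)"

lemma dpol_add [simp]: "dpol n (f + g) x v = dpol n f x v + dpol n g x v"
 by (simp add: dpol_def pol_deriv_add algebra_simps sum.distrib)

lemma dpol_mult [simp]:
 assumes "f : pols n"
 shows "dpol n (f * g) x v = dpol n f x v * pev g x + pev f x * dpol n g x v"
 using assms by (simp add: dpol_def pol_deriv_mult algebra_simps sum.distrib sum_distrib_left)

lemma dpol_pconst [simp]: "dpol n (pconst a) x v = 0" by (simp add: dpol_def)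

lemma dpol_0 [simp]: "dpol n 0 x v = 0" by (simp add: dpol_def)

lemma dpol_uminus [simp]: "dpol n (- f) x v = - dpol n f x v"
 using dpol_add[of n f "- f" x v] by (simp add: eq_neg_iff_add_eq_0 add.commute)

lemma dpol_diff [simp]: "dpol n (f - g) x v = dpol n f x v - dpol n g x v" using dpol_add[of n f "- g" x v] by simp

lemma dpol_pvar [simp]: "i < n ==> dpol n (pvar i) x v = v i"
proof -
 assume "i < n"
 have "pol_deriv j (pvar i :: 'a pol) = (if j = i then 1 else 0)" for j
  using pol_deriv_pvar_mult[of j i "pconst (1::'a)"] pol_deriv_pconst[of j "1::'a"]
  by (cases "j = i") (simp_all add: pconst_def)
 hence "dpol n (pvar i) x v = (SUM j<n. if j = i then v j else 0)"
  unfolding dpol_def using pol_eval_simps(4)[of "1::'a" x]  by (intro sum.cong) (auto simp: pconst_def)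
 thus ?thesis using `i < n` by simp
qed

lemma dpol_linear: "dpol n f x (%i. a * v i + b * w i) = a * dpol n f x v + b * dpol n f x w"
 by (simp add: dpol_def algebra_simps sum.distrib sum_distrib_left)

subsection \<open>Spaces with functions\<close>

text \<open>The sheaf properties used throughout: in addition to gluing these are restriction, the
  ring operations, and invertibility of a function where it does not vanish.\<close>

locale ringed_space =
 fixes X :: "('a, 'k::field) kspace"
 assumes reg_open: "kreg X W f ==> opn X W"
  and reg_cong: "kreg X W f ==> (!!x. x : W ==> f x = g x) ==> kreg X W g"
  and restrict: "kreg X W f ==> opn X W' ==> W' <= W ==> kreg X W' f"
  and glue: "opn X W ==> (!!x. x : W ==> EX N. x : N & kreg X N f) ==> kreg X W f"
  and const: "opn X W ==> kreg X W (%_. c)"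
  and add: "kreg X W f ==> kreg X W g ==> kreg X W (%x. f x + g x)"
  and mult: "kreg X W f ==> kreg X W g ==> kreg X W (%x. f x * g x)"
  and nonzero: "kreg X W f ==> opn X {x : W. f x ~= 0}"
  and inv: "kreg X W f ==> kreg X {x : W. f x ~= 0} (%x. inverse (f x))"

definition ringed :: "('a, 'k::field) kspace => bool" where "ringed X <-> ringed_space X"

lemmas ringed_open = ringed_space.reg_open[folded ringed_def] and ringed_cong = ringed_space.reg_cong[folded ringed_def]
 and ringed_restrict = ringed_space.restrict[folded ringed_def] and ringed_glue = ringed_space.glue[folded ringed_def]
 and ringed_const = ringed_space.const[folded ringed_def] and ringed_add = ringed_space.add[folded ringed_def]
 and ringed_mult = ringed_space.mult[folded ringed_def]
 and ringed_nonzero = ringed_space.nonzero[folded ringed_def]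
 and ringed_inverse = ringed_space.inv[folded ringed_def]

text \<open>A criterion for affine space, for induced subspaces and for \<open>hat\<close>: in each
  case regular means locally equal to a member of a family \<open>B\<close> of functions on open
  sets of an ambient topology \<open>T\<close>, and only closure properties of \<open>B\<close>
  remain to be checked.\<close>

lemma ringed_germwise:
 fixes X :: "('a, 'k::field) kspace"
 assumes S: "ktop X = subtopology T S"
  and reg: "!!W f. kreg X W f <-> opn X W & (ALL x:W. EX N g. x : N & B N g & (ALL y:N Int W. f y = g y))"
  and o: "!!N g. B N g ==> openin T N"
  and r: "!!N N' g. B N g ==> openin T N' ==> N' <= N ==> B N' g"
  and c: "!!x c. x : topspace T ==> EX N. x : N & B N (%_. c)"
  and am: "!!N f g. B N f ==> B N g ==> B N (%x. f x + g x) & B N (%x. f x * g x)"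
  and i: "!!N f. B N f ==> openin T {x : N. f x ~= 0} & B {x : N. f x ~= 0} (%x. inverse (f x))"
 shows "ringed X" unfolding ringed_def
proof
 have open_Int: "opn X (W Int N)" if "opn X W" "openin T N" for W N
  using openin_Int[OF that(1) openin_subtopology_Int[OF that(2), of S, folded S]] openin_subset[OF that(1)]
  unfolding S by (metis Int_assoc Int_commute inf.orderE topspace_subtopology le_infE)
 have germ: "EX N g. x : N & B N g & (ALL y:N Int W. f y = g y)" if "kreg X W f" "x : W" for W f x
  using that reg by blast
 have regI: "kreg X W f" if "opn X W" "!!x. x : W ==> EX N g. x : N & B N g & (ALL y:N Int W. f y = g y)" for W f
  using that reg by blast
 fix W W' :: "'a set" and f g :: "'a => 'k" and c' :: 'k
 show "kreg X W (%_. c')" if W: "opn X W" by (rule regI[OF W]) (use openin_subset[OF W] c S in fastforce)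
 show "kreg X W f" if W: "opn X W" "!!x. x : W ==> EX N. x : N & kreg X N f"
 proof (rule regI[OF W(1)])
  fix x assume x: "x : W"
  obtain N where N: "x : N" "kreg X N f" using W(2)[OF x] by blast
  obtain M a where a: "x : M" "B M a" "ALL y:M Int N. f y = a y" using germ[OF N(2,1)] by blast
  obtain N' where N': "openin T N'" "N = N' Int S" using N(2) unfolding reg S openin_subtopology by blast
  have "B (M Int N') a" by (rule r[OF a(2)]) (use o[OF a(2)] N' in auto)
  moreover have "W <= S" using openin_subset[OF W(1)] S by auto
  ultimately show "EX N g. x : N & B N g & (ALL y:N Int W. f y = g y)"
   using a N N' by (intro exI[of _ "M Int N'"]) blast
 qed
 assume f: "kreg X W f"
 thus W: "opn X W" using reg by blast
 have sub: "kreg X V h" if V: "opn X V" "V <= W" "!!x. x : V ==> f x = h x" for V h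
 proof (rule regI[OF V(1)])
  fix x assume "x : V"
  then obtain N a where "x : N" "B N a" "ALL y:N Int W. f y = a y" using germ[OF f, of x] V(2) by blast
  thus "EX N g. x : N & B N g & (ALL y:N Int V. h y = g y)"
   using V(2,3) by (intro exI[of _ N] exI[of _ a]) (metis IntD1 IntD2 IntI subsetD)
 qed
 show "kreg X W g" if "!!x. x : W ==> f x = g x" using sub[OF W _ that] by simp
 show "kreg X W' f" if "opn X W'" "W' <= W" using sub[OF that] by simp
 have "kreg X W (%x. f x + g x) & kreg X W (%x. f x * g x)" if g: "kreg X W g"
 proof -
  have "EX N a b. x : N & B N a & B N b & (ALL y:N Int W. f y = a y & g y = b y)" if x: "x : W" for x
  proof -
   obtain M a where a: "x : M" "B M a" "ALL y:M Int W. f y = a y" using germ[OF f x] by blast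
   obtain N b where b: "x : N" "B N b" "ALL y:N Int W. g y = b y" using germ[OF g x] by blast
   have "B (M Int N) a" "B (M Int N) b" using o r a(2) b(2) by blast+
   thus ?thesis using a b by (intro exI[of _ "M Int N"]) blast
  qed
  note ab = this
  have "(EX N h. x : N & B N h & (ALL y:N Int W. f y + g y = h y)) &
   (EX N h. x : N & B N h & (ALL y:N Int W. f y * g y = h y))" if x: "x : W" for x
  proof -
   obtain N a b where "x : N" "B N a" "B N b" "ALL y:N Int W. f y = a y & g y = b y" using ab[OF x] by blast
   thus ?thesis using am[of N a b] by (intro conjI exI[of _ N] exI[of _ "%x. a x + b x"] exI[of _ "%x. a x * b x"]) auto
  qed
  thus ?thesis by (intro conjI regI[OF W]) auto
 qed
 thus "kreg X W g ==> kreg X W (%x. f x + g x)" "kreg X W g ==> kreg X W (%x. f x * g x)" by auto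
 show oW: "opn X {x : W. f x ~= 0}"
 proof (subst openin_subopen, intro ballI)
  fix x assume x: "x : {x : W. f x ~= 0}"
  then obtain N a where a: "x : N" "B N a" "ALL y:N Int W. f y = a y" using germ[OF f] by blast
  have "opn X (W Int {x : N. a x ~= 0})" using open_Int[OF W] i[OF a(2)] by blast
  thus "EX T. opn X T & x : T & T <= {x : W. f x ~= 0}"
   by (rule exI[of _ "W Int {x : N. a x ~= 0}", OF conjI]) (use a x in auto)
 qed
 show "kreg X {x : W. f x ~= 0} (%x. inverse (f x))"
 proof (rule regI[OF oW])
  fix x assume x: "x : {x : W. f x ~= 0}"
  then obtain N a where a: "x : N" "B N a" "ALL y:N Int W. f y = a y" using germ[OF f] by blast
  with i[OF a(2)] x show "EX N g. x : N & B N g & (ALL y:N Int {x : W. f x ~= 0}. inverse (f y) = g y)"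
   by (intro exI[of _ "{x : N. a x ~= 0}"] exI[of _ "%x. inverse (a x)"]) auto
 qed
qed

text \<open>Sections that are defined by pullback along \<open>p\<close> inherit all sheaf
  properties from the source. This covers the quotient structure of \<open>Kn_Gr\<close> and, with
  an inverse map for \<open>p\<close>, the transport along isomorphisms.\<close>

lemma ringed_quotient:
 fixes X :: "('a, 'k::field) kspace" and F :: "('b, 'k) kspace"
 assumes F: "ringed F"
  and op: "!!W. opn X W <-> W <= pts X & opn F (preim F p W)"
  and reg: "!!W f. kreg X W f <-> opn X W & kreg F (preim F p W) (%z. f (p z))"
 shows "ringed X" unfolding ringed_def
proof
 fix W W' :: "'a set" and f g :: "'a => 'k" and c :: 'k
 let ?P = "preim F p"
 have nz: "?P {x : W. f x ~= 0} = {z : ?P W. f (p z) ~= 0}" by (auto simp: preim_def)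
 have oF: "opn X W ==> opn F (?P W)" for W using op by blast
 show "kreg X W (%_. c)" if "opn X W" using that ringed_const[OF F oF] by (simp add: reg)
 show "kreg X W f" if W: "opn X W" "!!x. x : W ==> EX N. x : N & kreg X N f" unfolding reg
 proof (intro conjI W(1) ringed_glue[OF F oF])
  fix z assume z: "z : ?P W"
  then obtain N where "p z : N" "kreg X N f" using W(2)[of "p z"] by (auto simp: preim_def)
  thus "EX N. z : N & kreg F N (%z. f (p z))" using z by (intro exI[of _ "?P N"]) (auto simp: reg preim_def)
 qed
 assume f: "kreg X W f"
 hence fF: "kreg F (?P W) (%z. f (p z))" by (simp add: reg)
 from f show W: "opn X W" by (simp add: reg)
 show "kreg X W g" if "!!x. x : W ==> f x = g x"
  unfolding reg by (intro conjI W ringed_cong[OF F fF]) (simp add: that preim_def)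
 show "kreg X W' f" if "opn X W'" "W' <= W"
  unfolding reg by (intro conjI that(1) ringed_restrict[OF F fF oF]) (insert that(2), auto simp: preim_def)
 show "kreg X W (%x. f x + g x)" "kreg X W (%x. f x * g x)" if "kreg X W g"
  using that W fF by (auto simp: reg intro: ringed_add[OF F] ringed_mult[OF F])
 show o: "opn X {x : W. f x ~= 0}" unfolding op nz using ringed_nonzero[OF F fF] openin_subset[OF W] by blast
 show "kreg X {x : W. f x ~= 0} (%x. inverse (f x))" using o ringed_inverse[OF F fF] by (simp add: reg nz)
qed

lemma ringed_pol_eval:
 assumes X: "ringed X" and g: "g : pols n" and W: "opn X W"
  and e: "!!k. k < n ==> kreg X W (%x. e x k)"
 shows "kreg X W (%x. pev g (e x))" using g
proof (induction rule: pols_induct)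
 case (const a)
 thus ?case using ringed_const[OF X W] by simp
next
 case (var i f)
 thus ?case using ringed_mult[OF X e[OF var(1)] var(3)] by simp
next
 case (add f g)
 thus ?case using ringed_add[OF X] by simp
qed

section \<open>The Zariski topology and regular functions on affine space\<close>

lemma zariski_topspace [simp]: "topspace (zariski n) = (Kn n :: (nat => 'k::field) set)"
proof (rule antisym)
 have "{x : Kn n. pev (pconst (1::'k)) x ~= 0} : {{x : Kn n. pev f x ~= 0} | f. f : pols n}"
  using pols_pconst[of "1::'k" n] by blast
 thus "Kn n <= topspace (zariski n :: (nat => 'k) topology)"
  unfolding zariski_def topology_generated_by_topspace by (force simp del: mem_Collect_eq)
qed (auto simp: zariski_def)

lemma openin_zariski_principal: "f : pols n ==> zopn n {x : Kn n. pev f x ~= 0}"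
 unfolding zariski_def by (rule topology_generated_by_Basis) blast

lemma zariski_base:
 fixes W :: "(nat => 'k::field) set"
 assumes "zopn n W" "x : W"
 obtains f where "f : pols n" "pev f x ~= 0" "{y : Kn n. pev f y ~= 0} <= W"
proof -
 have "generate_topology_on {{x : Kn n. pev f x ~= 0} | f. f : pols n} W"
  using assms(1) unfolding zariski_def by (rule openin_topology_generated_by)
 hence "EX f:pols n. pev f x ~= 0 & {y : Kn n. pev f y ~= 0} <= W" using assms(2)
 proof (induction rule: generate_topology_on.induct)
  case (Int a b)
  then obtain f g where "f : pols n" "pev f x ~= 0" "{y : Kn n. pev f y ~= 0} <= a"
   "g : pols n" "pev g x ~= 0" "{y : Kn n. pev g y ~= 0} <= b" by blast
  thus ?case by (intro bexI[of _ "f * g"]) auto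
 next
  case (UN K)
  thus ?case by blast
 next
  case (Basis s)
  thus ?case by blast
 qed simp
 thus ?thesis using that by blast
qed

lemma ktop_affine_space [simp]: "ktop (affine_space n) = zariski n" by (simp add: affine_space_def)

lemma kreg_affine_space: "kreg (affine_space n) U f <-> zopn n U & (ALL x:U. EX g:pols n. EX h:pols n. pev h x ~= 0 &
     (ALL y:U. pev h y ~= 0 --> f y = pev g y / pev h y))" by (simp add: affine_space_def)

text \<open>In the definition the denominator may vanish elsewhere on \<open>W\<close>. The local
  form replaces it by one without zeros on a neighbourhood, as \<open>ringed_germwise\<close>
  requires.\<close>

lemma kreg_asp_local: "kreg (affine_space n) W f <-> zopn n W &
  (ALL x:W. EX N g h. zopn n N & x : N & g : pols n & h : pols n &
   (ALL y:N. pev h y ~= 0 & (y : W --> f y = pev g y / pev h y)))" (is "_ <-> ?R")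
proof
 assume f: "kreg (affine_space n) W f"
 hence W: "zopn n W" by (simp add: kreg_affine_space)
 have "EX N g h. zopn n N & x : N & g : pols n & h : pols n &
   (ALL y:N. pev h y ~= 0 & (y : W --> f y = pev g y / pev h y))" if x: "x : W" for x
 proof -
  obtain g h where gh: "g : pols n" "h : pols n" "pev h x ~= 0" "ALL y:W. pev h y ~= 0 --> f y = pev g y / pev h y"
   using f x unfolding kreg_affine_space by blast
  have "zopn n {y : Kn n. pev h y ~= 0}" by (rule openin_zariski_principal[OF gh(2)])
  moreover have "x : {y : Kn n. pev h y ~= 0}" using gh(3) x openin_subset[OF W] by auto
  ultimately show ?thesis using gh by (intro exI[of _ "{y : Kn n. pev h y ~= 0}"] exI[of _ g] exI[of _ h]) auto
 qed
 thus ?R using W by blast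
next
 assume R: ?R
 have "EX g:pols n. EX h:pols n. pev h x ~= 0 & (ALL y:W. pev h y ~= 0 --> f y = pev g y / pev h y)" if x: "x : W" for x
 proof -
  obtain N g h where N: "zopn n N" "x : N" "g : pols n" "h : pols n"
   "ALL y:N. pev h y ~= 0 & (y : W --> f y = pev g y / pev h y)" using R x by meson
  obtain k where k: "k : pols n" "pev k x ~= 0" "{y : Kn n. pev k y ~= 0} <= N" using zariski_base[OF N(1,2)] by blast
  \<comment> \<open>The factor \<open>k\<close> in numerator and denominator confines the claim to
    \<open>N\<close>: where \<open>k * h\<close> does not vanish, the point lies in
    \<open>N\<close>.\<close>
  have "f y = pev (k * g) y / pev (k * h) y" if "y : W" "pev (k * h) y ~= 0" for y
  proof -
   have "y : N" using that k(3) R openin_subset[of "zariski n" W] by auto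
   thus ?thesis using that N(5) by auto
  qed
  moreover have "pev (k * h) x ~= 0" using N k by auto
  ultimately show ?thesis using N k by (meson pols_mult)
 qed
 thus "kreg (affine_space n) W f" unfolding kreg_affine_space using R by blast
qed

lemma ringed_affine_space: "ringed (affine_space n :: (nat => 'k, 'k::field) kspace)"
proof (rule ringed_germwise[where T = "zariski n" and S = UNIV and B = "%N g. zopn n N &
  (EX p:pols n. EX q:pols n. ALL y:N. pev q y ~= 0 & g y = pev p y / pev q y)"])
 fix W N N' and f g :: "(nat => 'k) => 'k" and x and c :: 'k
 let ?B = "%N g. zopn n N & (EX p:pols n. EX q:pols n. ALL y:N. pev q y ~= 0 & g y = pev p y / pev q y)"
 show "kreg (affine_space n) W f <-> opn (affine_space n) W &
   (ALL x:W. EX N g. x : N & ?B N g & (ALL y:N Int W. f y = g y))" (is "_ <-> _ & (ALL x:W. ?G x)")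
 proof -
  have "?G x <-> (EX N g h. zopn n N & x : N & g : pols n & h : pols n &
   (ALL y:N. pev h y ~= 0 & (y : W --> f y = pev g y / pev h y)))" (is "_ <-> ?L") for x
  proof
   assume "?G x"
   then obtain N g p q where "x : N" "zopn n N" "p : pols n" "q : pols n"
    "ALL y:N. pev q y ~= 0 & g y = pev p y / pev q y" "ALL y:N Int W. f y = g y" by blast
   thus ?L by (intro exI[of _ N] exI[of _ p] exI[of _ q]) auto
  next
   assume ?L
   then obtain N p q where "zopn n N" "x : N" "p : pols n" "q : pols n"
    "ALL y:N. pev q y ~= 0 & (y : W --> f y = pev p y / pev q y)" by blast
   thus "?G x" by (intro exI[of _ N] exI[of _ "%y. pev p y / pev q y"]) auto
  qed
  thus ?thesis unfolding kreg_asp_local by simp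
 qed
 show "EX N. x : N & ?B N (%_. c)" if "x : topspace (zariski n)"
  using that openin_topspace[of "zariski n :: (nat => 'k) topology"]
  by (intro exI[of _ "Kn n"] conjI bexI[of _ "pconst c"] bexI[of _ "pconst 1"]) (auto simp: pols_pconst)
 show "?B N (%x. f x + g x) & ?B N (%x. f x * g x)" if f: "?B N f" and g: "?B N g"
 proof -
  obtain p q p' q' where *: "p : pols n" "q : pols n" "p' : pols n" "q' : pols n" "ALL y:N. pev q y ~= 0 &
   f y = pev p y / pev q y" "ALL y:N. pev q' y ~= 0 & g y = pev p' y / pev q' y" using f g by blast
  have "EX p:pols n. EX q:pols n. ALL y:N. pev q y ~= 0 & f y + g y = pev p y / pev q y"
   by (rule bexI[of _ "p * q' + p' * q"], rule bexI[of _ "q * q'"]) (insert *, auto simp: add_frac_eq)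
  moreover have "EX p:pols n. EX q:pols n. ALL y:N. pev q y ~= 0 & f y * g y = pev p y / pev q y"
   by (rule bexI[of _ "p * p'"], rule bexI[of _ "q * q'"]) (use * in auto)
  ultimately show ?thesis using f by blast
 qed
 show "zopn n {x : N. f x ~= 0} & ?B {x : N. f x ~= 0} (%x. inverse (f x))" if f: "?B N f"
 proof -
  obtain p q where pq: "p : pols n" "q : pols n" "ALL y:N. pev q y ~= 0 & f y = pev p y / pev q y" using f by blast
  have "{x : N. f x ~= 0} = N Int {x : Kn n. pev p x ~= 0}" using pq(3) openin_subset[of "zariski n" N] f by auto
  hence "zopn n {x : N. f x ~= 0}" using f openin_zariski_principal[OF pq(1)] by auto
  thus ?thesis using pq by (intro conjI bexI[of _ q] bexI[of _ p]) auto
 qed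
qed auto

section \<open>Induced subspaces and isomorphisms\<close>

lemma ktop_induced [simp]: "ktop (induced X S) = subtopology (ktop X) S" by (simp add: induced_def)

lemma kreg_induced: "kreg (induced X S) U f <-> openin (subtopology (ktop X) S) U &
   (ALL x:U. EX W g. x : W & kreg X W g & (ALL y:W Int U. f y = g y))" by (simp add: induced_def)

lemma kreg_induced_subset:
 assumes "kreg X W f" "opn X W"
 shows "kreg (induced X S) (W Int S) f" unfolding kreg_induced using assms by (auto simp: openin_subtopology)

lemma ringed_induced: "ringed X ==> ringed (induced X S)"
 by (rule ringed_germwise[where T = "ktop X" and S = S and B = "kreg X"], simp, simp add: kreg_induced)
  (blast intro: ringed_open ringed_restrict ringed_const openin_topspace ringed_add ringed_mult
   ringed_nonzero ringed_inverse)+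

lemma iso_inj:
 assumes "isomorphism X Y ph"
 shows "inj_on ph (pts X)" "ph ` pts X = pts Y"
 using assms unfolding isomorphism_def homeomorphic_eq_everything_map by auto

lemma iso_open_image:
 assumes "isomorphism X Y ph" "opn X W"
 shows "opn Y (ph ` W)" using assms unfolding isomorphism_def homeomorphic_eq_everything_map open_map_def by auto

lemma iso_preim_image:
 assumes "isomorphism X Y ph" "W <= pts X"
 shows "preim X ph (ph ` W) = W" using iso_inj(1)[OF assms(1)] assms(2) by (auto simp: preim_def inj_on_def)

lemma iso_kreg_image:
 assumes iso: "isomorphism X Y ph" and X: "ringed X" and f: "kreg X W f"
 shows "kreg Y (ph ` W) (%y. f (inv_into (pts X) ph y))"
proof -
 have W: "opn X W" by (rule ringed_open[OF X f])
 note W' = openin_subset[OF W]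
 have "kreg X W (%x. f (inv_into (pts X) ph (ph x)))"
  by (rule ringed_cong[OF X f]) (insert W' iso_inj[OF iso], auto simp: inv_into_f_f)
 hence "kreg X (preim X ph (ph ` W)) ((%y. f (inv_into (pts X) ph y)) \<circ> ph)"
  by (simp add: iso_preim_image[OF iso W'] comp_def)
 thus ?thesis using iso iso_open_image[OF iso W] unfolding isomorphism_def by blast
qed

lemma iso_preim_open:
 assumes "isomorphism X Y ph" "opn Y W"
 shows "opn X (preim X ph W)" using assms unfolding isomorphism_def homeomorphic_eq_everything_map preim_def
 by (auto simp: continuous_map_def)

lemma iso_kreg_preim:
 assumes iso: "isomorphism X Y ph" and f: "kreg Y W f" "opn Y W"
 shows "kreg X (preim X ph W) (%x. f (ph x))" using assms unfolding isomorphism_def by (auto simp: comp_def)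

text \<open>Congruence on the source is a hypothesis since \<open>kreg\<close> of an arbitrary record need not have it.\<close>

lemma ringed_isomorphism:
 assumes iso: "isomorphism X Y ph" and Y: "ringed Y"
  and open_X: "!!W f. kreg X W f ==> opn X W"
  and cong_X: "!!W f g. kreg X W f ==> (!!x. x : W ==> f x = g x) ==> kreg X W g"
 shows "ringed X"
proof (rule ringed_quotient[OF Y])
 \<comment> \<open>The inverse map exhibits \<open>X\<close> as a quotient of \<open>Y\<close> in
   the sense of \<open>ringed_quotient\<close>.\<close>
 define j where "j = inv_into (pts X) ph"
 have j: "j (ph x) = x" if "x : pts X" for x using that iso_inj[OF iso] unfolding j_def by (auto simp: inv_into_f_f)
 have pre: "preim Y j W = ph ` W" if "W <= pts X" for W
  using that j unfolding preim_def iso_inj(2)[OF iso, symmetric] by auto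
 fix W f
 show op: "opn X W <-> W <= pts X & opn Y (preim Y j W)"
  using iso_open_image[OF iso] iso_preim_open[OF iso, of "ph ` W"]
   iso_preim_image[OF iso, of W] openin_subset[of "ktop X" W] by (auto simp: pre)
 have "kreg Y (ph ` W) (%y. f (j y)) <-> kreg X W (%x. f (j (ph x)))" if W: "opn X W"
  using iso iso_open_image[OF iso W] iso_preim_image[OF iso openin_subset[OF W]]
  unfolding isomorphism_def by (auto simp: comp_def)
 moreover have "kreg X W (%x. f (j (ph x))) <-> kreg X W f" if "opn X W"
  by (rule iffI; erule cong_X) (use j openin_subset[OF that] in auto)
 ultimately show "kreg X W f <-> opn X W & kreg Y (preim Y j W) (%y. f (j y))"
  using open_X[of W f] openin_subset[of "ktop X" W] by (auto simp: pre)
qed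

lemma function_sheafD:
 assumes "function_sheaf X"
 shows function_sheaf_cong: "kreg X U f ==> (!!x. x : U ==> f x = g x) ==> kreg X U g"
  and function_sheaf_open: "kreg X U f ==> opn X U"
  and function_sheaf_glue: "opn X U ==> (!!x. x : U ==> EX W. x : W & W <= U & kreg X W f) ==> kreg X U f"
  using assms unfolding function_sheaf_def by blast+


lemma kreg_induced_open:
 assumes X: "ringed X" and U: "opn X U"
 shows "kreg (induced X U) W f <-> W <= U & kreg X W f"
proof
 assume f: "kreg (induced X U) W f"
 hence oW: "opn X W" "W <= U" using U by (auto simp: kreg_induced openin_open_subtopology)
 have "kreg X W f"
 proof (rule ringed_glue[OF X oW(1)])
  fix x assume x: "x : W"
  then obtain A a where a: "x : A" "kreg X A a" "ALL y:A Int W. f y = a y" using f unfolding kreg_induced by blast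
  have "opn X (A Int W)" using ringed_open[OF X a(2)] oW(1) by blast
  hence "kreg X (A Int W) a" by (rule ringed_restrict[OF X a(2)]) blast
  hence "kreg X (A Int W) f" by (rule ringed_cong[OF X]) (use a in auto)
  thus "EX N. x : N & kreg X N f" using a(1) x by blast
 qed
 thus "W <= U & kreg X W f" using oW by blast
next
 assume "W <= U & kreg X W f"
 thus "kreg (induced X U) W f" using kreg_induced_subset[of X W f U] ringed_open[OF X] by (auto simp: Int_absorb2)
qed

text \<open>
  The axiom \<open>function_sheaf\<close> allows to glue but not to restrict functions.  The space \<open>hat X\<close> has
  the same germs as \<open>X\<close> and admits restriction.
\<close>

definition hat :: "('a, 'k) kspace => ('a, 'k) kspace" where "hat X = \<lparr>ktop = ktop X, kreg = (%W f. opn X W &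
  (ALL x:W. EX N W' g. opn X N & x : N & N <= W' & kreg X W' g & (ALL y:N. f y = g y)))\<rparr>"

lemma ktop_hat [simp]: "ktop (hat X) = ktop X" by (simp add: hat_def)

lemma kreg_hat: "kreg (hat X) W f <-> opn X W &
  (ALL x:W. EX N W' g. opn X N & x : N & N <= W' & kreg X W' g & (ALL y:N. f y = g y))" by (simp add: hat_def)

lemma kreg_imp_hat: "function_sheaf X ==> kreg X W f ==> kreg (hat X) W f"
 unfolding kreg_hat by (intro conjI ballI exI[of _ W] exI[of _ f]) (auto dest: function_sheaf_open)

lemma kreg_hat_glue:
 assumes "opn X W" "!!x. x : W ==> EX N. x : N & kreg (hat X) N f"
 shows "kreg (hat X) W f" using assms unfolding kreg_hat by meson

lemma kreg_induced_imp_hat: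
 assumes X: "function_sheaf X" and U: "opn X U" and f: "kreg (induced X U) W f"
 shows "kreg (hat X) W f" unfolding kreg_hat
proof (intro conjI ballI)
 show oW: "opn X W" using f U by (auto simp: kreg_induced openin_open_subtopology)
 fix x assume "x : W"
 then obtain A a where a: "x : A" "kreg X A a" "ALL y:A Int W. f y = a y" using f unfolding kreg_induced by blast
 have "opn X (A Int W)" using function_sheaf_open[OF X a(2)] oW by blast
 thus "EX N W' g. opn X N & x : N & N <= W' & kreg X W' g & (ALL y:N. f y = g y)"
  using a `x : W` by (intro exI[of _ "A Int W"] exI[of _ A] exI[of _ a]) auto
qed

lemma hat_germ_induced:
 assumes f: "kreg (hat X) W f" and U: "opn X U" and x: "x : W" "x : U"
 shows "EX N. x : N & opn X N & N <= W Int U & kreg (induced X U) N f"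
proof -
 obtain N W' g where N: "opn X N" "x : N" "N <= W'" "kreg X W' g" "ALL y:N. f y = g y"
  using f x(1) unfolding kreg_hat by blast
 have o: "opn X (N Int (W Int U))" using N(1) U f unfolding kreg_hat by blast
 have "kreg (induced X U) (N Int (W Int U)) f"
  unfolding kreg_induced using o N U by (auto simp: openin_open_subtopology)
 thus ?thesis using o N(2) x by (intro exI[of _ "N Int (W Int U)"]) auto
qed

lemma kreg_induced_hat:
 assumes X: "function_sheaf X" and U: "opn X U" and R: "ringed (induced X U)"
 shows "kreg (induced X U) W f <-> W <= U & kreg (hat X) W f"
proof
 assume f: "kreg (induced X U) W f"
 hence "W <= U" using U by (auto simp: kreg_induced openin_open_subtopology)
 thus "W <= U & kreg (hat X) W f" using kreg_induced_imp_hat[OF X U f] by blast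
next
 assume f: "W <= U & kreg (hat X) W f"
 show "kreg (induced X U) W f"
 proof (rule ringed_glue[OF R])
  show "opn (induced X U) W" using f U by (auto simp: kreg_hat openin_open_subtopology)
  fix x assume "x : W"
  thus "EX N. x : N & kreg (induced X U) N f" using f hat_germ_induced[OF _ U, of W f x] by blast
 qed
qed

lemma ringed_induced_iso:
 assumes "isomorphism (induced X U) Y ph" "ringed Y"
 shows "ringed (induced X U)"
proof (rule ringed_isomorphism[OF assms])
 fix W f g assume f: "kreg (induced X U) W f"
 thus "opn (induced X U) W" by (simp add: kreg_induced)
 show "kreg (induced X U) W g" if "!!x. x : W ==> f x = g x" using f that unfolding kreg_induced by (metis IntD2)
qed

lemma ringed_affine_variety: "ringed (affine_variety n V)"
 unfolding affine_variety_def by (rule ringed_induced[OF ringed_affine_space])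

lemma affine_open_ringed:
 assumes "affine_open X U"
 shows "opn X U" "ringed (induced X U)"
proof -
 from assms obtain n V ph where *: "affine_chart X U n V ph" by (auto simp: affine_open_def)
 thus "opn X U" by (simp add: affine_chart_def)
 show "ringed (induced X U)" using * ringed_induced_iso[OF _ ringed_affine_variety] unfolding affine_chart_def by blast
qed

lemma varietyD:
 assumes "variety X"
 shows variety_sheaf: "function_sheaf X"
  and variety_cover: "x : pts X ==> EX U. affine_open X U & x : U" using assms unfolding variety_def by blast+

text \<open>Restriction holds for \<open>hat X\<close> by construction. Sums, products and inverses
  are formed inside a member of an affine cover, where the structure is that of an affine variety
  and satisfies all axioms.\<close>

lemma ringed_hat:
 fixes X :: "('a, 'k::field) kspace"
 assumes X: "variety X"
 shows "ringed (hat X)"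
proof -
 note sh = variety_sheaf[OF X]
 have restr: "kreg (hat X) W' f" if "kreg (hat X) W f" "opn X W'" "W' <= W" for W W' f unfolding kreg_hat using that(2)
  by (rule conjI, intro ballI) (rule bspec, insert that(1,3), auto simp: kreg_hat)
 let ?B = "%N g. kreg (hat X) N g & (EX U. opn X U & N <= U & ringed (induced X U))"
 have loc: "EX U. opn X U & x : U & ringed (induced X U)" if "x : pts X" for x
  using variety_cover[OF X that] affine_open_ringed by blast
 have oh: "kreg (hat X) N g ==> opn X N" for N g by (simp add: kreg_hat)
 show ?thesis
 proof (rule ringed_germwise[where T = "ktop X" and S = UNIV and B = ?B])
  fix W N N' :: "'a set" and f g :: "'a => 'k" and c :: 'k and x :: 'a
  show "kreg (hat X) W f <-> opn (hat X) W & (ALL x:W. EX N g. x : N & ?B N g & (ALL y:N Int W. f y = g y))"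
  proof (intro iffI conjI ballI; (elim conjE)?)
   fix x assume f: "kreg (hat X) W f" and x: "x : W"
   then obtain U where U: "opn X U" "x : U" "ringed (induced X U)" using loc openin_subset[OF oh[OF f]] by blast
   have "kreg (hat X) (W Int U) f" by (rule restr[OF f]) (use oh[OF f] U in auto)
   thus "EX N g. x : N & ?B N g & (ALL y:N Int W. f y = g y)" using U x by blast
  next
   assume W: "opn (hat X) W" "ALL x:W. EX N g. x : N & ?B N g & (ALL y:N Int W. f y = g y)"
   show "kreg (hat X) W f" unfolding kreg_hat
   proof (intro conjI ballI)
    fix x assume x: "x : W"
    then obtain N g where N: "x : N" "kreg (hat X) N g" "ALL y:N Int W. f y = g y" using W(2) by blast
    obtain M V h where M: "opn X M" "x : M" "M <= V" "kreg X V h" "ALL y:M. g y = h y"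
     using N(1,2) unfolding kreg_hat by blast
    have "opn X (M Int N Int W)" using M(1) oh[OF N(2)] W(1) by auto
    thus "EX N V g. opn X N & x : N & N <= V & kreg X V g & (ALL y:N. f y = g y)"
     using x N M by (intro exI[of _ "M Int N Int W"] exI[of _ V] exI[of _ h]) auto
   qed (use W in simp)
  qed (simp add: oh)
  show "EX N. x : N & ?B N (%_. c)" if xp: "x : topspace (ktop X)"
  proof -
   obtain U where U: "opn X U" "x : U" "ringed (induced X U)" using loc[OF xp] by blast
   have "kreg (hat X) U (%_. c)" using kreg_induced_hat[OF sh U(1,3)] ringed_const[OF U(3), of U c] U(1)
    by (auto simp: openin_open_subtopology)
   thus ?thesis using U by blast
  qed
  show "?B N (%x. f x + g x) & ?B N (%x. f x * g x)" if f: "?B N f" and g: "?B N g"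
  proof -
   obtain U where U: "opn X U" "N <= U" "ringed (induced X U)" using f by blast
   note k = kreg_induced_hat[OF sh U(1,3), of N]
   have "kreg (induced X U) N f" "kreg (induced X U) N g" using k f g U(2) by blast+
   from ringed_add[OF U(3) this] ringed_mult[OF U(3) this] show ?thesis using k U by blast
  qed
  show "opn X {x : N. f x ~= 0} & ?B {x : N. f x ~= 0} (%x. inverse (f x))" if f: "?B N f"
  proof -
   obtain U where U: "opn X U" "N <= U" "ringed (induced X U)" using f by blast
   have "kreg (induced X U) N f" using kreg_induced_hat[OF sh U(1,3)] f U(2) by blast
   hence "kreg (hat X) {x : N. f x ~= 0} (%x. inverse (f x))"
    using kreg_induced_hat[OF sh U(1,3)] ringed_inverse[OF U(3)] by blast
   thus ?thesis using oh U by blast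
  qed
 qed (auto intro: oh restr)
qed

lemma iso_induced_hat:
 assumes X: "variety X" and U: "opn X U" and iso: "isomorphism (induced X U) Y ph"
  and Y: "ringed Y"
 shows "isomorphism (induced (hat X) U) Y ph"
proof -
 have "kreg (induced X U) W f <-> kreg (induced (hat X) U) W f" for W f
  using kreg_induced_hat[OF variety_sheaf[OF X] U ringed_induced_iso[OF iso Y]]
   kreg_induced_open[OF ringed_hat[OF X], of U] U by simp
 thus ?thesis using iso unfolding isomorphism_def preim_def by simp
qed

lemma affine_chart_hat: "variety X ==> affine_chart X U n V ph ==> affine_chart (hat X) U n V ph"
 unfolding affine_chart_def using iso_induced_hat[OF _ _ _ ringed_affine_variety] by auto

section \<open>Morphisms\<close>

lemma morphismD:
 assumes "morphism X Y ph"
 shows morphism_maps: "x : pts X ==> ph x : pts Y"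
  and morphism_open: "opn Y W ==> opn X {x : pts X. ph x : W}"
  and morphism_kreg: "kreg Y W f ==> kreg X {x : pts X. ph x : W} (%x. f (ph x))"
 using assms unfolding morphism_def continuous_map_def preim_def comp_def by auto

lemma morphismI:
 assumes "!!x. x : pts X ==> ph x : pts Y"
  and "!!W. opn Y W ==> opn X {x : pts X. ph x : W}"
  and "!!W f. kreg Y W f ==> kreg X {x : pts X. ph x : W} (%x. f (ph x))"
 shows "morphism X Y ph" using assms unfolding morphism_def continuous_map_def preim_def comp_def by auto

lemma morphism_hat:
 assumes m: "morphism Z X nu" and X: "function_sheaf X" and Z: "function_sheaf Z"
 shows "morphism (hat Z) (hat X) nu"
proof (rule morphismI)
 show "nu x : pts (hat X)" if "x : pts (hat Z)" for x using morphism_maps[OF m] that by simp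
 show o: "opn (hat Z) {x : pts (hat Z). nu x : W}" if "opn (hat X) W" for W using morphism_open[OF m] that by simp
 fix W f assume f: "kreg (hat X) W f"
 show "kreg (hat Z) {x : pts (hat Z). nu x : W} (%x. f (nu x))" unfolding kreg_hat
 proof (intro conjI ballI)
  show "opn Z {x : pts (hat Z). nu x : W}" using o f by (simp add: kreg_hat)
  fix z assume z: "z : {x : pts (hat Z). nu x : W}"
  then obtain N V g where N: "opn X N" "nu z : N" "N <= V" "kreg X V g" "ALL y:N. f y = g y"
   using f unfolding kreg_hat by blast
  thus "EX N W' g. opn Z N & z : N & N <= W' & kreg Z W' g & (ALL y:N. f (nu y) = g y)"
   using morphism_open[OF m N(1)] morphism_kreg[OF m N(4)] z
   by (intro exI[of _ "{x : pts Z. nu x : N}"] exI[of _ "{x : pts Z. nu x : V}"] exI[of _ "%x. g (nu x)"]) auto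
 qed
qed

lemma morphism_comp:
 assumes 1: "morphism X Y ph" and 2: "morphism Y Z ps"
 shows "morphism X Z (%x. ps (ph x))"
proof (rule morphismI)
 have *: "{x : pts X. ps (ph x) : W} = {x : pts X. ph x : {y : pts Y. ps y : W}}" for W
  using morphism_maps[OF 1] by auto
 show "ps (ph x) : pts Z" if "x : pts X" for x using that 1 2 morphism_maps by metis
 show "opn X {x : pts X. ps (ph x) : W}" if "opn Z W" for W
  unfolding * by (intro morphism_open[OF 1] morphism_open[OF 2] that)
 show "kreg X {x : pts X. ps (ph x) : W} (%x. f (ps (ph x)))" if "kreg Z W f" for W f
  unfolding * by (rule morphism_kreg[OF 1 morphism_kreg[OF 2 that]])
qed

lemma morphism_into_induced:
 assumes m: "morphism X Y ph" and X: "ringed X" and S: "!!x. x : pts X ==> ph x : S"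
 shows "morphism X (induced Y S) ph"
proof (rule morphismI)
 show "ph x : pts (induced Y S)" if "x : pts X" for x using that S morphism_maps[OF m] by simp
 show o: "opn X {x : pts X. ph x : W}" if W: "opn (induced Y S) W" for W
 proof -
  obtain T where T: "opn Y T" "W = T Int S" using W by (auto simp: openin_subtopology)
  have "{x : pts X. ph x : W} = {x : pts X. ph x : T}" using T S by auto
  thus ?thesis using morphism_open[OF m T(1)] by simp
 qed
 fix W f assume f: "kreg (induced Y S) W f"
 hence oW: "opn X {x : pts X. ph x : W}" using o by (simp add: kreg_induced)
 show "kreg X {x : pts X. ph x : W} (%x. f (ph x))"
 proof (rule ringed_glue[OF X oW])
  fix x assume x: "x : {x : pts X. ph x : W}"
  then obtain A a where a: "ph x : A" "kreg Y A a" "ALL y:A Int W. f y = a y" using f unfolding kreg_induced by blast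
  note k = morphism_kreg[OF m a(2)]
  have "kreg X ({x : pts X. ph x : A} Int {x : pts X. ph x : W}) (%x. a (ph x))"
   by (rule ringed_restrict[OF X k]) (use ringed_open[OF X k] oW in auto)
  hence "kreg X ({x : pts X. ph x : A} Int {x : pts X. ph x : W}) (%x. f (ph x))"
   by (rule ringed_cong[OF X]) (use a in auto)
  thus "EX N. x : N & kreg X N (%x. f (ph x))"
   using x a(1) by (intro exI[of _ "{x : pts X. ph x : A} Int {x : pts X. ph x : W}"]) auto
 qed
qed

lemma morphism_inclusion: "(!!W f. kreg X W f ==> opn X W) ==> morphism (induced X S) X (%x. x)"
proof (rule morphismI)
 have *: "{x : pts (induced X S). x : W} = W Int S" if "opn X W" for W using openin_subset[OF that] by auto
 show "opn (induced X S) {x : pts (induced X S). x : W}" if "opn X W" for W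
  unfolding *[OF that] using that by (simp add: openin_subtopology_Int)
 assume o: "!!W f. kreg X W f ==> opn X W"
 show "kreg (induced X S) {x : pts (induced X S). x : W} f" if "kreg X W f" for W f
  unfolding *[OF o[OF that]] by (rule kreg_induced_subset[OF that o[OF that]])
qed simp

lemma morphism_inv_into:
 assumes iso: "isomorphism X Y ph" and X: "ringed X"
 shows "morphism Y X (inv_into (pts X) ph)"
proof (rule morphismI)
 note inj = iso_inj[OF iso]
 have *: "{y : pts Y. inv_into (pts X) ph y : W} = ph ` W" if W: "opn X W" for W
 proof (intro subset_antisym subsetI)
  fix y assume "y : {y : pts Y. inv_into (pts X) ph y : W}"
  thus "y : ph ` W" using inj(2) by (metis (mono_tags) f_inv_into_f image_eqI mem_Collect_eq)
 next
  fix y assume "y : ph ` W"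
  then obtain x where "x : W" "y = ph x" "x : pts X" using openin_subset[OF W] by auto
  thus "y : {y : pts Y. inv_into (pts X) ph y : W}" using inj by (auto simp: inv_into_f_f)
 qed
 show "inv_into (pts X) ph y : pts X" if "y : pts Y" for y using that inj by (auto intro: inv_into_into)
 show "opn Y {y : pts Y. inv_into (pts X) ph y : W}" if "opn X W" for W
  unfolding *[OF that] by (rule iso_open_image[OF iso that])
 show "kreg Y {y : pts Y. inv_into (pts X) ph y : W} (%y. f (inv_into (pts X) ph y))" if "kreg X W f" for W f
  unfolding *[OF ringed_open[OF X that]] by (rule iso_kreg_image[OF iso X that])
qed

lemma morphism_into_affine:
 fixes e :: "'a => nat => 'k::field"
 assumes X: "ringed X" and e: "!!i. i < n ==> kreg X (pts X) (%x. e x i)"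
  and L: "!!x. x : pts X ==> e x : Kn n"
 shows "morphism X (affine_space n) e"
proof (rule morphismI)
 show "e x : pts (affine_space n)" if "x : pts X" for x using L that by simp
 have pe: "kreg X (pts X) (%x. pev g (e x))" if "g : pols n" for g
  by (rule ringed_pol_eval[OF X that openin_topspace]) (use e in auto)
 show o: "opn X {x : pts X. e x : W}" if W: "opn (affine_space n) W" for W :: "(nat => 'k) set"
 proof (subst openin_subopen, intro ballI)
  fix x assume x: "x : {x : pts X. e x : W}"
  then obtain f where f: "f : pols n" "pev f (e x) ~= 0" "{y : Kn n. pev f y ~= 0} <= W"
   using zariski_base[of n W "e x"] W by auto
  thus "EX T. opn X T & x : T & T <= {x : pts X. e x : W}" using ringed_nonzero[OF X pe[OF f(1)]] x L
   by (intro exI[of _ "{x : pts X. pev f (e x) ~= 0}"]) auto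
 qed
 fix W :: "(nat => 'k) set" and f assume f: "kreg (affine_space n) W f"
 hence W: "zopn n W" by (simp add: kreg_affine_space)
 hence oW: "opn X {x : pts X. e x : W}" using o by simp
 show "kreg X {x : pts X. e x : W} (%x. f (e x))"
 proof (rule ringed_glue[OF X oW])
  fix x assume x: "x : {x : pts X. e x : W}"
  obtain g h where gh: "g : pols n" "h : pols n" "pev h (e x) ~= 0" "ALL y:W. pev h y ~= 0 --> f y = pev g y / pev h y"
   using f x unfolding kreg_affine_space by blast
  let ?N = "{x : pts X. pev h (e x) ~= 0} Int {x : pts X. e x : W}"
  note oh = ringed_nonzero[OF X pe[OF gh(2)]]
  have o: "opn X ?N" using oh oW by blast
  have "kreg X ?N (%x. pev g (e x) * inverse (pev h (e x)))"
   using ringed_restrict[OF X pe[OF gh(1)] o] ringed_restrict[OF X ringed_inverse[OF X pe[OF gh(2)]] o]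
   by (intro ringed_mult[OF X]) auto
  hence "kreg X ?N (%x. f (e x))" by (rule ringed_cong[OF X]) (insert gh, auto simp: field_simps)
  thus "EX N. x : N & kreg X N (%x. f (e x))" using x gh(3) by (intro exI[of _ ?N]) auto
 qed
qed

lemma kreg_coordinate:
 fixes V :: "(nat => 'k::field) set"
 assumes k: "k < n" and V: "V <= Kn n"
 shows "kreg (affine_variety n V) V (%y. y k)"
proof -
 have o: "zopn n (Kn n :: (nat => 'k) set)" using openin_topspace[of "zariski n"] by simp
 have "kreg (affine_space n) (Kn n) (%y :: nat => 'k. y k)" unfolding kreg_affine_space
  by (intro conjI ballI o bexI[of _ "pvar k"] bexI[of _ "pconst 1"]) (use k in auto)
 from kreg_induced_subset[OF this, of V] show ?thesis using o V by (simp add: affine_variety_def Int_absorb1)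
qed

text \<open>Everything later known about a chart is expressed by the functions
  \<open>ph _ k\<close>; the last item says that regular functions are locally quotients of
  polynomials in them.\<close>

lemma affine_chartD:
 fixes ph :: "'a => nat => 'k::field"
 assumes X: "ringed X" and c: "affine_chart X U n V ph"
 shows affine_chart_open: "opn X U"
  and affine_chart_closed: "closedin (zariski n) V"
  and affine_chart_inj: "inj_on ph U"
  and affine_chart_image: "ph ` U = V"
  and affine_chart_Kn: "x : U ==> ph x : Kn n"
  and affine_chart_coordinate: "k < n ==> kreg X U (%x. ph x k)"
  and affine_chart_kreg: "kreg X W f ==> x : W ==> x : U ==> EX N g h. opn X N & x : N &
   N <= W Int U & g : pols n & h : pols n & (ALL y:N. pev h (ph y) ~= 0 & f y = pev g (ph y) / pev h (ph y))"
proof -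
 show U: "opn X U" and V: "closedin (zariski n) V" using c by (auto simp: affine_chart_def)
 have iso: "isomorphism (induced X U) (affine_variety n V) ph" using c by (auto simp: affine_chart_def)
 have VK: "V <= Kn n" using closedin_subset[OF V] by simp
 have pU: "pts (induced X U) = U" using openin_subset[OF U] by auto
 have pV: "pts (affine_variety n V) = V" using VK by (auto simp: affine_variety_def)
 show inj: "inj_on ph U" and im: "ph ` U = V" using iso_inj[OF iso] pU pV by auto
 show "x : U ==> ph x : Kn n" using im VK by auto
 show "kreg X U (%x. ph x k)" if k: "k < n"
 proof -
  note kV = kreg_coordinate[OF k VK]
  have "kreg (induced X U) (preim (induced X U) ph V) (%x. ph x k)"
   by (rule iso_kreg_preim[OF iso kV ringed_open[OF ringed_affine_variety kV]])
  moreover have "preim (induced X U) ph V = U" unfolding preim_def pU using im by auto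
  ultimately show ?thesis using kreg_induced_open[OF X U] by auto
 qed
 assume f: "kreg X W f" and x: "x : W" "x : U"
 let ?W = "W Int U" and ?j = "inv_into U ph"
 have oW: "opn X ?W" using ringed_open[OF X f] U by blast
 have "kreg (induced X U) ?W f" using ringed_restrict[OF X f oW] kreg_induced_open[OF X U] by blast
 from iso_kreg_image[OF iso ringed_induced[OF X] this]
 have k: "kreg (affine_variety n V) (ph ` ?W) (%y. f (?j y))" unfolding pU .
 then obtain A a where a: "ph x : A" "kreg (affine_space n) A a" "ALL y:A Int ph ` ?W. f (?j y) = a y"
  unfolding affine_variety_def kreg_induced using x by blast
 then obtain g h where gh: "g : pols n" "h : pols n" "pev h (ph x) ~= 0"
   "ALL y:A. pev h y ~= 0 --> a y = pev g y / pev h y" unfolding kreg_affine_space by blast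
 define B where "B = A Int {y : Kn n. pev h y ~= 0}"
 have oB: "zopn n B" unfolding B_def using a(2) openin_zariski_principal[OF gh(2)] by (auto simp: kreg_affine_space)
 have "opn (induced X U) (preim (induced X U) ph (B Int V))" by (rule iso_preim_open[OF iso])
   (insert oB, simp add: affine_variety_def openin_subtopology_Int)
 hence oN: "opn X (preim (induced X U) ph (B Int V))" using U by (simp add: openin_open_subtopology)
 define N where "N = preim (induced X U) ph (B Int V) Int ?W"
 have "opn X N" unfolding N_def using oN oW by blast
 moreover have "x : N" unfolding N_def B_def preim_def pU using x a(1) gh(3) im VK by auto
 moreover have "ALL y:N. pev h (ph y) ~= 0 & f y = pev g (ph y) / pev h (ph y)"
 proof
  fix y assume y: "y : N"
  hence yy: "y : W" "y : U" "ph y : A" "pev h (ph y) ~= 0" unfolding N_def B_def preim_def by auto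
  hence "?j (ph y) = y" using inj by simp
  moreover have "f (?j (ph y)) = a (ph y)" using a(3) yy by blast
  ultimately show "pev h (ph y) ~= 0 & f y = pev g (ph y) / pev h (ph y)" using gh yy by auto
 qed
 ultimately show "EX N g h. opn X N & x : N & N <= W Int U & g : pols n & h : pols n &
   (ALL y:N. pev h (ph y) ~= 0 & f y = pev g (ph y) / pev h (ph y))" using gh N_def by blast
qed

subsection \<open>Places and function fields\<close>

text \<open>\<open>E q a\<close>: the element \<open>q\<close> lies in the local ring, whose residue field is \<open>K\<close>, and has the residue \<open>a\<close>.\<close>

definition place :: "('k::field => 'r::field) => ('r => 'k => bool) => bool" where "place e E <-> (ALL c. E (e c) c) &
  (ALL q r a b. E q a --> E r b --> E (q + r) (a + b) & E (q * r) (a * b)) &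
  (ALL q a. E q a --> a ~= 0 --> E (inverse q) (inverse a)) & (ALL q a b. E q a --> E q b --> a = b)"

lemma placeD:
 assumes "place e E"
 shows place_const: "E (e c) c"
  and place_add: "E q a ==> E r b ==> E (q + r) (a + b)"
  and place_mult: "E q a ==> E r b ==> E (q * r) (a * b)"
  and place_inverse: "E q a ==> a ~= 0 ==> E (inverse q) (inverse a)"
  and place_unique: "E q a ==> E q b ==> a = b" using assms unfolding place_def by blast+

locale field_hom = uring_hom e for e :: "'k::field => 'r::field"
begin

lemma place_0: "place e E ==> E 0 0" using place_const[of e E 0] by simp

lemma place_1: "place e E ==> E 1 1" using place_const[of e E 1] by simp

lemma place_uminus: "place e E ==> E q a ==> E (- q) (- a)"
 using place_mult[of e E "e (-1)" "-1" q a] place_const[of e E "-1"] by (simp add: e_uminus)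

lemma place_diff: "place e E ==> E q a ==> E r b ==> E (q - r) (a - b)"
 using place_add[of e E q a "- r" "- b"] place_uminus[of E r b] by simp

lemma place_divide: "place e E ==> E q a ==> E r b ==> b ~= 0 ==> E (q / r) (a / b)"
 using place_mult[of e E q a "inverse r" "inverse b"] place_inverse[of e E r b] by (simp add: divide_inverse)

lemma place_power: "place e E ==> E q a ==> E (q ^ k) (a ^ k)" by (induction k) (auto simp: place_1 intro: place_mult)

lemma place_sum: "place e E ==> (!!i. i : I ==> E (q i) (a i)) ==> E (sum q I) (sum a I)"
 by (induction I rule: infinite_finite_induct) (auto simp: place_0 intro: place_add)

lemma place_nonzero: "place e E ==> E q a ==> a ~= 0 ==> q ~= 0" using place_0 place_unique by metis

lemma place_peval:
 assumes E: "place e E" and g: "g : pols n" and c: "!!k. k < n ==> E (c k) (a k)"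
 shows "E (peval e g c) (pev g a)" using g by (induction rule: pols_induct)
  (auto intro: place_const[OF E] place_mult[OF E] place_add[OF E] c)

end

text \<open>This is the localization of the K-algebra generated by \<open>G\<close> at the elements
  with nonzero residue. The inductive form lets properties of the generators, such as the behaviour
  of derivations and brackets, pass to the whole local ring.\<close>

inductive_set pgen :: "('k::field => 'r::field) => 'r set => ('r => 'k => bool) => 'r set" for e G E where
 const: "e c : pgen e G E"
| gen: "g : G ==> g : pgen e G E"
| add: "q : pgen e G E ==> r : pgen e G E ==> q + r : pgen e G E"
| mult: "q : pgen e G E ==> r : pgen e G E ==> q * r : pgen e G E"
| inverse: "q : pgen e G E ==> E q a ==> a ~= 0 ==> inverse q : pgen e G E"

lemma (in field_hom) peval_in_pgen:
 assumes "g : pols n" "!!k. k < n ==> c k : G"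
 shows "peval e g c : pgen e G E" using assms(1) by (induction rule: pols_induct) (auto intro: pgen.intros assms(2))

lemma (in field_hom) pgen_pol:
 assumes "h : pols n" "g : pols n" "!!k. k < n ==> c k : G"
  and E: "place e E" "!!k. k < n ==> E (c k) (a k)" "pev h a ~= 0"
  and q: "q * peval e h c = peval e g c"
 shows "q : pgen e G E"
proof -
 have h: "E (peval e h c) (pev h a)" by (rule place_peval) fact+
 hence "peval e h c ~= 0" using place_nonzero[OF E(1)] E(3) by blast
 hence "q = peval e g c * inverse (peval e h c)" using q by (simp add: field_simps)
 moreover have hg: "peval e h c : pgen e G E" "peval e g c : pgen e G E" using assms(1-3) by (auto intro: peval_in_pgen)
 moreover have "inverse (peval e h c) : pgen e G E" by (rule pgen.inverse[where E=E]; fact)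
 ultimately show ?thesis using pgen.mult by metis
qed

text \<open>\<open>th\<close> maps a section over an open set to an element of the function field;
  so \<open>ev X th x\<close> is the place given by the local ring of \<open>x\<close> and
  evaluation at \<open>x\<close>.\<close>

definition ev :: "('a, 'k) kspace => ('a set => ('a => 'k) => 'r) => 'a => 'r => 'k => bool" where
 "ev X th x q a <-> (EX W f. x : W & kreg X W f & th W f = q & f x = a)"

abbreviation "evh X \<equiv> ev (hat  X)"

text \<open>The field and the map \<open>th\<close> are given rather than constructed from
  \<open>X\<close>. Thus a space, its Nash blowup and its normalization can use literally the same
  field, and their local rings are compared as subsets of it.\<close>

locale ffield = field_hom e for e :: "'k::field => 'r::field" +
 fixes X :: "('a, 'k) kspace" and th :: "'a set => ('a => 'k) => 'r"
 assumes ringed: "ringed X" and nonempty: "pts X ~= {}"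
  and irred: "opn X A ==> opn X B ==> A ~= {} ==> B ~= {} ==> A Int B ~= {}"
  and th_const: "opn X W ==> W ~= {} ==> th W (%_. c) = e c"
  and th_add: "kreg X W f ==> kreg X W g ==> W ~= {} ==> th W (%x. f x + g x) = th W f + th W g"
  and th_mult: "kreg X W f ==> kreg X W g ==> W ~= {} ==> th W (%x. f x * g x) = th W f * th W g"
  and th_restrict: "kreg X W f ==> opn X W' ==> W' <= W ==> W' ~= {} ==> th W' f = th W f"
  and th_cong: "kreg X W f ==> (!!x. x : W ==> f x = g x) ==> th W f = th W g"
  and th_zero: "kreg X W f ==> th W f = 0 ==> x : W ==> f x = 0"
begin

lemmas r_open = ringed_open[OF ringed] and r_cong = ringed_cong[OF ringed]
 and r_restrict = ringed_restrict[OF ringed] and r_glue = ringed_glue[OF ringed]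
 and r_const = ringed_const[OF ringed] and r_add = ringed_add[OF ringed]
 and r_mult = ringed_mult[OF ringed] and r_open_nonzero = ringed_nonzero[OF ringed]
 and r_inverse = ringed_inverse[OF ringed]

lemma th_eq_imp:
 assumes f: "kreg X W f" and g: "kreg X W' g" and eq: "th W f = th W' g" and x: "x : W" "x : W'"
 shows "f x = g x"
proof -
 let ?W = "W Int W'"
 have W: "opn X ?W" "x : ?W" "?W ~= {}" using r_open[OF f] r_open[OF g] x by auto
 have fg: "kreg X ?W f" "kreg X ?W g" using r_restrict[OF f W(1)] r_restrict[OF g W(1)] by auto
 have m: "kreg X ?W (%x. (-1) * g x)" using r_mult[OF r_const[OF W(1)] fg(2)] .
 have "th ?W (%x. f x + (-1) * g x) = th ?W f + e (-1) * th ?W g"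
  unfolding th_add[OF fg(1) m W(3)] th_mult[OF r_const[OF W(1)] fg(2) W(3)] th_const[OF W(1,3)] ..
 also have "... = 0" using th_restrict[OF f W(1) _ W(3)] th_restrict[OF g W(1) _ W(3)] eq by (simp add: e_uminus)
 finally have "f x + (-1) * g x = 0" using th_zero[OF r_add[OF fg(1) m] _ W(2)] by blast
 thus ?thesis by simp
qed

lemma evI: "kreg X W f ==> x : W ==> ev X th x (th W f) (f x)" unfolding ev_def by blast

lemma place_ev:
 assumes x: "x : pts X"
 shows "place e (ev X th x)" unfolding place_def
proof (intro conjI allI impI)
 fix c q r a b
 show "ev X th x (e c) c"
  using evI[OF r_const[OF openin_topspace, of c] x] th_const[OF openin_topspace nonempty, of c] by simp
 assume "ev X th x q a"
 then obtain W f where f: "x : W" "kreg X W f" "th W f = q" "f x = a" unfolding ev_def by blast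
 show "ev X th x (inverse q) (inverse a)" if "a ~= 0"
 proof -
  let ?W = "{x : W. f x ~= 0}"
  note W = r_open_nonzero[OF f(2)]
  have ne: "?W ~= {}" "x : ?W" using f that by auto
  have fW: "kreg X ?W f" by (rule r_restrict[OF f(2) W]) auto
  have "th ?W (%x. inverse (f x)) * th ?W f = th ?W (%x. inverse (f x) * f x)"
   using th_mult[OF r_inverse[OF f(2)] fW ne(1)] by simp
  also have "... = th ?W (%_. 1)" by (rule th_cong[OF r_mult[OF r_inverse[OF f(2)] fW]]) auto
  also have "... = 1" using th_const[OF W ne(1)] by simp
  also have "th ?W f = q" using th_restrict[OF f(2) W _ ne(1)] f(3) by auto
  finally have "th ?W (%x. inverse (f x)) = inverse q" by (metis inverse_unique mult.commute)
  thus ?thesis using evI[OF r_inverse[OF f(2)] ne(2)] f(4) by simp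
 qed {
  fix b assume "ev X th x r b"
  then obtain W' g where g: "x : W'" "kreg X W' g" "th W' g = r" "g x = b" unfolding ev_def by blast
  have W: "opn X (W Int W')" "x : W Int W'" "W Int W' ~= {}" using r_open[OF f(2)] r_open[OF g(2)] f g by auto
  have fg: "kreg X (W Int W') f" "kreg X (W Int W') g" using r_restrict f(2) g(2) W(1) by auto
  have "th (W Int W') f = q" "th (W Int W') g = r"
   using th_restrict[OF f(2) W(1) _ W(3)] th_restrict[OF g(2) W(1) _ W(3)] f(3) g(3) by auto
  thus "ev X th x (q + r) (a + b)" "ev X th x (q * r) (a * b)"
   using evI[OF r_add[OF fg] W(2)] evI[OF r_mult[OF fg] W(2)] th_add[OF fg W(3)] th_mult[OF fg W(3)]
    f(4) g(4) by simp_all }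
 show "a = b" if "ev X th x q b"
 proof -
  obtain W' g where g: "x : W'" "kreg X W' g" "th W' g = q" "g x = b" using `ev X th x q b` unfolding ev_def by blast
  show ?thesis using th_eq_imp[OF f(2) g(2) _ f(1) g(1)] f g by simp
 qed
qed

definition rdom :: "'r => 'a set" where "rdom q = {x. EX a. ev X th x q a}"

definition rval :: "'r => 'a => 'k" where "rval q x = (THE a. ev X th x q a)"

lemma rdom_subset: "rdom q <= pts X" unfolding rdom_def ev_def using r_open openin_subset by fastforce

lemma ev_pts: "ev X th x q a ==> x : pts X" using rdom_subset[of q] unfolding rdom_def by auto

lemma ev_iff: "ev X th x q a <-> x : rdom q & rval q x = a"
proof -
 have "rval q x = a" if "ev X th x q a" for a
  unfolding rval_def using that place_unique[OF place_ev[OF ev_pts[OF that]]] by blast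
 thus ?thesis unfolding rdom_def by blast
qed

lemma ev_rval: "x : rdom q ==> ev X th x q (rval q x)" by (simp add: ev_iff)

lemma kreg_subset_rdom: "kreg X W f ==> th W f = q ==> W <= rdom q" using evI unfolding rdom_def by blast

lemma kreg_rval_eq: "kreg X W f ==> th W f = q ==> x : W ==> rval q x = f x" using evI ev_iff by blast

lemma openin_rdom: "opn X (rdom q)"
proof (subst openin_subopen, intro ballI)
 fix x assume "x : rdom q"
 then obtain W f where f: "x : W" "kreg X W f" "th W f = q" unfolding rdom_def ev_def by blast
 thus "EX T. opn X T & x : T & T <= rdom q" using r_open[OF f(2)] kreg_subset_rdom[OF f(2,3)] by blast
qed

lemma kreg_rval: "kreg X (rdom q) (rval q)"
proof (rule r_glue[OF openin_rdom])
 fix x assume "x : rdom q"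
 then obtain W f where f: "x : W" "kreg X W f" "th W f = q" unfolding rdom_def ev_def by blast
 have "kreg X W (rval q)" by (rule r_cong[OF f(2)]) (use kreg_rval_eq[OF f(2,3)] in auto)
 thus "EX N. x : N & kreg X N (rval q)" using f(1) by blast
qed

lemma kreg_rval_subset: "opn X W ==> W <= rdom q ==> kreg X W (rval q)" using r_restrict[OF kreg_rval] .

lemma th_rval:
 assumes "opn X W" "W <= rdom q" "W ~= {}"
 shows "th W (rval q) = q"
proof -
 obtain x where x: "x : W" using assms by blast
 then obtain V f where f: "x : V" "kreg X V f" "th V f = q" using assms unfolding rdom_def ev_def by blast
 have o: "opn X (V Int W)" "V Int W ~= {}" using r_open[OF f(2)] assms x f by auto
 have "th W (rval q) = th (V Int W) (rval q)" using th_restrict[OF kreg_rval_subset[OF assms(1,2)] o(1) _ o(2)] by auto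
 also have "... = th (V Int W) f"
  by (rule th_cong[OF kreg_rval_subset[OF o(1)]]) (use assms kreg_rval_eq[OF f(2,3)] in auto)
 also have "... = q" using th_restrict[OF f(2) o(1) _ o(2)] f by auto
 finally show ?thesis .
qed

lemma rval_zero_imp:
 assumes "opn X W" "W <= rdom q" "W ~= {}" "!!x. x : W ==> rval q x = 0"
 shows "q = 0"
proof -
 have "q = th W (rval q)" using th_rval[OF assms(1-3)] by simp
 also have "... = th W (%_. 0)" by (rule th_cong[OF kreg_rval_subset[OF assms(1,2)]]) (use assms(4) in auto)
 also have "... = 0" using th_const[OF assms(1,3), of 0] by simp
 finally show ?thesis .
qed

lemma rdom_nonzero:
 assumes "q ~= 0" "opn X W" "W <= rdom q" "W ~= {}"
 shows "opn X {x : W. rval q x ~= 0}" "{x : W. rval q x ~= 0} ~= {}"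
 using rval_zero_imp[OF assms(2-4)] assms(1) r_open_nonzero[OF kreg_rval_subset[OF assms(2,3)]] by auto

text \<open>A function on \<open>Y\<close> is pulled back along \<open>s\<close> and read in the
  function field of \<open>X\<close>; density of the image of \<open>s\<close> makes this injective.
  The map \<open>s\<close> will be the generic section of a Nash blowup, or the generic inverse of a
  normalization.\<close>

lemma pull_ffield:
 assumes Y: "ringed Y" and D: "opn X D" "D ~= {}"
  and s: "morphism (induced X D) Y s"
  and dense: "!!G. opn Y G ==> G ~= {} ==> EX x:D. s x : G"
 shows "ffield e Y (%W f. th {x : D. s x : W} (%x. f (s x)))"
proof -
 have D': "D <= pts X" by (rule openin_subset[OF D(1)])
 hence pO: "pts (induced X D) = D" by auto
 have so: "opn X {x : D. s x : W}" if "opn Y W" for W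
  using morphism_open[OF s that, unfolded pO] D(1) by (simp add: openin_open_subtopology)
 have sk: "kreg X {x : D. s x : W} (%x. f (s x))" if "kreg Y W f" for W f
  using morphism_kreg[OF s that, unfolded pO] kreg_induced_open[OF ringed D(1)] by blast
 have sn: "{x : D. s x : W} ~= {}" if "opn Y W" "W ~= {}" for W using dense[OF that] by blast
 note yo = ringed_open[OF Y]
 show ?thesis
 proof
  show "ringed Y" by (rule Y)
  show "pts Y ~= {}" using D(2) morphism_maps[OF s] pO by blast
  show "A Int B ~= {}" if "opn Y A" "opn Y B" "A ~= {}" "B ~= {}" for A B
   using irred[OF so[OF that(1)] so[OF that(2)] sn[OF that(1,3)] sn[OF that(2,4)]] by blast
  fix W f
  show "th {x : D. s x : W} (%x. c) = e c" if "opn Y W" "W ~= {}" for c by (rule th_const[OF so sn]) (use that in auto)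
  assume f: "kreg Y W f"
  show "th {x : D. s x : W} (%x. f (s x) + g (s x)) =
    th {x : D. s x : W} (%x. f (s x)) + th {x : D. s x : W} (%x. g (s x))"
   "th {x : D. s x : W} (%x. f (s x) * g (s x)) = th {x : D. s x : W} (%x. f (s x)) * th {x : D. s x : W} (%x. g (s x))"
   if "kreg Y W g" "W ~= {}" for g using th_add[OF sk[OF f] sk[OF that(1)] sn[OF yo[OF f] that(2)]]
    th_mult[OF sk[OF f] sk[OF that(1)] sn[OF yo[OF f] that(2)]] by auto
  show "th {x : D. s x : W'} (%x. f (s x)) = th {x : D. s x : W} (%x. f (s x))"
   if "opn Y W'" "W' <= W" "W' ~= {}" for W'
   by (rule th_restrict[OF sk[OF f] so[OF that(1)] _ sn[OF that(1,3)]]) (use that in auto)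
  show "th {x : D. s x : W} (%x. f (s x)) = th {x : D. s x : W} (%x. g (s x))" if "!!x. x : W ==> f x = g x" for g
   by (rule th_cong[OF sk[OF f]]) (use that in auto)
  show "f y = 0" if z: "th {x : D. s x : W} (%x. f (s x)) = 0" and y: "y : W" for y
  proof (rule ccontr)
   assume "f y ~= 0"
   hence "{y : W. f y ~= 0} ~= {}" using y by blast
   then obtain x where "x : D" "s x : W" "f (s x) ~= 0" using dense[OF ringed_nonzero[OF Y f]] by blast
   thus False using th_zero[OF sk[OF f] z, of x] by simp
  qed
 qed
qed

text \<open>Since \<open>s\<close> is a section of \<open>rh\<close>, pulling back by
  \<open>rh\<close> and then by \<open>s\<close> changes nothing on \<open>D\<close>. Hence the
  local ring of \<open>rh y\<close> lies in that of \<open>y\<close>, with the same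
  residues.\<close>

lemma pull_ev:
 assumes D: "opn X D" "D ~= {}"
  and rh: "morphism Y X rh" "!!x. x : D ==> s x : pts Y & rh (s x) = x"
  and y: "y : pts Y" and q: "ev X th (rh y) q a"
 shows "ev Y (%W f. th {x : D. s x : W} (%x. f (s x))) y q a"
proof -
 obtain W f where f: "rh y : W" "kreg X W f" "th W f = q" "f (rh y) = a" using q unfolding ev_def by blast
 have o: "opn X (D Int W)" "D Int W ~= {}" using D r_open[OF f(2)] irred[OF D(1) r_open[OF f(2)] D(2)] f(1) by auto
 have "{x : D. s x : {y : pts Y. rh y : W}} = D Int W" using rh(2) by auto
 hence "th {x : D. s x : {y : pts Y. rh y : W}} (%x. f (rh (s x))) = th (D Int W) (%x. f (rh (s x)))" by simp
 also have "... = th (D Int W) f" by (rule th_cong[symmetric]) (use r_restrict[OF f(2) o(1)] rh(2) in auto)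
 also have "... = q" using th_restrict[OF f(2) o(1) _ o(2)] f(3) by simp
 finally show ?thesis unfolding ev_def using morphism_kreg[OF rh(1) f(2)] y f(1,4)
  by (intro exI[of _ "{y : pts Y. rh y : W}"] exI[of _ "%y. f (rh y)"]) auto
qed

text \<open>The \<open>c k\<close> are the coordinate functions of the chart as elements of the
  field. The last two clauses say that the local ring at \<open>x\<close> is a localization of the
  coordinate ring, and that the vanishing ideal of \<open>V\<close> is the kernel of evaluation at
  \<open>c\<close>.\<close>

definition ccoords :: "'a set => nat => (nat => 'k) set => ('a => nat => 'k) => (nat => 'r) => bool" where
 "ccoords U n V ph c <-> (ALL x:U. ALL k<n. ev X th x (c k) (ph x k)) &
  (ALL x:U. ALL g:pols n. ev X th x (peval e g c) (pev g (ph x))) & (ALL x:U. ALL q a. ev X th x q a -->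
   (EX g:pols n. EX h:pols n. pev h (ph x) ~= 0 & q * peval e h c = peval e g c)) &
  (ALL g:pols n. (ALL y:V. pev g y = 0) <-> peval e g c = 0)"

lemma ccoordsD:
 assumes "ccoords U n V ph c"
 shows "!!x k. x : U ==> k < n ==> ev X th x (c k) (ph x k)"
  "!!x g. x : U ==> g : pols n ==> ev X th x (peval e g c) (pev g (ph x))"
  "!!x q a. x : U ==> ev X th x q a ==> EX g:pols n. EX h:pols n. pev h (ph x) ~= 0 & q * peval e h c = peval e g c"
  "!!g. g : pols n ==> (ALL y:V. pev g y = 0) <-> peval e g c = 0" using assms unfolding ccoords_def by blast+

lemma ccoordinates:
 assumes c: "affine_chart X U n V ph" and ne: "U ~= {}"
 shows "EX c. ccoords U n V ph c"
proof -
 define c where "c k = th U (%x. ph x k)" for k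
 note cd = affine_chartD[OF ringed c]
 have 1: "ev X th x (c k) (ph x k)" if "x : U" "k < n" for x k
  unfolding c_def by (rule evI[OF cd(6)[OF that(2)] that(1)])
 have Up: "U <= pts X" by (rule openin_subset[OF cd(1)])
 have 2: "ev X th x (peval e g c) (pev g (ph x))" if "x : U" "g : pols n" for x g
  by (rule place_peval[OF place_ev that(2)]) (use Up that 1 in auto)
 have Ur: "U <= rdom (peval e g c)" if "g : pols n" for g using 2[OF _ that] unfolding rdom_def by blast
 have 3: "EX g:pols n. EX h:pols n. pev h (ph x) ~= 0 & q * peval e h c = peval e g c"
  if x: "x : U" and q: "ev X th x q a" for x q a
 proof -
  obtain W f where f: "x : W" "kreg X W f" "th W f = q" "f x = a" using q unfolding ev_def by blast
  obtain N g h where N: "opn X N" "x : N" "N <= W Int U" "g : pols n" "h : pols n"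
   "ALL y:N. pev h (ph y) ~= 0 & f y = pev g (ph y) / pev h (ph y)" using cd(7)[OF f(2,1) x] by blast
  have Nn: "N ~= {}" using N by blast
  have kf: "kreg X N f" using r_restrict[OF f(2) N(1)] N(3) by blast
  have kh: "kreg X N (rval (peval e h c))" using kreg_rval_subset[OF N(1)] Ur[OF N(5)] N(3) by blast
  have "q * peval e h c = th N f * th N (rval (peval e h c))"
   using th_rval[OF N(1) _ Nn] Ur[OF N(5)] N(3) th_restrict[OF f(2) N(1) _ Nn] f(3) by auto
  also have "... = th N (%x. f x * rval (peval e h c) x)" using th_mult[OF kf kh Nn] by simp
  also have "... = th N (rval (peval e g c))"
  proof (rule th_cong[OF r_mult[OF kf kh]])
   fix y assume y: "y : N"
   thus "f y * rval (peval e h c) y = rval (peval e g c) y" using 2[of y h] 2[of y g] N by (auto simp: ev_iff)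
  qed
  also have "... = peval e g c" using th_rval[OF N(1) _ Nn] Ur[OF N(4)] N(3) by auto
  finally show ?thesis using N by blast
 qed
 have 4: "(ALL y:V. pev g y = 0) <-> peval e g c = 0" if g: "g : pols n" for g
 proof
  assume *: "ALL y:V. pev g y = 0"
  show "peval e g c = 0" by (rule rval_zero_imp[OF cd(1) Ur[OF g] ne]) (insert 2[OF _ g] * cd(4), auto simp: ev_iff)
 next
  assume *: "peval e g c = 0"
  show "ALL y:V. pev g y = 0"
  proof
   fix y assume "y : V"
   then obtain x where x: "x : U" "y = ph x" using cd(4) by blast
   hence "x : pts X" using Up by blast
   thus "pev g y = 0" using 2[OF x(1) g] place_0[OF place_ev] place_unique[OF place_ev] x(2) * by metis
  qed
 qed
 show ?thesis unfolding ccoords_def using 1 2 3 4 by (intro exI[of _ c] conjI ballI allI impI) auto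
qed

end

subsection \<open>The Hilbert basis theorem\<close>

text \<open>
  Noetherian rings in the form: every sequence has a member that is a combination of its
  predecessors.  This also serves to derive integral equations from the sequence of powers.
\<close>

definition noeth_subring :: "'r::comm_ring_1 set => bool" where "noeth_subring A <->
  (ALL f :: nat => 'r. range f <= A --> (EX N c. (ALL i<N. c i : A) & f N = (SUM i<N. c i * f i)))"

locale subring_set =
 fixes A :: "'r::comm_ring_1 set"
 assumes A_0: "0 : A" and A_1: "1 : A" and A_add: "a : A ==> b : A ==> a + b : A"
  and A_mult: "a : A ==> b : A ==> a * b : A" and A_uminus: "a : A ==> - a : A"
begin

lemma A_sum: "(!!i. i : I ==> f i : A) ==> sum f I : A"
 by (induction I rule: infinite_finite_induct) (auto simp: A_0 A_add)

definition "pover = {p :: 'r poly. ALL i. coeff p i : A}"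

lemma pover_add: "p : pover ==> q : pover ==> p + q : pover" by (auto simp: pover_def A_add)

lemma pover_mult: "p : pover ==> q : pover ==> p * q : pover" by (auto simp: pover_def coeff_mult intro!: A_sum A_mult)

lemma pover_monom: "a : A ==> monom a k : pover" by (auto simp: pover_def A_0)

definition "comb g k = {SUM i<k. c i * g i | c. ALL i. c i : pover}" for g :: "nat => 'r poly" and k :: nat

lemma combI: "p = (SUM i<k. c i * g i) ==> (!!i. c i : pover) ==> p : comb g k" by (auto simp: comb_def)

lemma comb_add: "p : comb g k ==> q : comb g k ==> p + q : comb g k"
proof -
 assume "p : comb g k" "q : comb g k"
 then obtain c d where "p = (SUM i<k. c i * g i)" "q = (SUM i<k. d i * g i)"
  "ALL i. c i : pover" "ALL i. d i : pover" by (auto simp: comb_def)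
 hence "p + q = (SUM i<k. (c i + d i) * g i)" "ALL i. c i + d i : pover"
  by (auto simp: sum.distrib algebra_simps pover_add)
 thus ?thesis by (auto intro: combI[of _ "%i. c i + d i"])
qed

lemma comb_mult: "r : pover ==> p : comb g k ==> r * p : comb g k"
proof -
 assume r: "r : pover" and "p : comb g k"
 then obtain c where "p = (SUM i<k. c i * g i)" "ALL i. c i : pover" by (auto simp: comb_def)
 hence "r * p = (SUM i<k. (r * c i) * g i)" "ALL i. r * c i : pover"
  by (auto simp: sum_distrib_left algebra_simps pover_mult[OF r])
 thus ?thesis by (auto intro: combI[of _ "%i. r * c i"])
qed

lemma comb_0: "0 : comb g k" by (rule combI[of _ "%_. 0"]) (auto simp: pover_def A_0)

lemma comb_sum: "(!!i. i : I ==> f i : comb g k) ==> sum f I : comb g k"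
 by (induction I rule: infinite_finite_induct) (auto simp: comb_0 comb_add)

lemma comb_gen: "i < k ==> g i : comb g k"
proof -
 assume "i < k"
 have "g i = (SUM j<k. if j = i then g j else 0)" using `i < k` by simp
 also have "... = (SUM j<k. (if j = i then 1 else 0) * g j)" by (intro sum.cong) auto
 finally show ?thesis unfolding comb_def
  using A_0 A_1 by (intro CollectI exI[of _ "%j. if j = i then 1 else 0"]) (auto simp: pover_def)
qed

lemma comb_subset: "(!!i. i < l ==> h i : comb g k) ==> comb h l <= comb g k"
proof
 fix p assume "!!i. i < l ==> h i : comb g k" "p : comb h l"
 thus "p : comb g k" by (auto simp: comb_def[of h] intro!: comb_sum comb_mult)
qed

lemma comb_cong: "(!!i. i < k ==> g i = h i) ==> comb g k = comb h k"
 unfolding comb_def by (intro Collect_cong ex_cong1) (auto intro!: sum.cong)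

text \<open>Hilbert's argument. If no \<open>f N\<close> were a combination of its predecessors, one
  could choose successively polynomials of least degree in the ideal outside the ideal of the
  earlier choices. A relation among their leading coefficients then produces a polynomial of smaller
  degree that is still outside.\<close>

lemma noetherian_pover:
 assumes A: "noeth_subring A"
 shows "noeth_subring pover" unfolding noeth_subring_def
proof (intro allI impI, rule ccontr)
 fix f :: "nat => 'r poly"
 assume f: "range f <= pover" and "~ (EX N c. (ALL i<N. c i : pover) & f N = (SUM i<N. c i * f i))"
 hence bad: "f N ~: comb f N" for N unfolding comb_def by blast
 define I where "I = (UN k. comb f k)"
 have mono: "comb f k <= comb f l" if "k <= l" for k l by (rule comb_subset) (insert that, auto intro: comb_gen)
 have I_add: "p + q : I" if pq: "p : I" "q : I" for p q
 proof -
  obtain k l where "p : comb f k" "q : comb f l" using pq by (auto simp: I_def)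
  hence "p : comb f (max k l)" "q : comb f (max k l)" using mono[of k "max k l"] mono[of l "max k l"] by auto
  thus ?thesis using comb_add unfolding I_def by blast
 qed
 have I_mult: "r * p : I" if "r : pover" "p : I" for r p using that comb_mult unfolding I_def by blast
 have I_sum: "sum h J : I" if "!!i. i : J ==> h i : I" for h and J :: "nat set"
 proof -
  have "0 : I" unfolding I_def using comb_0 by blast
  thus ?thesis using that by (induction J rule: infinite_finite_induct) (auto simp: I_add)
 qed
 have I_over: "I <= pover"
 proof
  fix p assume "p : I"
  then obtain k c where "p = (SUM i<k. c i * f i)" "ALL i. c i : pover" by (auto simp: I_def comb_def)
  moreover have "c i * f i : pover" for i using calculation f pover_mult by blast
  ultimately show "p : pover" by (auto simp: pover_def coeff_sum intro!: A_sum)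
 qed
 define M where "M g k p <-> p : I & p ~: comb g k & (ALL q. q : I --> q ~: comb g k --> degree p <= degree q)" for g k p
 have "EX g. ALL k. M g k (g k)"
 proof (rule dependent_wellorder_choice)
  show "M g k p = M h k p" if "!!i. i < k ==> g i = h i" for p g h k
   unfolding M_def using comb_cong[OF that, of k] by simp
  fix k and g :: "nat => 'r poly" assume g: "!!i. i < k ==> M g i (g i)"
  have "EX p. p : I & p ~: comb g k"
  proof (rule ccontr)
   assume "~ ?thesis"
   hence sub: "I <= comb g k" by blast
   \<comment> \<open>Finitely many choices involve only finitely many \<open>f i\<close>; so if they
     generated \<open>I\<close>, some \<open>comb f m\<close> would be all of \<open>I\<close> and
     contain \<open>f m\<close>.\<close>
   have "EX m. ALL i<l. g i : comb f m" if "l <= k" for l using that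
   proof (induction l)
    case (Suc l)
    then obtain m where m: "ALL i<l. g i : comb f m" by auto
    have "g l : I" using g[of l] Suc.prems by (simp add: M_def)
    then obtain m' where "g l : comb f m'" by (auto simp: I_def)
    hence "ALL i<Suc l. g i : comb f (max m m')"
     using m mono[of m "max m m'"] mono[of m' "max m m'"] by (auto simp: less_Suc_eq)
    thus ?case by blast
   qed auto
   then obtain m where "ALL i<k. g i : comb f m" by auto
   hence "I <= comb f m" using sub comb_subset[of k g f m] by blast
   moreover have "f m : I" unfolding I_def using comb_gen[of m "Suc m" f] by blast
   ultimately show False using bad by blast
  qed
  thus "EX p. M g k p" unfolding M_def using ex_has_least_nat[of "%p. p : I & p ~: comb g k" _ degree] by blast
 qed
 then obtain g where g: "M g k (g k)" for k by blast
 have deg: "degree (g i) <= degree (g k)" if "i < k" for i k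
  using g[of i] g[of k] that comb_subset[of i g g k] comb_gen[of _ k g] unfolding M_def
  by (meson order_less_trans subsetD)
 have gA: "range (%k. lead_coeff (g k)) <= A" using g I_over unfolding M_def pover_def by blast
 then obtain N c where c: "ALL i<N. c i : A" "lead_coeff (g N) = (SUM i<N. c i * lead_coeff (g i))"
  using A unfolding noeth_subring_def by blast
 \<comment> \<open>Each \<open>g i\<close> is raised to the degree of \<open>g N\<close>, so that
   \<open>s\<close> has the leading coefficient of \<open>g N\<close> in that degree.\<close>
 define s where "s = (SUM i<N. monom (c i) (degree (g N) - degree (g i)) * g i)"
 have s: "s : comb g N" unfolding s_def using c(1) by (intro comb_sum comb_mult pover_monom comb_gen) auto
 have sI: "s : I" unfolding s_def by (intro I_sum I_mult pover_monom) (insert c(1) g, auto simp: M_def)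
 have "- s = monom (- 1) 0 * s" by (simp add: monom_0)
 hence "- s : I" using I_mult[OF pover_monom[OF A_uminus[OF A_1]] sI] by metis
 hence dI: "g N - s : I" using I_add[of "g N" "- s"] g[of N] by (simp add: M_def)
 have dn: "g N - s ~: comb g N"
 proof
  assume "g N - s : comb g N"
  from comb_add[OF this s] show False using g[of N] by (simp add: M_def)
 qed
 have "coeff (monom (c i) (degree (g N) - degree (g i)) * g i) (degree (g N)) = c i * lead_coeff (g i)"
  if "i < N" for i using deg[OF that] by (simp add: coeff_monom_mult)
 hence cs: "coeff s (degree (g N)) = lead_coeff (g N)" unfolding s_def coeff_sum c(2) by simp
 have "degree s <= degree (g N)" unfolding s_def
 proof (rule degree_sum_le)
  fix i assume "i : {..<N}"
  hence "degree (g i) <= degree (g N)" using deg by auto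
  thus "degree (monom (c i) (degree (g N) - degree (g i)) * g i) <= degree (g N)"
   using degree_mult_le[of "monom (c i) (degree (g N) - degree (g i))" "g i"]
    degree_monom_le[of "c i" "degree (g N) - degree (g i)"] by linarith
 qed auto
 hence "degree (g N - s) <= degree (g N)" by (simp add: degree_diff_le)
 moreover have "coeff (g N - s) (degree (g N)) = 0" using cs by simp
 moreover have "g N - s ~= 0" using dn comb_0 by metis
 ultimately have "degree (g N - s) < degree (g N)" by (metis leading_coeff_0_iff order_le_less)
 moreover have "degree (g N) <= degree (g N - s)" using g[of N] dI dn unfolding M_def by blast
 ultimately show False by simp
qed

text \<open>The ring \<open>B\<close> is an image of the polynomial ring over \<open>A\<close>, and
  a relation among lifts descends.\<close>

lemma noetherian_adjoin:
 assumes "noeth_subring A" and B: "B = (%p. poly p x) ` pover"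
 shows "noeth_subring B" unfolding noeth_subring_def
proof (intro allI impI)
 fix f :: "nat => 'r" assume "range f <= B"
 hence "ALL k. EX p. p : pover & f k = poly p x" using B by blast
 then obtain p where p: "!!k. p k : pover" "!!k. f k = poly (p k) x" by metis
 obtain N c where "ALL i<N. c i : pover" "p N = (SUM i<N. c i * p i)"
  using noetherian_pover[OF assms(1)] p(1) unfolding noeth_subring_def by (metis image_subsetI)
 hence "(ALL i<N. poly (c i) x : B) & f N = (SUM i<N. poly (c i) x * f i)" using B p(2) by (auto simp: poly_sum)
 thus "EX N c. (ALL i<N. c i : B) & f N = (SUM i<N. c i * f i)" by (intro exI)
qed

end

lemma subring_pols: "subring_set (pols n)"
 by unfold_locales (auto simp: pols_pconst[of 0, unfolded pconst_def] pols_pconst[of 1, unfolded pconst_def, simplified])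

lemma pols_mono: "pols n <= pols (Suc n)" unfolding pols_def by (force simp: less_Suc_eq)

lemma pols_Suc: "pols (Suc n) = (%p. poly p (pvar n)) ` subring_set.pover (pols n)"
proof -
 interpret subring_set "pols n" by (rule subring_pols)
 have "EX p:pover. f = poly p (pvar n)" if "f : pols (Suc n)" for f :: "'a pol" using that
 proof (induction rule: pols_induct)
  case (const a)
  thus ?case by (intro bexI[of _ "[:pconst a:]"]) (auto simp: pover_def coeff_pCons split: nat.splits)
 next
  case (var i f)
  then obtain p where p: "p : pover" "f = poly p (pvar n)" by blast
  show ?case
  proof (cases "i = n")
   case True
   thus ?thesis using p by (intro bexI[of _ "pCons 0 p"]) (auto simp: pover_def coeff_pCons split: nat.splits)
  next
   case False
   hence "(pvar i :: 'a pol) : pols n" using var by simp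
   thus ?thesis using p by (intro bexI[of _ "smult (pvar i) p"]) (auto simp: pover_def simp del: pols_pvar)
  qed
 next
  case (add f g)
  then obtain p q where "p : pover" "f = poly p (pvar n)" "q : pover" "g = poly q (pvar n)" by blast
  thus ?case by (intro bexI[of _ "p + q"]) (auto simp: pover_add)
 qed
 moreover have "poly p (pvar n) : pols (Suc n)" if "p : pover" for p unfolding poly_altdef
 proof (intro pols_sum pols_mult)
  fix i
  show "coeff p i : pols (Suc n)" using that pols_mono by (auto simp: pover_def)
  have "pvar n ^ i : pols (Suc n)" for i
   by (induction i) (auto simp: pols_pconst[of 1, unfolded pconst_def, simplified])
  thus "pvar n ^ i : pols (Suc n)" .
 qed
 ultimately show ?thesis by auto
qed

theorem hilbert_basis: "noeth_subring (pols n :: 'k::field pol set)"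
proof (induction n)
 case 0
 show ?case unfolding noeth_subring_def
 proof (intro allI impI)
  fix f :: "nat => 'k pol" assume f: "range f <= pols 0"
  have "EX a. g = pconst a" if "g : pols 0" for g :: "'k pol" using that
  proof (induction rule: pols_induct)
   case (add f g)
   thus ?case by (metis pconst_def single_add)
  qed auto
  then obtain a b where ab: "f 0 = pconst a" "f 1 = pconst b" using f by (meson rangeI subsetD)
  \<comment> \<open>\<open>pols 0\<close> is the field of constants: \<open>f 0\<close> is either
    zero, which is the empty combination, or a unit dividing \<open>f 1\<close>.\<close>
  show "EX N c. (ALL i<N. c i : pols 0) & f N = (SUM i<N. c i * f i)"
  proof (cases "a = 0")
   case True
   thus ?thesis using ab by (intro exI[of _ 0]) (simp add: pconst_def)
  next
   case False
   hence "f 1 = pconst (b / a) * f 0" unfolding ab by (simp add: pconst_def mult_single)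
   thus ?thesis by (intro exI[of _ 1] exI[of _ "%_. pconst (b / a)"]) simp
  qed
 qed
next
 case (Suc n)
 interpret subring_set "pols n :: 'k pol set" by (rule subring_pols)
 show ?case by (rule noetherian_adjoin[OF Suc pols_Suc])
qed

subsection \<open>Extension of places along integral elements\<close>

text \<open>Over a finite field the product of all \<open>X - a\<close>, plus 1, has no
  root.\<close>

lemma alg_closed_infinite: "infinite (UNIV :: 'k::alg_closed_field set)"
proof
 assume fin: "finite (UNIV :: 'k set)"
 define p where "p = (PROD a:(UNIV :: 'k set). [:- a, 1:]) + 1"
 have ev: "poly p x = 1" for x using fin by (simp add: p_def poly_prod prod.remove[of UNIV x])
 have "degree (PROD a:(UNIV :: 'k set). [:- a, 1:]) = card (UNIV :: 'k set)" by (subst degree_prod_eq_sum_degree) auto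
 hence "degree (PROD a:(UNIV :: 'k set). [:- a, 1:]) > 0" using fin by (simp add: card_gt_0_iff)
 hence "degree p > 0" unfolding p_def by (subst degree_add_eq_left) auto
 then obtain x where "poly p x = 0" using alg_closed_imp_poly_has_root by blast
 thus False using ev by simp
qed

context field_hom
begin

text \<open>Nakayama's lemma by elimination: \<open>1 - mmu k k\<close> has residue 1 and is
  invertible, so the last unknown is expressed by the others, and the coefficients of the remaining
  system again have residue 0.\<close>

lemma place_nakayama:
 fixes k :: nat
 assumes E: "place e E" and "!!i j. i < k ==> j < k ==> E (mmu i j) 0"
  and "!!i. i < k ==> x i = (SUM j<k. mmu i j * x j)" and "i < k"
 shows "x i = 0" using assms(2-4)
proof (induction k arbitrary: mmu i)
 case (Suc k)
 define d where "d = 1 - mmu k k"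
 have dE: "E d 1" unfolding d_def using place_diff[OF E place_1[OF E] Suc.prems(1)[of k k]] by simp
 hence d: "d ~= 0" using place_nonzero[OF E] by force
 have "d * x k = (SUM j<k. mmu k j * x j)" using Suc.prems(2)[of k] by (simp add: d_def algebra_simps)
 hence "x k = (SUM j<k. mmu k j * x j) / d" using d by (simp add: eq_divide_eq mult.commute)
 hence xk: "x k = (SUM j<k. mmu k j / d * x j)" by (simp add: sum_divide_distrib)
 define mmu' where "mmu' i j = mmu i j + mmu i k * (mmu k j / d)" for i j
 have 1: "E (mmu' i j) 0" if "i < k" "j < k" for i j
 proof -
  have "E (mmu k j / d) (0 / 1)" using that Suc.prems(1) dE by (intro place_divide[OF E]) auto
  from place_add[OF E Suc.prems(1)[of i j] place_mult[OF E Suc.prems(1)[of i k] this]]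
  show ?thesis using that by (simp add: mmu'_def)
 qed
 have 2: "x i = (SUM j<k. mmu' i j * x j)" if "i < k" for i
 proof -
  have "x i = (SUM j<k. mmu i j * x j) + mmu i k * x k" using Suc.prems(2)[of i] that by simp
  also have "... = (SUM j<k. mmu i j * x j) + (SUM j<k. mmu i k * (mmu k j / d * x j))"
   by (subst xk) (simp add: sum_distrib_left)
  also have "... = (SUM j<k. mmu' i j * x j)" by (simp add: mmu'_def sum.distrib algebra_simps)
  finally show ?thesis .
 qed
 have "x i = 0" if "i < k" for i using Suc.IH[OF 1 2 that] .
 thus ?case using xk Suc.prems(3) by (auto simp: less_Suc_eq)
qed simp

definition reduces :: "('r => 'k => bool) => 'r poly => 'k poly => bool" where
 "reduces E G g <-> (ALL i. E (coeff G i) (coeff g i))"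

lemma reduces_add: "place e E ==> reduces E G g ==> reduces E H h ==> reduces E (G + H) (g + h)"
 unfolding reduces_def coeff_add using place_add[of e E] by blast

lemma reduces_diff: "place e E ==> reduces E G g ==> reduces E H h ==> reduces E (G - H) (g - h)"
 unfolding reduces_def coeff_diff using place_diff[of E] by blast

lemma reduces_mult:
 assumes E: "place e E" and G: "reduces E G g" "reduces E H h"
 shows "reduces E (G * H) (g * h)" unfolding reduces_def coeff_mult
proof
 fix n
 show "E (SUM i<=n. coeff G i * coeff H (n - i)) (SUM i<=n. coeff g i * coeff h (n - i))"
  by (rule place_sum[OF E], rule place_mult[OF E]) (insert G, simp_all add: reduces_def)
qed

lemma reduces_const:
 assumes E: "place e E" "E q a"
 shows "reduces E [:q:] [:a:]"
 unfolding reduces_def coeff_pCons using assms place_0[OF E(1)] by (simp split: nat.splits)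

lemma reduces_monom:
 assumes E: "place e E" "E q a"
 shows "reduces E (monom q k) (monom a k)" unfolding reduces_def coeff_monom using assms place_0[OF E(1)] by simp

lemma reduces_lift: "place e E ==> reduces E (map_poly e g) g"
 unfolding reduces_def by (simp add: coeff_map_poly place_const)

text \<open>Lying over, with explicit residues. The reductions of polynomials over the local ring
  that vanish at \<open>b\<close> form a proper ideal \<open>J\<close> of \<open>K[X]\<close>; a
  root \<open>be\<close> of its generator is a possible residue of \<open>b\<close>.\<close>

lemma place_extend_integral:
 fixes b :: 'r
 assumes K: "!!p :: 'k poly. degree p > 0 ==> EX x. poly p x = 0"
  and E: "place e E" and k: "k > 0" and a: "!!i. i < k ==> EX aal. E (a i) aal"
  and int: "b ^ k = (SUM i<k. a i * b ^ i)"
 shows "EX E'. place e E' & (ALL q aal. E q aal --> E' q aal) & (EX be. E' b be)"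
proof -
 define J where "J = {g. EX G. reduces E G g & poly G b = 0}"
 obtain aal where aal: "!!i. i < k ==> E (a i) (aal i)" using a by metis
 have J_diff: "g - h : J" if gh: "g : J" "h : J" for g h
 proof -
  obtain G H where "reduces E G g" "poly G b = 0" "reduces E H h" "poly H b = 0" using gh by (auto simp: J_def)
  thus ?thesis using reduces_diff[OF E, of G g H h] unfolding J_def by auto
 qed
 have J_mult: "h * g : J" if g: "g : J" for g h
 proof -
  obtain G where "reduces E G g" "poly G b = 0" using g by (auto simp: J_def)
  thus ?thesis using reduces_mult[OF E reduces_lift[OF E, of h], of G g] unfolding J_def by auto
 qed
 \<comment> \<open>By the integral equation all powers of \<open>b\<close> lie in the module spanned
   by the first \<open>k\<close> of them over the local ring.\<close>
 have powers: "EX c. (ALL i<k. EX gga. E (c i) gga) & b ^ s = (SUM i<k. c i * b ^ i)" for s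
 proof (induction s)
  case 0
  have "(1 :: 'r) = (SUM i<k. (if i = 0 then 1 else 0) * b ^ i)" using k by (simp add: if_distrib[of "%x. x * _"] cong: if_cong)
  thus ?case using place_0[OF E] place_1[OF E] by (intro exI[of _ "%i. if i = 0 then 1 else 0"]) auto
 next
  case (Suc s)
  then obtain c where c: "ALL i<k. EX gga. E (c i) gga" "b ^ s = (SUM i<k. c i * b ^ i)" by blast
  obtain l where l: "k = Suc l" using k by (cases k) auto
  define c' where "c' i = (if i = 0 then 0 else c (i - 1)) + c l * a i" for i
  have "b ^ Suc s = (SUM i<k. c i * b ^ Suc i)" using c(2) by (simp add: sum_distrib_left algebra_simps)
  also have "... = (SUM i<l. c i * b ^ Suc i) + c l * b ^ k" by (simp add: l)
  also have "(SUM i<l. c i * b ^ Suc i) = (SUM i<k. (if i = 0 then 0 else c (i - 1)) * b ^ i)"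
   unfolding l sum.lessThan_Suc_shift by simp
  also have "c l * b ^ k = (SUM i<k. c l * a i * b ^ i)" by (simp add: int sum_distrib_left mult.assoc)
  also have "(SUM i<k. (if i = 0 then 0 else c (i - 1)) * b ^ i) + ... = (SUM i<k. c' i * b ^ i)"
   by (simp add: c'_def sum.distrib distrib_right)
  finally have "b ^ Suc s = (SUM i<k. c' i * b ^ i)" .
  moreover have "EX gga. E (c' i) gga" if i: "i < k" for i
  proof -
   obtain x y where xy: "E (c l) x" "E (a i) y" using c(1) l aal i by blast
   have "EX z. E (if i = 0 then 0 else c (i - 1)) z" using c(1) i place_0[OF E] by (cases "i = 0") auto
   thus ?thesis unfolding c'_def using place_add[OF E] place_mult[OF E xy] by blast
  qed
  ultimately show ?case by blast
 qed
 have red1: "reduces E 1 1" using reduces_const[OF E place_1[OF E]] by (simp add: one_pCons)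
 \<comment> \<open>If 1 were in \<open>J\<close>, then \<open>poly M b = 1\<close> with all
   coefficients of \<open>M\<close> of residue 0. Rewriting \<open>poly M b * b ^ i\<close> by the
   first \<open>k\<close> powers gives a system to which Nakayama applies, with the absurd result
   \<open>b ^ 0 = 0\<close>.\<close>
 have one: "1 ~: J"
 proof
  assume "1 : J"
  then obtain G where G: "reduces E G 1" "poly G b = 0" by (auto simp: J_def)
  define M where "M = 1 - G"
  have M: "E (coeff M s) 0" for s using place_diff[OF E, of "coeff 1 s" "coeff 1 s" "coeff G s" "coeff 1 s"] G(1) red1
   by (auto simp: M_def reduces_def)
  have Mb: "poly M b = 1" using G(2) by (simp add: M_def)
  obtain c where c: "!!s. (ALL i<k. EX gga. E (c s i) gga) & b ^ s = (SUM i<k. c s i * b ^ i)" using powers by metis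
  define mmu where "mmu i j = (SUM s<=degree M. coeff M s * c (s + i) j)" for i j
  have "b ^ 0 = 0"
  proof (rule place_nakayama[OF E, where k = k and mmu = mmu and x = "%i. b ^ i"])
   show "E (mmu i j) 0" if "i < k" "j < k" for i j
   proof -
    have "ALL s. EX gga. E (c (s + i) j) gga" using c that by blast
    then obtain gga where "!!s. E (c (s + i) j) (gga s)" by metis
    hence "E (mmu i j) (SUM s<=degree M. 0 * gga s)" unfolding mmu_def by (intro place_sum[OF E] place_mult[OF E M])
    thus ?thesis by simp
   qed
   show "b ^ i = (SUM j<k. mmu i j * b ^ j)" if "i < k" for i
   proof -
    have "b ^ i = poly M b * b ^ i" using Mb by simp
    also have "... = (SUM s<=degree M. coeff M s * b ^ (s + i))"
     by (simp add: poly_altdef sum_distrib_right power_add mult.assoc)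
    also have "... = (SUM s<=degree M. SUM j<k. coeff M s * (c (s + i) j * b ^ j))"
     by (intro sum.cong refl) (simp add: sum_distrib_left[symmetric] c[THEN conjunct2, symmetric])
    also have "... = (SUM j<k. SUM s<=degree M. coeff M s * (c (s + i) j * b ^ j))" by (rule sum.swap)
    also have "... = (SUM j<k. mmu i j * b ^ j)" by (simp add: mmu_def sum_distrib_right mult.assoc)
    finally show ?thesis .
   qed
   show "0 < k" by (rule k)
  qed
  thus False by simp
 qed
 define Ph where "Ph = monom 1 k - (SUM i<k. monom (a i) i)"
 define ph where "ph = monom 1 k - (SUM i<k. monom (aal i) i)"
 have "reduces E Ph ph" unfolding Ph_def ph_def reduces_def coeff_diff coeff_sum
  by (intro allI place_diff[OF E] place_sum[OF E]) (use aal place_0[OF E] place_1[OF E] in auto)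
 moreover have "poly Ph b = 0" by (simp add: Ph_def poly_sum poly_monom int)
 ultimately have phJ: "ph : J" unfolding J_def by blast
 have "coeff ph k = 1" by (simp add: ph_def coeff_sum)
 hence "ph ~= 0" by auto
 then obtain j where j: "j : J" "j ~= 0" "!!h. h : J ==> h ~= 0 ==> degree j <= degree h"
  using ex_has_least_nat[of "%h. h : J & h ~= 0" ph degree] phJ by blast
 have "degree j > 0"
 proof (rule ccontr)
  assume "~ degree j > 0"
  then obtain c where "j = [:c:]" "c ~= 0" using j(2) by (metis degree_eq_zeroE gr_zeroI pCons_0_0)
  hence "[:inverse c:] * j = 1" by simp
  thus False using J_mult[OF j(1), of "[:inverse c:]"] one by simp
 qed
 then obtain be where be: "poly j be = 0" using K by blast
 have Jbe: "poly h be = 0" if h: "h : J" for h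
 proof -
  have "h mod j = h - (h div j) * j" by (simp add: minus_div_mult_eq_mod)
  hence "h mod j : J" using J_diff[OF h J_mult[OF j(1)]] by simp
  hence "h mod j = 0" using j(3)[of "h mod j"] degree_mod_less[OF j(2), of h] by force
  hence "h = (h div j) * j" by (metis add.right_neutral div_mult_mod_eq)
  thus ?thesis using be by (metis mult_zero_right poly_mult)
 qed
 \<comment> \<open>The new local ring consists of the quotients of \<open>G\<close> by
   \<open>H\<close> at \<open>b\<close> with \<open>h\<close> nonzero at \<open>be\<close>; by the
   choice of \<open>be\<close> no such denominator vanishes at \<open>b\<close>.\<close>
 define E' where "E' q gga <-> (EX G g H h. reduces E G g & reduces E H h & poly h be ~= 0 &
   q * poly H b = poly G b & gga = poly g be / poly h be)" for q gga
 have E'I: "E' q gga" if "reduces E G g" "reduces E H h" "poly h be ~= 0"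
  "q * poly H b = poly G b" "gga = poly g be / poly h be" for q gga G g H h
  unfolding E'_def by (intro exI conjI; fact that)
 have sub: "E' q x" if "E q x" for q x by (rule E'I[OF reduces_const[OF E that] red1]) auto
 have HH: "poly H b ~= 0" if "reduces E H h" "poly h be ~= 0" for H h using Jbe[of h] that unfolding J_def by blast
 have "place e E'" unfolding place_def
 proof (intro conjI allI impI)
  fix c q r x y
  show "E' (e c) c" by (rule sub[OF place_const[OF E]])
  assume "E' q x"
  then obtain G g H h where 1: "reduces E G g" "reduces E H h" "poly h be ~= 0"
   "q * poly H b = poly G b" "x = poly g be / poly h be" unfolding E'_def by blast {
   fix r y assume "E' r y"
   then obtain G' g' H' h' where 2: "reduces E G' g'" "reduces E H' h'" "poly h' be ~= 0"
    "r * poly H' b = poly G' b" "y = poly g' be / poly h' be" unfolding E'_def by blast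
   have hh: "reduces E (H * H') (h * h')" "poly (h * h') be ~= 0" using 1 2 reduces_mult[OF E] by auto
   have "reduces E (G * H' + G' * H) (g * h' + g' * h)" by (intro reduces_add[OF E] reduces_mult[OF E] 1 2)
   moreover have "(q + r) * poly (H * H') b = poly (G * H' + G' * H) b" by (simp add: algebra_simps flip: 1(4) 2(4))
   moreover have "x + y = poly (g * h' + g' * h) be / poly (h * h') be" using 1(3,5) 2(3,5) by (simp add: add_frac_eq)
   ultimately show "E' (q + r) (x + y)" using E'I[OF _ hh] by blast
   have "(q * r) * poly (H * H') b = poly (G * G') b" by (simp add: algebra_simps flip: 1(4) 2(4))
   moreover have "x * y = poly (g * g') be / poly (h * h') be" using 1(5) 2(5) by simp
   ultimately show "E' (q * r) (x * y)" using E'I[OF reduces_mult[OF E 1(1) 2(1)] hh] by blast } {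
   fix y assume "E' q y"
   then obtain G' g' H' h' where 2: "reduces E G' g'" "reduces E H' h'" "poly h' be ~= 0"
    "q * poly H' b = poly G' b" "y = poly g' be / poly h' be" unfolding E'_def by blast
   have "reduces E (G * H' - G' * H) (g * h' - g' * h)" using 1 2 by (intro reduces_diff[OF E] reduces_mult[OF E])
   moreover have "poly (G * H' - G' * H) b = 0" by (simp flip: 1(4) 2(4))
   ultimately have "poly (g * h' - g' * h) be = 0" using Jbe unfolding J_def by blast
   thus "x = y" using 1(3) 2(3) unfolding 1(5) 2(5) by (simp add: frac_eq_eq) }
  show "E' (inverse q) (inverse x)" if "x ~= 0"
  proof -
   have g: "poly g be ~= 0" using 1 that by auto
   hence "q ~= 0" using HH[OF 1(1)] 1(4) by auto
   thus ?thesis using 1(5) g by (intro E'I[OF 1(2,1) g]) (auto simp flip: 1(4))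
  qed
 qed
 moreover have "E' b be" by (rule E'I[OF reduces_monom[OF E place_1[OF E], of 1] red1]) (auto simp: poly_monom)
 ultimately show ?thesis using sub by blast
qed

lemma place_extend_integral_family:
 fixes b :: "nat => 'r"
 assumes K: "!!p :: 'k poly. degree p > 0 ==> EX x. poly p x = 0"
  and E: "place e E"
  and int: "!!l. l < m ==> EX k a. k > 0 & (ALL i<k. EX aal. E (a i) aal) & b l ^ k = (SUM i<k. a i * b l ^ i)"
 shows "EX E'. place e E' & (ALL q aal. E q aal --> E' q aal) & (ALL l<m. EX be. E' (b l) be)" using int
proof (induction m)
 case 0
 show ?case by (rule exI[of _ E]) (use E in simp)
next
 case (Suc m)
 from Suc.IH[OF Suc.prems[OF less_SucI]]
 obtain E' where E'0: "place e E' & (ALL q aal. E q aal --> E' q aal) & (ALL l<m. EX be. E' (b l) be)" ..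
 note E' = E'0[THEN conjunct1] E'0[THEN conjunct2, THEN conjunct1, rule_format]
  E'0[THEN conjunct2, THEN conjunct2, rule_format]
 from Suc.prems[OF lessI] obtain k where "EX a. k > 0 & (ALL i<k. EX aal. E (a i) aal) & b m ^ k = (SUM i<k. a i * b m ^ i)" ..
 then obtain a where k0: "k > 0 & (ALL i<k. EX aal. E (a i) aal) & b m ^ k = (SUM i<k. a i * b m ^ i)" ..
 have a: "EX aal. E' (a i) aal" if "i < k" for i
 proof -
  from k0 that have "EX aal. E (a i) aal" by simp
  then obtain aal where "E (a i) aal" ..
  from E'(2)[OF this] show ?thesis ..
 qed
 from place_extend_integral[OF K E'(1) k0[THEN conjunct1] a k0[THEN conjunct2, THEN conjunct2]]
 obtain E'' where E''0: "place e E'' & (ALL q aal. E' q aal --> E'' q aal) & (EX be. E'' (b m) be)" ..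
 note E'' = E''0[THEN conjunct1] E''0[THEN conjunct2, THEN conjunct1, rule_format] E''0[THEN conjunct2, THEN conjunct2]
 have "EX be. E'' (b l) be" if "l < Suc m" for l
 proof (cases "l = m")
  case False
  with that have "l < m" by simp
  from E'(3)[OF this] obtain be where "E' (b l) be" ..
  from E''(2)[OF this] show ?thesis ..
 next
  case True
  thus ?thesis using E''(3) by (simp only:)
 qed
 hence 1: "ALL l<Suc m. EX be. E'' (b l) be" by (intro allI impI)
 have 2: "ALL q aal. E q aal --> E'' q aal"
 proof (intro allI impI)
  fix q aal assume "E q aal"
  thus "E'' q aal" by (rule E''(2)[OF E'(2)])
 qed
 show ?case by (rule exI[of _ E'']) (rule conjI[OF E''(1) conjI[OF 2 1]])
qed

end

subsection \<open>Domains of rational functions\<close>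

lemma affine_chart_base:
 assumes X: "ringed X" and c: "affine_chart X U n V ph" and G: "opn X G" and x: "x : G" "x : U"
 shows "EX f:pols n. pev f (ph x) ~= 0 & {y : U. pev f (ph y) ~= 0} <= G"
proof -
 note cd = affine_chartD[OF X c]
 have iso: "isomorphism (induced X U) (affine_variety n V) ph" using c by (auto simp: affine_chart_def)
 have "opn (induced X U) (G Int U)" using G by (simp add: openin_subtopology_Int)
 from iso_open_image[OF iso this]
 obtain T where T: "zopn n T" "ph ` (G Int U) = T Int V" by (auto simp: affine_variety_def openin_subtopology)
 have "ph x : T" using T(2) x by blast
 then obtain f where f: "f : pols n" "pev f (ph x) ~= 0" "{y : Kn n. pev f y ~= 0} <= T"
  using zariski_base[OF T(1)] by blast
 have "y : G" if y: "y : U" "pev f (ph y) ~= 0" for y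
 proof -
  have "ph y : T Int V" using f(3) y cd(4,5) by blast
  then obtain z where "z : G Int U" "ph y = ph z" using T(2) by (metis imageE)
  thus ?thesis using cd(3) y(1) by (auto dest: inj_onD)
 qed
 thus ?thesis using f by blast
qed

lemma closedin_zariski_separate:
 fixes V :: "(nat => 'k::field) set"
 assumes V: "closedin (zariski n) V" and x: "x : Kn n" "!!f. f : pols n ==> ALL y:V. pev f y = 0 ==> pev f x = 0"
 shows "x : V"
proof (rule ccontr)
 assume "x ~: V"
 hence "x : Kn n - V" "zopn n (Kn n - V)" using x V by (auto simp: closedin_def)
 then obtain f where f: "f : pols n" "pev f x ~= 0" "{y : Kn n. pev f y ~= 0} <= Kn n - V" using zariski_base by blast
 have "V <= Kn n" using closedin_subset[OF V] by simp
 hence "ALL y:V. pev f y = 0" using f(3) by blast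
 thus False using x(2)[OF f(1)] f(2) by blast
qed

lemma noetherian_pols_seq:
 fixes f :: "nat => 'k::field pol"
 assumes "!!j. f j : pols n"
 obtains N c where "!!i. i < N ==> c i : pols n" "f N = (SUM i<N. c i * f i)"
proof -
 have "range f <= pols n" using assms by blast
 with hilbert_basis[of n] show ?thesis unfolding noeth_subring_def using that by blast
qed

lemma pol_eval_sum: "pev (sum f I) x = (SUM i:I. pev (f i) x)" by (induction I rule: infinite_finite_induct) auto

lemma (in uring_hom) peval_sum: "peval e (sum f I) x = (SUM i:I. peval e (f i) x)"
 by (induction I rule: infinite_finite_induct) auto

text \<open>Otherwise there are points \<open>x k\<close> new in \<open>G (Suc k)\<close>,
  infinitely many of them in one affine chart. Polynomials that are nonzero at these points and
  vanish on the chart outside the corresponding open sets satisfy a relation by the basis theorem,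
  and evaluation at the last point contradicts it.\<close>

lemma variety_open_chain:
 fixes X :: "('a, 'k::field) kspace"
 assumes X: "variety X" and G: "!!k. opn X (G k)" "!!k. G k <= G (Suc k)"
 shows "EX k :: nat. G (Suc k) = G k"
proof (rule ccontr)
 assume "~ ?thesis"
 hence "ALL k. EX x. x : G (Suc k) - G k" using G(2) by blast
 then obtain x where x: "!!k. x k : G (Suc k)" "!!k. x k ~: G k" by (metis DiffD1 DiffD2)
 have mono: "G i <= G j" if "i <= j" for i j by (rule lift_Suc_mono_le[of G]) (use G(2) that in auto)
 obtain \<U> where \<U>: "finite \<U>" "ALL U:\<U>. affine_open X U" "\<Union>\<U> = pts X"
  using X[unfolded variety_def] by (elim conjE exE) (rule that)
 have "x k : \<Union>\<U>" for k using \<U>(3) x(1)[of k] openin_subset[OF G(1)[of "Suc k"]] by auto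
 hence "ALL k. EX U. U : \<U> & x k : U" by auto
 from choice[OF this] obtain u where u: "!!k. u k : \<U>" "!!k. x k : u k" by auto
 have "range u <= \<U>" using u(1) by auto
 hence "finite (range u)" using finite_subset \<U>(1) by auto
 then obtain k0 where k0: "infinite {k. u k = u k0}" using pigeonhole_infinite[of UNIV u] by auto
 define r where "r = enumerate {k. u k = u k0}"
 have r: "strict_mono r" "!!j. x (r j) : u k0"
 proof -
  show "strict_mono r" unfolding r_def by (rule strict_mono_enumerate[OF k0])
  show "x (r j) : u k0" for j using enumerate_in_set[OF k0, of j] u(2)[of "r j"] by (simp add: r_def)
 qed
 have "affine_open X (u k0)" using \<U>(2) u(1)[of k0] by auto
 then obtain n V ph where c0: "affine_chart X (u k0) n V ph" unfolding affine_open_def by auto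
 note c = affine_chart_hat[OF X c0]
 have "ALL j. EX f:pols n. pev f (ph (x (r j))) ~= 0 & {y : u k0. pev f (ph y) ~= 0} <= G (Suc (r j))"
  using affine_chart_base[OF ringed_hat[OF X] c _ x(1) r(2)] G(1) by simp
 then obtain f where f: "!!j. f j : pols n" "!!j. pev (f j) (ph (x (r j))) ~= 0"
  "!!j. {y : u k0. pev (f j) (ph y) ~= 0} <= G (Suc (r j))" by metis
 obtain N c where c: "!!i. i < N ==> c i : pols n" "f N = (SUM i<N. c i * f i)"
  using noetherian_pols_seq[of f n] f(1) by metis
 have "pev (f i) (ph (x (r N))) = 0" if "i < N" for i
 proof (rule ccontr)
  assume "~ ?thesis"
  hence "x (r N) : G (Suc (r i))" using f(3) r(2) by blast
  moreover have "Suc (r i) <= r N" using strict_monoD[OF r(1) that] by simp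
  ultimately show False using mono x(2) by blast
 qed
 hence "pev (f N) (ph (x (r N))) = 0" unfolding c(2) by (simp add: pol_eval_sum)
 thus False using f(2) by blast
qed

locale variety_field = ffield e "hat X" th
 for e :: "'k::alg_closed_field => 'r::field" and X :: "('a, 'k) kspace" and th +
 assumes variety: "variety X"
begin

lemmas sheaf = variety_sheaf[OF variety]

lemma open_chain: "(!!k. opn X (G k)) ==> (!!k. G k <= G (Suc k)) ==> EX k :: nat. G (Suc k) = G k"
 by (rule variety_open_chain[OF variety])

lemma open_rdom: "opn X (rdom q)" using openin_rdom by simp

lemma rdomI: "evh X th x q a ==> x : rdom q" unfolding rdom_def by blast

lemma pts_place: "x : pts X ==> place e (evh X th x)" using place_ev by simp

lemma rdom_pts: "x : rdom q ==> x : pts X" using rdom_subset by auto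

lemma rdom_add: "x : rdom q ==> x : rdom r ==> x : rdom (q + r)"
 using place_add[OF pts_place[OF rdom_pts]] rdomI ev_rval by metis

lemma rdom_mult: "x : rdom q ==> x : rdom r ==> x : rdom (q * r)"
 using place_mult[OF pts_place[OF rdom_pts]] rdomI ev_rval by metis

lemma rdom_diff: "x : rdom q ==> x : rdom r ==> x : rdom (q - r)"
 using place_diff[OF pts_place[OF rdom_pts]] rdomI ev_rval by metis

lemma rdom_const: "x : pts X ==> x : rdom (e c)" using place_const[OF pts_place] rdomI by metis

lemma rdom_1: "x : pts X ==> x : rdom 1" using rdom_const[of x 1] by simp

lemma rdom_power: "x : rdom q ==> x : rdom (q ^ k)" by (induction k) (auto intro: rdom_mult rdom_1 rdom_pts)

lemma rdom_uminus_iff: "rdom (- q) = rdom q"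
proof -
 have "x : rdom (- q)" if "x : rdom q" for x q
  using place_uminus[OF pts_place[OF rdom_pts[OF that]]] rdomI ev_rval that by metis
 from this[of _ q] this[of _ "- q"] show ?thesis by auto
qed

lemma e_nonzero: "c ~= 0 ==> e c ~= 0" using e_mult[of c "inverse c"] by auto

lemma rdom_scale: "c ~= 0 ==> rdom (e c * q) = rdom q"
proof -
 assume c: "c ~= 0"
 have 1: "rdom q <= rdom (e c * q)" for c q using rdom_mult rdom_const rdom_pts by blast
 have "e (inverse c) * e c = 1" using c e_mult[of "inverse c" c] by simp
 hence *: "e (inverse c) * (e c * q) = q" by (simp add: mult.assoc[symmetric])
 hence "rdom (e c * q) <= rdom q" using 1[of "e c * q" "inverse c"] by (simp only: *)
 thus ?thesis using 1 by blast
qed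

text \<open>For two exceptional scalars the domains meet only in the common domain of
  \<open>q\<close> and \<open>r\<close>, because \<open>r\<close> is a multiple of the difference of
  the two elements. Infinitely many of them would give an ascending chain of open sets that never
  stops.\<close>

lemma finite_bad_scalars: "finite {c. rdom (q + e c * r) ~= rdom q Int rdom r}"
proof (rule ccontr)
 assume inf: "infinite {c. rdom (q + e c * r) ~= rdom q Int rdom r}" (is "infinite ?B")
 from infinite_countable_subset[OF inf] obtain c :: "nat => 'k" where c: "inj c" "range c <= ?B" by auto
 define D where "D = rdom q Int rdom r"
 have D: "D <= rdom (q + e (c j) * r)" for j
  unfolding D_def by (auto intro!: rdom_add rdom_mult rdom_const dest: rdom_pts)
 define G where "G k = D Un (UN j<k. rdom (q + e (c j) * r))" for k
 have "EX k. G (Suc k) = G k"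
  by (rule open_chain) (auto simp: G_def D_def intro!: openin_Un openin_Int open_rdom openin_Union)
 then obtain k where k: "G (Suc k) = G k" ..
 have "rdom (q + e (c k) * r) ~= D" using c(2) unfolding D_def by auto
 then obtain y where y: "y : rdom (q + e (c k) * r)" "y ~: D" using D by blast
 hence "y : G k" using k unfolding G_def by auto
 then obtain j where j: "j < k" "y : rdom (q + e (c j) * r)" using y(2) unfolding G_def by auto
 hence jk: "c j ~= c k" using c(1) by (auto dest: injD)
 have "y : rdom ((q + e (c j) * r) - (q + e (c k) * r))" by (rule rdom_diff[OF j(2) y(1)])
 moreover have "(q + e (c j) * r) - (q + e (c k) * r) = e (c j - c k) * r"
  using e_add[of "c j" "- c k"] unfolding e_uminus by (simp add: left_diff_distrib)
 ultimately have yr: "y : rdom r" using rdom_scale[of "c j - c k" r] jk by simp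
 have "y : rdom ((q + e (c k) * r) - e (c k) * r)"
  by (rule rdom_diff[OF y(1)]) (intro rdom_mult rdom_const yr rdom_pts[OF yr])
 thus False using y(2) yr by (simp add: D_def)
qed

text \<open>As the field is infinite, the coefficients of a linear combination \<open>v\<close> of
  the elements of \<open>I\<close> can avoid all exceptional scalars, so that no poles cancel in any
  \<open>aal * v\<close>.\<close>

lemma generic_combination:
 assumes "finite A" "finite I" "w0 ~= 0" "w0 : I"
 shows "EX v. v ~= 0 & (ALL aal:A. rdom (aal * v) = (INT w:I. rdom (aal * w)))"
proof -
 have "EX v. v ~= 0 & (ALL aal:A. rdom (aal * v) = (INT w:insert w0 J. rdom (aal * w)))" if "finite J" for J using that
 proof (induction J)
  case empty
  show ?case using assms(3) by auto
 next
  case (insert w J)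
  then obtain v where v: "v ~= 0" "ALL aal:A. rdom (aal * v) = (INT w:insert w0 J. rdom (aal * w))" by blast
  have "finite (UN aal:A. {c. rdom (aal * v + e c * (aal * w)) ~= rdom (aal * v) Int rdom (aal * w)})" (is "finite ?B")
   using assms(1) finite_bad_scalars by blast
  moreover have "finite {c. v + e c * w = 0}"
  proof (rule finite_subset)
   have "c = c'" if "v + e c * w = 0" "v + e c' * w = 0" for c c'
   proof (rule ccontr)
    assume "c ~= c'"
    have "e (c - c') * w = (v + e c * w) - (v + e c' * w)"
     using e_add[of c "- c'"] unfolding e_uminus by (simp add: left_diff_distrib)
    hence "w = 0" using that e_nonzero[of "c - c'"] `c ~= c'` by simp
    thus False using that v(1) by simp
   qed
   thus "{c. v + e c * w = 0} <= {THE c. v + e c * w = 0}" by (auto intro: the_equality[symmetric])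
  qed simp
  ultimately have "finite (?B Un {c. v + e c * w = 0})" by simp
  from ex_new_if_finite[OF alg_closed_infinite this]
  obtain c where c: "c ~: ?B" "v + e c * w ~= 0" by blast
  have "rdom (aal * (v + e c * w)) = (INT w:insert w0 (insert w J). rdom (aal * w))" if aal: "aal : A" for aal
  proof -
   have "rdom (aal * (v + e c * w)) = rdom (aal * v + e c * (aal * w))" by (simp add: algebra_simps)
   also have "... = rdom (aal * v) Int rdom (aal * w)" using c(1) aal by blast
   finally show ?thesis using v(2) aal by auto
  qed
  thus ?case using c(2) by blast
 qed
 from this[OF assms(2)] show ?thesis using assms(4) by (simp add: insert_absorb)
qed

text \<open>Gluing in the original structure works because every section that represents
  \<open>q\<close> has its whole open set inside \<open>rdom q\<close>. This is why elements with a
  prescribed exact domain are needed later.\<close>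

lemma kreg_original: "kreg X (rdom q) (rval q)"
proof (rule function_sheaf_glue[OF sheaf open_rdom])
 fix x assume x: "x : rdom q"
 then obtain W f where f: "x : W" "kreg (hat X) W f" "th W f = q" unfolding rdom_def ev_def by blast
 obtain N W' g where N: "opn X N" "x : N" "N <= W'" "kreg X W' g" "ALL y:N. f y = g y"
  using f unfolding kreg_hat by blast
 have kg: "kreg (hat X) W' g" by (rule kreg_imp_hat[OF sheaf N(4)])
 have o: "opn (hat X) (N Int W)" "N Int W ~= {}" using N(1,2) f(1) r_open[OF f(2)] by auto
 have "N Int W <= W'" using N(3) by auto
 hence "th W' g = th (N Int W) g" using th_restrict[OF kg o(1) _ o(2)] by simp
 also have "... = th (N Int W) f" by (rule th_cong[OF r_restrict[OF kg o(1) `N Int W <= W'`]]) (use N in auto)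
 also have "... = q" using th_restrict[OF f(2) o(1) _ o(2)] f(3) by auto
 finally have q: "th W' g = q" .
 have "kreg X W' (rval q)" by (rule function_sheaf_cong[OF sheaf N(4)]) (use kreg_rval_eq[OF kg q] in auto)
 thus "EX W. x : W & W <= rdom q & kreg X W (rval q)" using kreg_subset_rdom[OF kg q] N by blast
qed

text \<open>A valuative form of separatedness: two points whose local rings are dominated by one
  common place are equal. In this form it passes to Nash blowups and normalizations.\<close>

definition separated :: bool where "separated <-> (ALL x y E'. x : pts X --> y : pts X --> place e E' -->
  (ALL q a. evh X th x q a --> E' q a) --> (ALL q a. evh X th y q a --> E' q a) --> x = y)"

text \<open>
  \<open>afflike P b m\<close> expresses that \<open>P\<close> behaves like an affine open set whose ring of functions is
  generated by \<open>b 0, \<dots>, b (m - 1)\<close>.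
\<close>

definition afflike :: "'a set => (nat => 'r) => nat => bool" where
 "afflike P b m <-> opn X P & m > 0 & (ALL k<m. P <= rdom (b k)) &
  (ALL y E'. y : pts X --> place e E' --> (ALL q a. evh X th y q a --> E' q a) -->
    (ALL k<m. EX be. E' (b k) be) --> y : P)"

text \<open>A place that is finite on the coordinates takes values forming a point of
  \<open>V\<close>, since it respects the relations among the coordinates; separatedness identifies
  this point with the given one. The extra generator, the inverse of \<open>H\<close>, keeps the
  point inside the principal open set.\<close>

lemma afflike_chart:
 assumes sep: separated and c: "affine_chart (hat X) U n V ph" and H: "H : pols n"
  and P: "P = {x : U. pev H (ph x) ~= 0}" "P ~= {}"
  and co: "ccoords U n V ph c"
 shows "afflike P (%k. if k < n then c k else inverse (peval e H c)) (Suc n)"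
proof -
 note cd = affine_chartD[OF ringed c]
 note c1 = ccoordsD(1)[OF co] and c2 = ccoordsD(2)[OF co]
  and c3 = ccoordsD(3)[OF co] and c4 = ccoordsD(4)[OF co]
 define b where "b = (%k. if k < n then c k else inverse (peval e H c))"
 have Up: "U <= pts X" using openin_subset[OF cd(1)] by simp
 have "P = {x : U. rval (peval e H c) x ~= 0}" unfolding P using c2[OF _ H] by (auto simp: ev_iff)
 moreover have "U <= rdom (peval e H c)" using c2[OF _ H] rdomI by blast
 ultimately have oP: "opn X P" using r_open_nonzero[OF kreg_rval_subset[OF cd(1)]] by simp
 have 1: "x : rdom (b k)" if x: "x : P" and k: "k < Suc n" for x k
 proof (cases "k < n")
  case True
  thus ?thesis using c1[of x k] x P(1) rdomI by (simp add: b_def)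
 next
  case False
  have "evh X th x (inverse (peval e H c)) (inverse (pev H (ph x)))"
   by (rule place_inverse[OF pts_place]) (use x Up P(1) c2[OF _ H] in auto)
  thus ?thesis using False rdomI by (simp add: b_def)
 qed
 have 2: "y : P" if y: "y : pts X" and E': "place e E'" "ALL q a. evh X th y q a --> E' q a"
  "ALL k<Suc n. EX be. E' (b k) be" for y E'
 proof -
  obtain be where be: "!!k. k < Suc n ==> E' (b k) (be k)" using E'(3) by metis
  define p where "p = (%i. if i < n then be i else 0)"
  have pe: "E' (peval e g c) (pev g p)" if "g : pols n" for g
  proof (rule place_peval[OF E'(1) that])
   fix k assume "k < n"
   thus "E' (c k) (p k)" using be[of k] by (simp add: b_def p_def)
  qed
  have "p : V"
  proof (rule closedin_zariski_separate[OF cd(2)])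
   show "p : Kn n" by (simp add: p_def Kn_def)
   show "pev f p = 0" if "f : pols n" "ALL y:V. pev f y = 0" for f
    using pe[OF that(1)] c4[OF that(1)] that(2) place_0[OF E'(1)] place_unique[OF E'(1)] by metis
  qed
  then obtain x where x: "x : U" "ph x = p" using cd(4) by blast
  have xp: "x : pts X" using x Up by blast
  have sub: "E' q a" if q: "evh X th x q a" for q a
  proof -
   obtain g h where gh: "g : pols n" "h : pols n" "pev h (ph x) ~= 0" "q * peval e h c = peval e g c"
    using c3[OF x(1) q] by blast
   have h0: "peval e h c ~= 0" using place_nonzero[OF pts_place[OF xp] c2[OF x(1) gh(2)]] gh(3) by blast
   hence qq: "q = peval e g c / peval e h c" using gh(4) by (simp add: field_simps)
   have "evh X th x q (pev g p / pev h p)" unfolding qq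
    using place_divide[OF pts_place[OF xp] c2[OF x(1) gh(1)] c2[OF x(1) gh(2)]] gh(3) x(2) by simp
   hence "a = pev g p / pev h p" using place_unique[OF pts_place[OF xp]] q by blast
   moreover have "E' q (pev g p / pev h p)" unfolding qq
    by (rule place_divide[OF E'(1) pe[OF gh(1)] pe[OF gh(2)]]) (use gh(3) x(2) in simp)
   ultimately show ?thesis by simp
  qed
  have yx: "y = x" using sep y xp E'(1,2) sub unfolding separated_def by blast
  have "E' (peval e H c * inverse (peval e H c)) (pev H p * be n)"
   using place_mult[OF E'(1) pe[OF H] be[of n]] by (simp add: b_def)
  moreover have "peval e H c ~= 0" using P c2[OF _ H] place_nonzero[OF pts_place] Up by blast
  ultimately have "pev H p * be n = 1" using place_unique[OF E'(1) _ place_1[OF E'(1)]] by simp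
  thus ?thesis using yx x P(1) by auto
 qed
 show ?thesis unfolding afflike_def using oP 1 2 unfolding b_def by blast
qed

end

section \<open>Bounded poles and functions with an exact domain\<close>

context variety_field
begin

lemma wf_closed_subsets: "wf {(S, T). closedin (ktop X) S & closedin (ktop X) T & S \<subset> T}"
 unfolding wf_iff_no_infinite_down_chain
proof
 assume "EX T. ALL k :: nat. (T (Suc k), T k) : {(S, T). closedin (ktop X) S & closedin (ktop X) T & S \<subset> T}"
 then obtain T where T0: "ALL k :: nat. (T (Suc k), T k) : {(S, T). closedin (ktop X) S & closedin (ktop X) T & S \<subset> T}" ..
 have T: "closedin (ktop X) (T k)" "T (Suc k) \<subset> T k" for k using T0[rule_format, of k] by auto
 have "EX k. pts X - T (Suc k) = pts X - T k" by (rule open_chain) (insert T, auto simp: closedin_def)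
 then obtain k where "pts X - T (Suc k) = pts X - T k" ..
 moreover have "T (Suc k) <= pts X" "T k <= pts X" using T(1) closedin_subset by blast+
 ultimately have "T (Suc k) = T k" by blast
 thus False using T(2) by blast
qed

lemma afflikeD:
 assumes "afflike P b m"
 shows afflike_open: "opn X P" and afflike_pos: "m > 0"
  and afflike_rdom: "k < m ==> P <= rdom (b k)"
  and afflike_place: "y : pts X ==> place e E' ==> (!!q a. evh X th y q a ==> E' q a) ==>
    (!!k. k < m ==> EX be. E' (b k) be) ==> y : P" using assms unfolding afflike_def by blast+

definition integral_at :: "'r => 'a => bool" where
 "integral_at b y <-> (EX k a. k > 0 & (ALL i<k. EX aal. evh X th y (a i) aal) & b ^ k = (SUM i<k. a i * b ^ i))"

text \<open>Write \<open>e0 * b ^ j\<close> as a fraction of \<open>g j\<close> by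
  \<open>h j\<close> that is regular at some point of \<open>T\<close>. A relation expressing
  \<open>g N\<close> by its predecessors becomes, after division by \<open>e0 * h N\<close>, an
  integral equation for \<open>b\<close> with coefficients regular where \<open>h N\<close> does not
  vanish.\<close>

lemma integral_near:
 assumes T: "closedin (ktop X) T" "T ~= {}" and e0: "e0 ~= 0"
  and irr: "!!A B. opn X A ==> opn X B ==> A Int T ~= {} ==> B Int T ~= {} ==> A Int B Int T ~= {}"
  and ne: "!!j. rdom (e0 * b ^ j) Int T ~= {}"
 shows "EX W. opn X W & W Int T ~= {} & (ALL y:W. integral_at b y)"
proof -
 obtain y0 where y0: "y0 : T" using T by blast
 hence "y0 : pts X" using closedin_subset[OF T(1)] by blast
 then obtain U n V ph where U: "affine_chart X U n V ph" "y0 : U"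
  using variety_cover[OF variety] unfolding affine_open_def by blast
 note ch = affine_chart_hat[OF variety U(1)]
 note cd = affine_chartD[OF ringed ch]
 have oU: "opn X U" using cd(1) by simp
 have Un: "U ~= {}" using U by blast
 obtain c where "ccoords U n V ph c" using ccoordinates[OF ch Un] by blast
 note c = ccoordsD[OF this]
 have "EX y g h. y : U Int T & g : pols n & h : pols n & pev h (ph y) ~= 0 &
   e0 * b ^ j * peval e h c = peval e g c" for j
 proof -
  have "rdom (e0 * b ^ j) Int U Int T ~= {}" by (rule irr[OF open_rdom oU ne]) (use y0 U in blast)
  then obtain y where y: "y : rdom (e0 * b ^ j)" "y : U" "y : T" by blast
  from c(3)[OF y(2) ev_rval[OF y(1)]] y show ?thesis by blast
 qed
 then obtain y g h where ygh: "!!j. y j : U Int T" "!!j. g j : pols n" "!!j. h j : pols n"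
  "!!j. pev (h j) (ph (y j)) ~= 0" "!!j. e0 * b ^ j * peval e (h j) c = peval e (g j) c" by metis
 obtain N C where C: "!!i. i < N ==> C i : pols n" "g N = (SUM i<N. C i * g i)"
  using noetherian_pols_seq[of g n] ygh(2) by metis
 have hn: "peval e (h j) c ~= 0" for j
 proof -
  have "y j : U" "y j : pts X" using ygh(1)[of j] openin_subset[OF oU] by auto
  thus ?thesis using place_nonzero[OF pts_place c(2)[OF _ ygh(3)] ygh(4)] by blast
 qed
 define a where "a i = peval e (C i) c * peval e (h i) c / peval e (h N) c" for i
 have "e0 * b ^ N * peval e (h N) c = (SUM i<N. peval e (C i) c * (e0 * b ^ i * peval e (h i) c))"
  unfolding ygh(5) C(2) by (simp add: peval_sum)
 also have "... = e0 * peval e (h N) c * (SUM i<N. a i * b ^ i)"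
  using hn[of N] by (simp add: a_def sum_distrib_left mult_ac)
 finally have "(e0 * peval e (h N) c) * b ^ N = (e0 * peval e (h N) c) * (SUM i<N. a i * b ^ i)" by (simp add: mult_ac)
 hence bN: "b ^ N = (SUM i<N. a i * b ^ i)" using e0 hn[of N] by simp
 have N0: "N > 0"
 proof (rule ccontr)
  assume "~ N > 0"
  hence "N = 0" by simp
  thus False using bN by simp
 qed
 define W where "W = {x : U. pev (h N) (ph x) ~= 0}"
 have "W = {x : U. rval (peval e (h N) c) x ~= 0}" unfolding W_def using c(2)[OF _ ygh(3)] by (auto simp: ev_iff)
 moreover have "U <= rdom (peval e (h N) c)" using c(2)[OF _ ygh(3)] rdomI by blast
 ultimately have oW: "opn X W" using r_open_nonzero[OF kreg_rval_subset[OF cd(1)]] by simp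
 have "integral_at b x" if x: "x : W" for x
 proof -
  have xU: "x : U" "x : pts X" "pev (h N) (ph x) ~= 0" using x openin_subset[OF oU] by (auto simp: W_def)
  have "EX aal. evh X th x (a i) aal" if "i < N" for i unfolding a_def
   by (rule exI, rule place_divide[OF pts_place[OF xU(2)] place_mult[OF pts_place[OF xU(2)] c(2)[OF xU(1) C(1)[OF that]] c(2)[OF xU(1) ygh(3)]]
     c(2)[OF xU(1) ygh(3)] xU(3)])
  thus ?thesis unfolding integral_at_def using N0 bN by (intro exI[of _ N] exI[of _ a]) auto
 qed
 moreover have "W Int T ~= {}" using ygh(1)[of N] ygh(4)[of N] unfolding W_def by blast
 ultimately show ?thesis using oW by blast
qed

text \<open>
  Otherwise there is a minimal, hence irreducible, closed set \<open>T\<close> outside \<open>P\<close> meeting all these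
  domains.  Noetherianity makes the generators integral over the local ring of a point of \<open>T\<close>; the
  place of that point then extends to the generators, which forces the point into \<open>P\<close>.
\<close>

lemma pole_bound:
 assumes al: "afflike P b m" and e0: "e0 ~= 0"
 shows "EX d. (INT k<m. INT j<=d. rdom (e0 * b k ^ j)) <= P"
proof (rule ccontr)
 define U where "U d = (INT k<m. INT j<=d. rdom (e0 * b k ^ j))" for d
 assume "~ ?thesis"
 hence nP: "~ U d <= P" for d unfolding U_def by blast
 have U_anti: "U d' <= U d" if "d <= d'" for d d' using that unfolding U_def by fastforce
 have U_pts: "U d <= pts X" for d using afflike_pos[OF al] rdom_pts unfolding U_def by fastforce
 define \<T> where "\<T> = {T. closedin (ktop X) T & T Int P = {} & (ALL d. U d Int T ~= {})}"
 have "U d Int (pts X - P) ~= {}" for d using nP[of d] U_pts[of d] by auto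
 moreover have "closedin (ktop X) (pts X - P)" by (rule closedin_diff[OF closedin_topspace afflike_open[OF al]])
 ultimately have PT: "pts X - P : \<T>" unfolding \<T>_def by auto
 define R where "R = {(S, T). closedin (ktop X) S & closedin (ktop X) T & S \<subset> T}"
 have "EX T:\<T>. ALL S. (S, T) : R --> S ~: \<T>"
  using wf_closed_subsets[folded R_def, unfolded wf_eq_minimal, THEN spec, THEN spec, THEN mp, OF PT] .
 then obtain T where T: "T : \<T>" and min0: "ALL S. (S, T) : R --> S ~: \<T>" ..
 have T1: "closedin (ktop X) T" "T Int P = {}" "!!d. U d Int T ~= {}" using T unfolding \<T>_def by simp_all
 have min: "S ~: \<T>" if "closedin (ktop X) S" "S \<subset> T" for S
  by (rule min0[THEN spec, THEN mp]) (insert that T1(1), simp add: R_def)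
 have Tn: "T ~= {}" using T1(3) by blast
 have cut: "EX d. U d Int (T - A) = {}" if "opn X A" "A Int T ~= {}" for A
 proof -
  have cl: "closedin (ktop X) (T - A)" by (rule closedin_diff[OF T1(1) that(1)])
  moreover have "T - A \<subset> T" using that(2) by blast
  ultimately have "T - A ~: \<T>" by (rule min)
  thus ?thesis using cl T1(2) unfolding \<T>_def by blast
 qed
 have irr: "A Int B Int T ~= {}" if AB: "opn X A" "opn X B" "A Int T ~= {}" "B Int T ~= {}" for A B
 proof
  assume *: "A Int B Int T = {}"
  obtain d d' where d: "U d Int (T - A) = {}" "U d' Int (T - B) = {}" using cut[OF AB(1,3)] cut[OF AB(2,4)] by blast
  have "U (max d d') <= U d" "U (max d d') <= U d'" by (auto intro!: U_anti)
  hence "U (max d d') Int T = {}" using d * by blast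
  thus False using T1(3) by blast
 qed
 have "EX W. opn X W & W Int T ~= {} & (ALL y:W. integral_at (b k) y)" if k: "k < m" for k
 proof (rule integral_near[OF T1(1) Tn e0 irr])
  show "rdom (e0 * b k ^ j) Int T ~= {}" for j
  proof -
   have "U j <= rdom (e0 * b k ^ j)" unfolding U_def using k by blast
   thus ?thesis using T1(3)[of j] by blast
  qed
 qed
 hence "ALL k. EX W. k < m --> opn X W & W Int T ~= {} & (ALL y:W. integral_at (b k) y)" by blast
 from choice[OF this] obtain W where
  W0: "ALL k. k < m --> opn X (W k) & W k Int T ~= {} & (ALL y:W k. integral_at (b k) y)" ..
 hence W: "!!k. k < m ==> opn X (W k)" "!!k. k < m ==> W k Int T ~= {}"
  "!!k y. k < m ==> y : W k ==> integral_at (b k) y" by simp_all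
 have "EX A. opn X A & A Int T ~= {} & (ALL k<l. A <= W k)" if "l <= m" for l using that
 proof (induction l)
  case 0
  have "pts X Int T ~= {}" using Tn closedin_subset[OF T1(1)] by blast
  thus ?case by (intro exI[of _ "pts X"]) auto
 next
  case (Suc l)
  then obtain A where A: "opn X A" "A Int T ~= {}" "ALL k<l. A <= W k" by auto
  have "opn X (A Int W l)" "A Int W l Int T ~= {}" using A W(1,2)[of l] irr[of A "W l"] Suc.prems by auto
  thus ?case using A(3) by (intro exI[of _ "A Int W l"]) (auto simp: less_Suc_eq)
 qed
 from this[of m] obtain A where A: "A Int T ~= {}" "ALL k<m. A <= W k" by auto
 then obtain y where y: "y : T" "!!k. k < m ==> y : W k" by blast
 have yp: "y : pts X" using y(1) closedin_subset[OF T1(1)] by blast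
 from place_extend_integral_family[OF alg_closed_imp_poly_has_root pts_place[OF yp] W(3)[OF _ y(2), unfolded integral_at_def], of m]
 obtain E' where E': "place e E' & (ALL q aal. evh X th y q aal --> E' q aal) & (ALL l<m. EX be. E' (b l) be)" ..
 have "y : P" by (rule afflike_place[OF al yp E'[THEN conjunct1] E'[THEN conjunct2, THEN conjunct1, rule_format]
    E'[THEN conjunct2, THEN conjunct2, rule_format]])
 thus False using y(1) T1(2) by blast
qed

text \<open>By \<open>pole_bound\<close>, multiplication by sufficiently high powers of the
  generators leaves no common regular point outside \<open>P\<close>; a generic combination of these
  powers has all their poles at once.\<close>

lemma exact_domain:
 assumes al: "afflike P b m" and A: "finite A" "!!aal. aal : A ==> aal ~= 0" "!!aal. aal : A ==> P <= rdom aal"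
 obtains v where "v ~= 0" "!!aal. aal : A ==> rdom (aal * v) = P"
proof -
 have "ALL aal:A. EX d. (INT k<m. INT j<=d. rdom (aal * b k ^ j)) <= P" using pole_bound[OF al A(2)] by blast
 then obtain d where d: "!!aal. aal : A ==> (INT k<m. INT j<=d aal. rdom (aal * b k ^ j)) <= P" by metis
 define D where "D = Max (insert 0 (d ` A))"
 have D: "d aal <= D" if "aal : A" for aal unfolding D_def using A(1) that by auto
 define I where "I = (%(k, j). b k ^ j) ` ({..<m} \<times> {..D})"
 have "b 0 ^ 0 : I" unfolding I_def using afflike_pos[OF al] by (intro image_eqI[of _ _ "(0, 0)"]) auto
 hence 1: "1 : I" by simp
 have "finite I" unfolding I_def by simp
 from generic_combination[OF A(1) this _ 1] obtain v where
  v: "v ~= 0" "ALL aal:A. rdom (aal * v) = (INT w:I. rdom (aal * w))" by auto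
 have "(INT w:I. rdom (aal * w)) = P" if aal: "aal : A" for aal
 proof
  have "(INT w:I. rdom (aal * w)) <= rdom (aal * b k ^ j)" if "k < m" "j <= d aal" for k j
  proof (rule INT_lower)
   show "b k ^ j : I" unfolding I_def by (rule image_eqI[of _ _ "(k, j)"]) (use that D[OF aal] in auto)
  qed
  hence "(INT w:I. rdom (aal * w)) <= (INT k<m. INT j<=d aal. rdom (aal * b k ^ j))" by (intro INT_greatest) auto
  thus "(INT w:I. rdom (aal * w)) <= P" using d[OF aal] by (rule subset_trans)
  show "P <= (INT w:I. rdom (aal * w))"
  proof
   fix x assume x: "x : P"
   have "x : rdom (aal * b k ^ j)" if "k < m" for k j
    by (rule rdom_mult[OF subsetD[OF A(3)[OF aal] x] rdom_power[OF subsetD[OF afflike_rdom[OF al that] x]]])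
   thus "x : (INT w:I. rdom (aal * w))" unfolding I_def by auto
  qed
 qed
 thus ?thesis using that v by auto
qed

lemma exact_domain_add:
 assumes "rdom v = P" "finite S" "!!q. q : S ==> P <= rdom q"
 obtains c where "c ~= 0" "!!q. q : S ==> rdom (q + e c * v) = P"
proof -
 have "finite ((UN q:S. {c. rdom (q + e c * v) ~= rdom q Int rdom v}) Un {0})"
  using assms(2) finite_bad_scalars by blast
 from ex_new_if_finite[OF alg_closed_infinite this] obtain c where
  c: "c ~= 0" "!!q. q : S ==> rdom (q + e c * v) = rdom q Int rdom v" by blast
 have "rdom q Int rdom v = P" if "q : S" for q using assms(1,3) that by blast
 thus ?thesis using that c by blast
qed

end

lemma sum_lessThan_add: "(SUM i<k + n. f i) = (SUM i<k. f i) + (SUM i<n. f (k + i :: nat) :: 'a::comm_monoid_add)"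
 by (induction n) (auto simp: add.assoc)

context variety_field
begin

text \<open>Only elements with domain exactly \<open>P\<close> are known to be sections over
  \<open>P\<close> in the original structure; the difference makes every function regular on
  \<open>P\<close> accessible.\<close>

lemma exact_split:
 assumes al: "afflike P b m" and q: "P <= rdom q"
 obtains q1 q2 where "q = q1 - q2" "rdom q1 = P" "rdom q2 = P"
proof -
 have P1: "P <= rdom 1" using openin_subset[OF afflike_open[OF al]] rdom_1 by blast
 have ne: "aal ~= 0" if "aal : {1}" for aal :: 'r using that by simp
 obtain v where v: "v ~= 0" "!!aal. aal : {1} ==> rdom (aal * v) = P"
  by (rule exact_domain[OF al, of "{1}"]) (use P1 in auto)
 have rv: "rdom v = P" using v(2)[of 1] by simp
 obtain c where c: "c ~= 0" "!!r. r : {q} ==> rdom (r + e c * v) = P"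
  by (rule exact_domain_add[OF rv, of "{q}"]) (use q in auto)
 show ?thesis by (rule that[of "q + e c * v" "e c * v"]) (use c rv rdom_scale[of c v] in auto)
qed

text \<open>Denominators of the finitely many elements cut a principal open set out of a chart
  around \<open>y\<close>.\<close>

lemma afflike_nbhd:
 assumes sep: separated and y: "y : pts X" and S: "finite S" "!!q. q : S ==> y : rdom q"
 obtains P b m where "afflike P b m" "y : P" "!!q. q : S ==> P <= rdom q"
proof -
 obtain U n V ph where U: "affine_chart X U n V ph" "y : U"
  using variety_cover[OF variety y] unfolding affine_open_def by blast
 note ch = affine_chart_hat[OF variety U(1)]
 note cd = affine_chartD[OF ringed ch]
 have Up: "U <= pts X" using openin_subset[OF cd(1)] by simp
 have Un: "U ~= {}" using U by blast
 obtain c where co: "ccoords U n V ph c" using ccoordinates[OF ch Un] by blast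
 note c = ccoordsD[OF co]
 have "EX H:pols n. pev H (ph y) ~= 0 & (ALL q:S. {x : U. pev H (ph x) ~= 0} <= rdom q)" using S
 proof (induction S)
  case empty
  show ?case by (rule bexI[of _ "pconst 1"]) auto
 next
  case (insert q S)
  then obtain H where H: "H : pols n" "pev H (ph y) ~= 0" "ALL q:S. {x : U. pev H (ph x) ~= 0} <= rdom q" by auto
  have "y : rdom q" using insert.prems by simp
  from c(3)[OF U(2) ev_rval[OF this]] obtain g h where gh: "g : pols n" "h : pols n" "pev h (ph y) ~= 0"
   "q * peval e h c = peval e g c" by blast
  have *: "x : rdom q" if x: "x : U" "pev h (ph x) ~= 0" for x
  proof -
   have xp: "x : pts X" using x Up by blast
   have "peval e h c ~= 0" using place_nonzero[OF pts_place[OF xp] c(2)[OF x(1) gh(2)] x(2)] .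
   hence "q = peval e g c / peval e h c" using gh(4) by (simp add: field_simps)
   thus ?thesis using rdomI[OF place_divide[OF pts_place[OF xp] c(2)[OF x(1) gh(1)] c(2)[OF x(1) gh(2)] x(2)]] by simp
  qed
  show ?case
  proof (rule bexI[of _ "H * h"])
   have "{x : U. pev (H * h) (ph x) ~= 0} <= {x : U. pev H (ph x) ~= 0}" by auto
   hence "ALL r:S. {x : U. pev (H * h) (ph x) ~= 0} <= rdom r" using H(3) by (meson subset_trans)
   moreover have "{x : U. pev (H * h) (ph x) ~= 0} <= rdom q" using * by auto
   moreover have "pev (H * h) (ph y) ~= 0" using H(2) gh(3) by simp
   ultimately show "pev (H * h) (ph y) ~= 0 & (ALL q:insert q S. {x : U. pev (H * h) (ph x) ~= 0} <= rdom q)" by simp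
   show "H * h : pols n" using H(1) gh(2) by simp
  qed
 qed
 then obtain H where H: "H : pols n" "pev H (ph y) ~= 0" "!!q. q : S ==> {x : U. pev H (ph x) ~= 0} <= rdom q" by blast
 have "y : {x : U. pev H (ph x) ~= 0}" using U(2) H(2) by simp
 with afflike_chart[OF sep ch H(1) refl _ co] show ?thesis using that H(3) by blast
qed

text \<open>\<open>normal_at\<close> speaks of sections over a single open set in the original
  structure, so all data are replaced by elements with domain exactly \<open>P\<close>. The equation
  \<open>t ^ k = h\<close> itself does not qualify: its middle coefficients are 0, which is regular
  everywhere.\<close>

lemma normal_root:
 assumes sep: separated and normal: "normal_at X y" and y: "y : pts X"
  and f0: "y : rdom f0" and g0: "y : rdom g0" "g0 ~= 0" and h: "y : rdom h"
  and k: "k > 0" and eq: "f0 ^ k = h * g0 ^ k"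
 shows "y : rdom (f0 / g0)"
proof (cases "f0 = 0")
 case True
 thus ?thesis using rdom_const[OF y, of 0] by simp
next
 case False
 have h0: "h ~= 0" using eq False k by auto
 obtain P b m where P: "afflike P b m" "y : P" "!!q. q : {f0, g0, h, 1} ==> P <= rdom q"
  by (rule afflike_nbhd[OF sep y, of "{f0, g0, h, 1}"]) (use f0 g0 h rdom_1[OF y] in auto)
 have oP: "opn X P" by (rule afflike_open[OF P(1)])
 obtain v where v: "v ~= 0" "!!aal. aal : {f0, g0, h, 1} ==> rdom (aal * v) = P"
  by (rule exact_domain[OF P(1), of "{f0, g0, h, 1}"]) (use P(3) False g0 h0 in auto)
 have v1: "rdom v = P" using v(2)[of 1] by simp
 \<comment> \<open>The scalar is chosen so that \<open>w - h\<close>, a coefficient of the equation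
   below, also has domain exactly \<open>P\<close>.\<close>
 obtain c where c: "c ~= 0" "!!q. q : {- h} ==> rdom (q + e c * v) = P"
  by (rule exact_domain_add[OF v1, of "{- h}"]) (use P(3)[of h] rdom_uminus_iff in auto)
 define w where "w = e c * v"
 have w0: "w ~= 0" using c(1) v(1) e_nonzero by (simp add: w_def)
 have wP: "rdom (aal * w) = P" if "aal : {f0, g0, h, 1}" for aal
 proof -
  have "rdom (aal * w) = rdom (e c * (aal * v))" by (simp add: w_def mult_ac)
  also have "... = P" unfolding rdom_scale[OF c(1)] by (rule v(2)[OF that])
  finally show ?thesis .
 qed
 define f where "f = f0 * w"
 define g where "g = g0 * w"
 \<comment> \<open>Coefficients of the product of \<open>t ^ k - h\<close> with
   \<open>t ^ k + w * (t ^ (k - 1) + ... + 1)\<close>. Below the leading term only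
   \<open>- (h * w)\<close>, \<open>w - h\<close> and \<open>w\<close> occur, all with domain
   exactly \<open>P\<close>.\<close>
 define a where "a i = (if i < k then - (h * w) else if i = k then w - h else w)" for i
 have fg: "rdom f = P" "rdom g = P" unfolding f_def g_def using wP by auto
 have aP: "rdom (a i) = P" for i
  unfolding a_def using wP[of h] wP[of 1] c(2)[of "- h"] rdom_uminus_iff[of "h * w"] by (simp add: w_def)
 define q where "q = f0 / g0"
 have qk: "q ^ k = h" using eq g0(2) by (simp add: q_def power_divide field_simps)
 have fq: "f = q * g" using g0(2) by (simp add: f_def g_def q_def)
 have "(SUM i<k + k. a i * q ^ i) = (SUM i<k. - (h * w) * q ^ i) + (SUM i<k. a (k + i) * (q ^ k * q ^ i))"
  unfolding sum_lessThan_add by (simp add: a_def power_add)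
 also have "(SUM i<k. a (k + i) * (q ^ k * q ^ i)) = (SUM i<k. w * h * q ^ i - (if i = 0 then h * h else 0))"
  unfolding qk by (intro sum.cong) (auto simp: a_def algebra_simps)
 also have "... = (SUM i<k. w * h * q ^ i) - h * h" using k by (simp add: sum_subtractf)
 finally have "(SUM i<k + k. a i * q ^ i) = - (h * h)" by (simp add: sum_negf mult.commute)
 hence "q ^ (k + k) + (SUM i<k + k. a i * q ^ i) = 0" by (simp add: power_add qk)
 hence "0 = g ^ (k + k) * (q ^ (k + k) + (SUM i<k + k. a i * q ^ i))" by simp
 also have "... = f ^ (k + k) + (SUM i<k + k. g ^ (k + k) * (a i * q ^ i))"
  by (simp add: fq power_mult_distrib distrib_left sum_distrib_left mult.commute)
 also have "(SUM i<k + k. g ^ (k + k) * (a i * q ^ i)) = (SUM i<k + k. a i * f ^ i * g ^ (k + k - i))"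
 proof (intro sum.cong refl)
  fix i assume "i : {..<k + k}"
  hence "g ^ (k + k) = g ^ i * g ^ (k + k - i)" by (simp add: power_add[symmetric])
  thus "g ^ (k + k) * (a i * q ^ i) = a i * f ^ i * g ^ (k + k - i)" by (simp add: fq power_mult_distrib mult_ac)
 qed
 finally have eq0: "f ^ (k + k) + (SUM i<k + k. a i * f ^ i * g ^ (k + k - i)) = 0" by simp
 have val: "rval f x ^ (k + k) + (SUM i<k + k. rval (a i) x * rval f x ^ i * rval g x ^ (k + k - i)) = 0"
  if x: "x : P" for x
 proof -
  have xp: "x : pts X" using x openin_subset[OF oP] by blast
  note E = pts_place[OF xp]
  have ev: "evh X th x f (rval f x)" "evh X th x g (rval g x)" "evh X th x (a i) (rval (a i) x)" for i
   using x fg aP ev_rval by auto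
  have "evh X th x (f ^ (k + k) + (SUM i<k + k. a i * f ^ i * g ^ (k + k - i)))
   (rval f x ^ (k + k) + (SUM i<k + k. rval (a i) x * rval f x ^ i * rval g x ^ (k + k - i)))"
   by (rule place_add[OF E place_power[OF E ev(1)] place_sum[OF E]],
     rule place_mult[OF E place_mult[OF E ev(3) place_power[OF E ev(1)]] place_power[OF E ev(2)]])
  thus ?thesis unfolding eq0 using place_unique[OF E _ place_0[OF E]] by blast
 qed
 have kr: "kreg X P (rval r)" if "rdom r = P" for r using kreg_original[of r] that by simp
 have gz: "~ germ_zero X y (rval g)"
 proof
  assume "germ_zero X y (rval g)"
  then obtain W where W: "opn X W" "y : W" "ALL x:W. rval g x = 0" unfolding germ_zero_def by blast
  have "g = 0" by (rule rval_zero_imp[of "W Int P"]) (use W P(2) oP fg in auto)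
  thus False using g0(2) w0 by (simp add: g_def)
 qed
 have "y : P & kreg X P (rval f) & kreg X P (rval g) & ~ germ_zero X y (rval g) & (ALL i<k + k. kreg X P (rval (a i))) &
   (ALL x:P. rval f x ^ (k + k) + (SUM i<k + k. rval (a i) x * rval f x ^ i * rval g x ^ (k + k - i)) = 0)"
  using P(2) kr fg aP gz val by simp
 then obtain W r where W: "y : W" "W <= P" "kreg X W r" "ALL x:W. rval f x = r x * rval g x"
  using normal[unfolded normal_at_def, THEN conjunct2, rule_format, of P "rval f" "rval g" "k + k" "%i. rval (a i)"]
  by blast
 have kW: "kreg (hat X) W r" by (rule kreg_imp_hat[OF sheaf W(3)])
 have oW: "opn (hat X) W" "W ~= {}" using r_open[OF kW] W(1) by auto
 have kf: "kreg (hat X) W (rval f)" "kreg (hat X) W (rval g)" by (rule kreg_rval_subset[OF oW(1)], use W(2) fg in simp)+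
 have "f = th W (rval f)" using th_rval[OF oW(1) _ oW(2)] W(2) fg by simp
 also have "... = th W (%x. r x * rval g x)" by (rule th_cong[OF kf(1)]) (use W(4) in simp)
 also have "... = th W r * g" using th_mult[OF kW kf(2) oW(2)] th_rval[OF oW(1) _ oW(2), of g] W(2) fg by simp
 finally have "f0 / g0 = th W r" using w0 g0(2) by (simp add: f_def g_def field_simps)
 thus ?thesis using kreg_subset_rdom[OF kW refl] W(1) by auto
qed

end

subsection \<open>Complete integral closure of polynomial rings\<close>

text \<open>Complete integral closedness, stated without fractions: a quotient of \<open>P\<close>
  by \<open>Q\<close> all of whose powers have a common denominator \<open>d\<close> lies in the
  ring.\<close>

definition compl_closed :: "'a::idom itself => bool" where "compl_closed _ <->
  (ALL P Q d :: 'a. Q ~= 0 --> d ~= 0 --> (ALL k. Q ^ k dvd d * P ^ k) --> Q dvd P)"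

lemma compl_closedD:
 "compl_closed TYPE('a::idom) ==> Q ~= 0 ==> d ~= 0 ==> (!!k. Q ^ k dvd d * P ^ k) ==> Q dvd (P :: 'a)"
 unfolding compl_closed_def by blast

lemma power_add_dvd:
 fixes a b :: "'a::comm_ring_1"
 shows "EX X. (a + b) ^ k = a * X + b ^ k"
proof (induction k)
 case 0
 show ?case by (intro exI[of _ 0]) simp
next
 case (Suc k)
 then obtain X where "(a + b) ^ k = a * X + b ^ k" ..
 hence "(a + b) ^ Suc k = a * ((a + b) * X + b ^ k) + b ^ Suc k" by (simp add: algebra_simps)
 thus ?case ..
qed

text \<open>Modulo \<open>Q ^ k\<close> the power \<open>s ^ k\<close> is a multiple of
  \<open>P\<close>; hence one factor \<open>P\<close> after the other can be exchanged for
  \<open>s ^ k\<close>.\<close>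

lemma coprime_up_to_constant:
 fixes P Q :: "'a::comm_ring_1"
 assumes s: "s = u * P + v * Q" and dv: "Q ^ k dvd P ^ j * A"
 shows "Q ^ k dvd s ^ (k * j) * A" using dv
proof (induction j arbitrary: A)
 case (Suc j)
 have "Q ^ k dvd P ^ j * (P * A)" using Suc.prems by (simp add: mult_ac)
 hence 1: "Q ^ k dvd s ^ (k * j) * (P * A)" by (rule Suc.IH)
 obtain X where X: "s ^ k = u * P * X + (v * Q) ^ k" using power_add_dvd[of "u * P" "v * Q" k] s by auto
 have "s ^ (k * Suc j) * A = u * X * (s ^ (k * j) * (P * A)) + Q ^ k * (v ^ k * s ^ (k * j) * A)"
  by (simp add: power_add X algebra_simps power_mult_distrib)
 also have "Q ^ k dvd ..." by (rule dvd_add[OF dvd_mult[OF 1] dvd_triv_left])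
 finally show ?case .
qed simp

text \<open>Over the fraction field of the coefficients one would take a gcd. Here, with
  pseudo-division, an element \<open>G\<close> of least degree in the ideal of \<open>P\<close> and
  \<open>Q\<close> acts as one; the cofactors \<open>P1\<close> and \<open>Q1\<close> are coprime up
  to the constant \<open>s\<close>, so every power of \<open>Q1\<close> divides a constant multiple
  of \<open>d\<close>, and \<open>Q1\<close> is constant.\<close>

lemma dvd_up_to_constant:
 fixes P Q d :: "'a::idom poly"
 assumes Q: "Q ~= 0" and d: "d ~= 0" and dv: "!!k. Q ^ k dvd d * P ^ k"
 shows "EX r. r ~= 0 & Q dvd smult r P"
proof -
 define I where "I = {u * P + v * Q | u v. True}"
 have QI: "Q : I" unfolding I_def by (intro CollectI exI[of _ 0] exI[of _ 1]) simp
 have PI: "P : I" unfolding I_def by (intro CollectI exI[of _ 1] exI[of _ 0]) simp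
 obtain G where G: "G : I" "G ~= 0" "!!H. H : I ==> H ~= 0 ==> degree G <= degree H"
  using ex_has_least_nat[of "%H. H : I & H ~= 0" Q degree] QI Q by blast
 have div: "EX c A1. c ~= 0 & smult c A = G * A1" if A: "A : I" for A
 proof -
  obtain q r where qr: "pseudo_divmod A G = (q, r)" by force
  define c where "c = coeff G (degree G) ^ (Suc (degree A) - degree G)"
  have c: "c ~= 0" using G(2) by (simp add: c_def)
  have eq: "smult c A = G * q + r" and r: "r = 0 | degree r < degree G"
   using pseudo_divmod[OF G(2) qr] by (auto simp: c_def)
  obtain u v u' v' where uv: "A = u * P + v * Q" "G = u' * P + v' * Q" using A G(1) unfolding I_def by blast
  have "r = smult c A - G * q" using eq by simp
  also have "... = ([:c:] * u - u' * q) * P + ([:c:] * v - v' * q) * Q" by (simp add: uv algebra_simps smult_add_right)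
  finally have "r : I" unfolding I_def by blast
  hence "r = 0" using r G(3)[of r] by force
  thus ?thesis using eq c by auto
 qed
 obtain rp P1 where P1: "rp ~= 0" "smult rp P = G * P1" using div[OF PI] by blast
 obtain rq Q1 where Q1: "rq ~= 0" "smult rq Q = G * Q1" using div[OF QI] by blast
 obtain u v where uv: "G = u * P + v * Q" using G(1) unfolding I_def by blast
 define s where "s = rp * rq"
 have "G * [:s:] = smult rq u * smult rp P + smult rp v * smult rq Q"
  by (subst uv) (simp add: s_def algebra_simps smult_add_right)
 also have "... = G * (smult rq u * P1 + smult rp v * Q1)" unfolding P1 Q1 by (simp add: algebra_simps)
 finally have s: "[:s:] = smult rq u * P1 + smult rp v * Q1" using mult_left_cancel[OF G(2)] by blast
 have s0: "s ~= 0" using P1 Q1 by (simp add: s_def)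
 have dv1: "Q1 ^ k dvd P1 ^ k * ([:rq ^ k:] * d)" for k
 proof -
  obtain E where E: "d * P ^ k = Q ^ k * E" using dv[of k] by blast
  have "G ^ k * (P1 ^ k * ([:rq ^ k:] * d)) = [:rq ^ k:] * d * (smult rp P) ^ k"
   unfolding P1 by (simp add: power_mult_distrib mult_ac)
  also have "... = smult (rq ^ k * rp ^ k) (d * P ^ k)" by (simp add: smult_power mult_ac)
  also have "... = smult (rp ^ k) ((smult rq Q) ^ k * E)" unfolding E by (simp add: smult_power mult_ac)
  also have "... = G ^ k * (Q1 ^ k * smult (rp ^ k) E)" unfolding Q1 by (simp add: power_mult_distrib mult_ac)
  finally have "P1 ^ k * ([:rq ^ k:] * d) = Q1 ^ k * smult (rp ^ k) E"
   using mult_left_cancel[OF power_not_zero[OF G(2)]] by blast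
  thus ?thesis by (metis dvd_triv_left)
 qed
 \<comment> \<open>One more than the degree of \<open>d\<close>, which forces \<open>Q1\<close> to
   have degree 0.\<close>
 define k where "k = Suc (degree d)"
 have big: "Q1 ^ k dvd [:s:] ^ (k * k) * ([:rq ^ k:] * d)" by (rule coprime_up_to_constant[OF s dv1])
 have sm: "[:s:] ^ (k * k) * ([:rq ^ k:] * d) = smult (s ^ (k * k) * rq ^ k) d"
  by (simp add: poly_const_pow mult.commute)
 have "degree (Q1 ^ k) <= degree d" using dvd_imp_degree_le[OF big] s0 Q1(1) d unfolding sm by simp
 moreover have Q10: "Q1 ~= 0" using Q1 Q by auto
 ultimately have "k * degree Q1 <= degree d" by (simp add: degree_power_eq)
 hence "degree Q1 = 0" unfolding k_def by (cases "degree Q1") auto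
 then obtain c where c: "Q1 = [:c:]" "c ~= 0" using Q10 by (metis degree_eq_zeroE pCons_0_0)
 have "smult (c * rp) P = smult c (G * P1)" unfolding P1(2)[symmetric] by simp
 also have "... = Q * smult rq P1" unfolding mult_smult_right mult_smult_left[symmetric] Q1(2) c by simp
 finally have "Q dvd smult (c * rp) P" by (metis dvd_triv_left)
 thus ?thesis using c(2) P1(1) by (intro exI[of _ "c * rp"]) simp
qed

lemma power_dvd_shift:
 fixes x d G M :: "'a::comm_ring_1"
 assumes "!!k. x ^ k dvd d * G ^ k"
 shows "x ^ k dvd d * (G + x * M) ^ k"
proof -
 have "d * (G + x * M) ^ k = (SUM i<=k. d * (of_nat (k choose i) * G ^ i * (x * M) ^ (k - i)))"
  by (simp add: binomial_ring sum_distrib_left)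
 also have "x ^ k dvd ..."
 proof (rule dvd_sum)
  fix i assume "i : {..k}"
  hence "x ^ k = x ^ i * x ^ (k - i)" by (simp add: power_add[symmetric])
  moreover have "x ^ i * x ^ (k - i) dvd (d * G ^ i) * (x * M) ^ (k - i)"
   by (rule mult_dvd_mono[OF assms]) (simp add: power_mult_distrib)
  ultimately have "x ^ k dvd of_nat (k choose i) * ((d * G ^ i) * (x * M) ^ (k - i))" by simp
  thus "x ^ k dvd d * (of_nat (k choose i) * G ^ i * (x * M) ^ (k - i))" by (simp add: mult_ac)
 qed
 finally show ?thesis .
qed

text \<open>The leading coefficient of \<open>G\<close> is divisible by \<open>r\<close> because the
  coefficient ring is completely integrally closed. Subtracting the leading term preserves the
  hypothesis, by the binomial formula.\<close>

lemma const_dvd_of_powers: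
 fixes G d :: "'a::idom poly"
 assumes R: "compl_closed TYPE('a)" and r: "r ~= 0" and d: "d ~= 0"
  and "!!k. [:r:] ^ k dvd d * G ^ k"
 shows "[:r:] dvd G" using assms(4)
proof (induction "degree G" arbitrary: G rule: less_induct)
 case less
 have "r ^ k dvd lead_coeff d * lead_coeff G ^ k" for k
 proof -
  have "[:r ^ k:] dvd d * G ^ k" using less.prems[of k] by (simp add: poly_const_pow)
  hence "r ^ k dvd lead_coeff (d * G ^ k)" unfolding const_poly_dvd_iff by blast
  thus ?thesis by (simp add: lead_coeff_mult lead_coeff_power)
 qed
 hence "r dvd lead_coeff G" using compl_closedD[OF R r] d by (metis leading_coeff_0_iff)
 then obtain g where g: "lead_coeff G = r * g" by blast
 define M where "M = monom g (degree G)"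
 define G' where "G' = G + [:r:] * (- M)"
 have "[:r:] dvd G'"
 proof (cases "G' = 0")
  case False
  have "coeff G' (degree G) = 0" by (simp add: G'_def M_def g[symmetric])
  moreover have "degree G' <= degree G" unfolding G'_def M_def
   by (intro degree_add_le) (auto intro: order_trans[OF degree_smult_le] simp: degree_monom_le)
  ultimately have "degree G' < degree G" using False by (metis leading_coeff_0_iff order_le_less)
  thus ?thesis by (rule less.hyps) (unfold G'_def, rule power_dvd_shift[OF less.prems])
 qed simp
 from dvd_add[OF this dvd_triv_left[of "[:r:]" M]] show ?case by (simp add: G'_def)
qed

text \<open>First divide over the fraction field of the coefficients, then remove the constant
  \<open>r\<close> that cleared the denominators.\<close>

theorem compl_closed_poly:
 assumes R: "compl_closed TYPE('a::idom)"
 shows "compl_closed TYPE('a poly)" unfolding compl_closed_def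
proof (intro allI impI)
 fix P Q d :: "'a poly" assume Q: "Q ~= 0" and d: "d ~= 0" and dv: "ALL k. Q ^ k dvd d * P ^ k"
 obtain r G where r: "r ~= 0" "smult r P = Q * G" using dvd_up_to_constant[OF Q d] dv by blast
 have "[:r:] ^ k dvd d * G ^ k" for k
 proof -
  obtain E where E: "d * P ^ k = Q ^ k * E" using dv by blast
  have "Q ^ k * (d * G ^ k) = d * (smult r P) ^ k" unfolding r by (simp add: power_mult_distrib mult_ac)
  also have "... = smult (r ^ k) (d * P ^ k)" by (simp add: smult_power)
  also have "... = Q ^ k * ([:r:] ^ k * E)" unfolding E by (simp add: poly_const_pow)
  finally have "d * G ^ k = [:r:] ^ k * E" using mult_left_cancel[OF power_not_zero[OF Q]] by blast
  thus ?thesis by (metis dvd_triv_left)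
 qed
 hence "[:r:] dvd G" by (rule const_dvd_of_powers[OF R r(1) d])
 then obtain G' where "G = [:r:] * G'" by blast
 hence "smult r P = smult r (Q * G')" using r by simp
 hence "[:r:] * P = [:r:] * (Q * G')" by simp
 hence "P = Q * G'" using mult_left_cancel[of "[:r:]" P "Q * G'"] r(1) by simp
 thus "Q dvd P" by (metis dvd_triv_left)
qed

lemma compl_closed_field: "compl_closed TYPE('a::field)" unfolding compl_closed_def by (auto simp: dvd_field_iff)

subsection \<open>The field of rational functions in two variables\<close>

type_synonym 'k rat2 = "'k poly poly fract"

definition emb :: "'a::idom => 'a fract" where "emb p = Fraction_Field.Fract p 1"

lemma emb_add: "emb (p + q) = emb p + emb q" by (simp add: emb_def)
lemma emb_mult: "emb (p * q) = emb p * emb q" by (simp add: emb_def)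
lemma emb_1 [simp]: "emb 1 = 1" by (simp add: emb_def One_fract_def)
lemma emb_0 [simp]: "emb 0 = 0" by (simp add: emb_def Zero_fract_def)
lemma emb_eq_iff [simp]: "emb p = emb q <-> p = q" by (simp add: emb_def eq_fract)
lemma emb_eq_0_iff [simp]: "emb p = 0 <-> p = 0" using emb_eq_iff[of p 0] by simp
lemma emb_power: "emb (p ^ k) = emb p ^ k" by (induction k) (auto simp: emb_mult)
lemma emb_sum: "emb (sum f I) = (SUM i:I. emb (f i))" by (induction I rule: infinite_finite_induct) (auto simp: emb_add)

lemma Fract_eq_divide: "b ~= 0 ==> Fraction_Field.Fract a b = emb a / emb b" by (simp add: emb_def)

lemma fract_as_quotient: obtains a b where "q = emb a / emb b" "b ~= 0"
 by (cases q rule: Fract_cases) (auto simp: Fract_eq_divide)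

definition fconst :: "'k::field => 'k rat2" where "fconst c = emb [:[:c:]:]"

interpretation fconst: field_hom "fconst :: 'k::field => 'k rat2"
 by unfold_locales (auto simp: fconst_def emb_def One_fract_def one_pCons)

text \<open>In \<open>'k poly poly\<close> the inner indeterminate \<open>[:[:0, 1:]:]\<close> is
  the first torus coordinate and the outer one \<open>[:0, 1:]\<close> the second.\<close>

definition mon :: "int \<times> int => 'k::field rat2" where
 "mon m = emb [:[:0, 1:]:] powi fst m * emb [:0, 1:] powi snd m"

lemma mon_nonzero [simp]: "mon m ~= (0 :: 'k::field rat2)" by (simp add: mon_def)

lemma mon_0 [simp]: "mon 0 = 1" by (simp add: mon_def)

lemma mon_add: "mon (a + b) = (mon a * mon b :: 'k::field rat2)" by (simp add: mon_def power_int_add)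

lemma mon_uminus: "mon (- a) = (inverse (mon a) :: 'k::field rat2)" by (simp add: mon_def power_int_minus)

lemma mon_diff: "mon (a - b) = (mon a / mon b :: 'k::field rat2)"
 using mon_add[of a "- b"] by (simp add: mon_uminus divide_inverse)

definition scale :: "int => int \<times> int => int \<times> int" where "scale k m = (k * fst m, k * snd m)"

lemma mon_scale: "mon (scale (int k) m) = (mon m ^ k :: 'k::field rat2)"
proof (induction k)
 case (Suc k)
 have "scale (int (Suc k)) m = m + scale (int k) m" by (simp add: scale_def prod_eq_iff algebra_simps)
 thus ?case using Suc by (simp add: mon_add)
qed (simp add: scale_def zero_prod_def[symmetric])

lemma mon_nat:
 "0 <= fst m ==> 0 <= snd m ==> fconst c * mon m = (emb (monom (monom c (nat (fst m))) (nat (snd m))) :: 'k::field rat2)"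
proof -
 assume m: "0 <= fst m" "0 <= snd m"
 have *: "monom (monom c (nat (fst m))) (nat (snd m)) = [:[:c:]:] * ([:[:0, 1:]:] ^ nat (fst m) * [:0, 1:] ^ nat (snd m))"
  by (simp add: poly_const_pow monom_altdef smult_power mult_ac)
 show ?thesis unfolding * emb_mult emb_power using m by (simp add: fconst_def mon_def power_int_def)
qed

section \<open>Laurent polynomials as rational functions\<close>

definition tor :: "((int \<times> int) \<Rightarrow>\<^sub>0 'k::field) => 'k rat2" where
 "tor a = (SUM m:keys a. fconst (lookup a m) * mon m)"

lemma tor_superset:
 assumes "finite M" "keys a <= M"
 shows "tor a = (SUM m:M. fconst (lookup a m) * mon m)"
 unfolding tor_def by (rule sum.mono_neutral_left) (insert assms, auto simp: in_keys_iff)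

lemma tor_0 [simp]: "tor 0 = 0" by (simp add: tor_def)

lemma tor_add: "tor (a + b) = tor a + tor b"
proof -
 let ?M = "keys a Un keys b"
 have "keys (a + b) <= ?M" by (rule keys_add)
 thus ?thesis by (simp add: tor_superset[of ?M] lookup_add fconst.e_add distrib_right sum.distrib)
qed

lemma tor_single: "tor (single m c) = fconst c * mon m" by (simp add: tor_def)

lemma tor_mult: "tor (a * b) = tor a * tor b"
proof (induction a rule: poly_mapping_single_induct)
 case (single m c)
 show ?case
 proof (induction b rule: poly_mapping_single_induct)
  case (single m' d)
  show ?case by (simp add: mult_single tor_single mon_add fconst.e_mult)
 qed (simp_all add: algebra_simps tor_add)
qed (simp_all add: algebra_simps tor_add)

lemma bound_below:
 fixes f :: "'a => int"
 assumes "finite M"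
 shows "EX N::nat. ALL m:M. 0 <= f m + int N" using assms
proof induction
 case (insert x M)
 then obtain N where "ALL m:M. 0 <= f m + int N" by blast
 thus ?case by (intro exI[of _ "N + nat \<bar>f x\<bar>"]) auto
qed auto

definition tor_num :: "nat => ((int \<times> int) \<Rightarrow>\<^sub>0 'k::field) => 'k poly poly" where
 "tor_num N a = (SUM m:keys a. monom (monom (lookup a m) (nat (fst m + int N))) (nat (snd m + int N)))"

lemma tor_num:
 assumes N: "ALL m:keys a. 0 <= fst m + int N & 0 <= snd m + int N"
 shows "tor a * mon (int N, int N) = emb (tor_num N a)"
proof -
 have "tor a * mon (int N, int N) = (SUM m:keys a. fconst (lookup a m) * mon (m + (int N, int N)))"
  by (simp add: tor_def sum_distrib_right mon_add mult.assoc)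
 also have "... = (SUM m:keys a. emb (monom (monom (lookup a m) (nat (fst m + int N))) (nat (snd m + int N))))"
  by (rule sum.cong[OF refl]) (insert N, simp add: mon_nat)
 finally show ?thesis by (simp add: tor_num_def emb_sum)
qed

lemma tor_num_coeff:
 assumes N: "ALL m:keys a. 0 <= fst m + int N & 0 <= snd m + int N" and m: "m : keys a"
 shows "coeff (coeff (tor_num N a) (nat (snd m + int N))) (nat (fst m + int N)) = lookup a m"
proof -
 have "coeff (coeff (tor_num N a) (nat (snd m + int N))) (nat (fst m + int N)) =
   (SUM m':keys a. if m' = m then lookup a m' else 0)" unfolding tor_num_def coeff_sum
 proof (rule sum.cong[OF refl])
  fix m' assume m': "m' : keys a"
  have "nat (fst m' + int N) = nat (fst m + int N) <-> fst m' = fst m"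
   "nat (snd m' + int N) = nat (snd m + int N) <-> snd m' = snd m"
   using N[rule_format, OF m] N[rule_format, OF m'] by (auto simp: eq_nat_nat_iff)
  thus "coeff (coeff (monom (monom (lookup a m') (nat (fst m' + int N))) (nat (snd m' + int N)))
    (nat (snd m + int N))) (nat (fst m + int N)) = (if m' = m then lookup a m' else 0)"
   by (auto simp: coeff_monom prod_eq_iff)
 qed
 also have "... = lookup a m" using m by simp
 finally show ?thesis .
qed

lemma tor_shift: "EX N. ALL m:keys a. 0 <= fst m + int N & 0 <= snd (m :: int \<times> int) + int N"
proof -
 obtain N1 N2 where "ALL m:keys a. 0 <= fst m + int N1" "ALL m:keys a. 0 <= snd m + int N2"
  using bound_below[of "keys a" fst] bound_below[of "keys a" snd] by auto
 thus ?thesis by (intro exI[of _ "N1 + N2"]) fastforce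
qed

lemma tor_eq_0_iff [simp]: "tor a = 0 <-> a = 0"
proof
 assume "tor a = 0"
 obtain N where N: "ALL m:keys a. 0 <= fst m + int N & 0 <= snd m + int N" using tor_shift by blast
 have "tor_num N a = 0" using tor_num[OF N] `tor a = 0` by simp
 hence "m ~: keys a" for m using tor_num_coeff[OF N, of m] by (cases "m : keys a") (simp_all add: in_keys_iff)
 hence "keys a = {}" by blast
 thus "a = 0" by (simp only: keys_eq_empty)
qed simp

lemma tor_uminus: "tor (- a) = - tor a" using tor_add[of a "- a"] by (simp add: eq_neg_iff_add_eq_0 add.commute)

lemma tor_eq_iff [simp]: "tor a = tor b <-> a = b"
proof -
 have "tor a - tor b = tor (a - b)" using tor_add[of a "- b"] by (simp add: tor_uminus)
 thus ?thesis by (metis eq_iff_diff_eq_0 tor_eq_0_iff)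
qed

lemma poly_poly_zeroI:
 fixes p :: "'k::field poly poly"
 assumes K: "infinite (UNIV :: 'k set)" and z: "!!x y. x ~= 0 ==> y ~= 0 ==> poly (poly p [:y:]) x = 0"
 shows "p = 0"
proof (rule ccontr)
 assume p: "p ~= 0"
 have inf: "infinite (UNIV - {0 :: 'k})" using K by simp
 have "poly p [:y:] = 0" if "y ~= 0" for y
 proof (rule ccontr)
  assume "poly p [:y:] ~= 0"
  from poly_roots_finite[OF this] show False
   using inf finite_subset[of "UNIV - {0}" "{x. poly (poly p [:y:]) x = 0}"] z[OF _ that] by auto
 qed
 hence "(%y. [:y:]) ` (UNIV - {0}) <= {y. poly p y = 0}" by auto
 moreover have "infinite ((%y :: 'k. [:y:]) ` (UNIV - {0}))" using inf by (subst finite_image_iff) (auto intro: inj_onI)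
 ultimately show False using poly_roots_finite[OF p] finite_subset by blast
qed

lemma laurent_zeroI:
 fixes a :: "(int \<times> int) \<Rightarrow>\<^sub>0 'k::field"
 assumes K: "infinite (UNIV :: 'k set)"
  and z: "!!x y. x ~= 0 ==> y ~= 0 ==> (SUM m:keys a. lookup a m * (x powi fst m * y powi snd m)) = 0"
 shows "a = 0"
proof -
 obtain N where N: "ALL m:keys a. 0 <= fst m + int N & 0 <= snd m + int N" using tor_shift by blast
 have "tor_num N a = 0"
 proof (rule poly_poly_zeroI[OF K])
  fix x y :: 'k assume xy: "x ~= 0" "y ~= 0"
  have "poly (poly (tor_num N a) [:y:]) x =
    (SUM m:keys a. lookup a m * (x ^ nat (fst m + int N) * y ^ nat (snd m + int N)))"
   by (simp add: tor_num_def poly_sum poly_monom poly_const_pow mult_ac)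
  also have "... = (SUM m:keys a. x ^ N * y ^ N * (lookup a m * (x powi fst m * y powi snd m)))"
  proof (rule sum.cong[OF refl])
   fix m assume m: "m : keys a"
   have "x ^ nat (fst m + int N) = x powi fst m * x ^ N" "y ^ nat (snd m + int N) = y powi snd m * y ^ N"
    using N m xy power_int_add[of x "fst m" "int N"] power_int_add[of y "snd m" "int N"]
    by (simp_all flip: power_int_of_nat)
   thus "lookup a m * (x ^ nat (fst m + int N) * y ^ nat (snd m + int N)) =
     x ^ N * y ^ N * (lookup a m * (x powi fst m * y powi snd m))" by (simp add: mult_ac)
  qed
  also have "... = 0" using z[OF xy] by (simp add: sum_distrib_left[symmetric])
  finally show "poly (poly (tor_num N a) [:y:]) x = 0" .
 qed
 hence "m ~: keys a" for m using tor_num_coeff[OF N, of m] by (cases "m : keys a") (simp_all add: in_keys_iff)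
 hence "keys a = {}" by blast
 thus ?thesis by (simp only: keys_eq_empty)
qed

subsection \<open>Derivations\<close>

definition derivation :: "('k::field => 'r::field) => ('r => 'r) => bool" where
 "derivation e D <-> (ALL a b. D (a + b) = D a + D b) & (ALL a b. D (a * b) = D a * b + a * D b) & (ALL c. D (e c) = 0)"

lemma derivationD:
 assumes "derivation e D"
 shows dern_add: "D (a + b) = D a + D b" and dern_mult: "D (a * b) = D a * b + a * D b"
  and dern_const: "D (e c) = 0" using assms unfolding derivation_def by blast+

lemma dern_0: "derivation e D ==> D 0 = 0" using dern_add[of e D 0 0] by (simp only: add_0_left add_cancel_right_right)

lemma dern_1: "derivation e D ==> D 1 = 0"
 using dern_mult[of e D 1 1] by (simp only: mult_1_left mult_1_right add_cancel_right_right)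

lemma dern_inverse:
 assumes D: "derivation e D"
 shows "D (inverse q) = - (D q * inverse q * inverse q)"
proof (cases "q = 0")
 case False
 have "0 = D (q * inverse q)" using False dern_1[OF D] by simp
 also have "... = D q * inverse q + q * D (inverse q)" by (rule dern_mult[OF D])
 finally have "q * D (inverse q) = - (D q * inverse q)" by (simp add: eq_neg_iff_add_eq_0 add.commute)
 have "D (inverse q) = inverse q * (q * D (inverse q))" using False by simp
 also have "... = inverse q * - (D q * inverse q)" by (simp only: `q * D (inverse q) = - (D q * inverse q)`)
 finally show ?thesis by (simp add: mult_ac)
qed (simp add: dern_0[OF D])

lemma dern_powi:
 assumes D: "derivation e D" and x: "D x = l * x" "x ~= 0"
 shows "D (x powi n) = of_int n * l * x powi n"
proof -
 have p: "D (x ^ k) = of_nat k * l * x ^ k" for k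
  by (induction k) (auto simp: dern_1[OF D] dern_mult[OF D] x algebra_simps)
 show ?thesis
 proof (cases n rule: int_cases2)
  case (nonneg k)
  thus ?thesis using p by simp
 next
  case (nonpos k)
  thus ?thesis using p[of k] x(2) by (simp add: power_int_minus dern_inverse[OF D])
 qed
qed

text \<open>The quotient rule on an arbitrary representation; \<open>fderiv_quotient\<close> shows
  that the choice does not matter.\<close>

definition fderiv :: "('a::idom => 'a) => 'a fract => 'a fract" where
 "fderiv d q = (SOME r. EX a b. b ~= 0 & q = emb a / emb b & r = emb (b * d a - a * d b) / emb (b * b))"

context
 fixes d :: "'a::idom => 'a"
 assumes d_add: "!!a b. d (a + b) = d a + d b" and d_mult: "!!a b. d (a * b) = d a * b + a * d b"
begin

lemma fderiv_quotient:
 assumes b: "b ~= 0"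
 shows "fderiv d (emb a / emb b) = emb (b * d a - a * d b) / emb (b * b)"
proof -
 have "r = emb (b * d a - a * d b) / emb (b * b)"
  if *: "EX a' b'. b' ~= 0 & emb a / emb b = emb a' / emb b' & r = emb (b' * d a' - a' * d b') / emb (b' * b')" for r
 proof -
  obtain a' b' where b': "b' ~= 0" "emb a / emb b = emb a' / emb b'"
   "r = emb (b' * d a' - a' * d b') / emb (b' * b')" using * by blast
  have "emb (a * b') = emb (a' * b)" using b b'(1,2) by (simp add: emb_mult field_simps)
  hence eq: "a * b' = a' * b" by simp
  have "d (a * b') = d (a' * b)" using eq by simp
  hence eq': "d a * b' + a * d b' = d a' * b + a' * d b" by (simp add: d_mult)
  have "(b' * d a' - a' * d b') * (b * b) = b' * b * (d a' * b) - (a' * b) * d b' * b" by (simp add: algebra_simps)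
  also have "... = b' * b * (d a * b' + a * d b' - a' * d b) - (a * b') * d b' * b" unfolding eq' eq by simp
  also have "... = (b' * b') * b * d a - (a' * b) * d b * b'" by (simp add: algebra_simps)
  also have "... = (b * d a - a * d b) * (b' * b')" unfolding eq[symmetric] by (simp add: algebra_simps)
  finally have "emb (b' * d a' - a' * d b') * emb (b * b) = emb (b * d a - a * d b) * emb (b' * b')"
   by (simp flip: emb_mult)
  thus ?thesis unfolding b'(3) using b b'(1) by (simp add: frac_eq_eq)
 qed
 thus ?thesis unfolding fderiv_def using b by (intro some_equality) blast+
qed

lemma d_1: "d 1 = 0" using d_mult[of 1 1] by (simp only: mult_1_left mult_1_right add_cancel_right_right)

lemma fderiv_emb: "fderiv d (emb a) = emb (d a)" using fderiv_quotient[of 1 a] by (simp add: d_1)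

lemma fderiv_derivation:
 assumes "!!c. d (f c) = 0"
 shows "derivation (%c. emb (f c)) (fderiv d)" unfolding derivation_def
proof (intro conjI allI)
 fix q r :: "'a fract" and c
 obtain a b where 1: "q = emb a / emb b" "b ~= 0" by (rule fract_as_quotient)
 obtain a' b' where 2: "r = emb a' / emb b'" "b' ~= 0" by (rule fract_as_quotient)
 have "q + r = emb (a * b' + a' * b) / emb (b * b')" using 1 2 by (simp add: emb_add emb_mult add_frac_eq)
 hence "fderiv d (q + r) = emb (b * b' * d (a * b' + a' * b) - (a * b' + a' * b) * d (b * b')) / emb (b * b' * (b * b'))"
  using fderiv_quotient[of "b * b'"] 1(2) 2(2) by simp
 also have "... = emb ((b * d a - a * d b) * (b' * b') + (b' * d a' - a' * d b') * (b * b)) / emb ((b * b) * (b' * b'))"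
  by (simp add: d_add d_mult algebra_simps)
 also have "... = fderiv d q + fderiv d r" using 1 2 by (simp add: fderiv_quotient emb_add emb_mult add_frac_eq)
 finally show "fderiv d (q + r) = fderiv d q + fderiv d r" .
 have "q * r = emb (a * a') / emb (b * b')" using 1 2 by (simp add: emb_mult)
 hence "fderiv d (q * r) = emb (b * b' * d (a * a') - (a * a') * d (b * b')) / emb (b * b' * (b * b'))"
  using fderiv_quotient[of "b * b'"] 1(2) 2(2) by simp
 also have "... = emb ((b * d a - a * d b) * a' * (b * b' * b') + a * (b' * d a' - a' * d b') * (b * b * b')) / emb ((b * b * b') * (b * b' * b'))"
  using 1(2) 2(2) by (simp add: d_mult frac_eq_eq flip: emb_mult) (simp add: algebra_simps)
 also have "... = fderiv d q * r + q * fderiv d r"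
  using 1 2 by (simp add: fderiv_quotient emb_add emb_mult add_frac_eq mult_ac)
 finally show "fderiv d (q * r) = fderiv d q * r + q * fderiv d r" .
 show "fderiv d (emb (f c)) = 0" using assms by (simp add: fderiv_emb)
qed

end

text \<open>The logarithmic derivations: \<open>D2\<close> is \<open>t2 * d/dt2\<close> in the outer
  indeterminate, and \<open>D1\<close> is \<open>t1 * d/dt1\<close> applied to the coefficients.
  Monomials are eigenvectors with their exponents as eigenvalues.\<close>

definition D2 :: "'k::field rat2 => 'k rat2" where "D2 = fderiv (%p. [:0, 1:] * pderiv p)"

definition D1 :: "'k::field rat2 => 'k rat2" where "D1 = fderiv (map_poly (%c. [:0, 1:] * pderiv c))"

lemma D2_derivation: "derivation fconst D2" unfolding D2_def fconst_def[abs_def]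
 by (rule fderiv_derivation) (auto simp: pderiv_add pderiv_mult algebra_simps pderiv_pCons)

lemma D2_emb: "D2 (emb p) = emb ([:0, 1:] * pderiv p)"
 unfolding D2_def by (rule fderiv_emb) (auto simp: pderiv_add pderiv_mult algebra_simps)

lemma D1_poly:
 fixes p q :: "'k::field poly poly" defines "de \<equiv> %c :: 'k poly. [:0, 1:] * pderiv c"
 shows "map_poly de (p + q) = map_poly de p + map_poly de q"
  "map_poly de (p * q) = map_poly de p * q + p * map_poly de q"
proof -
 have d0: "de 0 = 0" and da: "de (a + b) = de a + de b" and dm: "de (a * b) = de a * b + a * de b" for a b
  by (auto simp: de_def pderiv_add pderiv_mult algebra_simps smult_add_right)
 have ds: "de (sum f I) = (SUM i:I. de (f i))" for f :: "nat => _" and I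
  by (induction I rule: infinite_finite_induct) (auto simp: d0 da)
 show "map_poly de (p + q) = map_poly de p + map_poly de q" by (rule poly_eqI) (simp add: coeff_map_poly d0 da)
 show "map_poly de (p * q) = map_poly de p * q + p * map_poly de q"
  by (rule poly_eqI) (simp add: coeff_map_poly d0 coeff_mult ds dm sum.distrib)
qed

lemma D1_derivation: "derivation fconst D1" unfolding D1_def fconst_def[abs_def]
 by (rule fderiv_derivation) (auto simp: D1_poly[simplified] map_poly_pCons pderiv_pCons)

lemma D1_emb: "D1 (emb p) = emb (map_poly (%c. [:0, 1:] * pderiv c) p)"
 unfolding D1_def by (rule fderiv_emb) (auto simp: D1_poly[simplified])

lemma D1_mon: "D1 (mon m) = of_int (fst m) * (mon m :: 'k::field rat2)"
 and D2_mon: "D2 (mon m) = of_int (snd m) * (mon m :: 'k rat2)"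
proof -
 let ?X = "emb [:[:0, 1:]:] :: 'k rat2" and ?Y = "emb [:0, 1:] :: 'k rat2"
 have X: "D1 ?X = 1 * ?X" "D2 ?X = 0 * ?X" and Y: "D1 ?Y = 0 * ?Y" "D2 ?Y = 1 * ?Y"
  by (simp_all add: D1_emb D2_emb map_poly_pCons pderiv_pCons)
 have n: "?X ~= 0" "?Y ~= 0" by auto
 show "D1 (mon m) = of_int (fst m) * (mon m :: 'k rat2)" "D2 (mon m) = of_int (snd m) * (mon m :: 'k rat2)"
  unfolding mon_def dern_mult[OF D1_derivation] dern_mult[OF D2_derivation]
   dern_powi[OF D1_derivation X(1) n(1)] dern_powi[OF D1_derivation Y(1) n(2)]
   dern_powi[OF D2_derivation X(2) n(1)] dern_powi[OF D2_derivation Y(2) n(2)] by (simp_all add: mult_ac)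
qed

subsection \<open>Semigroup rings of cones\<close>

text \<open>The K-span of the monomials with exponents in \<open>S\<close>. It is a ring when
  \<open>S\<close> is a monoid, but it is also used for level sets and open half planes.\<close>

definition KS :: "(int \<times> int) set => 'k::field rat2 set" where "KS S = tor ` {a. keys a <= S}"

lemma KS_I: "keys a <= S ==> tor a : KS S" by (simp add: KS_def)

lemma KS_mono: "S <= T ==> KS S <= KS T" by (auto simp: KS_def)

lemma KS_0 [simp]: "0 : KS S" using KS_I[of 0 S] by simp

lemma KS_add: "A : KS S ==> B : KS S ==> A + B : KS S"
proof -
 assume "A : KS S" "B : KS S"
 then obtain a b where ab: "A = tor a" "B = tor b" "keys a <= S" "keys b <= S" by (auto simp: KS_def)
 hence "keys (a + b) <= S" using keys_add[of a b] by blast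
 thus ?thesis using KS_I[of "a + b" S] ab by (simp add: tor_add)
qed

lemma KS_uminus: "A : KS S ==> - A : KS S" unfolding KS_def by (force simp: tor_uminus[symmetric])

lemma KS_diff: "A : KS S ==> B : KS S ==> A - B : KS S" using KS_add[of A S "- B"] KS_uminus[of B S] by simp

lemma KS_sum: "(!!i. i : I ==> f i : KS S) ==> sum f I : KS S"
 by (induction I rule: infinite_finite_induct) (auto intro: KS_add)

lemma KS_mult:
 assumes "A : KS S" "B : KS T" and st: "!!s t. s : S ==> t : T ==> s + t : R"
 shows "A * B : KS R"
proof -
 obtain a b where ab: "A = tor a" "B = tor b" "keys a <= S" "keys b <= T" using assms(1,2) by (auto simp: KS_def)
 have "keys (a * b) <= R"
 proof
  fix m assume "m : keys (a * b)"
  then obtain s t where "m = s + t" "s : keys a" "t : keys b" using keys_mult[of a b] by blast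
  thus "m : R" using st ab by blast
 qed
 thus ?thesis using KS_I[of "a * b" R] ab by (simp add: tor_mult)
qed

lemma KS_mon: "m : S ==> mon m : KS S" using KS_I[of "single m 1" S] by (simp add: tor_single)

lemma KS_const: "0 : S ==> fconst c : KS S" using KS_I[of "single 0 c" S] by (simp add: tor_single)

lemma KS_Int: "A : KS S ==> A : KS T ==> A : KS (S Int T)" by (auto simp: KS_def)

lemma KS_empty: "A : KS {} ==> A = 0" by (auto simp: KS_def)

lemma KS_induct [consumes 1, case_names zero mon add]:
 assumes A: "A : KS S" and "P 0" "!!m c. m : S ==> P (fconst c * mon m)"
  "!!A B. A : KS S ==> B : KS S ==> P A ==> P B ==> P (A + B)"
 shows "P A"
proof -
 obtain a where a: "A = tor a" "keys a <= S" using A by (auto simp: KS_def)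
 have "P (SUM m:M. fconst (lookup a m) * mon m) & (SUM m:M. fconst (lookup a m) * mon m) : KS S"
  if "finite M" "M <= S" for M using that
 proof induction
  case (insert m M)
  have "fconst (lookup a m) * mon m : KS S"
   using KS_I[of "single m (lookup a m)" S] insert.prems by (simp add: tor_single split: if_splits)
  thus ?case using insert assms(3)[of m] by (auto intro!: assms(4) KS_add)
 qed (use assms(2) in auto)
 from this[of "keys a"] show ?thesis using a by (simp add: tor_def)
qed

lemma KS_split:
 assumes "A : KS S"
 shows "EX A0 A1. A = A0 + A1 & A0 : KS (S Int T) & A1 : KS (S - T)" using assms
proof (induction rule: KS_induct)
 case zero
 show ?case by (intro exI[of _ 0]) simp
next
 case (mon m c)
 have *: "fconst c * mon m : KS R" if "m : R" for R
  using KS_I[of "single m c" R] that by (simp add: tor_single split: if_splits)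
 show ?case
 proof (cases "m : T")
  case True
  thus ?thesis using mon * by (intro exI[of _ "fconst c * mon m"] exI[of _ 0]) simp
 next
  case False
  thus ?thesis using mon * by (intro exI[of _ 0] exI[of _ "fconst c * mon m"]) simp
 qed
next
 case (add A B)
 then obtain A0 A1 B0 B1 where "A = A0 + A1" "A0 : KS (S Int T)" "A1 : KS (S - T)"
  "B = B0 + B1" "B0 : KS (S Int T)" "B1 : KS (S - T)" by blast
 thus ?case by (intro exI[of _ "A0 + B0"] exI[of _ "A1 + B1"]) (auto intro: KS_add)
qed

lemma emb_in_KS:
 fixes p :: "'k::field poly poly"
 shows "emb p : KS {m. 0 <= fst m & 0 <= snd m}"
proof -
 let ?S = "{m :: int \<times> int. 0 <= fst m & 0 <= snd m}"
 have X: "emb [:[:0, 1:]:] = (mon (1, 0) :: 'k rat2)" and Y: "emb [:0, 1:] = (mon (0, 1) :: 'k rat2)" by (simp_all add: mon_def)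
 have cl: "A * B : KS ?S" if "A : KS ?S" "B : KS ?S" for A B :: "'k rat2" by (rule KS_mult[OF that]) auto
 have 1: "emb [:a:] : KS ?S" for a :: "'k poly"
 proof (induction a)
  case (pCons c a)
  have "[:pCons c a:] = [:[:c:]:] + [:[:0, 1:]:] * [:a:]" by simp
  hence "emb [:pCons c a:] = fconst c + mon (1, 0) * emb [:a:]" by (simp only: emb_add emb_mult X fconst_def)
  moreover have "fconst c : KS ?S" by (rule KS_const) simp
  moreover have "(mon (1, 0) :: 'k rat2) : KS ?S" by (rule KS_mon) simp
  ultimately show ?case using pCons(2) cl by (auto intro!: KS_add)
 qed simp
 show ?thesis
 proof (induction p)
  case (pCons a p)
  have "pCons a p = [:a:] + [:0, 1:] * p" by simp
  hence "emb (pCons a p) = emb [:a:] + mon (0, 1) * emb p" by (simp only: emb_add emb_mult Y)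
  moreover have "(mon (0, 1) :: 'k rat2) : KS ?S" by (rule KS_mon) simp
  ultimately show ?case using pCons(2) 1 cl by (auto intro!: KS_add)
 qed simp
qed

section \<open>Complete integral closedness of the Laurent ring and of the semigroup rings of
  cones\<close>

lemma prime_elem_pX: "prime_elem ([:0, 1:] :: 'a::idom poly)"
proof (rule prime_elemI)
 show "~ [:0, 1:] dvd (1 :: 'a poly)" by (auto simp: poly_eq_0_iff_dvd[of _ 0, simplified, symmetric])
 fix a b :: "'a poly" assume "[:0, 1:] dvd a * b"
 thus "[:0, 1:] dvd a | [:0, 1:] dvd b"
  using poly_eq_0_iff_dvd[of "a * b" 0] poly_eq_0_iff_dvd[of a 0] poly_eq_0_iff_dvd[of b 0] by simp
qed simp

lemma prime_cancel:
 fixes p :: "'a::idom"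
 assumes p: "prime_elem p" "~ p dvd Q" and "Q ^ k dvd p ^ N * A"
 shows "Q ^ k dvd A" using assms(3)
proof (induction N)
 case (Suc N)
 then obtain B where B: "p * (p ^ N * A) = Q ^ k * B" by (auto simp: mult.assoc)
 hence "p dvd Q ^ k * B" by (metis dvd_triv_left)
 hence "p dvd B" using p prime_elem_dvd_mult_iff prime_elem_dvd_power by blast
 then obtain B' where "B = p * B'" by blast
 hence "p * (p ^ N * A) = p * (Q ^ k * B')" using B by (simp add: mult_ac)
 hence "p ^ N * A = Q ^ k * B'" using p(1) by (simp add: prime_elem_def)
 thus ?case using Suc.IH by simp
qed simp

text \<open>The leading coefficient in the outer indeterminate loses a degree with every factor
  removed, which ends the process.\<close>

lemma split_X:
 fixes Q :: "'k::field poly poly"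
 assumes "Q ~= 0"
 shows "EX a Q'. Q = [:[:0, 1:]:] ^ a * Q' & ~ [:[:0, 1:]:] dvd Q'" using assms
proof (induction "degree (lead_coeff Q)" arbitrary: Q rule: less_induct)
 case less
 show ?case
 proof (cases "[:[:0, 1:]:] dvd Q")
  case True
  then obtain Q1 where Q1: "Q = [:[:0, 1:]:] * Q1" by blast
  hence n: "Q1 ~= 0" using less.prems by auto
  have "lead_coeff Q = [:0, 1:] * lead_coeff Q1" unfolding Q1 lead_coeff_mult by simp
  hence "degree (lead_coeff Q) = Suc (degree (lead_coeff Q1))" using n by (simp add: degree_mult_eq)
  then obtain a Q' where "Q1 = [:[:0, 1:]:] ^ a * Q' & ~ [:[:0, 1:]:] dvd Q'" using less.hyps[of Q1] n by auto
  thus ?thesis using Q1 by (intro exI[of _ "Suc a"] exI[of _ Q']) (simp add: mult.assoc)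
 qed (intro exI[of _ 0] exI[of _ Q], simp)
qed

text \<open>Monomial factors are split off from the denominator, since they are units of the Laurent
  ring. The rest \<open>Q0\<close> is prime to both indeterminates, so these can be cancelled from
  the divisibilities, and complete integral closedness of the polynomial ring makes
  \<open>Q0\<close> divide the numerator.\<close>

lemma laurent_compl_closed:
 fixes q d :: "'k::field rat2"
 assumes d: "d ~= 0" and dq: "!!k. d * q ^ k : KS UNIV"
 shows "q : KS UNIV"
proof -
 let ?X = "[:[:0, 1:]:] :: 'k poly poly" and ?Y = "[:0, 1:] :: 'k poly poly"
 define z where "z = ?X * ?Y"
 have zpow: "z ^ N = ?X ^ N * ?Y ^ N" for N unfolding z_def by (rule power_mult_distrib)
 have "emb z = emb ?X * emb ?Y" unfolding z_def by (rule emb_mult)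
 hence monz: "mon (int N, int N) = emb (z ^ N)" for N by (simp add: mon_def emb_power power_mult_distrib)
 have num: "EX N E. A * emb (z ^ N) = emb E" if "A : KS UNIV" for A :: "'k rat2"
 proof -
  obtain a where a: "A = tor a" using `A : KS UNIV` by (auto simp: KS_def)
  obtain N where "ALL m:keys a. 0 <= fst m + int N & 0 <= snd m + int N" using tor_shift by blast
  from tor_num[OF this] show ?thesis unfolding a monz[symmetric] by blast
 qed
 obtain P Q where PQ: "q = emb P / emb Q" "Q ~= 0" by (rule fract_as_quotient)
 obtain M d' where d': "d * emb (z ^ M) = emb d'" using num[of d] dq[of 0] by auto
 have z0: "z ~= 0" by (simp add: z_def)
 have d0: "d' ~= 0" using d d' z0 by (metis emb_eq_0_iff mult_eq_0_iff power_not_zero)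
 obtain a Q' where Q': "Q = ?X ^ a * Q'" "~ ?X dvd Q'" using split_X[OF PQ(2)] by blast
 have Q'n: "Q' ~= 0" using Q' PQ(2) by auto
 obtain Q0 where Q0: "Q' = ?Y ^ order 0 Q' * Q0" "~ ?Y dvd Q0" using order_decomp[OF Q'n, of 0] by auto
 have XQ0: "~ ?X dvd Q0" using Q'(2) Q0(1) by (metis dvd_mult)
 define b where "b = order 0 Q'"
 have Q: "Q = ?X ^ a * ?Y ^ b * Q0" using Q'(1) Q0(1) by (simp add: b_def mult.assoc)
 have Q0n: "Q0 ~= 0" using Q PQ(2) by auto
 have pX: "prime_elem ?X" by (rule lift_prime_elem_poly[OF prime_elem_pX])
 have pY: "prime_elem ?Y" by (rule prime_elem_pX)
 have "Q0 ^ k dvd d' * P ^ k" for k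
 proof -
  obtain N E where E: "d * q ^ k * emb (z ^ N) = emb E" using num[OF dq] by blast
  have "emb (d' * P ^ k * z ^ N) = d * emb (z ^ M) * (q * emb Q) ^ k * emb (z ^ N)"
   using PQ by (simp add: emb_mult emb_power d'[symmetric])
  also have "... = (d * q ^ k * emb (z ^ N)) * emb (Q ^ k * z ^ M)"
   by (simp add: power_mult_distrib emb_mult emb_power mult_ac)
  also have "... = emb (E * (Q ^ k * z ^ M))" unfolding E by (simp add: emb_mult)
  finally have "d' * P ^ k * z ^ N = E * (Q ^ k * z ^ M)" by simp
  hence "?X ^ N * (?Y ^ N * (d' * P ^ k)) = Q0 ^ k * (E * (?X ^ a * ?Y ^ b) ^ k * z ^ M)"
   unfolding Q by (simp add: zpow power_mult_distrib mult_ac)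
  hence "Q0 ^ k dvd ?X ^ N * (?Y ^ N * (d' * P ^ k))" by (metis dvd_triv_left)
  from prime_cancel[OF pY Q0(2) prime_cancel[OF pX XQ0 this]] show ?thesis .
 qed
 hence "Q0 dvd P" by (rule compl_closedD[OF compl_closed_poly[OF compl_closed_poly[OF compl_closed_field]] Q0n d0])
 then obtain G where G: "P = Q0 * G" by blast
 have "q = emb G / (emb ?X ^ a * emb ?Y ^ b)" unfolding PQ(1) Q G using Q0n by (simp add: emb_mult emb_power)
 also have "... = emb G * mon (- int a, - int b)" by (simp add: mon_def power_int_minus field_simps)
 finally have q: "q = emb G * mon (- int a, - int b)" .
 show ?thesis unfolding q by (rule KS_mult[OF emb_in_KS KS_mon[of _ UNIV]]) auto
qed

lemma KS_leading:
 fixes l :: "int \<times> int => int"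
 assumes A: "A : KS UNIV" "A ~= 0"
 shows "EX mmu A0 A1. A = A0 + A1 & A0 ~= 0 & A0 : KS {m. l m = mmu} & A1 : KS {m. l m > mmu}"
proof -
 obtain a where a: "A = tor a" using A(1) by (auto simp: KS_def)
 have ne: "keys a ~= {}" using A(2) a by auto
 define mmu where "mmu = Min (l ` keys a)"
 have min: "mmu <= l m" if "m : keys a" for m unfolding mmu_def using that by simp
 have "mmu : l ` keys a" unfolding mmu_def by (rule Min_in) (use ne in auto)
 then obtain m0 where m0: "m0 : keys a" "l m0 = mmu" by auto
 have "A : KS {m. mmu <= l m}" unfolding a by (rule KS_I) (use min in auto)
 from KS_split[OF this, of "{m. l m = mmu}"]
 obtain A0 A1 where A01: "A = A0 + A1" "A0 : KS ({m. mmu <= l m} Int {m. l m = mmu})" "A1 : KS ({m. mmu <= l m} - {m. l m = mmu})"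
  by blast
 have "{m. mmu <= l m} Int {m. l m = mmu} = {m. l m = mmu}" "{m. mmu <= l m} - {m. l m = mmu} = {m. l m > mmu}" by auto
 hence A01': "A0 : KS {m. l m = mmu}" "A1 : KS {m. l m > mmu}" using A01 by simp_all
 have "A0 ~= 0"
 proof
  assume "A0 = 0"
  hence "tor a : KS {m. l m > mmu}" using A01(1) A01'(2) a by simp
  hence "m0 : {m. l m > mmu}" using m0(1) by (auto simp: KS_def)
  thus False using m0(2) by simp
 qed
 thus ?thesis using A01(1) A01' by blast
qed

text \<open>Compare leading forms for the grading by \<open>l\<close>: if that of \<open>q\<close>
  had degree \<open>mmu < 0\<close>, then \<open>d * q ^ k\<close> would have a nonzero leading form
  of degree \<open>nu + k * mmu\<close>, which is negative for large \<open>k\<close>.\<close>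

lemma KS_halfplane_closed:
 fixes l :: "int \<times> int => int" and q d :: "'k::field rat2"
 assumes l: "!!a b. l (a + b) = l a + l b" and d: "d ~= 0" and q: "q : KS UNIV"
  and dq: "!!k. d * q ^ k : KS {m. l m >= 0}"
 shows "q : KS {m. l m >= 0}"
proof (rule ccontr)
 assume nq: "q ~: KS {m. l m >= 0}"
 hence q0: "q ~= 0" by auto
 have dU: "d : KS UNIV" using dq[of 0] KS_mono[of "{m. l m >= 0}" UNIV] by auto
 obtain mmu A0 A1 where A: "q = A0 + A1" "A0 ~= 0" "A0 : KS {m. l m = mmu}" "A1 : KS {m. l m > mmu}"
  using KS_leading[OF q q0] by blast
 obtain nu B0 B1 where B: "d = B0 + B1" "B0 ~= 0" "B0 : KS {m. l m = nu}" "B1 : KS {m. l m > nu}"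
  using KS_leading[OF dU d] by blast
 have "mmu < 0"
 proof (rule ccontr)
  assume "~ mmu < 0"
  hence "{m. l m = mmu} <= {m. l m >= 0}" "{m. l m > mmu} <= {m. l m >= 0}" by auto
  hence "q : KS {m. l m >= 0}" unfolding A(1) by (intro KS_add[OF subsetD[OF KS_mono A(3)] subsetD[OF KS_mono A(4)]])
  thus False using nq by blast
 qed
 have l0: "l 0 = 0" using l[of 0 0] by simp
 have pow: "EX R. q ^ k = A0 ^ k + R & R : KS {m. l m > int k * mmu} & A0 ^ k : KS {m. l m = int k * mmu}" for k
 proof (induction k)
  case 0
  have "1 : KS {m. l m = 0}" using KS_mon[of 0 "{m. l m = 0}"] l0 by simp
  thus ?case by (intro exI[of _ 0]) simp
 next
  case (Suc k)
  then obtain R where R: "q ^ k = A0 ^ k + R" "R : KS {m. l m > int k * mmu}" "A0 ^ k : KS {m. l m = int k * mmu}" by blast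
  have "q ^ Suc k = (A0 + A1) * (A0 ^ k + R)" using R(1) A(1) by simp
  hence "q ^ Suc k = A0 ^ Suc k + (A0 * R + A1 * A0 ^ k + A1 * R)" by (simp add: algebra_simps)
  moreover have "A0 * R : KS {m. l m > int (Suc k) * mmu}" by (rule KS_mult[OF A(3) R(2)]) (auto simp: l algebra_simps)
  moreover have "A1 * A0 ^ k : KS {m. l m > int (Suc k) * mmu}"
   by (rule KS_mult[OF A(4) R(3)]) (auto simp: l algebra_simps)
  moreover have "A1 * R : KS {m. l m > int (Suc k) * mmu}" by (rule KS_mult[OF A(4) R(2)]) (auto simp: l algebra_simps)
  moreover have "A0 ^ Suc k : KS {m. l m = int (Suc k) * mmu}"
   unfolding power_Suc by (rule KS_mult[OF A(3) R(3)]) (auto simp: l algebra_simps)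
  ultimately show ?case by (intro exI[of _ "A0 * R + A1 * A0 ^ k + A1 * R"]) (auto intro: KS_add)
 qed
 \<comment> \<open>As \<open>mmu\<close> is at most -1, this many factors push the degree below
   0.\<close>
 define k where "k = nat (\<bar>nu\<bar> + 1)"
 define s where "s = nu + int k * mmu"
 have "int k * mmu <= int k * (- 1)" using `mmu < 0` by (intro mult_left_mono) auto
 hence neg: "s < 0" unfolding s_def k_def by simp
 obtain R where R: "q ^ k = A0 ^ k + R" "R : KS {m. l m > int k * mmu}" "A0 ^ k : KS {m. l m = int k * mmu}"
  using pow by blast
 have "d * q ^ k = (B0 + B1) * (A0 ^ k + R)" using R(1) B(1) by simp
 hence eq: "B0 * A0 ^ k = d * q ^ k - (B0 * R + B1 * A0 ^ k + B1 * R)" by (simp add: algebra_simps)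
 have "B0 * R : KS {m. l m > s}" by (rule KS_mult[OF B(3) R(2)]) (auto simp: l s_def)
 moreover have "B1 * A0 ^ k : KS {m. l m > s}" by (rule KS_mult[OF B(4) R(3)]) (auto simp: l s_def)
 moreover have "B1 * R : KS {m. l m > s}" by (rule KS_mult[OF B(4) R(2)]) (auto simp: l s_def)
 moreover have "d * q ^ k : KS {m. l m > s}" by (rule subsetD[OF KS_mono dq]) (use neg in auto)
 ultimately have 1: "B0 * A0 ^ k : KS {m. l m > s}" unfolding eq by (intro KS_diff KS_add)
 have 2: "B0 * A0 ^ k : KS {m. l m = s}" by (rule KS_mult[OF B(3) R(3)]) (auto simp: l s_def)
 have "{m. l m > s} Int {m. l m = s} = {}" by auto
 hence "B0 * A0 ^ k = 0" using KS_empty[of "B0 * A0 ^ k"] KS_Int[OF 1 2] by (simp only:)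
 thus False using A(2) B(2) by simp
qed

definition det2 :: "int \<times> int => int \<times> int => int" where "det2 a b = fst a * snd b - snd a * fst b"

text \<open>For \<open>det2 u v > 0\<close> this is the cone spanned by \<open>u\<close> and
  \<open>v\<close>, described by its two supporting half planes. It is the cone of exponents, that
  is, the dual of the cone of the fan.\<close>

definition cone2 :: "int \<times> int => int \<times> int => (int \<times> int) set" where
 "cone2 u v = {m. 0 <= det2 u m & 0 <= det2 m v}"

lemma det2_add_left: "det2 (a + b) c = det2 a c + det2 b c"
 and det2_add_right: "det2 c (a + b) = det2 c a + det2 c b"
 and det2_diff_left: "det2 (a - b) c = det2 a c - det2 b c"
 and det2_diff_right: "det2 c (a - b) = det2 c a - det2 c b"
 and det2_scale_left: "det2 (scale k a) c = k * det2 a c"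
 and det2_scale_right: "det2 c (scale k a) = k * det2 c a"
 and det2_self [simp]: "det2 a a = 0"
 and det2_swap: "det2 a b = - det2 b a" by (simp_all add: det2_def scale_def algebra_simps)

lemma det2_zero [simp]: "det2 0 a = 0" "det2 a 0 = 0" by (simp_all add: det2_def)

lemma cone2_add: "a : cone2 u v ==> b : cone2 u v ==> a + b : cone2 u v"
 by (simp add: cone2_def det2_add_left det2_add_right)

lemma cone2_0 [simp]: "0 : cone2 u v" by (simp add: cone2_def)

lemma KS_cone_mult: "A : KS (cone2 u v) ==> B : KS (cone2 u v) ==> A * B : KS (cone2 u v)"
 by (rule KS_mult) (auto intro: cone2_add)

theorem KS_cone_compl_closed:
 assumes d: "d ~= 0" and dq: "!!k. d * q ^ k : KS (cone2 u v)"
 shows "q : KS (cone2 u v)"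
proof -
 have qU: "q : KS UNIV" by (rule laurent_compl_closed[OF d]) (use dq KS_mono[of "cone2 u v" UNIV] in auto)
 have 1: "q : KS {m. 0 <= det2 u m}" by (rule KS_halfplane_closed[OF _ d qU])
   (insert dq KS_mono[of "cone2 u v" "{m. 0 <= det2 u m}"], auto simp: det2_add_right cone2_def)
 have 2: "q : KS {m. 0 <= det2 m v}" by (rule KS_halfplane_closed[OF _ d qU])
   (insert dq KS_mono[of "cone2 u v" "{m. 0 <= det2 m v}"], auto simp: det2_add_left cone2_def)
 have "{m. 0 <= det2 u m} Int {m. 0 <= det2 m v} = cone2 u v" by (auto simp: cone2_def)
 thus ?thesis using KS_Int[OF 1 2] by simp
qed

lemma shift_into_cone:
 assumes uv: "det2 u v > 0" and M: "finite M"
 shows "EX m0. m0 : cone2 u v & (ALL m:M. m + m0 : cone2 u v)"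
proof -
 obtain N1 where N1: "ALL m:M. 0 <= det2 u m + int N1" using bound_below[OF M, of "det2 u"] by blast
 obtain N2 where N2: "ALL m:M. 0 <= det2 m v + int N2" using bound_below[OF M, of "%m. det2 m v"] by blast
 let ?m0 = "scale (int (N1 + N2)) (u + v)"
 have "int (N1 + N2) <= int (N1 + N2) * det2 u v" using uv by (simp add: mult_le_cancel_left1)
 hence a: "det2 u ?m0 >= int (N1 + N2)" "det2 ?m0 v >= int (N1 + N2)"
  by (simp_all add: det2_scale_right det2_scale_left det2_add_left det2_add_right)
 thus ?thesis using N1 N2 by (intro exI[of _ ?m0]) (fastforce simp: cone2_def det2_add_left det2_add_right)
qed

lemma cone_fraction:
 assumes uv: "det2 u v > 0"
 obtains P Q where "q = P / Q" "Q ~= 0" "P : KS (cone2 u v)" "Q : KS (cone2 u v)"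
proof -
 obtain a b where ab: "q = emb a / emb b" "b ~= 0" by (rule fract_as_quotient)
 obtain A B where AB: "emb a = tor A" "emb b = tor B" using emb_in_KS[of a] emb_in_KS[of b] by (auto simp: KS_def)
 obtain m0 where m0: "ALL m:keys A Un keys B. m + m0 : cone2 u v"
  using shift_into_cone[OF uv, of "keys A Un keys B"] by auto
 have "tor A * mon m0 : KS (cone2 u v)" by (rule KS_mult[OF KS_I[OF order_refl] KS_mon[of m0 "{m0}"]]) (use m0 in auto)
 moreover have "tor B * mon m0 : KS (cone2 u v)"
  by (rule KS_mult[OF KS_I[OF order_refl] KS_mon[of m0 "{m0}"]]) (use m0 in auto)
 moreover have "q = (tor A * mon m0) / (tor B * mon m0)" using ab AB by simp
 moreover have "tor B * mon m0 ~= 0" using ab AB by (metis emb_eq_0_iff mon_nonzero mult_eq_0_iff)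
 ultimately show ?thesis using that by blast
qed

lemma cone_common_denominator:
 assumes uv: "det2 u v > 0" and "finite B"
 shows "EX d. d ~= 0 & d : KS (cone2 u v) & (ALL b:B. d * b : KS (cone2 u v))" using assms(2)
proof induction
 case empty
 show ?case by (intro exI[of _ 1]) (use KS_const[of "cone2 u v" 1] in simp)
next
 case (insert b B)
 then obtain d where d: "d ~= 0" "d : KS (cone2 u v)" "ALL b:B. d * b : KS (cone2 u v)" by blast
 obtain P Q where PQ: "b = P / Q" "Q ~= 0" "P : KS (cone2 u v)" "Q : KS (cone2 u v)" by (rule cone_fraction[OF uv])
 have "d * Q * b = d * P" using PQ(1,2) by simp
 hence b: "d * Q * b : KS (cone2 u v)" using KS_cone_mult[OF d(2) PQ(3)] by (simp only:)
 have "d * Q * c : KS (cone2 u v)" if "c : B" for c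
  using KS_cone_mult[OF PQ(4) d(3)[rule_format, OF that]] by (simp add: mult_ac)
 with b have "ALL c:insert b B. d * Q * c : KS (cone2 u v)" by blast
 thus ?case using d PQ(2,4) by (intro exI[of _ "d * Q"]) (auto intro: KS_cone_mult)
qed

subsection \<open>Hirzebruch--Jung sequences\<close>

lemma scale_simps: "fst (scale k m) = k * fst m" "snd (scale k m) = k * snd m" by (simp_all add: scale_def)

lemma cramer: "scale (det2 a b) m = scale (det2 m b) a + scale (det2 a m) b"
 by (simp add: prod_eq_iff det2_def scale_simps algebra_simps)

definition primitive :: "int \<times> int => bool" where "primitive u <-> (EX x. det2 u x = 1)"

lemma primitive_parallel:
 assumes "primitive w" "det2 w m = 0"
 obtains a where "m = scale a w"
proof -
 obtain x where "det2 w x = 1" using assms(1) by (auto simp: primitive_def)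
 hence "m = scale (det2 m x) w" using cramer[of w x m] assms(2) by (simp add: prod_eq_iff scale_simps)
 thus ?thesis by (rule that)
qed

lemma primitiveI: "det2 x u = 1 ==> primitive u"
 unfolding primitive_def by (rule exI[of _ "- x"]) (simp add: det2_def algebra_simps)

text \<open>The Hilbert basis of \<open>cone2 u v\<close> in its natural order, with
  \<open>r\<close> interior elements. The numbers \<open>a\<close> are the coefficients of the
  Hirzebruch-Jung continued fraction.\<close>

definition hj :: "int \<times> int => int \<times> int => nat => (nat => int \<times> int) => bool" where
 "hj u v r gga <-> gga 0 = u & gga (Suc r) = v & (ALL i<=r. det2 (gga i) (gga (Suc i)) = 1) &
  (ALL i<r. EX a>=2. gga i + gga (Suc (Suc i)) = scale a (gga (Suc i)))"

text \<open>Euclid's algorithm: the neighbour \<open>w\<close> of \<open>u\<close> is determined up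
  to multiples of \<open>u\<close> by \<open>det2 u w = 1\<close>, and is normalized by reducing
  \<open>det2 w v\<close> modulo \<open>det2 u v\<close>; then the cone of \<open>w\<close> and
  \<open>v\<close> is smaller.\<close>

lemma hj_exists:
 assumes "primitive u" "primitive v" "det2 u v > 0"
 shows "EX r gga. hj u v r gga & (ALL i<=Suc r. 0 <= det2 (gga i) v)" using assms
proof (induction "nat (det2 u v)" arbitrary: u rule: less_induct)
 case less
 show ?case
 proof (cases "det2 u v = 1")
  case True
  define gga where "gga = (%i::nat. if i = 0 then u else v)"
  have "hj u v 0 gga & (ALL i<=Suc 0. 0 <= det2 (gga i) v)" using True by (auto simp: hj_def gga_def)
  thus ?thesis by blast
 next
  case False
  define q where "q = det2 u v"
  have q: "q >= 2" using False less.prems(3) q_def by simp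
  obtain w0 where w0: "det2 u w0 = 1" using less.prems(1) by (auto simp: primitive_def)
  define w where "w = w0 - scale (det2 w0 v div q) u"
  define d where "d = det2 w v"
  have uw: "det2 u w = 1" by (simp add: w_def det2_diff_right det2_scale_right w0)
  have dm: "d = det2 w0 v mod q"
   by (simp add: d_def w_def det2_diff_left det2_scale_left q_def[symmetric] minus_div_mult_eq_mod)
  hence d: "0 <= d" "d < q" using q by simp_all
  \<comment> \<open>Otherwise \<open>v\<close> would be \<open>q\<close> times \<open>w\<close>,
    contrary to its primitivity.\<close>
  have "d ~= 0"
  proof
   assume "d = 0"
   hence v: "v = scale q w" using cramer[of u w v] uw
    by (simp add: d_def q_def prod_eq_iff scale_simps det2_swap[of v w])
   obtain x where "det2 v x = 1" using less.prems(2) by (auto simp: primitive_def)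
   hence "q * det2 w x = 1" by (simp add: v det2_scale_left)
   thus False using q by (auto simp: zmult_eq_1_iff)
  qed
  hence d0: "0 < d" using d by simp
  have wp: "primitive w" by (rule primitiveI[OF uw])
  have "nat (det2 w v) < nat (det2 u v)" using d d0 by (simp add: d_def q_def)
  then obtain r gga where h: "hj w v r gga" "ALL i<=Suc r. 0 <= det2 (gga i) v"
   using less.hyps[OF _ wp less.prems(2)] d0 unfolding d_def by blast
  define gga' where "gga' = (%i. case i of 0 => u | Suc l => gga l)"
  have "det2 w (gga 1) = 1" using h(1) by (auto simp: hj_def)
  hence "det2 w (u + gga 1) = 0" using uw by (simp add: det2_add_right det2_swap[of w u])
  from primitive_parallel[OF wp this] obtain a where a: "u + gga 1 = scale a w" .
  \<comment> \<open>Determinants with \<open>v\<close> show \<open>a * d > d\<close>, hence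
    \<open>a >= 2\<close>.\<close>
  have "a * d = q + det2 (gga 1) v"
   using arg_cong[OF a, of "%m. det2 m v"] by (simp add: det2_add_left det2_scale_left d_def q_def)
  moreover have "0 <= det2 (gga 1) v" using h(2) by simp
  ultimately have "1 * d < a * d" using d by simp
  hence "a >= 2" using d0 by (simp only: mult_less_cancel_right) linarith
  moreover have "det2 (gga' i) (gga' (Suc i)) = 1" if "i <= Suc r" for i
   using that h(1) uw by (cases i) (auto simp: hj_def gga'_def)
  moreover have "EX a>=2. gga' i + gga' (Suc (Suc i)) = scale a (gga' (Suc i))" if "i < Suc r" for i
   using that h(1) a `a >= 2` by (cases i) (auto simp: hj_def gga'_def)
  moreover have "0 <= det2 (gga' i) v" if "i <= Suc (Suc r)" for i
   using that h(2) q by (cases i) (auto simp: gga'_def q_def)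
  moreover have "gga' 0 = u" "gga' (Suc (Suc r)) = v" using h(1) by (auto simp: hj_def gga'_def)
  ultimately have "hj u v (Suc r) gga' & (ALL i<=Suc (Suc r). 0 <= det2 (gga' i) v)" by (simp add: hj_def)
  thus ?thesis by blast
 qed
qed

text \<open>A coefficient of at least 2 makes the sequence convex, so its initial increase
  persists.\<close>

lemma recurrence_increasing:
 fixes x :: "nat => int"
 assumes "x 0 = 0" "x 1 = 1" and rec: "!!l. Suc l < N ==> EX a>=2. x l + x (Suc (Suc l)) = a * x (Suc l)"
 shows "l < N ==> 0 <= x l & x l < x (Suc l)"
proof (induction l)
 case 0
 thus ?case using assms by simp
next
 case (Suc l)
 then obtain a where a: "a >= 2" "x l + x (Suc (Suc l)) = a * x (Suc l)" using rec by blast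
 have "2 * x (Suc l) <= a * x (Suc l)" using Suc a by (intro mult_right_mono) auto
 thus ?case using Suc a by linarith
qed

context
 fixes u v r gga
 assumes hj: "hj u v r gga"
begin

lemma hj_adj: "i <= r ==> det2 (gga i) (gga (Suc i)) = 1" using hj by (simp add: hj_def)

lemma hj_rec: "i < r ==> EX a>=2. gga i + gga (Suc (Suc i)) = scale a (gga (Suc i))" using hj by (simp add: hj_def)

lemma hj_det_right:
 assumes "i + l <= r"
 shows "0 <= det2 (gga i) (gga (i + l)) & det2 (gga i) (gga (i + l)) < det2 (gga i) (gga (i + Suc l))"
proof (rule recurrence_increasing[of "%l. det2 (gga i) (gga (i + l))" "Suc r - i"])
 show "det2 (gga i) (gga (i + 1)) = 1" using hj_adj[of i] assms by simp
 show "EX a>=2. det2 (gga i) (gga (i + l)) + det2 (gga i) (gga (i + Suc (Suc l))) = a * det2 (gga i) (gga (i + Suc l))"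
  if "Suc l < Suc r - i" for l
  using hj_rec[of "i + l"] that by (fastforce simp: det2_add_right[symmetric] det2_scale_right)
qed (use assms in auto)

lemma hj_det_left:
 assumes "l <= r" "j <= Suc r" "Suc l <= j"
 shows "0 <= det2 (gga (j - l)) (gga j) & det2 (gga (j - l)) (gga j) < det2 (gga (j - Suc l)) (gga j)"
proof (rule recurrence_increasing[of "%l. det2 (gga (j - l)) (gga j)" j])
 show "det2 (gga (j - 1)) (gga j) = 1" using hj_adj[of "j - 1"] assms by (cases j) auto
 show "EX a>=2. det2 (gga (j - l)) (gga j) + det2 (gga (j - Suc (Suc l))) (gga j) = a * det2 (gga (j - Suc l)) (gga j)"
  if "Suc l < j" for l
 proof -
  define m where "m = j - Suc (Suc l)"
  have m: "j - Suc l = Suc m" "j - l = Suc (Suc m)" "j - Suc (Suc l) = m" "m < r" using that assms by (auto simp: m_def)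
  obtain a where a: "a >= 2" "gga m + gga (Suc (Suc m)) = scale a (gga (Suc m))" using hj_rec[OF m(4)] by blast
  show ?thesis unfolding m using a(1) arg_cong[OF a(2), of "%m. det2 m (gga j)"]
   by (intro exI[of _ a]) (simp add: det2_add_left det2_scale_left add.commute)
 qed
qed (use assms in auto)

lemma hj_det_pos:
 assumes "i < j" "j <= Suc r"
 shows "0 < det2 (gga i) (gga j)"
proof -
 have "i + (j - Suc i) <= r" "i + Suc (j - Suc i) = j" using assms by auto
 thus ?thesis using hj_det_right[of i "j - Suc i"] by auto
qed

lemma hj_det_mono_right: "i < j ==> j <= k ==> k <= Suc r ==> det2 (gga i) (gga j) <= det2 (gga i) (gga k)"
proof (induction "k - j" arbitrary: k)
 case (Suc l)
 obtain k' where k': "k = Suc k'" using Suc.hyps(2) by (cases k) auto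
 have "det2 (gga i) (gga j) <= det2 (gga i) (gga k')" using Suc k' by simp
 moreover have "i + (k' - i) = k'" "i + Suc (k' - i) = k" using Suc.prems Suc.hyps(2) k' by auto
 ultimately show ?case using hj_det_right[of i "k' - i"] Suc.prems k' by auto
qed simp

lemma hj_det_mono_left: "i <= j ==> j < k ==> k <= Suc r ==> det2 (gga j) (gga k) <= det2 (gga i) (gga k)"
proof (induction "j - i" arbitrary: i)
 case (Suc l)
 have "det2 (gga j) (gga k) <= det2 (gga (Suc i)) (gga k)" using Suc by simp
 moreover have "k - (k - Suc i) = Suc i" "k - Suc (k - Suc i) = i" using Suc.prems Suc.hyps(2) by auto
 moreover have "Suc (k - Suc i) <= k" "k - Suc i <= r" using Suc.prems Suc.hyps(2) by auto
 ultimately show ?case using hj_det_left[of "k - Suc i" k] Suc.prems(3) by auto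
qed simp

lemma hj_in_cone:
 assumes "i <= Suc r"
 shows "gga i : cone2 u v"
proof -
 have "0 <= det2 (gga 0) (gga i)" using hj_det_pos[of 0 i] assms by (cases "i = 0") auto
 moreover have "0 <= det2 (gga i) (gga (Suc r))" using hj_det_pos[of i "Suc r"] assms by (cases "i = Suc r") auto
 ultimately show ?thesis using hj by (simp add: cone2_def hj_def)
qed

text \<open>The sequence subdivides the cone into regular cones; \<open>i\<close> is the last index
  for which \<open>m\<close> is on the counterclockwise side of \<open>gga i\<close>.\<close>

lemma hj_generates:
 assumes m: "m : cone2 u v"
 obtains i k l where "i <= r" "0 <= k" "0 <= l" "m = scale k (gga i) + scale l (gga (Suc i))"
proof -
 define i where "i = Max {i. i <= r & 0 <= det2 (gga i) m}"
 let ?A = "{i. i <= r & 0 <= det2 (gga i) m}"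
 have ne: "0 : ?A" using m hj by (simp add: cone2_def hj_def)
 have f: "finite ?A" by simp
 have i: "i : ?A" unfolding i_def using Max_in[OF f] ne by blast
 have le: "l <= i" if "l : ?A" for l using Max_ge[OF f that] by (simp add: i_def)
 have "0 <= det2 m (gga (Suc i))"
 proof (cases "i = r")
  case True
  thus ?thesis using m hj by (simp add: cone2_def hj_def)
 next
  case False
  have "Suc i ~: ?A" using le[of "Suc i"] by auto
  thus ?thesis using False i det2_swap[of m "gga (Suc i)"] by auto
 qed
 thus ?thesis using that[of i "det2 m (gga (Suc i))" "det2 (gga i) m"] i cramer[of "gga i" "gga (Suc i)" m] hj_adj[of i]
  by (simp add: prod_eq_iff scale_simps)
qed

end

subsection \<open>Saturated semigroups\<close>

text \<open>Below, \<open>a - b : R\<close> serves as an order \<open>a >= b\<close>: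
  \<open>R\<close> will consist of the exponents whose monomials are regular at a point, and then
  the quotient of \<open>mon a\<close> by \<open>mon b\<close> is regular.\<close>

definition sat :: "(int \<times> int) set => bool" where
 "sat R <-> 0 : R & (ALL a:R. ALL b:R. a + b : R) & (ALL k m. 0 < k --> scale k m : R --> m : R)"

context
 fixes R
 assumes R: "sat R"
begin

lemma sat_0: "0 : R" and sat_add: "a : R ==> b : R ==> a + b : R"
 and sat_div: "0 < k ==> scale k m : R ==> m : R" using R unfolding sat_def by blast+

lemma sat_scale: "0 <= k ==> m : R ==> scale k m : R"
proof (induction "nat k" arbitrary: k)
 case 0
 hence "k = 0" by simp
 thus ?case using sat_0 by (simp add: scale_def zero_prod_def)
next
 case (Suc n)
 hence "scale (k - 1) m : R" by simp
 moreover have "scale k m = scale (k - 1) m + m" by (simp add: prod_eq_iff scale_simps algebra_simps)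
 ultimately show ?case using sat_add Suc.prems by simp
qed

lemma sat_cone:
 assumes "u : R" "v : R" "0 < det2 u v"
 shows "cone2 u v <= R"
proof
 fix m assume "m : cone2 u v"
 hence "scale (det2 m v) u + scale (det2 u m) v : R" using assms by (intro sat_add sat_scale) (auto simp: cone2_def)
 thus "m : R" using sat_div[OF assms(3)] cramer[of u v m] by simp
qed

text \<open>Saturation enters in the first step: twice \<open>g 2 - g 1\<close> equals
  \<open>g 2 - g 0\<close> plus \<open>a - 2\<close> times \<open>g 1\<close>. From there on the
  increments only gain multiples \<open>a - 2\<close> of elements of \<open>R\<close>.\<close>

lemma sat_convex:
 assumes rec: "!!l. l + 2 <= N ==> EX a>=2. g l + g (Suc (Suc l)) = scale a (g (Suc l))"
  and 0: "g 0 : R" "g 1 : R" and 2: "2 <= N ==> g 2 - g 0 : R"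
 shows "l + 2 <= N ==> g (Suc l) : R & g (l + 2) : R & g (l + 2) - g 0 : R & g (l + 2) - g 1 : R & g (l + 2) - g (Suc l) : R"
proof (induction l)
 case 0
 obtain a where a: "a >= 2" "g 0 + g 2 = scale a (g 1)" using rec[of 0] 0 by (auto simp: numeral_2_eq_2)
 have g2: "g 2 = scale a (g 1) - g 0" by (metis a(2) add_diff_cancel_left')
 have "scale 2 (g 2 - g 1) = (g 2 - g 0) + scale (a - 2) (g 1)" by (simp add: g2 prod_eq_iff scale_simps algebra_simps)
 moreover have "(g 2 - g 0) + scale (a - 2) (g 1) : R" using assms 0 a by (intro sat_add sat_scale) auto
 ultimately have d: "g 2 - g 1 : R" using sat_div[of 2] by simp
 hence "g 2 : R" using sat_add[OF d assms(3)] by simp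
 thus ?case using d assms 0 by (simp add: numeral_2_eq_2)
next
 case (Suc l)
 obtain a where a: "a >= 2" "g (Suc l) + g (Suc (Suc (Suc l))) = scale a (g (Suc (Suc l)))" using rec[of "Suc l"] Suc.prems by auto
 have g3: "g (Suc (Suc (Suc l))) = scale a (g (Suc (Suc l))) - g (Suc l)" by (metis a(2) add_diff_cancel_left')
 have IH: "g (Suc l) : R" "g (Suc (Suc l)) : R" "g (Suc (Suc l)) - g 0 : R" "g (Suc (Suc l)) - g 1 : R" "g (Suc (Suc l)) - g (Suc l) : R"
  using Suc by simp_all
 have "g (Suc (Suc (Suc l))) - g (Suc (Suc l)) = scale (a - 2) (g (Suc (Suc l))) + (g (Suc (Suc l)) - g (Suc l))"
  by (simp add: g3 prod_eq_iff scale_simps algebra_simps)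
 moreover have "scale (a - 2) (g (Suc (Suc l))) + (g (Suc (Suc l)) - g (Suc l)) : R"
  using IH a by (intro sat_add sat_scale) auto
 ultimately have d: "g (Suc (Suc (Suc l))) - g (Suc (Suc l)) : R" by simp
 from sat_add[OF d IH(2)] sat_add[OF d IH(3)] sat_add[OF d IH(4)] show ?case using d IH by simp
qed

text \<open>\<open>sat_convex\<close> is applied in both directions, starting from the adjacent pair
  \<open>k\<close>, \<open>Suc k\<close>. Thus conditions on the two outer neighbours imply that
  this pair has the least sum.\<close>

lemma sat_hj_pairs:
 assumes hj: "hj u v r gga" and k: "k <= r" "gga k : R" "gga (Suc k) : R"
  and left: "!!i. k = Suc i ==> gga i - gga (Suc k) : R" and right: "k < r ==> gga (Suc (Suc k)) - gga k : R"
 shows "i <= Suc r ==> gga i : R"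
  and "i <= Suc r ==> j <= Suc r ==> i ~= j ==> gga i + gga j - (gga k + gga (Suc k)) : R"
proof -
 have up: "gga i : R & gga i - gga k : R & gga i - gga (Suc k) : R" if "k + 2 <= i" "i <= Suc r" for i
 proof -
  have le: "i - (k + 2) + 2 <= Suc r - k" using that by simp
  have *: "EX a>=2. gga (k + l) + gga (k + Suc (Suc l)) = scale a (gga (k + Suc l))" if "l + 2 <= Suc r - k" for l
   using hj_rec[OF hj, of "k + l"] that by simp
  have "gga (k + 2) - gga (k + 0) : R" if "2 <= Suc r - k" using right that by simp
  from sat_convex[of "Suc r - k" "%l. gga (k + l)", OF * _ _ this le]
  have "gga (k + (i - (k + 2) + 2)) : R & gga (k + (i - (k + 2) + 2)) - gga (k + 0) : R &
   gga (k + (i - (k + 2) + 2)) - gga (k + 1) : R" using k by simp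
  moreover have "k + (i - (k + 2) + 2) = i" using that by simp
  ultimately show ?thesis by (simp only: add_0_right One_nat_def add_Suc_right)
 qed
 have down: "gga i : R & gga i - gga k : R & gga i - gga (Suc k) : R" if "i < k" for i
 proof -
  have le: "k - Suc i + 2 <= Suc k" using that by simp
  have *: "EX a>=2. gga (Suc k - l) + gga (Suc k - Suc (Suc l)) = scale a (gga (Suc k - Suc l))" if "l + 2 <= Suc k" for l
  proof -
   define m where "m = Suc k - Suc (Suc l)"
   have m: "Suc k - Suc l = Suc m" "Suc k - l = Suc (Suc m)" "Suc k - Suc (Suc l) = m" "m < r" using that k by (auto simp: m_def)
   show ?thesis unfolding m using hj_rec[OF hj m(4)] by (simp add: add.commute)
  qed
  have "gga (Suc k - 2) - gga (Suc k - 0) : R" if "2 <= Suc k" using left[of "k - 1"] that by (simp add: numeral_2_eq_2)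
  from sat_convex[of "Suc k" "%l. gga (Suc k - l)", OF * _ _ this le]
  have "gga (Suc k - (k - Suc i + 2)) : R & gga (Suc k - (k - Suc i + 2)) - gga (Suc k - 0) : R &
   gga (Suc k - (k - Suc i + 2)) - gga (Suc k - 1) : R" using k by simp
  moreover have "Suc k - (k - Suc i + 2) = i" using that by simp
  ultimately show ?thesis by simp
 qed
 have cases: "i < k | i = k | i = Suc k | k + 2 <= i" for i by linarith
 show "gga i : R" if "i <= Suc r" using cases[of i] up[of i] down[of i] k that by auto
 have A: "gga i - gga k : R" if "i ~= Suc k" "i <= Suc r" for i using cases[of i] up[of i] down[of i] that sat_0 by auto
 have B: "gga i - gga (Suc k) : R" if "i ~= k" "i <= Suc r" for i
  using cases[of i] up[of i] down[of i] that sat_0 by auto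
 show "gga i + gga j - (gga k + gga (Suc k)) : R" if ij: "i <= Suc r" "j <= Suc r" "i ~= j"
 proof (cases "i ~= Suc k & j ~= k")
  case True
  thus ?thesis using sat_add[OF A[of i] B[of j]] ij by (simp add: algebra_simps)
 next
  case False
  hence "i ~= k & j ~= Suc k" using ij by auto
  thus ?thesis using sat_add[OF B[of i] A[of j]] ij by (simp add: algebra_simps)
 qed
qed

text \<open>Here the characteristic is dealt with. The pair \<open>i\<close>, \<open>j\<close> is
  known to be least only in comparison with neighbouring pairs, whose determinant is 1; the pair
  \<open>i\<close>, \<open>Suc i\<close> turns out to be equally good. Comparison with the pairs at
  \<open>i\<close> and at \<open>j - 1\<close> gives \<open>gga (Suc i) >= gga j\<close> and
  \<open>gga (j - 1) >= gga i\<close> in the order of \<open>R\<close>; Cramer's rule turns these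
  into two inequalities between multiples of \<open>gga i\<close> and \<open>gga j\<close>.\<close>

lemma sat_adjacent_minimum:
 assumes hj: "hj u v r gga" and S: "cone2 u v <= R" and ij: "i < j" "j <= Suc r"
  and min: "!!k. k <= r ==> gga k + gga (Suc k) - (gga i + gga j) : R" and k: "k <= r"
 shows "gga k + gga (Suc k) - (gga i + gga (Suc i)) : R"
proof -
 have g: "gga l : R" if "l <= Suc r" for l using hj_in_cone[OF hj that] S by blast
 have "gga j - gga (Suc i) : R"
 proof (cases "j = Suc i")
  case True
  thus ?thesis using sat_0 by simp
 next
  case False
  hence lt: "Suc i < j" using ij by simp
  define Q where "Q = det2 (gga i) (gga j) - 1"
  define d where "d = det2 (gga (Suc i)) (gga j)"
  define d' where "d' = det2 (gga i) (gga (j - 1))"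
  have d: "0 < d" "d <= Q"
   using hj_det_pos[OF hj, of "Suc i" j] hj_det_left[OF hj, of "j - Suc i" j] lt ij by (auto simp: d_def Q_def Suc_diff_Suc)
  have d': "0 < d'" "d' <= Q" using hj_det_pos[OF hj, of i "j - 1"] hj_det_right[OF hj, of i "j - Suc i"] lt ij
   by (auto simp: d'_def Q_def Suc_diff_Suc)
  have a1: "det2 (gga i) (gga (Suc i)) = 1" using hj_adj[OF hj, of i] ij by simp
  have a2: "det2 (gga (j - 1)) (gga j) = 1" using hj_adj[OF hj, of "j - 1"] ij by simp
  have c1: "scale (Q + 1) (gga (Suc i)) = scale d (gga i) + gga j"
   using cramer[of "gga i" "gga j" "gga (Suc i)"] a1 by (simp add: Q_def d_def prod_eq_iff scale_simps)
  have c2: "scale (Q + 1) (gga (j - 1)) = gga i + scale d' (gga j)"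
   using cramer[of "gga i" "gga j" "gga (j - 1)"] a2 by (simp add: Q_def d'_def prod_eq_iff scale_simps)
  have m1: "gga (Suc i) - gga j : R" using min[of i] ij by (simp add: algebra_simps)
  have m2: "gga (j - 1) - gga i : R" using min[of "j - 1"] ij by (simp add: algebra_simps)
  have "scale (Q + 1) (gga (Suc i) - gga j) : R" by (rule sat_scale[OF _ m1]) (use d in simp)
  moreover have "scale (Q + 1) (gga (Suc i) - gga j) = scale d (gga i) - scale Q (gga j)"
   using c1 by (simp add: prod_eq_iff scale_simps algebra_simps)
  ultimately have A: "scale d (gga i) - scale Q (gga j) : R" by simp
  have "scale (Q + 1) (gga (j - 1) - gga i) : R" by (rule sat_scale[OF _ m2]) (use d in simp)
  moreover have "scale (Q + 1) (gga (j - 1) - gga i) = scale d' (gga j) - scale Q (gga i)"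
   using c2 by (simp add: prod_eq_iff scale_simps algebra_simps)
  ultimately have B: "scale d' (gga j) - scale Q (gga i) : R" by simp
  have target: "scale (Q + 1) (gga j - gga (Suc i)) = scale Q (gga j) - scale d (gga i)"
   using c1 by (simp add: prod_eq_iff scale_simps algebra_simps)
  \<comment> \<open>If \<open>d = d' = Q\<close>, the second inequality is the claim. Otherwise the
    two inequalities combine to \<open>- gga i : R\<close>, and the claim follows since also
    \<open>gga j : R\<close>.\<close>
  have "scale Q (gga j) - scale d (gga i) : R"
  proof (cases "d = Q & d' = Q")
   case True
   thus ?thesis using B by simp
  next
   case False
   have "d * d' < Q * Q"
   proof (cases "d = Q")
    case True
    thus ?thesis using False d d' by simp
   next
    case False
    hence "d * d' < Q * d'" using d d' by simp
    also have "... <= Q * Q" using d d' by simp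
    finally show ?thesis .
   qed
   hence pos: "0 < Q * Q - d * d'" by simp
   have "scale d' (scale d (gga i) - scale Q (gga j)) + scale Q (scale d' (gga j) - scale Q (gga i)) : R"
    using A B d d' by (intro sat_add sat_scale) auto
   moreover have "scale d' (scale d (gga i) - scale Q (gga j)) + scale Q (scale d' (gga j) - scale Q (gga i))
     = scale (Q * Q - d * d') (- gga i)" by (simp add: prod_eq_iff scale_simps algebra_simps)
   ultimately have "- gga i : R" using sat_div[OF pos] by simp
   hence "scale Q (gga j) + scale d (- gga i) : R" using d g[of j] ij by (intro sat_add sat_scale) auto
   thus ?thesis by (simp add: prod_eq_iff scale_simps algebra_simps scale_def)
  qed
  thus ?thesis unfolding target[symmetric] using sat_div[of "Q + 1"] d by simp
 qed
 from sat_add[OF min[OF k] this] show ?thesis by (simp add: algebra_simps)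
qed

end

subsection \<open>The cone after a normalized Nash blowup\<close>

text \<open>With \<open>a e - f\<close> the neighbour of \<open>e\<close> opposite to
  \<open>f\<close>, the vector \<open>a e - 2 f\<close> is the difference of the two neighbours. As
  \<open>e\<close> and \<open>f\<close> form a lattice basis, it is twice a primitive vector for
  even \<open>a\<close> and primitive for odd \<open>a\<close>.\<close>

lemma half_vector:
 assumes ef: "\<bar>det2 e f\<bar> = 1"
 obtains ep w where "scale ep w = scale a e - scale 2 f" "primitive w" "ep = 2 | ep = 1 & odd a"
proof -
 have p: "primitive x" if "\<bar>det2 x y\<bar> = 1" for x y
 proof -
  have "det2 x (scale (det2 x y) y) = 1" using that by (auto simp: det2_scale_right abs_if split: if_splits)
  thus ?thesis unfolding primitive_def by (rule exI)
 qed
 show ?thesis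
 proof (cases "even a")
  case True
  then obtain t where t: "a = 2 * t" by blast
  show ?thesis by (rule that[of 2 "scale t e - f", OF _ p[of _ e]])
    (insert ef, simp_all add: t prod_eq_iff scale_simps algebra_simps det2_diff_left det2_scale_left det2_swap[of f e])
 next
  case False
  then obtain t where t: "a = 2 * t + 1" by (rule oddE)
  show ?thesis by (rule that[of 1 "scale a e - scale 2 f", OF _ p[of _ "f - scale t e"]])
    (insert ef, simp_all add: t prod_eq_iff scale_simps algebra_simps det2_diff_left det2_diff_right
     det2_scale_left det2_scale_right det2_swap[of f e])
 qed
qed

text \<open>The increment marks the cones whose Hilbert basis has at most one interior element, for
  then \<open>u + v\<close> is a multiple of it by the determinant. For these the determinant may
  fail to drop, and a nonregular cone then loses the increment.\<close>

definition cmeas :: "int \<times> int => int \<times> int => int" where "cmeas u v = 2 * det2 u v +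
  (if det2 u v dvd fst (u + v) & det2 u v dvd snd (u + v) then 1 else 0)"

lemma cmeas_bounds: "2 * det2 u v <= cmeas u v" "cmeas u v <= 2 * det2 u v + 1" by (simp_all add: cmeas_def)

lemma cmeas_divisible: "u + v = scale (det2 u v) w ==> cmeas u v = 2 * det2 u v + 1"
 by (simp add: cmeas_def scale_simps)

lemma cmeas_not_divisible:
 assumes "\<bar>det2 (u + v) w\<bar> = 1" "1 < det2 u v"
 shows "cmeas u v = 2 * det2 u v"
proof -
 have "~ (det2 u v dvd fst (u + v) & det2 u v dvd snd (u + v))"
 proof
  assume "det2 u v dvd fst (u + v) & det2 u v dvd snd (u + v)"
  hence "det2 u v dvd det2 (u + v) w" unfolding det2_def[of "u + v"] by (intro dvd_diff dvd_mult2) auto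
  hence "det2 u v dvd \<bar>det2 (u + v) w\<bar>" by simp
  thus False using assms by simp
 qed
 thus ?thesis by (simp add: cmeas_def)
qed

text \<open>The case of one interior vector \<open>f\<close>. For even \<open>b\<close> the
  determinant is halved; for odd \<open>b\<close> it stays \<open>b\<close>, but the sum of the new
  generators is \<open>b f - x\<close>, which is not divisible by \<open>b\<close>.\<close>

lemma half_vector_measure:
 assumes x: "\<bar>det2 x f\<bar> = 1" and PQ: "P + Q = scale b f" "det2 P Q = b" and b: "2 <= b"
  and P': "P' + Q' = x + w" "ep * det2 P' Q' = b" and w: "scale ep w = scale b f - scale 2 x" "ep = 2 | ep = 1 & odd b"
 shows "cmeas P' Q' < cmeas P Q"
proof -
 have mu: "cmeas P Q = 2 * b + 1" using cmeas_divisible[of P Q f] PQ by simp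
 from w(2) show ?thesis
 proof
  assume "ep = 2"
  hence "2 * det2 P' Q' = b" using P'(2) by simp
  thus ?thesis using mu cmeas_bounds[of P' Q'] b by linarith
 next
  assume o: "ep = 1 & odd b"
  hence "w = scale b f - scale 2 x" using w(1) by (simp add: scale_def)
  hence "\<bar>det2 (P' + Q') f\<bar> = 1" using x by (simp add: P'(1) det2_diff_left det2_scale_left det2_add_left)
  from cmeas_not_divisible[OF this] show ?thesis using P'(2) o mu b by simp
 qed
qed

text \<open>In general the new cone is spanned by the primitive vectors \<open>w\<close> and
  \<open>z\<close> along the differences \<open>gga (i - 1) - f\<close> and
  \<open>gga (i + 2) - e\<close>; where a neighbour is missing, the old edge \<open>u\<close> or
  \<open>v\<close> is kept. The clause over \<open>R'\<close> records that the old generators and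
  the differences of pair sums can be recovered from the new cone and its units; \<open>R'\<close>
  will be the exponents in the localized semigroup ring.\<close>

theorem nash_cone:
 assumes hj: "hj u v r gga" and prim: "primitive u" "primitive v"
  and R: "sat R" and S: "cone2 u v <= R" and ij: "i < j" "j <= Suc r"
  and min: "!!k. k <= r ==> gga k + gga (Suc k) - (gga i + gga j) : R"
 shows "EX k u' v'. k <= r & primitive u' & primitive v' & 0 < det2 u' v' & cone2 u' v' <= R &
  (det2 u' v' = 1 | cmeas u' v' < cmeas u v) &
  (ALL R'. sat R' --> cone2 u' v' <= R' --> (ALL m:cone2 u' v'. - m : R --> - m : R') --> (ALL i<=Suc r. gga i : R') &
   (ALL i<=Suc r. ALL j<=Suc r. i ~= j --> gga i + gga j - (gga k + gga (Suc k)) : R'))"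
proof -
 define e f where "e = gga i" and "f = gga (Suc i)"
 \<comment> \<open>What has to be checked for \<open>R'\<close>: by \<open>sat_hj_pairs\<close> the
   two vectors and the differences with the outer neighbours suffice.\<close>
 let ?N = "%R'. e : R' & f : R' & (ALL l. i = Suc l --> gga l - f : R') & (i < r --> gga (Suc (Suc i)) - e : R')"
 have ir: "i <= r" using ij by simp
 have ef: "det2 e f = 1" using hj_adj[OF hj ir] by (simp add: e_def f_def)
 hence fe: "det2 f e = - 1" using det2_swap[of f e] by simp
 have eR: "e : R" and fR: "f : R" using hj_in_cone[OF hj] S ir by (auto simp: e_def f_def)
 have adj: "gga k + gga (Suc k) - (e + f) : R" if "k <= r" for k
  using sat_adjacent_minimum[OF R hj S ij min that] by (simp add: e_def f_def)
 have fin: ?thesis if p: "primitive u'" "primitive v'" "0 < det2 u' v'" "u' : R" "v' : R"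
   and m: "det2 u' v' = 1 | cmeas u' v' < cmeas u v"
   and R': "!!R'. sat R' ==> cone2 u' v' <= R' ==> (!!m. m : cone2 u' v' ==> - m : R ==> - m : R') ==> ?N R'" for u' v'
 proof (rule exI[of _ i], rule exI[of _ u'], rule exI[of _ v'], intro conjI allI impI ir p(1-3) m sat_cone[OF R p(4,5,3)])
  fix R' assume a: "sat R'" "cone2 u' v' <= R'" "ALL m:cone2 u' v'. - m : R --> - m : R'"
  have g: "gga i : R'" "gga (Suc i) : R'" "!!l. i = Suc l ==> gga l - gga (Suc i) : R'" "i < r ==> gga (Suc (Suc i)) - gga i : R'"
   using R'[OF a(1,2) a(3)[rule_format]] by (simp_all add: e_def f_def)
  show "gga k : R'" if "k <= Suc r" for k by (rule sat_hj_pairs(1)[OF a(1) hj ir g that])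
  show "gga k + gga l - (gga i + gga (Suc i)) : R'" if "k <= Suc r" "l <= Suc r" "k ~= l" for k l
   by (rule sat_hj_pairs(2)[OF a(1) hj ir g that])
 qed
 have u0: "gga 0 = u" and vr: "gga (Suc r) = v" using hj by (auto simp: hj_def)
 \<comment> \<open>A drop of the determinant lowers \<open>cmeas\<close>, whatever the increments
   are.\<close>
 have bnd: "det2 u' v' = 1 | cmeas u' v' < cmeas u v" if "0 < det2 u' v'" "det2 u' v' < det2 u v" for u' v'
  using cmeas_bounds[of u' v'] cmeas_bounds[of u v] that by linarith
 have inc: "u' : cone2 u' v'" "v' : cone2 u' v'" if "0 < det2 u' v'" for u' v' using that by (auto simp: cone2_def)
 have pos: "0 < x" if "0 < ep * x" "ep = 2 | ep = 1 & P" for ep x :: int and P using that by auto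
 note det2_lin = det2_diff_left det2_diff_right det2_scale_left det2_scale_right
 let ?L = "%w ep l a. 2 <= a & gga l = scale a e - f & (ep = 2 | ep = 1 & odd a) & scale ep w = scale a e - scale 2 f"
 \<comment> \<open>The left edge. For \<open>i = 0\<close> the edge \<open>u\<close> is kept;
   otherwise \<open>half_vector\<close> applies to the left neighbour \<open>gga l\<close>.\<close>
 obtain w ep where w: "primitive w" "w : R" "0 <= det2 w e" "0 < det2 w f" "0 <= ep"
  "!!l. i = Suc l ==> gga l - f = scale ep w" "i = 0 ==> w = u" "!!l. i = Suc l ==> EX a. ?L w ep l a"
 proof (cases i)
  case 0
  hence "e = u" using u0 by (simp add: e_def)
  thus ?thesis by (intro that[of u 1]) (use 0 prim eR ef in auto)
 next
  case (Suc l)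
  obtain a where a: "2 <= a" "gga l + gga (Suc (Suc l)) = scale a (gga (Suc l))" using hj_rec[OF hj, of l] ir Suc by auto
  have gl: "gga l = scale a e - f" using a(2) Suc by (simp add: e_def f_def eq_diff_eq)
  obtain ep w where w: "scale ep w = scale a e - scale 2 f" "primitive w" "ep = 2 | ep = 1 & odd a"
   by (rule half_vector[of e f]) (use ef in auto)
  have s: "gga l - f = scale ep w" unfolding w gl by (simp add: prod_eq_iff scale_simps)
  have gR: "gga l - f : R" using adj[of l] Suc ir by (simp add: e_def f_def algebra_simps)
  have wR: "w : R" by (rule sat_div[OF R, of ep]) (use w(3) gR[unfolded s] in auto)
  have d: "ep * det2 w e = 2" "ep * det2 w f = a"
   using arg_cong[OF w(1), of "%m. det2 m e"] arg_cong[OF w(1), of "%m. det2 m f"] ef fe by (simp_all add: det2_lin)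
  have p1: "0 < det2 w e" by (rule pos[OF _ w(3)]) (simp add: d)
  have p2: "0 < det2 w f" by (rule pos[OF _ w(3)]) (use d a(1) in simp)
  have L: "EX a. ?L w ep l a" using w(1,3) gl a(1) by blast
  show ?thesis
  proof (rule that[OF w(2) wR less_imp_le[OF p1] p2, of ep])
   show "0 <= ep" using w(3) by auto
  qed (use Suc s L in simp_all)
 qed
 let ?Z = "%z et b. 2 <= b & gga (Suc (Suc i)) = scale b f - e & (et = 2 | et = 1 & odd b) & scale et z = scale b f - scale 2 e"
 \<comment> \<open>The right edge, symmetrically.\<close>
 obtain z et where z: "primitive z" "z : R" "0 <= det2 f z" "0 < det2 e z" "0 <= et"
  "i < r ==> gga (Suc (Suc i)) - e = scale et z" "i = r ==> z = v" "i < r ==> EX b. ?Z z et b"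
 proof (cases "i < r")
  case False
  hence "f = v" using vr ir by (simp add: f_def)
  thus ?thesis by (intro that[of v 1]) (use False prim fR ef in auto)
 next
  case True
  obtain b where b: "2 <= b" "gga i + gga (Suc (Suc i)) = scale b (gga (Suc i))" using hj_rec[OF hj True] by auto
  have gl: "gga (Suc (Suc i)) = scale b f - e" using b(2) by (simp add: e_def f_def eq_diff_eq add.commute)
  obtain et z where z: "scale et z = scale b f - scale 2 e" "primitive z" "et = 2 | et = 1 & odd b"
   by (rule half_vector[of f e]) (use fe in auto)
  have s: "gga (Suc (Suc i)) - e = scale et z" unfolding z gl by (simp add: prod_eq_iff scale_simps)
  have gR: "gga (Suc (Suc i)) - e : R" using adj[of "Suc i"] True by (simp add: e_def f_def algebra_simps)
  have zR: "z : R" by (rule sat_div[OF R, of et]) (use z(3) gR[unfolded s] in auto)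
  have d: "et * det2 e z = b" "et * det2 f z = 2"
   using arg_cong[OF z(1), of "det2 e"] arg_cong[OF z(1), of "det2 f"] ef fe by (simp_all add: det2_lin)
  have p1: "0 < det2 f z" by (rule pos[OF _ z(3)]) (simp add: d)
  have p2: "0 < det2 e z" by (rule pos[OF _ z(3)]) (use d b(1) in simp)
  have L: "EX b. ?Z z et b" using z(1,3) gl b(1) by blast
  show ?thesis
  proof (rule that[OF z(2) zR less_imp_le[OF p1] p2, of et])
   show "0 <= et" using z(3) by auto
  qed (use True s L in simp_all)
 qed
 \<comment> \<open>The usual case, in which \<open>w\<close> and \<open>z\<close> span a strongly
   convex cone.\<close>
 have wz: ?thesis if D: "0 < det2 w z" and m: "det2 w z = 1 | cmeas w z < cmeas u v"
 proof (rule fin[OF w(1) z(1) D w(2) z(2) m])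
  fix R' assume R': "sat R'" "cone2 w z <= R'"
  have "e : cone2 w z" "f : cone2 w z" using w z by (auto simp: cone2_def)
  moreover have "scale ep w : R'" "scale et z : R'" by (rule sat_scale[OF R'(1)], use inc[OF D] R' w(5) z(5) in auto)+
  ultimately show "?N R'" using R' w(6) z(6) by auto
 qed
 \<comment> \<open>A regular cone; the least pair at the left end, at the right end, or in the
   interior.\<close>
 consider "r = 0" | "i = 0" "0 < r" | l where "i = Suc l" "i = r" | l where "i = Suc l" "i < r" using ir le_less[of i r] by (cases i) auto
 thus ?thesis
 proof cases
  case 1
  hence "w = e" "z = f" using ir u0 vr w(7) z(7) by (auto simp: e_def f_def)
  thus ?thesis by (intro wz) (simp_all add: ef)
 next
  case 2
  have eu: "e = u" and wu: "w = u" using 2 u0 w(7) by (simp_all add: e_def)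
  obtain b where b: "?Z z et b" using z(8) 2 by auto
  hence bz: "scale et z = scale b f - scale 2 e" by blast
  have q: "et * det2 u z = b" using arg_cong[OF bz, of "det2 e"] ef by (simp add: det2_lin eu)
  have qp: "0 < det2 u z" using z(4) eu by simp
  have g2: "gga 2 = scale b f - e" using b 2 by (simp add: numeral_2_eq_2)
  hence d: "det2 u (gga 2) = b" using ef eu by (simp add: det2_lin)
  show ?thesis
  proof (rule wz; unfold wu)
   show "det2 u z = 1 | cmeas u z < cmeas u v"
   \<comment> \<open>For \<open>r = 1\<close> the determinant of the cone equals \<open>b\<close>
     and the finer measure is needed; for \<open>r > 1\<close> it exceeds \<open>b\<close>, of which
     \<open>det2 u z\<close> is a divisor.\<close>
   proof (cases "r = 1")
    case True
    hence "gga 2 = v" using vr by (simp add: numeral_2_eq_2)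
    hence "cmeas u z < cmeas u v"
     by (intro half_vector_measure[of u f u v b u z z et]) (insert d g2 ef eu b q, auto simp: algebra_simps)
    thus ?thesis ..
   next
    case False
    have "det2 (gga 0) (gga 2) <= det2 (gga 0) (gga r)" by (rule hj_det_mono_right[OF hj]) (use False 2 in auto)
    also have "... < det2 (gga 0) (gga (Suc r))" using hj_det_right[OF hj, of 0 r] by simp
    finally have "b < det2 u v" using d u0 vr by simp
    thus ?thesis using bnd[OF qp] q b qp by auto
   qed
  qed (rule qp)
 next
  case 3
  have fv: "f = v" and zv: "z = v" using 3 vr z(7) by (simp_all add: f_def)
  obtain a where a: "?L w ep l a" using w(8) 3 by auto
  hence aw: "scale ep w = scale a e - scale 2 f" by blast
  have q: "ep * det2 w v = a" using arg_cong[OF aw, of "%m. det2 m f"] ef by (simp add: det2_lin fv)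
  have qp: "0 < det2 w v" using w(4) fv by simp
  have d: "det2 (gga l) v = a" using a ef fv by (simp add: det2_lin)
  show ?thesis
  proof (rule wz; unfold zv)
   show "det2 w v = 1 | cmeas w v < cmeas u v"
   proof (cases "r = 1")
    case True
    hence "gga l = u" using 3 u0 by simp
    hence "cmeas w v < cmeas u v"
     by (intro half_vector_measure[of v e u v a w v w ep]) (insert d fe fv a q, auto simp: algebra_simps)
    thus ?thesis ..
   next
    case False
    have "det2 (gga l) (gga (Suc r)) <= det2 (gga 1) (gga (Suc r))" by (rule hj_det_mono_left[OF hj]) (use False 3 in auto)
    also have "... < det2 (gga 0) (gga (Suc r))" using hj_det_left[OF hj, of r "Suc r"] by simp
    finally have "a < det2 u v" using d u0 vr by simp
    thus ?thesis using bnd[OF qp] q a qp by auto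
   qed
  qed (rule qp)
 next
  case 4
  obtain a where a: "?L w ep l a" using w(8) 4 by auto
  obtain b where b: "?Z z et b" using z(8) 4 by auto
  have w': "scale ep w = scale a e - scale 2 f" and z': "scale et z = scale b f - scale 2 e" using a b by auto
  \<comment> \<open>For \<open>a = b = 2\<close> the vectors \<open>w\<close> and \<open>z\<close>
    are opposite, so \<open>R\<close> contains the line through them. The regular cone of
    \<open>w\<close> and \<open>e\<close>, together with \<open>- w\<close>, then suffices.\<close>
  show ?thesis
  proof (cases "a = 2 & b = 2")
   case True
   have w2: "w = e - f" and z2: "z = f - e" using w' z' True a b by (auto simp: prod_eq_iff scale_simps)
   have d1: "det2 w e = 1" using fe by (simp add: w2 det2_lin)
   show ?thesis
   proof (rule fin[OF w(1) _ _ w(2) eR])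
    show "primitive e" using ef primitive_def by blast
    fix R' assume R': "sat R'" "cone2 w e <= R'" "!!m. m : cone2 w e ==> - m : R ==> - m : R'"
    have wR: "w : R'" and eR': "e : R'" using inc[of w e] d1 R'(2) by auto
    have zR: "z : R'" using R'(3)[of w] inc[of w e] d1 z(2) z2 w2 by auto
    have "f : R'" using sat_add[OF R'(1) eR' zR] z2 by simp
    moreover have "scale ep w : R'" "scale et z : R'" by (rule sat_scale[OF R'(1)], use w(5) z(5) wR zR in auto)+
    ultimately show "?N R'" using eR' w(6) z(6) by auto
   qed (use d1 in auto)
  next
   case False
   \<comment> \<open>\<open>det2 w z\<close> divides \<open>a * b - 4\<close>, whereas the cone of
     the two outer neighbours already has determinant \<open>a * b - 1\<close>.\<close>
   have ab: "4 < a * b"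
   proof (cases "a = 2")
    case True
    thus ?thesis using False b by simp
   next
    case False
    hence "2 * 2 < a * 2" using a by simp
    also have "... <= a * b" using a b by (intro mult_left_mono) auto
    finally show ?thesis by simp
   qed
   have "det2 (scale ep w) (scale et z) = a * b - 4" unfolding w' z' using ef fe by (simp add: det2_lin)
   hence q: "ep * (et * det2 w z) = a * b - 4" by (simp add: det2_lin mult_ac)
   have e0: "ep = 2 | ep = 1 & odd a" "et = 2 | et = 1 & odd b" using a b by auto
   have qp: "0 < det2 w z" by (rule pos[OF pos[OF _ e0(1)] e0(2)]) (use q ab in simp)
   have "det2 (gga l) (gga (Suc (Suc i))) = a * b - 1" using a b ef fe by (simp add: det2_lin)
   moreover have "det2 (gga l) (gga (Suc (Suc i))) <= det2 (gga 0) (gga (Suc (Suc i)))" by (rule hj_det_mono_left[OF hj]) (use 4 in auto)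
   moreover have "det2 (gga 0) (gga (Suc (Suc i))) <= det2 (gga 0) (gga (Suc r))" by (rule hj_det_mono_right[OF hj]) (use 4 in auto)
   ultimately have abq: "a * b - 1 <= det2 u v" using u0 vr by simp
   have "det2 w z <= ep * (et * det2 w z)" using qp e0 by auto
   thus ?thesis by (intro wz[OF qp] bnd[OF qp]) (use q abq in linarith)
  qed
 qed
qed

subsection \<open>Toric places\<close>

definition pdom :: "('r => 'k => bool) => 'r set" where "pdom E = {q. EX a. E q a}"

lemma pdomI: "E q a ==> q : pdom E" by (auto simp: pdom_def)

lemma pdomE:
 assumes "q : pdom E"
 obtains a where "E q a" using assms by (auto simp: pdom_def)

context field_hom
begin

lemma pdom_const: "place e E ==> e c : pdom E" unfolding pdom_def by (blast dest: place_const)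

lemma pdom_0: "place e E ==> 0 : pdom E" and pdom_1: "place e E ==> 1 : pdom E"
 unfolding pdom_def using place_0 place_1 by blast+

lemma pdom_add: "place e E ==> q : pdom E ==> r : pdom E ==> q + r : pdom E"
 unfolding pdom_def by (blast dest: place_add)

lemma pdom_mult: "place e E ==> q : pdom E ==> r : pdom E ==> q * r : pdom E"
 unfolding pdom_def by (blast dest: place_mult)

lemma pdom_inverse: "place e E ==> E q a ==> a ~= 0 ==> inverse q : pdom E"
 unfolding pdom_def by (blast dest: place_inverse)

lemma pdom_divide: "place e E ==> r : pdom E ==> E q a ==> a ~= 0 ==> r / q : pdom E"
 unfolding divide_inverse by (rule pdom_mult, assumption, assumption, rule pdom_inverse)

lemma pdom_uminus: "place e E ==> q : pdom E ==> - q : pdom E" unfolding pdom_def by (blast dest: place_uminus)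

lemma pdom_diff: "place e E ==> q : pdom E ==> r : pdom E ==> q - r : pdom E"
 unfolding pdom_def by (blast dest: place_diff)

lemma pgen_in_dom:
 assumes E: "place e E" and G: "G <= pdom E"
 shows "q : pgen e G E ==> q : pdom E"
proof (induction rule: pgen.induct)
 case (inverse q a)
 thus ?case using pdom_inverse[OF E] by blast
qed (insert G, auto simp: pdom_const[OF E] pdom_add[OF E] pdom_mult[OF E])

lemma pgen_power: "q : pgen e G E ==> q ^ k : pgen e G E" by (induction k) (insert pgen.const[of e 1] pgen.mult, auto)

end

text \<open>Up to the factor \<open>t1 * t2\<close> this is the Jacobian determinant; for coordinate
  functions it is a Pluecker coordinate of the tangent plane.\<close>

definition bracket :: "'k::field rat2 => 'k rat2 => 'k rat2" where "bracket f g = D1 f * D2 g - D2 f * D1 g"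

lemma bracket_swap: "bracket g f = - bracket f g" by (simp add: bracket_def)

lemma bracket_const: "bracket (fconst c) g = 0"
 by (simp add: bracket_def dern_const[OF D1_derivation] dern_const[OF D2_derivation])

lemma bracket_add: "bracket (f + f') g = bracket f g + bracket f' g"
 by (simp add: bracket_def dern_add[OF D1_derivation] dern_add[OF D2_derivation] algebra_simps)

lemma bracket_mult: "bracket (f * f') g = f * bracket f' g + f' * bracket f g"
 by (simp add: bracket_def dern_mult[OF D1_derivation] dern_mult[OF D2_derivation] algebra_simps)

lemma bracket_inverse: "bracket (inverse f) g = - (inverse f * inverse f) * bracket f g"
 by (simp add: bracket_def dern_inverse[OF D1_derivation] dern_inverse[OF D2_derivation] algebra_simps)

lemma bracket_mon: "bracket (mon a) (mon b) = of_int (det2 a b) * (mon (a + b) :: 'k::field rat2)"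
 by (simp add: bracket_def D1_mon D2_mon mon_add det2_def algebra_simps)

text \<open>The bracket is a derivation in each argument, so membership in a module \<open>J\<close>
  over the local ring passes from generators to their localizations.\<close>

lemma bracket_pgen:
 assumes E: "place fconst E" and A: "A <= pdom E" and B: "B <= pdom E"
  and J: "!!x y. x : J ==> y : J ==> x + y : J" "!!x y. x : pdom E ==> y : J ==> x * y : J" "0 : J"
  and AB: "!!a b. a : A ==> b : B ==> bracket a b : J"
  and f: "f : pgen fconst A E" and g: "g : pgen fconst B E"
 shows "bracket f g : J"
proof -
 have step: "bracket f g : J"
  if f: "f : pgen fconst A E" and A: "A <= pdom E" and Ag: "!!a. a : A ==> bracket a g : J" for A f g using f
 proof induction
  case (const c)
  thus ?case by (simp add: bracket_const J)
 next
  case (gen g)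
  thus ?case by (rule Ag)
 next
  case (add q r)
  thus ?case by (simp add: bracket_add J)
 next
  case (mult q r)
  thus ?case unfolding bracket_mult by (intro J fconst.pgen_in_dom[OF E A]) auto
 next
  case (inverse q a)
  have "inverse q : pdom E" by (rule fconst.pdom_inverse[OF E inverse(2,3)])
  thus ?case unfolding bracket_inverse by (intro J fconst.pdom_uminus[OF E] fconst.pdom_mult[OF E] inverse)
 qed
 have neg: "- x : J" if "x : J" for x
  using J(2)[OF fconst.pdom_const[OF E, of "- 1"] that] by (simp add: fconst.e_uminus)
 show ?thesis
 proof (rule step[OF f A])
  fix a assume a: "a : A"
  have "bracket g a : J"
  proof (rule step[OF g B])
   fix b assume "b : B"
   from neg[OF AB[OF a this]] show "bracket b a : J" by (simp add: bracket_swap[of a b])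
  qed
  from neg[OF this] show "bracket a g : J" by (simp add: bracket_swap[of g a])
 qed
qed

lemma bracket_pgen_divide:
 assumes E: "place fconst E" and A: "A <= pdom E"
  and J: "!!x y. x : J ==> y : J ==> x + y : J" "!!x y. x : pdom E ==> y : J ==> x * y : J" "0 : J"
  and AA: "!!a b. a : A ==> b : A ==> bracket a b / d : J"
  and fg: "f : pgen fconst A E" "g : pgen fconst A E"
 shows "bracket f g / d : J"
proof -
 have "bracket f g : {x. x / d : J}" by (rule bracket_pgen[OF E A A _ _ _ _ fg])
   (insert J AA, auto simp: add_divide_distrib simp flip: times_divide_eq_right)
 thus ?thesis by simp
qed

definition cloc :: "(int \<times> int) set => ('k::field rat2 => 'k => bool) => 'k rat2 set" where
 "cloc S E = {q. EX P:KS S. EX H:KS S. EX h. E H h & h ~= 0 & q = P / H}"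

text \<open>The local ring of a point on the affine toric surface of \<open>S\<close>. The point may
  lie on any torus orbit: \<open>E\<close> decides which monomials are units.\<close>

definition toric_place :: "('k::field rat2 => 'k => bool) => (int \<times> int) set => bool" where
 "toric_place E S <-> place fconst E & mon ` S <= pdom E & pdom E <= cloc S E"

lemma clocI: "P : KS S ==> H : KS S ==> E H h ==> h ~= 0 ==> q = P / H ==> q : cloc S E" unfolding cloc_def by blast

lemma clocE:
 assumes "q : cloc S E"
 obtains P H h where "P : KS S" "H : KS S" "E H h" "h ~= 0" "q = P / H" using assms unfolding cloc_def by blast

lemma KS_pdom:
 assumes E: "place fconst E" and S: "mon ` S <= pdom E" and P: "P : KS S"
 shows "P : pdom E" using P
proof (induction rule: KS_induct)
 case zero
 show ?case by (rule fconst.pdom_0[OF E])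
next
 case (mon m c)
 thus ?case using S by (intro fconst.pdom_mult[OF E] fconst.pdom_const[OF E]) auto
qed (rule fconst.pdom_add[OF E])

context
 fixes E :: "'k::field rat2 => 'k => bool" and u v :: "int \<times> int"
 assumes E: "place fconst E"
begin

lemma KS_in_localization: "P : KS (cone2 u v) ==> P : cloc (cone2 u v) E" by (rule clocI[where H = 1 and h = 1])
  (use KS_const[of "cone2 u v" 1] fconst.place_1[OF E] in auto)

lemma localization_const: "fconst c : cloc (cone2 u v) E" by (rule KS_in_localization, rule KS_const) simp

lemma localization_add:
 assumes "q : cloc (cone2 u v) E" "r : cloc (cone2 u v) E"
 shows "q + r : cloc (cone2 u v) E"
proof -
 obtain P H h where 1: "P : KS (cone2 u v)" "H : KS (cone2 u v)" "E H h" "h ~= 0" "q = P / H"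
  by (rule clocE[OF assms(1)])
 obtain P' H' h' where 2: "P' : KS (cone2 u v)" "H' : KS (cone2 u v)" "E H' h'" "h' ~= 0" "r = P' / H'"
  by (rule clocE[OF assms(2)])
 have n: "H ~= 0" "H' ~= 0" using 1 2 fconst.place_nonzero[OF E] by blast+
 show ?thesis
 proof (rule clocI)
  show "E (H * H') (h * h')" by (rule place_mult[OF E 1(3) 2(3)])
  show "P * H' + P' * H : KS (cone2 u v)" "H * H' : KS (cone2 u v)" by (intro KS_add KS_cone_mult 1 2)+
 qed (insert 1 2 n, auto simp: add_frac_eq)
qed

lemma localization_mult:
 assumes "q : cloc (cone2 u v) E" "r : cloc (cone2 u v) E"
 shows "q * r : cloc (cone2 u v) E"
proof -
 obtain P H h where 1: "P : KS (cone2 u v)" "H : KS (cone2 u v)" "E H h" "h ~= 0" "q = P / H"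
  by (rule clocE[OF assms(1)])
 obtain P' H' h' where 2: "P' : KS (cone2 u v)" "H' : KS (cone2 u v)" "E H' h'" "h' ~= 0" "r = P' / H'"
  by (rule clocE[OF assms(2)])
 show ?thesis by (rule clocI[where E = E and h = "h * h'", OF KS_cone_mult[OF 1(1) 2(1)] KS_cone_mult[OF 1(2) 2(2)]])
   (use 1 2 place_mult[OF E 1(3) 2(3)] in auto)
qed

lemma localization_inverse:
 assumes "q : cloc (cone2 u v) E" "E q a" "a ~= 0"
 shows "inverse q : cloc (cone2 u v) E"
proof -
 obtain P H h where 1: "P : KS (cone2 u v)" "H : KS (cone2 u v)" "E H h" "h ~= 0" "q = P / H"
  by (rule clocE[OF assms(1)])
 have "H ~= 0" using 1 fconst.place_nonzero[OF E] by blast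
 hence "P = q * H" using 1 by simp
 hence "E P (a * h)" using place_mult[OF E assms(2) 1(3)] by simp
 thus ?thesis by (rule clocI[OF 1(2,1)]) (use 1 assms in auto)
qed

lemma pgen_localization:
 assumes EE: "!!q a. E' q a ==> E q a" and G: "G <= cloc (cone2 u v) E"
  and q: "q : pgen fconst G E'"
 shows "q : cloc (cone2 u v) E" using q
proof induction
 case (inverse q a)
 show ?case by (rule localization_inverse[OF inverse(4) EE[OF inverse(2)] inverse(3)])
qed (use G localization_const localization_add localization_mult in auto)

text \<open>The Hilbert basis generates the semigroup, hence also the local ring.\<close>

lemma toric_pgen:
 assumes T: "toric_place E (cone2 u v)" and hj: "hj u v r gga" and q: "q : pdom E"
 shows "q : pgen fconst (mon ` gga ` {..Suc r}) E"
proof -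
 let ?G = "pgen fconst (mon ` gga ` {..Suc r}) E"
 have m: "mon m : ?G" if mc: "m : cone2 u v" for m
 proof -
  obtain i k l where i: "i <= r" "0 <= k" "0 <= l" "m = scale k (gga i) + scale l (gga (Suc i))"
   by (rule hj_generates[OF hj mc])
  obtain k' where k': "k = int k'" using i(2) by (rule nonneg_int_cases)
  obtain l' where l': "l = int l'" using i(3) by (rule nonneg_int_cases)
  have "mon (gga i) : ?G" "mon (gga (Suc i)) : ?G" using i(1) by (auto intro: pgen.gen)
  thus ?thesis unfolding i(4) k' l' mon_add mon_scale by (intro pgen.mult fconst.pgen_power)
 qed
 have K: "P : ?G" if "P : KS (cone2 u v)" for P using that
 proof (induction rule: KS_induct)
  case zero
  show ?case using pgen.const[of fconst 0] by simp
 next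
  case (mon k c)
  thus ?case by (intro pgen.mult pgen.const m)
 qed (rule pgen.add)
 have "q : cloc (cone2 u v) E" using T q by (auto simp: toric_place_def)
 then obtain P H h where 1: "P : KS (cone2 u v)" "H : KS (cone2 u v)" "E H h" "h ~= 0" "q = P / H" by (rule clocE)
 show ?thesis unfolding 1(5) divide_inverse by (intro pgen.mult K 1 pgen.inverse[OF K[OF 1(2)] 1(3,4)])
qed

end

lemma dern_KS:
 assumes D: "derivation fconst D" and m: "!!m. EX k. D (mon m) = fconst k * (mon m :: 'k::field rat2)" and P: "P : KS S"
 shows "D P : KS S" using P
proof (induction rule: KS_induct)
 case zero
 show ?case by (simp add: dern_0[OF D])
next
 case (mon n c)
 obtain k where "D (mon n) = fconst k * (mon n :: 'k rat2)" using m by blast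
 hence "D (fconst c * mon n) = tor (single n (c * k))"
  by (simp add: dern_mult[OF D] dern_const[OF D] tor_single fconst.e_mult mult_ac)
 also have "... : KS S" by (rule KS_I) (insert mon, auto split: if_splits)
 finally show ?case .
qed (simp add: dern_add[OF D] KS_add)

lemma toric_place_derivation:
 fixes E :: "'k::field rat2 => 'k => bool"
 assumes T: "toric_place E S" and q: "q : pdom E"
 shows "D1 q : pdom E" "D2 q : pdom E"
proof -
 have E: "place fconst E" and S: "mon ` S <= pdom E" using T by (auto simp: toric_place_def)
 have "D q : pdom E" if D: "derivation fconst D" and m: "!!m. EX k. D (mon m) = fconst k * (mon m :: 'k rat2)" for D
 proof -
  have "q : cloc S E" using T q by (auto simp: toric_place_def)
  then obtain P H h where 1: "P : KS S" "H : KS S" "E H h" "h ~= 0" "q = P / H" by (rule clocE)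
  note d = KS_pdom[OF E S]
  have i: "inverse H : pdom E" by (rule fconst.pdom_inverse[OF E 1(3,4)])
  have "D q = D P * inverse H - P * (D H * inverse H * inverse H)"
   by (simp add: 1(5) divide_inverse dern_mult[OF D] dern_inverse[OF D])
  also have "... : pdom E" by (intro fconst.pdom_diff[OF E] fconst.pdom_mult[OF E] i d dern_KS[OF D m] 1)
  finally show ?thesis .
 qed
 note * = this
 have "EX k. D1 (mon m) = fconst k * (mon m :: 'k rat2)" for m
  by (rule exI[of _ "of_int (fst m)"]) (simp add: D1_mon fconst.e_of_int)
 thus "D1 q : pdom E" by (rule *[OF D1_derivation])
 have "EX k. D2 (mon m) = fconst k * (mon m :: 'k rat2)" for m
  by (rule exI[of _ "of_int (snd m)"]) (simp add: D2_mon fconst.e_of_int)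
 thus "D2 q : pdom E" by (rule *[OF D2_derivation])
qed

text \<open>Closedness under roots is the aspect of normality that makes the semigroup of regular
  monomials saturated.\<close>

definition root_closed :: "('r::field => 'k => bool) => bool" where
 "root_closed E <-> (ALL f g h k. f : pdom E --> g : pdom E --> h : pdom E -->
  g ~= 0 --> k > 0 --> f ^ k = h * g ^ k --> f / g : pdom E)"

lemma sat_pdom:
 fixes E :: "'k::field rat2 => 'k => bool"
 assumes E: "place fconst E" and root: "root_closed E"
  and shift: "!!m. EX m0. (mon m0 :: 'k rat2) : pdom E & (mon (m + m0) :: 'k rat2) : pdom E"
 shows "sat {m. (mon m :: 'k rat2) : pdom E}"
proof -
 have "(mon m :: 'k rat2) : pdom E" if k: "0 < k" and km: "(mon (scale k m) :: 'k rat2) : pdom E" for k m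
 proof -
  obtain m0 where m0: "(mon m0 :: 'k rat2) : pdom E" "(mon (m + m0) :: 'k rat2) : pdom E" using shift by blast
  obtain k' where k': "k = int k'" "k' > 0" using k by (metis zero_less_imp_eq_int)
  have "(mon (m + m0)) ^ k' = mon (scale k m) * (mon m0 ^ k' :: 'k rat2)"
   by (simp add: k' mon_scale mon_add power_mult_distrib)
  hence "mon (m + m0) / (mon m0 :: 'k rat2) : pdom E"
   by (intro root[unfolded root_closed_def, rule_format, OF m0(2,1) km mon_nonzero k'(2)])
  thus ?thesis by (simp add: mon_add)
 qed
 moreover have "(1 :: 'k rat2) : pdom E" by (rule fconst.pdom_1[OF E])
 ultimately show ?thesis unfolding sat_def using fconst.pdom_mult[OF E] by (simp add: mon_add)
qed

text \<open>The hypotheses make \<open>g\<close> almost integral over the localization, which is completely integrally closed.\<close>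

lemma loc_finite_extension:
 fixes E :: "'k::field rat2 => 'k => bool" and N :: nat
 assumes E: "place fconst E" and uv: "0 < det2 u v"
  and b: "j0 < N" "b j0 ~= 0"
  and g: "!!j. j < N ==> EX a. (ALL l<N. a l : cloc (cone2 u v) E) & g * b j = (SUM l<N. a l * b l)"
 shows "g : cloc (cone2 u v) E"
proof -
 obtain a where a: "!!j l. j < N ==> l < N ==> a j l : cloc (cone2 u v) E"
  "!!j. j < N ==> g * b j = (SUM l<N. a j l * b l)" using g by metis
 have "EX P H h. P : KS (cone2 u v) & H : KS (cone2 u v) & E H h & h ~= 0 & a j l = P / H" if "j < N" "l < N" for j l
  using a(1)[OF that] by (auto simp: cloc_def)
 then obtain P H h where PH: "!!j l. j < N ==> l < N ==> P j l : KS (cone2 u v) & H j l : KS (cone2 u v) & E (H j l) (h j l) & h j l ~= 0 & a j l = P j l / H j l"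
  by metis
 have Hn: "H j l ~= 0" if "j < N" "l < N" for j l using PH[OF that] fconst.place_nonzero[OF E] by blast
 have prod: "(PROD x:A. H (fst x) (snd x)) : KS (cone2 u v) & E (PROD x:A. H (fst x) (snd x)) (PROD x:A. h (fst x) (snd x))"
  if "finite A" "A <= {..<N} \<times> {..<N}" for A using that
 proof induction
  case empty
  show ?case using KS_const[of "cone2 u v" 1] fconst.place_1[OF E] by simp
 next
  case (insert x A)
  hence x: "fst x < N" "snd x < N" by auto
  show ?case using insert PH[OF x] by (auto intro: KS_cone_mult place_mult[OF E])
 qed
 let ?A = "{..<N} \<times> {..<N}"
 \<comment> \<open>A common denominator of all \<open>a j l\<close>; its residue is nonzero, being a
   product of nonzero residues.\<close>
 define H0 where "H0 = (PROD x:?A. H (fst x) (snd x))"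
 define h0 where "h0 = (PROD x:?A. h (fst x) (snd x))"
 have fA: "finite ?A" by simp
 have H0: "H0 : KS (cone2 u v)" "E H0 h0" using prod[OF fA order_refl] unfolding H0_def h0_def by blast+
 have h0: "h0 ~= 0" unfolding h0_def using PH by (auto simp: prod_zero_iff)
 have H0a: "H0 * a j l : KS (cone2 u v)" if "j < N" "l < N" for j l
 proof -
  have "H0 = H j l * (PROD x:?A - {(j, l)}. H (fst x) (snd x))"
   unfolding H0_def using that by (subst prod.remove[of _ "(j, l)"]) auto
  hence "H0 * a j l = P j l * (PROD x:?A - {(j, l)}. H (fst x) (snd x))" using PH[OF that] Hn[OF that] by simp
  thus ?thesis using PH[OF that] prod[OF finite_Diff[OF fA] Diff_subset, THEN conjunct1] by (simp add: KS_cone_mult)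
 qed
 obtain d where d: "d ~= 0" "d : KS (cone2 u v)" "ALL x:b ` {..<N}. d * x : KS (cone2 u v)"
  using cone_common_denominator[OF uv, of "b ` {..<N}"] by auto
 \<comment> \<open>Multiplication by \<open>H0 * g\<close> maps the span of the
   \<open>d * b l\<close> over the semigroup ring into itself.\<close>
 have "j < N ==> (d * b j) * (H0 * g) ^ k : KS (cone2 u v)" for k j
 proof (induction k arbitrary: j)
  case 0
  thus ?case using d by simp
 next
  case (Suc k)
  have "(d * b j) * (H0 * g) ^ Suc k = d * H0 * (g * b j) * (H0 * g) ^ k" by (simp add: mult_ac)
  also have "... = (SUM l<N. (H0 * a j l) * ((d * b l) * (H0 * g) ^ k))"
   by (simp add: a(2)[OF Suc.prems] sum_distrib_left sum_distrib_right mult_ac)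
  also have "... : KS (cone2 u v)" by (rule KS_sum, rule KS_cone_mult) (use Suc H0a in auto)
  finally show ?case .
 qed
 from this[OF b(1)] have "H0 * g : KS (cone2 u v)" by (rule KS_cone_compl_closed[rotated]) (use b d(1) in simp)
 moreover have "g = H0 * g / H0" using fconst.place_nonzero[OF E H0(2) h0] by simp
 ultimately show ?thesis by (rule clocI[where E = E, OF _ H0 h0])
qed

text \<open>Local form of the Nash blowup: \<open>E0\<close> belongs to the point below, with
  coordinates \<open>c\<close>, and \<open>E1\<close> is generated over it by the ratios of all
  Pluecker coordinates to a fixed one.\<close>

definition nash_generators ::
  "('k::field rat2 => 'k => bool) => ('k rat2 => 'k => bool) => nat => (nat => 'k rat2) => nat => nat => bool" where
 "nash_generators E0 E1 n c k l <-> c ` {..<n} <= pdom E0 & pdom E0 <= pgen fconst (c ` {..<n}) E0 &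
  k < n & l < n & bracket (c k) (c l) ~= 0 & (ALL i<n. ALL j<n. bracket (c i) (c j) / bracket (c k) (c l) : pdom E1) &
  pdom E1 <= pgen fconst (c ` {..<n} Un {bracket (c i) (c j) / bracket (c k) (c l) | i j. i < n & j < n}) E1"

text \<open>Local form of finiteness: \<open>G\<close> acts on the module spanned by the
  \<open>b j\<close> over the local ring of \<open>E1\<close>, and generates the local ring of
  \<open>E2\<close> as a localization.\<close>

definition finite_generators ::
  "('k::field rat2 => 'k => bool) => ('k rat2 => 'k => bool) => nat => (nat => 'k rat2) => 'k rat2 set => bool" where
 "finite_generators E1 E2 N b G <-> (EX j<N. b j ~= 0) &
  (ALL g:G. ALL j<N. EX a. (ALL l<N. a l : pdom E1) & g * b j = (SUM l<N. a l * b l)) & pdom E2 <= pgen fconst G E2"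

text \<open>\<open>E2\<close> is the place of a point of the normalization, \<open>E1\<close> and
  \<open>E0\<close> are those of its images. Saturation puts the ring of the new cone into the local
  ring of \<open>E2\<close>. For the converse the coordinates, the ratios of brackets and finally
  the finite extension are followed into the localization of that ring.\<close>

theorem toric_nash_step:
 fixes E0 E1 E2 :: "'k::field rat2 => 'k => bool"
 assumes uv: "primitive u" "primitive v" "0 < det2 u v"
  and T: "toric_place E0 (cone2 u v)"
  and Z: "place fconst E1" and XZ: "!!q a. E0 q a ==> E1 q a"
  and Y: "place fconst E2" and ZY: "!!q a. E1 q a ==> E2 q a"
  and NG: "nash_generators E0 E1 n c k0 l0" and root: "root_closed E2" and FG: "finite_generators E1 E2 N b G"
 shows "EX u' v'. primitive u' & primitive v' & 0 < det2 u' v' & toric_place E2 (cone2 u' v') &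
  (det2 u' v' = 1 | cmeas u' v' < cmeas u v)"
proof -
 define de where "de i j = bracket (c i) (c j)" for i j
 note NG' = NG[unfolded nash_generators_def, folded de_def]
 have c: "c ` {..<n} <= pdom E0" "pdom E0 <= pgen fconst (c ` {..<n}) E0"
  and kl: "k0 < n" "l0 < n" "de k0 l0 ~= 0"
  and de: "!!i j. i < n ==> j < n ==> de i j / de k0 l0 : pdom E1"
  and genZ: "pdom E1 <= pgen fconst (c ` {..<n} Un {de i j / de k0 l0 | i j. i < n & j < n}) E1" using NG' by auto
 obtain j0 where b: "j0 < N" "b j0 ~= 0"
  and G: "!!g j. g : G ==> j < N ==> EX a. (ALL l<N. a l : pdom E1) & g * b j = (SUM l<N. a l * b l)"
  and genY: "pdom E2 <= pgen fconst G E2" using FG unfolding finite_generators_def by blast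
 obtain r gga where hj: "hj u v r gga" using hj_exists[OF uv] by blast
 have X: "place fconst E0" and SX: "mon ` cone2 u v <= pdom E0" using T by (auto simp: toric_place_def)
 have domXZ: "q : pdom E1" if "q : pdom E0" for q using that XZ by (auto simp: pdom_def)
 have domZY: "q : pdom E2" if "q : pdom E1" for q using that ZY by (auto simp: pdom_def)
 have SY: "mon ` cone2 u v <= pdom E2" using SX domXZ domZY by blast
 let ?Ga = "mon ` gga ` {..Suc r} :: 'k rat2 set"
 have GaX: "?Ga <= pdom E0" using SX hj_in_cone[OF hj] by auto
 have cX: "c i : pdom E0" if "i < n" for i using c(1) that by auto
 have ggagen: "mon (gga i) : pgen fconst (c ` {..<n}) E0" if "i <= Suc r" for i using GaX c(2) that by auto
 have cgen: "c i : pgen fconst ?Ga E0" if "i < n" for i by (rule toric_pgen[OF X T hj cX[OF that]])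
 define dd where "dd = de k0 l0"
 \<comment> \<open>The monomial is recovered from its bracket only if the determinant is nonzero in
   K; in positive characteristic this need not reach all pairs.\<close>
 have eZ: "mon (gga i + gga j) / dd : pdom E1"
  if ij: "i <= Suc r" "j <= Suc r" "of_int (det2 (gga i) (gga j)) ~= (0 :: 'k)" for i j
 proof -
  let ?d = "of_int (det2 (gga i) (gga j)) :: 'k"
  have "bracket (mon (gga i)) (mon (gga j)) / dd : pdom E1"
   by (rule bracket_pgen_divide[OF X c(1) fconst.pdom_add[OF Z] fconst.pdom_mult[OF Z domXZ]
      fconst.pdom_0[OF Z] _ ggagen[OF ij(1)] ggagen[OF ij(2)]]) (insert de, auto simp: dd_def de_def)
  hence "fconst ?d * mon (gga i + gga j) / dd : pdom E1" by (simp add: bracket_mon fconst.e_of_int)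
  from fconst.pdom_mult[OF Z fconst.pdom_const[OF Z, of "inverse ?d"] this]
  have "fconst (inverse ?d * ?d) * mon (gga i + gga j) / dd : pdom E1" by (simp only: fconst.e_mult mult.assoc times_divide_eq_right)
  thus ?thesis using ij(3) fconst.e_1 by simp
 qed
 \<comment> \<open>Some such monomial differs from \<open>dd\<close> by a unit: otherwise all
   brackets divided by \<open>dd\<close> would have residue 0, including \<open>dd\<close>
   itself.\<close>
 have "EX i j a. i < j & j <= Suc r & E2 (mon (gga i + gga j) / dd) a & a ~= 0"
 proof (rule ccontr)
  assume no: "~ ?thesis"
  have no': "E2 (mon (gga i + gga j) / dd) 0" if ij: "i <= Suc r" "j <= Suc r" "of_int (det2 (gga i) (gga j)) ~= (0 :: 'k)" for i j
  proof -
   have ne: "i ~= j" using ij(3) by auto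
   obtain a where a: "E2 (mon (gga i + gga j) / dd) a" using domZY[OF eZ[OF ij]] by (rule pdomE)
   have "a = 0"
   proof (cases "i < j")
    case True
    thus ?thesis using no a ij by blast
   next
    case False
    hence "j < i" using ne by simp
    moreover have "E2 (mon (gga j + gga i) / dd) a" using a by (simp only: add.commute)
    ultimately show ?thesis using no ij by blast
   qed
   thus ?thesis using a by simp
  qed
  have "bracket (c k0) (c l0) / dd : {x. E2 x 0}"
  proof (rule bracket_pgen_divide[OF X GaX _ _ _ _ cgen[OF kl(1)] cgen[OF kl(2)]])
   show "x + y : {x. E2 x 0}" if "x : {x. E2 x 0}" "y : {x. E2 x 0}" for x y
    using place_add[OF Y, of x 0 y 0] that by simp
   show "x * y : {x. E2 x 0}" if xy: "x : pdom E0" "y : {x. E2 x 0}" for x y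
    using place_mult[OF Y ZY[OF XZ], of x _ y 0] xy by (auto elim!: pdomE)
   show "0 : {x. E2 x 0}" using fconst.place_0[OF Y] by simp
   show "bracket x y / dd : {x. E2 x 0}" if xy: "x : ?Ga" "y : ?Ga" for x y
   proof -
    obtain i j where ij: "x = mon (gga i)" "y = mon (gga j)" "i <= Suc r" "j <= Suc r" using xy by auto
    show ?thesis
    proof (cases "of_int (det2 (gga i) (gga j)) = (0 :: 'k)")
     case True
     have "(of_int (det2 (gga i) (gga j)) :: 'k rat2) = fconst (of_int (det2 (gga i) (gga j)))" by (simp add: fconst.e_of_int)
     hence "(of_int (det2 (gga i) (gga j)) :: 'k rat2) = 0" using True by simp
     thus ?thesis using fconst.place_0[OF Y] by (simp add: ij bracket_mon)
    next
     case False
     from place_mult[OF Y place_const[OF Y, of "of_int (det2 (gga i) (gga j))"] no'[OF ij(3,4) False]]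
     show ?thesis by (simp add: ij(1,2) bracket_mon fconst.e_of_int)
    qed
   qed
  qed
  hence "E2 1 0" using kl(3) by (simp add: dd_def de_def)
  thus False using place_unique[OF Y _ fconst.place_1[OF Y]] zero_neq_one by blast
 qed
 then obtain i j a where ij: "i < j" "j <= Suc r" and a: "E2 (mon (gga i + gga j) / dd) a" "a ~= 0" by blast
 have dd0: "dd ~= 0" using kl by (simp add: dd_def)
 let ?R = "{m. (mon m :: 'k rat2) : pdom E2}"
 have "EX m0. mon m0 : pdom E2 & mon (m + m0) : pdom E2" for m using shift_into_cone[OF uv(3), of "{m}"] SY by blast
 hence R: "sat ?R" by (rule sat_pdom[OF Y root])
 \<comment> \<open>Neighbours have determinant 1 in every characteristic, so their monomials are
   always among those reached.\<close>
 have adj: "mon (gga k + gga (Suc k)) / dd : pdom E2" if "k <= r" for k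
  by (rule domZY[OF eZ]) (use that hj_adj[OF hj that] in auto)
 have min: "gga k + gga (Suc k) - (gga i + gga j) : ?R" if "k <= r" for k
  using fconst.pdom_divide[OF Y adj[OF that] a] dd0 by (simp add: mon_diff)
 have "cone2 u v <= ?R" using SY by auto
 from nash_cone[OF hj uv(1,2) R this ij min] obtain k u' v' where k: "k <= r"
  and u': "primitive u'" "primitive v'" "0 < det2 u' v'" "cone2 u' v' <= ?R" "det2 u' v' = 1 | cmeas u' v' < cmeas u v"
  and R'0: "ALL R'. sat R' --> cone2 u' v' <= R' --> (ALL m:cone2 u' v'. - m : ?R --> - m : R') -->
   (ALL i<=Suc r. gga i : R') &
   (ALL i<=Suc r. ALL j<=Suc r. i ~= j --> gga i + gga j - (gga k + gga (Suc k)) : R')" by metis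
 let ?S = "cone2 u' v'" and ?L = "cloc (cone2 u' v') E2"
 note L_mult = localization_mult[OF Y] and L_add = localization_add[OF Y] and L_const = localization_const[OF Y]
 \<comment> \<open>Exponents of monomials in the localization: a shift \<open>s\<close> with
   \<open>mon s\<close> a unit at \<open>E2\<close> moves them into the new cone.\<close>
 define R' where "R' = {m. EX s:?S. EX b. E2 (mon s) b & b ~= 0 & m + s : ?S}"
 have Ssat: "sat ?S"
  unfolding sat_def using cone2_add[of _ u' v'] by (auto simp: cone2_def det2_scale_left det2_scale_right zero_le_mult_iff)
 have "sat R'" unfolding sat_def
 proof (intro conjI ballI allI impI)
  show "0 : R'" unfolding R'_def using fconst.place_1[OF Y] by (auto intro!: bexI[of _ 0] exI[of _ 1])
  show "m + m' : R'" if mm: "m : R'" "m' : R'" for m m'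
  proof -
   obtain s b s' b' where "s : ?S" "E2 (mon s) b" "b ~= 0" "m + s : ?S" "s' : ?S" "E2 (mon s') b'" "b' ~= 0" "m' + s' : ?S"
    using mm unfolding R'_def by blast
   hence "s + s' : ?S & E2 (mon (s + s')) (b * b') & b * b' ~= 0 & (m + s) + (m' + s') : ?S"
    using place_mult[OF Y] cone2_add by (simp add: mon_add)
   moreover have "(m + s) + (m' + s') = (m + m') + (s + s')" by (simp add: algebra_simps)
   ultimately show ?thesis unfolding R'_def by (auto intro!: bexI[of _ "s + s'"] exI[of _ "b * b'"])
  qed
  show "m : R'" if km: "0 < k" "scale k m : R'" for k m
  proof -
   obtain s b where s: "s : ?S" "E2 (mon s) b" "b ~= 0" "scale k m + s : ?S" using km unfolding R'_def by blast
   have "scale (k - 1) s : ?S" by (rule sat_scale[OF Ssat]) (use km s in auto)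
   moreover have "scale k (m + s) = scale k m + s + scale (k - 1) s"
    by (simp add: prod_eq_iff scale_simps algebra_simps)
   ultimately have "scale k (m + s) : ?S" using sat_add[OF Ssat s(4)] by simp
   hence "m + s : ?S" by (rule sat_div[OF Ssat km(1)])
   thus ?thesis unfolding R'_def using s by blast
  qed
 qed
 moreover have "?S <= R'"
 proof
  fix m assume "m : ?S"
  thus "m : R'" unfolding R'_def using fconst.place_1[OF Y] by (auto intro!: bexI[of _ 0] exI[of _ 1])
 qed
 \<comment> \<open>If \<open>mon m\<close> and its inverse are both regular at \<open>E2\<close>,
   their residues are nonzero, and \<open>m\<close> itself is a suitable shift.\<close>
 moreover have "- m : R'" if m: "m : ?S" "- m : ?R" for m
 proof -
  have "m : ?R" using m(1) u'(4) by blast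
  then obtain b where b: "E2 (mon m) b" by (auto elim: pdomE)
  obtain b' where b': "E2 (mon (- m)) b'" using m(2) by (auto elim: pdomE)
  have "mon m * mon (- m) = (1 :: 'k rat2)" by (simp add: mon_add[symmetric])
  hence "E2 1 (b * b')" using place_mult[OF Y b b'] by simp
  hence "b ~= 0" using place_unique[OF Y _ fconst.place_1[OF Y]] by fastforce
  thus ?thesis unfolding R'_def using m(1) b by (auto intro!: bexI[of _ m])
 qed
 ultimately have R'gga: "ALL i<=Suc r. gga i : R'"
  "ALL i<=Suc r. ALL j<=Suc r. i ~= j --> gga i + gga j - (gga k + gga (Suc k)) : R'"
  using R'0[rule_format, of R'] by auto
 have R'L: "mon m : ?L" if "m : R'" for m
 proof -
  obtain s b where s: "s : ?S" "E2 (mon s) b" "b ~= 0" "m + s : ?S" using `m : R'` unfolding R'_def by blast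
  show ?thesis by (rule clocI[where E = E2, OF KS_mon[OF s(4)] KS_mon[OF s(1)] s(2,3)]) (simp add: mon_add)
 qed
 have GaL: "?Ga <= ?L"
 proof
  fix x assume "x : ?Ga"
  then obtain i where i: "x = mon (gga i)" "i <= Suc r" by auto
  show "x : ?L" unfolding i(1) by (rule R'L) (use R'gga(1) i(2) in blast)
 qed
 have XL: "q : ?L" if "q : pdom E0" for q by (rule pgen_localization[OF Y ZY[OF XZ] GaL toric_pgen[OF X T hj that]])
 define m0 where "m0 = gga k + gga (Suc k)"
 have deL: "de i j / mon m0 : ?L" if ij: "i < n" "j < n" for i j
 proof -
  have "bracket (c i) (c j) / mon m0 : ?L"
  proof (rule bracket_pgen_divide[OF X GaX L_add L_mult[OF XL] _ _ cgen[OF ij(1)] cgen[OF ij(2)]])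
   show "0 : ?L" using L_const[of 0 u' v'] by simp
   show "bracket x y / mon m0 : ?L" if xy: "x : ?Ga" "y : ?Ga" for x y
   proof -
    obtain i j where ij: "x = mon (gga i)" "y = mon (gga j)" "i <= Suc r" "j <= Suc r" using xy by auto
    show ?thesis
    proof (cases "i = j")
     case True
     thus ?thesis using L_const[of 0 u' v'] by (simp add: ij bracket_mon)
    next
     case False
     hence "mon (gga i + gga j - m0) : ?L" using R'L R'gga(2) ij(3,4) unfolding m0_def by blast
     from L_mult[OF L_const[of "of_int (det2 (gga i) (gga j))"] this]
     show ?thesis by (simp add: ij(1,2) bracket_mon fconst.e_of_int mon_diff)
    qed
   qed
  qed
  thus ?thesis by (simp add: de_def)
 qed
 have KY: "P : pdom E2" if "P : KS ?S" for P by (rule KS_pdom[OF Y _ that]) (use u'(4) in auto)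
 have LY: "q : pdom E2" if qL: "q : ?L" for q
 proof -
  obtain P H h where 1: "P : KS ?S" "H : KS ?S" "E2 H h" "h ~= 0" "q = P / H" by (rule clocE[OF qL])
  show ?thesis unfolding 1(5) by (rule fconst.pdom_divide[OF Y KY[OF 1(1)] 1(3,4)])
 qed
 \<comment> \<open>Both quotients of \<open>mon m0\<close> and \<open>dd\<close> are regular at
   \<open>E2\<close>, so they are units there, and \<open>dd\<close> can replace
   \<open>mon m0\<close> as the denominator.\<close>
 have inv: "mon m0 / dd : ?L"
 proof -
  obtain a where a: "E2 (dd / mon m0) a" using LY[OF deL[OF kl(1,2)]] unfolding dd_def by (rule pdomE)
  obtain a' where a': "E2 (mon m0 / dd) a'" using adj[OF k] unfolding m0_def by (rule pdomE)
  have "E2 1 (a * a')" using place_mult[OF Y a a'] dd0 by simp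
  hence "a ~= 0" using place_unique[OF Y _ fconst.place_1[OF Y]] by fastforce
  from localization_inverse[OF Y deL[OF kl(1,2), folded dd_def] a this] show ?thesis by simp
 qed
 have dedd: "de i j / dd : ?L" if "i < n" "j < n" for i j using L_mult[OF deL[OF that] inv] by simp
 have ZL: "q : ?L" if q: "q : pdom E1" for q
 proof (rule pgen_localization[OF Y ZY _ subsetD[OF genZ q]])
  show "c ` {..<n} Un {de i j / de k0 l0 |i j. i < n & j < n} <= ?L" using XL cX dedd unfolding dd_def by auto
 qed
 \<comment> \<open>The passage to the normalization: \<open>G\<close> acts on a finitely generated
   module over the localization, so its elements are almost integral.\<close>
 have "g : ?L" if g: "g : G" for g
 proof (rule loc_finite_extension[OF Y u'(3), of j0 N b])
  show "EX a. (ALL l<N. a l : ?L) & g * b j = (SUM l<N. a l * b l)" if "j < N" for j using G[OF g that] ZL by blast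
 qed (use b in auto)
 hence GL: "G <= ?L" by blast
 have "pdom E2 <= ?L"
 proof
  fix q assume q: "q : pdom E2"
  show "q : ?L" by (rule pgen_localization[OF Y _ GL subsetD[OF genY q]])
 qed
 hence "toric_place E2 ?S" unfolding toric_place_def using Y u'(4) by auto
 thus ?thesis using u' by blast
qed

subsection \<open>Planes and Pluecker coordinates\<close>

definition lin2 :: "(nat => 'k::field) => (nat => 'k) => (nat => 'k) set" where
 "lin2 a b = {v. EX s t. v = (%i. s * a i + t * b i)}"

definition plu :: "(nat => 'k::field) => (nat => 'k) => nat => nat => 'k" where "plu a b i j = a i * b j - a j * b i"

lemma lin2I: "(!!i. v i = s * a i + t * b i) ==> v : lin2 a b" unfolding lin2_def by auto

lemma lin2E:
 assumes "v : lin2 a b"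
 obtains s t where "ALL i. v i = s * a i + t * b i" using assms unfolding lin2_def by auto

lemma lin2_left: "a : lin2 a b" and lin2_right: "b : lin2 a b"
 by (rule lin2I[of _ 1 _ 0], simp) (rule lin2I[of _ 0 _ 1], simp)

lemma span_eq_lin2: "kvec.span {a, b} = lin2 a b"
proof (intro equalityI subsetI)
 fix v assume "v : kvec.span {a, b}"
 then obtain s where "v - vscale s a : kvec.span {b}" unfolding kvec.span_insert[of a] by blast
 then obtain t where "v - vscale s a = vscale t b" by (auto simp: kvec.span_singleton)
 hence "v = vscale s a + vscale t b" by (metis diff_eq_eq add.commute)
 thus "v : lin2 a b" by (intro lin2I[of _ s _ t]) (simp add: vscale_def)
next
 fix v assume "v : lin2 a b"
 then obtain s t where st: "ALL i. v i = s * a i + t * b i" by (rule lin2E)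
 have "vscale s a + vscale t b : kvec.span {a, b}" by (intro kvec.span_add kvec.span_scale kvec.span_base) auto
 moreover have "v = vscale s a + vscale t b" by (rule ext) (simp add: st vscale_def)
 ultimately show "v : kvec.span {a, b}" by simp
qed

lemma plu_lin2:
 assumes "a' : lin2 a b" "b' : lin2 a b"
 obtains ka where "!!i j. plu a' b' i j = ka * plu a b i j"
proof -
 obtain s t where 1: "ALL i. a' i = s * a i + t * b i" using assms(1) by (rule lin2E)
 obtain s' t' where 2: "ALL i. b' i = s' * a i + t' * b i" using assms(2) by (rule lin2E)
 have "plu a' b' i j = (s * t' - t * s') * plu a b i j" for i j by (simp add: plu_def 1 2 algebra_simps)
 thus ?thesis by (rule that)
qed

text \<open>Cramer's rule for the minor \<open>k\<close>, \<open>l\<close>. Membership is expressed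
  by Pluecker coordinates alone, so bases with proportional coordinates span the same plane.\<close>

lemma lin2_iff_plu:
 assumes "plu a b k l ~= 0"
 shows "v : lin2 a b <-> (ALL i. v i * plu a b k l = v k * plu a b i l + v l * plu a b k i)"
proof
 assume "v : lin2 a b"
 then obtain s t where "ALL i. v i = s * a i + t * b i" by (rule lin2E)
 thus "ALL i. v i * plu a b k l = v k * plu a b i l + v l * plu a b k i" by (simp add: plu_def algebra_simps)
next
 assume *: "ALL i. v i * plu a b k l = v k * plu a b i l + v l * plu a b k i"
 let ?p = "plu a b k l"
 have "v i = (v k * b l - v l * b k) / ?p * a i + (a k * v l - a l * v k) / ?p * b i" for i
 proof -
  have "v i = (v k * plu a b i l + v l * plu a b k i) / ?p" using * assms by (metis nonzero_mult_div_cancel_right)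
  also have "v k * plu a b i l + v l * plu a b k i = (v k * b l - v l * b k) * a i + (a k * v l - a l * v k) * b i"
   by (simp add: plu_def algebra_simps)
  finally show ?thesis by (simp add: add_divide_distrib)
 qed
 thus "v : lin2 a b" by (rule lin2I)
qed

lemma lin2_eq:
 assumes "a' : lin2 a b" "b' : lin2 a b" "plu a' b' k l ~= 0"
 shows "lin2 a' b' = lin2 a b" "plu a b k l ~= 0"
proof -
 obtain ka where ka: "!!i j. plu a' b' i j = ka * plu a b i j" using plu_lin2[OF assms(1,2)] by blast
 thus ne: "plu a b k l ~= 0" using assms(3) by auto
 have k0: "ka ~= 0" using ka assms(3) by auto
 have "v : lin2 a' b' <-> v : lin2 a b" for v
 proof -
  have "v i * plu a' b' k l = v k * plu a' b' i l + v l * plu a' b' k i <->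
    v i * plu a b k l = v k * plu a b i l + v l * plu a b k i" for i
  proof -
   have "v i * plu a' b' k l = v k * plu a' b' i l + v l * plu a' b' k i <->
    ka * (v i * plu a b k l) = ka * (v k * plu a b i l + v l * plu a b k i)" by (simp add: ka algebra_simps)
   thus ?thesis using k0 by simp
  qed
  thus ?thesis by (simp only: lin2_iff_plu[OF assms(3)] lin2_iff_plu[OF ne])
 qed
 thus "lin2 a' b' = lin2 a b" by blast
qed

lemma plu_Kn:
 assumes "a : Kn n" "b : Kn n" "plu a b k l ~= 0"
 shows "k < n" "l < n"
proof -
 have "a i = 0 & b i = 0" if "~ i < n" for i using assms that by (auto simp: Kn_def)
 thus "k < n" "l < n" using assms(3) unfolding plu_def by (metis mult_zero_left mult_zero_right diff_self)+
qed

lemma dim_lin2: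
 assumes "plu a b k l ~= 0"
 shows "kvec.dim (lin2 a b) = 2"
proof -
 have ne: "a ~= b" using assms by (auto simp: plu_def)
 have "a ~: kvec.span {b}"
 proof
  assume "a : kvec.span {b}"
  then obtain t where "a = vscale t b" by (auto simp: kvec.span_singleton)
  hence "plu a b k l = 0" by (simp add: plu_def vscale_def)
  thus False using assms by simp
 qed
 moreover have "b ~= 0" using assms by (auto simp: plu_def)
 ultimately have ind: "kvec.independent {a, b}" using ne by (simp add: kvec.independent_insert)
 have "kvec.dim (kvec.span {a, b}) = card {a, b}" unfolding kvec.dim_span by (rule kvec.dim_eq_card_independent[OF ind])
 thus ?thesis using ne by (simp add: span_eq_lin2)
qed

lemma Gr2_iff: "W : Gr 2 n <-> (EX a:Kn n. EX b:Kn n. EX k l. plu a b k l ~= 0 & W = lin2 a b)"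
proof
 assume W: "W : Gr 2 n"
 hence W': "kvec.subspace W" "W <= Kn n" "kvec.dim W = 2" by (auto simp: Gr_def)
 obtain B where B: "B <= W" "kvec.independent B" "W <= kvec.span B" "card B = kvec.dim W" by (rule kvec.basis_exists)
 then obtain a b where ab: "B = {a, b}" "a ~= b" using W'(3) by (auto simp: card_2_iff)
 have span: "kvec.span B = W" using B W'(1) kvec.span_subspace by blast
 have "EX k l. plu a b k l ~= 0"
 proof (rule ccontr)
  assume no: "\<nexists>k l. plu a b k l ~= 0"
  have "a ~: kvec.span {b}" using B(2) ab by (simp add: kvec.independent_insert)
  have "b ~= 0" using B(2) ab kvec.dependent_zero[of B] by auto
  then obtain k where k: "b k ~= 0" by (auto simp: fun_eq_iff)
  have e: "a i = a k / b k * b i" for i using no k by (auto simp: plu_def field_simps)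
  have "a = vscale (a k / b k) b" unfolding vscale_def by (rule ext, rule e)
  thus False using `a ~: kvec.span {b}` using kvec.span_scale[OF kvec.span_base[of b "{b}"], of "a k / b k"] by simp
 qed
 thus "EX a:Kn n. EX b:Kn n. EX k l. plu a b k l ~= 0 & W = lin2 a b"
  using B(1) W'(2) ab span span_eq_lin2[of a b] by blast
next
 assume "EX a:Kn n. EX b:Kn n. EX k l. plu a b k l ~= 0 & W = lin2 a b"
 then obtain a b k l where 1: "a : Kn n" "b : Kn n" "plu a b k l ~= 0" "W = lin2 a b" by blast
 have "W <= Kn n" using 1(1,2) unfolding 1(4) lin2_def Kn_def by auto
 thus "W : Gr 2 n" using dim_lin2[OF 1(3)] kvec.subspace_span[of "{a, b}"] by (simp add: Gr_def 1(4) span_eq_lin2)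
qed

lemma lin2_Gr: "a : Kn n ==> b : Kn n ==> plu a b k l ~= 0 ==> lin2 a b : Gr 2 n" unfolding Gr2_iff by blast

text \<open>A standard chart of the Grassmannian. The coordinates \<open>plr\<close> below are the
  Pluecker coordinates normalized to 1 at \<open>k\<close>, \<open>l\<close>; as ratios they depend
  on the plane alone.\<close>

definition plc :: "nat => nat => (nat => 'k::field) set set" where
 "plc k l = {W. EX a b. W = lin2 a b & plu a b k l ~= 0}"

definition plr :: "nat => nat => (nat => 'k::field) set => nat => nat => 'k" where
 "plr k l W i j = (SOME r. EX a b. W = lin2 a b & plu a b k l ~= 0 & r = plu a b i j / plu a b k l)"

lemma lin2_in_plc: "lin2 a b : plc k l <-> plu a b k l ~= 0"
proof
 assume "lin2 a b : plc k l"
 then obtain a' b' where 1: "lin2 a b = lin2 a' b'" "plu a' b' k l ~= 0" by (auto simp: plc_def)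
 hence "a' : lin2 a b" "b' : lin2 a b" using lin2_left lin2_right by blast+
 from lin2_eq(2)[OF this 1(2)] show "plu a b k l ~= 0" .
qed (auto simp: plc_def)

lemma plr_lin2:
 assumes "plu a b k l ~= 0"
 shows "plr k l (lin2 a b) i j = plu a b i j / plu a b k l" unfolding plr_def
proof (rule some_equality)
 show "EX a' b'. lin2 a b = lin2 a' b' & plu a' b' k l ~= 0 & plu a b i j / plu a b k l = plu a' b' i j / plu a' b' k l"
  using assms by blast
 fix r assume "EX a' b'. lin2 a b = lin2 a' b' & plu a' b' k l ~= 0 & r = plu a' b' i j / plu a' b' k l"
 then obtain a' b' where 1: "lin2 a b = lin2 a' b'" "plu a' b' k l ~= 0" "r = plu a' b' i j / plu a' b' k l" by blast
 hence "a' : lin2 a b" "b' : lin2 a b" using lin2_left lin2_right by blast+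
 then obtain ka where ka: "!!i j. plu a' b' i j = ka * plu a b i j" using plu_lin2 by blast
 hence "ka ~= 0" using 1(2) by auto
 thus "r = plu a b i j / plu a b k l" using 1(3) by (simp add: ka)
qed

lemma plc_change:
 assumes "W : plc k l"
 shows "W : plc k' l' <-> plr k l W k' l' ~= 0"
  "plr k l W k' l' ~= 0 ==> plr k' l' W i j = plr k l W i j / plr k l W k' l'"
proof -
 obtain a b where ab: "W = lin2 a b" "plu a b k l ~= 0" using assms by (auto simp: plc_def)
 show *: "W : plc k' l' <-> plr k l W k' l' ~= 0" unfolding ab(1) lin2_in_plc plr_lin2[OF ab(2)] using ab(2) by simp
 assume "plr k l W k' l' ~= 0"
 hence "plu a b k' l' ~= 0" using * by (simp add: ab(1) lin2_in_plc)
 thus "plr k' l' W i j = plr k l W i j / plr k l W k' l'" unfolding ab(1) using ab(2) by (simp add: plr_lin2)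
qed

lemma Gr2_plc:
 assumes "W : Gr 2 n"
 obtains k l where "k < n" "l < n" "W : plc k l"
proof -
 obtain a b k l where 1: "a : Kn n" "b : Kn n" "plu a b k l ~= 0" "W = lin2 a b" using assms unfolding Gr2_iff by blast
 hence "W : plc k l" by (simp add: lin2_in_plc)
 thus ?thesis by (rule that[OF plu_Kn[OF 1(1-3)]])
qed

text \<open>The normalized Pluecker coordinates with second index \<open>l\<close>, respectively
  first index \<open>k\<close>, are the entries of the reduced echelon basis with pivots
  \<open>k\<close> and \<open>l\<close>.\<close>

lemma plc_normal_frame:
 assumes W: "W : plc k l" "W : Gr 2 n"
 shows "plu (%i. plr k l W i l) (%i. plr k l W k i) k l = 1" "W = lin2 (%i. plr k l W i l) (%i. plr k l W k i)"
  "(%i. plr k l W i l) : Kn n" "(%i. plr k l W k i) : Kn n"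
proof -
 obtain a b where ab: "W = lin2 a b" "a : Kn n" "b : Kn n" using W(2) by (auto simp: Gr2_iff)
 hence ne: "plu a b k l ~= 0" using W(1) by (simp add: lin2_in_plc)
 have r: "plr k l W i j = plu a b i j / plu a b k l" for i j unfolding ab(1) by (rule plr_lin2[OF ne])
 show *: "plu (%i. plr k l W i l) (%i. plr k l W k i) k l = 1"
  using ne unfolding plu_def[of "%i. plr k l W i l"] r by (simp add: plu_def)
 have "(%i. plr k l W i l) : lin2 a b" "(%i. plr k l W k i) : lin2 a b"
  unfolding lin2_iff_plu[OF ne] r using ne by (auto simp: plu_def field_simps)
 from lin2_eq(1)[OF this, of k l] show "W = lin2 (%i. plr k l W i l) (%i. plr k l W k i)" using * ab(1) by simp
 show "(%i. plr k l W i l) : Kn n" "(%i. plr k l W k i) : Kn n" unfolding r using ab(2,3) by (auto simp: Kn_def plu_def)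
qed

subsection \<open>The Grassmannian of planes as a space with functions\<close>

definition mkframe :: "nat => (nat => 'k::field) => (nat => 'k) => (nat => 'k) => nat => 'k" where
 "mkframe n p a b = (%t. if t < n then p t else if t < 2 * n then a (t - n)
  else if t < 3 * n then b (t - 2 * n) else 0)"

lemma mkframe_Kn: "mkframe n p a b : Kn (3 * n)" by (simp add: mkframe_def Kn_def)

lemma mkframe_simps:
 assumes "p : Kn n" "a : Kn n" "b : Kn n"
 shows "frame_point n (mkframe n p a b) = p" "frame_vec n (mkframe n p a b) 0 = a"
  "frame_vec n (mkframe n p a b) (Suc 0) = b"
 using assms by (auto simp: frame_point_def frame_vec_def mkframe_def Kn_def fun_eq_iff)

lemma frame_vec_Kn: "frame_vec n z j : Kn n" and frame_point_Kn: "frame_point n z : Kn n"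
 by (simp_all add: frame_vec_def frame_point_def Kn_def)

lemma frame_span_lin2: "frame_span 2 n z = lin2 (frame_vec n z 0) (frame_vec n z (Suc 0))"
proof -
 have "frame_vec n z ` {..<2} = {frame_vec n z 0, frame_vec n z (Suc 0)}" by (auto simp: numeral_2_eq_2 lessThan_Suc)
 thus ?thesis by (simp add: frame_span_def span_eq_lin2)
qed

lemma frames2: "frames 2 n = induced (affine_space (3 * n)) {z : Kn (3 * n). frame_span 2 n z : Gr 2 n}"
 by (simp add: frames_def)

lemma pts_frames: "pts (frames 2 n) = {z : Kn (3 * n). frame_span 2 n z : Gr 2 n}" by (auto simp: frames2)

lemma ringed_frames: "ringed (frames d n)" unfolding frames_def by (rule ringed_induced[OF ringed_affine_space])

lemma frame_proj_in: "z : pts (frames 2 n) ==> frame_proj 2 n z : Kn n \<times> Gr 2 n"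
 by (auto simp: pts_frames frame_proj_def frame_point_Kn)

lemma pts_Kn_Gr: "pts (Kn_Gr 2 n) = (Kn n \<times> Gr 2 n :: ((nat => 'k::field) \<times> _) set)"
proof -
 have "preim (frames 2 n) (frame_proj 2 n) (Kn n \<times> Gr 2 n) = (pts (frames 2 n) :: (nat => 'k) set)"
  using frame_proj_in by (auto simp: preim_def)
 hence "opn (Kn_Gr 2 n) (Kn n \<times> Gr 2 n :: ((nat => 'k) \<times> _) set)"
  unfolding openin_Kn_Gr using openin_topspace by auto
 moreover have "pts (Kn_Gr 2 n) <= (Kn n \<times> Gr 2 n :: ((nat => 'k) \<times> _) set)"
  using openin_topspace[of "ktop (Kn_Gr 2 n)"] unfolding openin_Kn_Gr by blast
 ultimately show ?thesis using openin_subset by blast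
qed

lemma kreg_Kn_Gr: "kreg (Kn_Gr d n) U f <-> opn (Kn_Gr d n) U &
  kreg (frames d n) (preim (frames d n) (frame_proj d n) U) (%z. f (frame_proj d n z))"
 unfolding openin_Kn_Gr by (simp add: Kn_Gr_def Let_def comp_def)

lemma morphism_frame_proj: "morphism (frames 2 n) (Kn_Gr 2 n) (frame_proj 2 n)"
 by (rule morphismI) (insert frame_proj_in, auto simp: pts_Kn_Gr openin_Kn_Gr kreg_Kn_Gr preim_def)

lemma ringed_Kn_Gr: "ringed (Kn_Gr 2 n :: (_, 'k::field) kspace)"
 by (rule ringed_quotient[OF ringed_frames]) (auto simp: pts_Kn_Gr openin_Kn_Gr kreg_Kn_Gr)

lemma ringed_affine_nash: "ringed (affine_nash 2 n V)"
 unfolding affine_nash_def by (rule ringed_induced[OF ringed_Kn_Gr])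

lemma kreg_frames_pol:
 assumes g: "g : pols (3 * n)"
 shows "kreg (frames 2 n) (pts (frames 2 n)) (pev g)"
proof -
 let ?S = "{z :: nat => 'a : Kn (3 * n). frame_span 2 n z : Gr 2 n}"
 have o: "openin (zariski (3 * n)) (Kn (3 * n) :: (nat => 'a) set)" using openin_topspace[of "zariski (3 * n)"] by simp
 have 1: "kreg (affine_space (3 * n)) (Kn (3 * n)) (pev g)" unfolding kreg_affine_space
 proof (intro conjI ballI o)
  fix x
  show "EX ga:pols (3 * n). EX h:pols (3 * n). pev h x ~= 0 &
   (ALL y:Kn (3 * n). pev h y ~= 0 --> pev g y = pev ga y / pev h y)"
  proof (rule bexI[OF _ g])
   show "EX h:pols (3 * n). pev h x ~= 0 & (ALL y:Kn (3 * n). pev h y ~= 0 --> pev g y = pev g y / pev h y)"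
    by (rule bexI[where x = "pconst 1"]) simp_all
  qed
 qed
 have e: "pts (frames 2 n) = Kn (3 * n) Int ?S"
  unfolding pts_frames by (simp only: Collect_conj_eq Int_assoc Int_absorb Collect_mem_eq Int_left_absorb)
 have "kreg (frames 2 n) (Kn (3 * n) Int ?S) (pev g)"
  unfolding frames2 by (rule kreg_induced_subset[OF 1]) (simp add: o)
 thus ?thesis unfolding e .
qed

definition plupol :: "nat => nat => nat => 'k::field pol" where
 "plupol n i j = pvar (n + i) * pvar (2 * n + j) - pvar (n + j) * pvar (2 * n + i)"

lemma plupol_pols: "i < n ==> j < n ==> plupol n i j : pols (3 * n)" unfolding plupol_def by simp

lemma pol_eval_plupol: "i < n ==> j < n ==> pev (plupol n i j) z = plu (frame_vec n z 0) (frame_vec n z (Suc 0)) i j"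
 by (simp add: plupol_def plu_def frame_vec_def mult_2)

lemma kreg_plr:
 assumes "k < n" "l < n" "i < n" "j < n"
 shows "kreg (Kn_Gr 2 n :: (_, 'k::field) kspace) {x : Kn n \<times> Gr 2 n. snd x : plc k l} (%x. plr k l (snd x) i j)"
proof -
 let ?F = "frames 2 n :: (nat => 'k, 'k) kspace"
 let ?U = "{x : Kn n \<times> Gr 2 n. snd x : (plc k l :: (nat => 'k) set set)}"
 note R = ringed_frames[of 2 n, where 'a = 'k]
 note kl = kreg_frames_pol[OF plupol_pols[OF assms(1,2)], where 'a = 'k]
 note ij = kreg_frames_pol[OF plupol_pols[OF assms(3,4)], where 'a = 'k]
 let ?D = "{z : pts ?F. pev (plupol n k l) z ~= 0}"
 have D: "preim ?F (frame_proj 2 n) ?U = ?D" using frame_proj_in[where 'a = 'k, of _ n]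
  by (auto simp: preim_def frame_proj_def frame_span_lin2 lin2_in_plc pol_eval_plupol[OF assms(1,2)])
 have o: "opn ?F ?D" by (rule ringed_nonzero[OF R kl])
 have oU: "opn (Kn_Gr 2 n) ?U" unfolding openin_Kn_Gr D using o by auto
 have "kreg ?F ?D (%z. pev (plupol n i j) z * inverse (pev (plupol n k l) z))"
  by (rule ringed_mult[OF R ringed_restrict[OF R ij o] ringed_inverse[OF R kl]]) auto
 hence "kreg ?F ?D (%z. plr k l (snd (frame_proj 2 n z)) i j)"
 proof (rule ringed_cong[OF R])
  fix z assume z: "z : ?D"
  show "pev (plupol n i j) z * inverse (pev (plupol n k l) z) = plr k l (snd (frame_proj 2 n z)) i j"
   using z assms by (simp add: frame_proj_def frame_span_lin2 pol_eval_plupol plr_lin2 divide_inverse)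
 qed
 thus ?thesis using oU by (simp add: kreg_Kn_Gr D)
qed

text \<open>Regular entries give a morphism to the frames, which is composed with the projection
  \<open>frame_proj\<close>.\<close>

lemma morphism_Kn_Gr:
 fixes p a b :: "'x => nat => 'k::field"
 assumes X: "ringed X"
  and K: "!!x. x : pts X ==> p x : Kn n" "!!x. x : pts X ==> a x : Kn n" "!!x. x : pts X ==> b x : Kn n"
  and G: "!!x. x : pts X ==> lin2 (a x) (b x) : Gr 2 n"
  and k: "!!i. i < n ==> kreg X (pts X) (%x. p x i)" "!!i. i < n ==> kreg X (pts X) (%x. a x i)"
   "!!i. i < n ==> kreg X (pts X) (%x. b x i)"
 shows "morphism X (Kn_Gr 2 n) (%x. (p x, lin2 (a x) (b x)))"
proof -
 define m where "m = (%x. mkframe n (p x) (a x) (b x))"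
 have "kreg X (pts X) (%x. m x i)" if "i < 3 * n" for i using that k(1)[of i] k(2)[of "i - n"] k(3)[of "i - 2 * n"]
  by (cases "i < n"; cases "i < 2 * n") (auto simp: m_def mkframe_def)
 hence 1: "morphism X (affine_space (3 * n)) m" by (rule morphism_into_affine[OF X]) (simp_all add: m_def mkframe_Kn)
 have "m x : {z : Kn (3 * n). frame_span 2 n z : Gr 2 n}" if "x : pts X" for x
  using K[OF that] G[OF that] by (simp add: m_def mkframe_Kn frame_span_lin2 mkframe_simps)
 from morphism_into_induced[OF 1 X this] have "morphism X (frames 2 n) m" by (simp add: frames2)
 from morphism_comp[OF this morphism_frame_proj]
 have M: "morphism X (Kn_Gr 2 n) (%x. frame_proj 2 n (m x))" .
 have e: "frame_proj 2 n (m x) = (p x, lin2 (a x) (b x))" if "x : pts X" for x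
  using K[OF that] by (simp add: m_def frame_proj_def frame_span_lin2 mkframe_simps)
 have s: "{x : pts X. frame_proj 2 n (m x) : W} = {x : pts X. (p x, lin2 (a x) (b x)) : W}" for W using e by auto
 show ?thesis
 proof (rule morphismI)
  show "(p x, lin2 (a x) (b x)) : pts (Kn_Gr 2 n)" if "x : pts X" for x
   using morphism_maps[OF M that] e[OF that] by simp
  show "opn X {x : pts X. (p x, lin2 (a x) (b x)) : W}" if "opn (Kn_Gr 2 n) W" for W
   using morphism_open[OF M that] by (simp add: s)
  show "kreg X {x : pts X. (p x, lin2 (a x) (b x)) : W} (%x. f (p x, lin2 (a x) (b x)))" if "kreg (Kn_Gr 2 n) W f" for W f
  proof -
   have "kreg X {x : pts X. (p x, lin2 (a x) (b x)) : W} (%x. f (frame_proj 2 n (m x)))"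
    using morphism_kreg[OF M that] by (simp add: s)
   thus ?thesis by (rule ringed_cong[OF X]) (simp add: e)
  qed
 qed
qed

lemma open_frames_principal:
 fixes z0 :: "nat => 'k::field"
 assumes "opn (frames 2 n) N" "z0 : N"
 obtains f where "f : pols (3 * n)" "pev f z0 ~= 0" "!!z. z : pts (frames 2 n) ==> pev f z ~= 0 ==> z : N"
proof -
 let ?S = "{z :: nat => 'k : Kn (3 * n). frame_span 2 n z : Gr 2 n}"
 obtain N' where N': "openin (zariski (3 * n)) N'" "N = N' Int ?S"
  using assms(1) by (auto simp: frames2 openin_subtopology)
 obtain f where "f : pols (3 * n)" "pev f z0 ~= 0" "{y : Kn (3 * n). pev f y ~= 0} <= N'"
  using zariski_base[OF N'(1), of z0] assms(2) N'(2) by blast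
 thus ?thesis using that[of f] N'(2) by (auto simp: pts_frames)
qed

text \<open>Regularity on the quotient is tested on frames, where functions are locally quotients of
  polynomials in the frame entries.\<close>

lemma kreg_nash_local:
 fixes z0 :: "nat => 'k::field"
 assumes f: "kreg (induced (Kn_Gr 2 n) S) N f" and z0: "z0 : pts (frames 2 n)" "frame_proj 2 n z0 : N"
 obtains G H where "G : pols (3 * n)" "H : pols (3 * n)" "pev H z0 ~= 0"
  "!!z. z : pts (frames 2 n) ==> pev H z ~= 0 ==> frame_proj 2 n z : S ==>
   frame_proj 2 n z : N & f (frame_proj 2 n z) = pev G z / pev H z"
proof -
 let ?p = "preim (frames 2 n) (frame_proj 2 n)"
 obtain N'' where N'': "opn (Kn_Gr 2 n) N''" "N = N'' Int S" using f by (auto simp: kreg_induced openin_subtopology)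
 obtain W g where W: "frame_proj 2 n z0 : W" "kreg (Kn_Gr 2 n) W g" "ALL y:W Int N. f y = g y"
  using f z0(2) unfolding kreg_induced by blast
 have oW: "opn (frames 2 n) (?p (N'' Int W))"
  using openin_Int[OF N''(1), of W] W(2) by (simp add: kreg_Kn_Gr openin_Kn_Gr)
 have z0W: "z0 : ?p (N'' Int W)" using z0 W(1) N''(2) by (simp add: preim_def)
 obtain f1 where f1: "f1 : pols (3 * n)" "pev f1 z0 ~= 0"
   "!!z. z : pts (frames 2 n) ==> pev f1 z ~= 0 ==> z : ?p (N'' Int W)" using open_frames_principal[OF oW z0W] by blast
 have kg: "kreg (frames 2 n) (?p W) (%z. g (frame_proj 2 n z))" using W(2) by (simp add: kreg_Kn_Gr)
 have "z0 : ?p W" using z0W by (simp add: preim_def)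
 then obtain W' g' where W': "z0 : W'" "kreg (affine_space (3 * n)) W' g'" "ALL y:W' Int ?p W. g (frame_proj 2 n y) = g' y"
  using kg unfolding frames2 kreg_induced by blast
 obtain G0 H0 where GH: "G0 : pols (3 * n)" "H0 : pols (3 * n)" "pev H0 z0 ~= 0"
   "ALL y:W'. pev H0 y ~= 0 --> g' y = pev G0 y / pev H0 y" using W'(1,2) unfolding kreg_affine_space by blast
 have oW': "openin (zariski (3 * n)) W'" using W'(2) by (simp add: kreg_affine_space)
 obtain f0 where f0: "f0 : pols (3 * n)" "pev f0 z0 ~= 0" "{y : Kn (3 * n). pev f0 y ~= 0} <= W'"
  using zariski_base[OF oW' W'(1)] by blast
 show ?thesis
 proof (rule that[of "G0 * (f0 * f1)" "H0 * (f0 * f1)"])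
  fix z assume z: "z : pts (frames 2 n)" "pev (H0 * (f0 * f1)) z ~= 0" "frame_proj 2 n z : S"
  hence ne: "pev H0 z ~= 0" "pev f0 z ~= 0" "pev f1 z ~= 0" by auto
  have 1: "z : ?p (N'' Int W)" by (rule f1(3)[OF z(1) ne(3)])
  have 2: "z : W'" using f0(3) ne(2) z(1) by (auto simp: pts_frames)
  have 3: "frame_proj 2 n z : N" "frame_proj 2 n z : W" using 1 z(3) N''(2) by (auto simp: preim_def)
  have "z : ?p W" using 1 by (simp add: preim_def)
  thus "frame_proj 2 n z : N & f (frame_proj 2 n z) = pev (G0 * (f0 * f1)) z / pev (H0 * (f0 * f1)) z"
   using 3 W(3) W'(3) GH(4) 2 ne by simp
 qed (use GH f0 f1 in auto)
qed

subsection \<open>Polynomial frames of tangent planes\<close>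

definition pvec :: "nat => (nat => 'k::field pol) => (nat => 'k) => nat => 'k" where
 "pvec n A x = (%t. if t < n then pev (A t) x else 0)"

lemma pvec_Kn: "pvec n A x : Kn n" by (simp add: pvec_def Kn_def)

lemma tangent_space_dpol: "v : tsp n V x <-> v : Kn n & (ALL f:vanishing_ideal n V. dpol n f x v = 0)"
 by (simp add: tangent_space_def dpol_def)

lemma tangent_space_subspace: "kvec.subspace (tsp n V x)" unfolding kvec.subspace_def
proof (intro conjI ballI allI)
 show "v + w : tsp n V x" if "v : tsp n V x" "w : tsp n V x" for v w unfolding tangent_space_dpol
 proof (intro conjI ballI)
  show "v + w : Kn n" using that by (simp add: tangent_space_dpol Kn_def)
  show "dpol n f x (v + w) = 0" if "f : vanishing_ideal n V" for f
   using dpol_linear[of n f x 1 v 1 w] that `v : _` `w : _` by (simp add: tangent_space_dpol plus_fun_def)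
 qed
 show "vscale c v : tsp n V x" if "v : tsp n V x" for c v unfolding tangent_space_dpol
 proof (intro conjI ballI)
  show "vscale c v : Kn n" using that by (simp add: tangent_space_dpol Kn_def vscale_def)
  show "dpol n f x (vscale c v) = 0" if "f : vanishing_ideal n V" for f
   using dpol_linear[of n f x c v 0 v] that `v : _` by (simp add: tangent_space_dpol vscale_def)
 qed
qed (auto simp: tangent_space_dpol Kn_def dpol_def)

lemma pol_eval_derivative_along: "pev (SUM t<n. pol_deriv t f * A t) x = dpol n f x (pvec n A x)"
 by (simp add: pol_eval_sum dpol_def pvec_def)

lemma dpol_sum: "dpol n f x (%t. SUM i:I. aal i * w i t) = (SUM i:I. aal i * dpol n f x (w i))"
 unfolding dpol_def sum_distrib_left by (subst sum.swap) (simp add: mult_ac)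

text \<open>Gaussian elimination: \<open>W i\<close> for \<open>i \<in> I\<close> are polynomial vector fields spanning all tangent spaces near \<open>x0\<close>,
  those with index \<open>k\<close> and \<open>l\<close> spanning the tangent space at \<open>x0\<close>. A field transversal to it is removed by means of
  an equation of \<open>V\<close> with nonvanishing derivative along the field.\<close>

definition frsys :: "nat => (nat => 'k::field) set => (nat => 'k) => nat => nat => nat set => (nat => nat => 'k pol) => 'k pol => bool" where
 "frsys n V x0 k l I W h <-> finite I & k : I & l : I & h : pols n & pev h x0 ~= 0 &
  (ALL i:I. ALL t<n. W i t : pols n) &
  (ALL x:V. pev h x ~= 0 --> (ALL v:tangent_space n V x. EX aal. v = (%t. SUM i:I. aal i * pvec n (W i) x t))) &
  pvec n (W k) x0 : tsp n V x0 & pvec n (W l) x0 : tsp n V x0 &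
  (ALL aal. (%t. SUM i:I. aal i * pvec n (W i) x0 t) : tsp n V x0 --> (ALL i:I - {k, l}. aal i = 0)) &
  plu (pvec n (W k) x0) (pvec n (W l) x0) k l ~= 0"

lemma frsys_step:
 assumes s: "frsys n V x0 k l I W h" and j: "j : I - {k, l}"
 shows "EX W' h'. frsys n V x0 k l (I - {j}) W' h'"
proof -
 have I: "finite I" "k : I" "l : I" and h: "h : pols n" "pev h x0 ~= 0"
  and W: "!!i t. i : I ==> t < n ==> W i t : pols n"
  and span: "!!x v. x : V ==> pev h x ~= 0 ==> v : tsp n V x ==> EX aal. v = (%t. SUM i:I. aal i * pvec n (W i) x t)"
  and kl: "pvec n (W k) x0 : tsp n V x0" "pvec n (W l) x0 : tsp n V x0"
  and ind: "!!aal i. (%t. SUM i:I. aal i * pvec n (W i) x0 t) : tsp n V x0 ==> i : I - {k, l} ==> aal i = 0"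
  and plu: "plu (pvec n (W k) x0) (pvec n (W l) x0) k l ~= 0" using s unfolding frsys_def by simp_all
 have jI: "j : I" using j by simp
 have "pvec n (W j) x0 ~: tsp n V x0"
 proof
  assume a: "pvec n (W j) x0 : tsp n V x0"
  have "(%t. SUM i:I. (if i = j then 1 else 0) * pvec n (W i) x0 t) = pvec n (W j) x0"
   using I(1) jI by (simp add: if_distrib[of "%c. c * _"] cong: if_cong)
  hence "(if j = j then 1 else 0 :: 'a) = 0" using ind[of "%i. if i = j then 1 else 0" j] a j by simp
  thus False by simp
 qed
 then obtain f where f: "f : vanishing_ideal n V" "dpol n f x0 (pvec n (W j) x0) ~= 0"
  unfolding tangent_space_dpol using pvec_Kn by blast
 have fp: "f : pols n" using f(1) by (simp add: vanishing_ideal_def)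
 define D where "D i = (SUM t<n. pol_deriv t f * W i t)" for i
 \<comment> \<open>The combination of \<open>W i\<close> and \<open>W j\<close> that the
   differential of \<open>f\<close> annihilates.\<close>
 define W' where "W' i t = D j * W i t - D i * W j t" for i t
 have Dp: "D i : pols n" if "i : I" for i unfolding D_def using W[OF that] fp by (intro pols_sum) auto
 have De: "pev (D i) x = dpol n f x (pvec n (W i) x)" for i x unfolding D_def by (rule pol_eval_derivative_along)
 have pv: "pvec n (W' i) x t = pev (D j) x * pvec n (W i) x t - pev (D i) x * pvec n (W j) x t" for i x t
  by (simp add: pvec_def W'_def)
 have pvj: "pvec n (W' j) x t = 0" for x t by (simp add: pv)
 have ka: "pev (D j) x0 ~= 0" using f(2) by (simp add: De)
 have tan: "pvec n (W' i) x0 : tsp n V x0" if i: "pvec n (W i) x0 : tsp n V x0" for i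
 proof -
  have "pev (D i) x0 = 0" using i f(1) by (simp add: De tangent_space_dpol)
  hence "pvec n (W' i) x0 = vscale (pev (D j) x0) (pvec n (W i) x0)" by (auto simp: pv vscale_def)
  thus ?thesis using kvec.subspace_scale[OF tangent_space_subspace i] by simp
 qed
 have Dk: "pev (D i) x0 = 0" if "pvec n (W i) x0 : tsp n V x0" for i
  using that f(1) by (simp add: De tangent_space_dpol)
 have plu': "plu (pvec n (W' k) x0) (pvec n (W' l) x0) k l = pev (D j) x0 * pev (D j) x0 * plu (pvec n (W k) x0) (pvec n (W l) x0) k l"
  by (simp add: plu_def pv Dk[OF kl(1)] Dk[OF kl(2)] algebra_simps)
 have span': "EX aal. v = (%t. SUM i:I - {j}. aal i * pvec n (W' i) x t)"
  if x: "x : V" "pev (h * D j) x ~= 0" "v : tsp n V x" for x v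
 proof -
  have ne: "pev h x ~= 0" "pev (D j) x ~= 0" using x(2) by auto
  obtain aal where aal: "v = (%t. SUM i:I. aal i * pvec n (W i) x t)" using span[OF x(1) ne(1) x(3)] by blast
  have "0 = dpol n f x v" using x(3) f(1) by (simp add: tangent_space_dpol)
  hence 0: "(SUM i:I. aal i * pev (D i) x) = 0" unfolding aal dpol_sum De by simp
  have "pev (D j) x * v t = (SUM i:I. aal i * pvec n (W' i) x t)" for t
  proof -
   have "(SUM i:I. aal i * pvec n (W' i) x t) = pev (D j) x * v t - (SUM i:I. aal i * pev (D i) x) * pvec n (W j) x t"
    unfolding pv aal by (simp add: right_diff_distrib sum_subtractf sum_distrib_left sum_distrib_right mult_ac)
   thus ?thesis using 0 by simp
  qed
  also have "(SUM i:I. aal i * pvec n (W' i) x t) = (SUM i:I - {j}. aal i * pvec n (W' i) x t)" for t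
   using sum.remove[OF I(1) jI, of "%i. aal i * pvec n (W' i) x t"] by (simp add: pvj)
  finally have e: "pev (D j) x * v t = (SUM i:I - {j}. aal i * pvec n (W' i) x t)" for t .
  have "v = (%t. SUM i:I - {j}. (aal i / pev (D j) x) * pvec n (W' i) x t)"
  proof
   fix t
   have "(SUM i:I - {j}. (aal i / pev (D j) x) * pvec n (W' i) x t) = (SUM i:I - {j}. aal i * pvec n (W' i) x t) / pev (D j) x"
    by (simp add: sum_divide_distrib)
   thus "v t = (SUM i:I - {j}. (aal i / pev (D j) x) * pvec n (W' i) x t)" unfolding e[symmetric] using ne(2) by simp
  qed
  thus ?thesis by (rule exI[where x = "%i. aal i / pev (D j) x"])
 qed
 have ind': "aal i = 0" if a: "(%t. SUM i:I - {j}. aal i * pvec n (W' i) x0 t) : tsp n V x0" and i: "i : I - {j} - {k, l}" for aal i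
 proof -
  \<comment> \<open>With these coefficients the combination of the \<open>W' i\<close> at
    \<open>x0\<close> becomes one of the \<open>W i\<close>, whose independence modulo the tangent
    space is known.\<close>
  define be where "be m = (if m = j then - (SUM i:I - {j}. aal i * pev (D i) x0) else pev (D j) x0 * aal m)" for m
  have "(SUM i:I. be i * pvec n (W i) x0 t) = (SUM i:I - {j}. aal i * pvec n (W' i) x0 t)" for t
  proof -
   have "(SUM i:I. be i * pvec n (W i) x0 t) = be j * pvec n (W j) x0 t + (SUM i:I - {j}. be i * pvec n (W i) x0 t)"
    by (rule sum.remove[OF I(1) jI])
   also have "(SUM i:I - {j}. be i * pvec n (W i) x0 t) = (SUM i:I - {j}. pev (D j) x0 * aal i * pvec n (W i) x0 t)"
    by (rule sum.cong) (auto simp: be_def)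
   also have "be j = - (SUM i:I - {j}. aal i * pev (D i) x0)" by (simp add: be_def)
   finally show ?thesis
    unfolding pv by (simp add: right_diff_distrib sum_subtractf sum_distrib_left sum_distrib_right mult_ac)
  qed
  hence "(%t. SUM i:I. be i * pvec n (W i) x0 t) : tsp n V x0" using a by simp
  from ind[OF this, of i] i have "be i = 0" by simp
  thus ?thesis using ka i by (simp add: be_def)
 qed
 have "frsys n V x0 k l (I - {j}) W' (h * D j)" unfolding frsys_def
 proof (intro conjI ballI allI impI)
  show "plu (pvec n (W' k) x0) (pvec n (W' l) x0) k l ~= 0" using plu ka by (simp add: plu')
  show "W' i t : pols n" if "i : I - {j}" "t < n" for i t unfolding W'_def using W[of _ t] Dp jI that by auto
 qed (use I j h ka Dp[OF jI] tan kl span' ind' in auto)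
 thus ?thesis by blast
qed

lemma frsys_reduce:
 assumes "frsys n V x0 k l I W h"
 shows "EX W' h'. frsys n V x0 k l {k, l} W' h'" using assms
proof (induction "card (I - {k, l})" arbitrary: I W h)
 case 0
 have "finite I" "k : I" "l : I" using 0(2) by (auto simp: frsys_def)
 hence "I = {k, l}" using 0(1) by auto
 thus ?case using 0(2) by blast
next
 case (Suc m)
 have fin: "finite (I - {k, l})" using Suc(3) by (auto simp: frsys_def)
 obtain j where j: "j : I - {k, l}" using Suc(2) by (metis card.empty ex_in_conv nat.distinct(1))
 obtain W' h' where s: "frsys n V x0 k l (I - {j}) W' h'" using frsys_step[OF Suc(3) j] by blast
 have "I - {j} - {k, l} = I - {k, l} - {j}" by auto
 hence "m = card (I - {j} - {k, l})" using Suc(2) fin j by simp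
 from Suc(1)[OF this s] show ?case .
qed

text \<open>Elimination starts from a constant basis of the whole space that extends the echelon
  basis of the tangent plane at \<open>x0\<close>. Near \<open>x0\<close> the two remaining fields
  span a space containing the tangent space, which is enough to move from the plane at
  \<open>x0\<close> to nearby tangent planes.\<close>

lemma tangent_frames:
 fixes V :: "(nat => 'k::field) set"
 assumes T: "tsp n V x0 : Gr 2 n"
 obtains h A B where "h : pols n" "pev h x0 ~= 0" "!!t. t < n ==> A t : pols n" "!!t. t < n ==> B t : pols n"
  "tsp n V x0 = lin2 (pvec n A x0) (pvec n B x0)"
  "!!x. x : V ==> pev h x ~= 0 ==> tsp n V x <= lin2 (pvec n A x) (pvec n B x)"
proof -
 define W where "W = tsp n V x0"
 obtain k l where kl: "k < n" "l < n" "W : plc k l" using Gr2_plc T unfolding W_def by blast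
 define a where "a = (%i. plr k l W i l)"
 define b where "b = (%i. plr k l W k i)"
 note nf = plc_normal_frame[OF kl(3) T[folded W_def], folded a_def b_def]
 obtain a' b' where ab': "W = lin2 a' b'" "plu a' b' k l ~= 0" using kl(3) by (auto simp: plc_def)
 have pl: "plr k l W i j = plu a' b' i j / plu a' b' k l" for i j unfolding ab'(1) by (rule plr_lin2[OF ab'(2)])
 have ab: "a k = 1" "a l = 0" "b k = 0" "b l = 1" using ab'(2) by (simp_all add: a_def b_def pl) (simp_all add: plu_def)
 have ne: "k ~= l" using ab by auto
 define w where "w i = (if i = k then a else if i = l then b else (%t. if t = i then 1 else 0))" for i
 define F where "F i t = pconst (w i t)" for i t
 have wK: "w i : Kn n" if "i < n" for i using nf(3,4) that by (auto simp: w_def Kn_def)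
 have pF: "pvec n (F i) x = w i" if "i < n" for i x using wK[OF that] by (auto simp: pvec_def F_def Kn_def)
 have S: "(SUM i<n. aal i * w i t) = aal k * a t + aal l * b t + (if t = k | t = l | ~ t < n then 0 else aal t)" for aal t
 proof -
  have "(SUM i<n. aal i * w i t) = aal k * w k t + (aal l * w l t + (SUM i:{..<n} - {k} - {l}. aal i * w i t))"
   using sum.remove[of "{..<n}" k "%i. aal i * w i t"] sum.remove[of "{..<n} - {k}" l "%i. aal i * w i t"] kl ne by simp
  also have "(SUM i:{..<n} - {k} - {l}. aal i * w i t) = (SUM i:{..<n} - {k} - {l}. if t = i then aal i else 0)"
   by (rule sum.cong) (auto simp: w_def)
  also have "... = (if t = k | t = l | ~ t < n then 0 else aal t)" by (subst sum.delta') auto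
  finally show ?thesis using ne by (simp add: w_def)
 qed
 have pS: "(SUM i<n. aal i * pvec n (F i) x t) = (SUM i<n. aal i * w i t)" for aal x t
  by (rule sum.cong) (simp_all add: pF)
 have "frsys n V x0 k l {..<n} F (pconst 1)" unfolding frsys_def
 proof (intro conjI ballI allI impI)
  fix x v assume v: "v : tsp n V x"
  define aal where "aal i = (if i = k | i = l then v i else v i - v k * a i - v l * b i)" for i
  have vK: "v t = 0" "a t = 0" "b t = 0" if "~ t < n" for t
   using v nf(3,4) that by (auto simp: tangent_space_dpol Kn_def)
  have "v = (%t. SUM i<n. aal i * pvec n (F i) x t)" unfolding pS S using ab vK kl by (auto simp: aal_def fun_eq_iff)
  thus "EX aal. v = (%t. SUM i<n. aal i * pvec n (F i) x t)" by (rule exI[where x = aal])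
 next
  show "pvec n (F k) x0 : tsp n V x0" "pvec n (F l) x0 : tsp n V x0"
   using kl ne nf(2) lin2_left lin2_right W_def by (auto simp: pF w_def)
 next
  fix aal i assume a0: "(%t. SUM i<n. aal i * pvec n (F i) x0 t) : tsp n V x0" and i: "i : {..<n} - {k, l}"
  hence "(%t. SUM i<n. aal i * w i t) : lin2 a b" using nf(2) unfolding pS W_def by simp
  then obtain s t where st: "ALL i. (SUM j<n. aal j * w j i) = s * a i + t * b i" by (rule lin2E)
  have "aal k = s" using st[rule_format, of k] ab unfolding S by simp
  moreover have "aal l = t" using st[rule_format, of l] ab unfolding S by simp
  ultimately show "aal i = 0" using st[rule_format, of i] i unfolding S by simp
 next
  show "plu (pvec n (F k) x0) (pvec n (F l) x0) k l ~= 0" using kl ne nf(1) by (simp add: pF w_def)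
 qed (insert kl, auto simp: F_def)
 from frsys_reduce[OF this] obtain W' h where s: "frsys n V x0 k l {k, l} W' h" by blast
 have s1: "h : pols n" "pev h x0 ~= 0" "!!t. t < n ==> W' k t : pols n" "!!t. t < n ==> W' l t : pols n"
  and s2: "!!x v. x : V ==> pev h x ~= 0 ==> v : tsp n V x ==> EX aal. v = (%t. SUM i:{k, l}. aal i * pvec n (W' i) x t)"
  and s3: "pvec n (W' k) x0 : tsp n V x0" "pvec n (W' l) x0 : tsp n V x0"
   "plu (pvec n (W' k) x0) (pvec n (W' l) x0) k l ~= 0" using s unfolding frsys_def by simp_all
 show ?thesis
 proof (rule that[OF s1(1,2)])
  show "W' k t : pols n" "W' l t : pols n" if "t < n" for t using s1(3,4) that by auto
  show "tsp n V x0 = lin2 (pvec n (W' k) x0) (pvec n (W' l) x0)"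
   using lin2_eq(1)[of "pvec n (W' k) x0" a b "pvec n (W' l) x0" k l] s3 nf(2) W_def by simp
  show "tsp n V x <= lin2 (pvec n (W' k) x) (pvec n (W' l) x)" if xv: "x : V" "pev h x ~= 0" for x
  proof
   fix v assume "v : tsp n V x"
   then obtain aal where "v = (%t. SUM i:{k, l}. aal i * pvec n (W' i) x t)" using s2[OF xv] by blast
   thus "v : lin2 (pvec n (W' k) x) (pvec n (W' l) x)" using ne by (intro lin2I[of _ "aal k" _ "aal l"]) simp
  qed
 qed
qed

subsection \<open>Tangent spaces and derivations\<close>

context field_hom
begin

lemma dern_pgen:
 assumes E: "place e E" and D: "derivation e D" and G: "G <= pdom E" "D ` G <= pdom E"
  and q: "q : pgen e G E"
 shows "D q : pdom E" using q
proof induction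
 case (const c)
 show ?case using pdom_0[OF E] by (simp add: dern_const[OF D])
next
 case (mult q r)
 thus ?case unfolding dern_mult[OF D]
  by (intro pdom_add[OF E] pdom_mult[OF E] pgen_in_dom[OF E G(1) mult(1)] pgen_in_dom[OF E G(1) mult(2)])
next
 case (inverse q a)
 thus ?case unfolding dern_inverse[OF D] by (intro pdom_uminus[OF E] pdom_mult[OF E] pdom_inverse[OF E])
qed (insert G, auto simp: dern_add[OF D] pdom_add[OF E])

lemma dern_peval_value:
 assumes E: "place e E" and D: "derivation e D" and f: "f : pols n"
  and c: "!!k. k < n ==> E (c k) (p k)" "!!k. k < n ==> E (D (c k)) (v k)"
 shows "E (D (peval e f c)) (dpol n f p v)"
proof -
 have "D (peval e f c) = (SUM i<n. peval e (pol_deriv i f) c * D (c i))"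
  by (rule dern_peval[OF f dern_add[OF D] dern_mult[OF D] dern_const[OF D]])
 moreover have "E (SUM i<n. peval e (pol_deriv i f) c * D (c i)) (SUM i<n. pev (pol_deriv i f) p * v i)"
 proof (rule place_sum[OF E])
  fix i assume i: "i : {..<n}"
  have "E (peval e (pol_deriv i f) c) (pev (pol_deriv i f) p)" by (rule place_peval[OF E pols_pol_deriv[OF f] c(1)])
  from place_mult[OF E this c(2)] i
  show "E (peval e (pol_deriv i f) c * D (c i)) (pev (pol_deriv i f) p * v i)" by simp
 qed
 ultimately show ?thesis by (simp add: dpol_def)
qed

end

context ffield
begin

context
 fixes U n V ph c x
 assumes co: "ccoords U n V ph c" and x: "x : U" "ph x : Kn n"
begin

lemma chart_place: "place e (ev X th x)"
proof -
 have "ev X th x (peval e 0 c) (pev 0 (ph x))" by (rule ccoordsD(2)[OF co x(1)]) simp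
 thus ?thesis using place_ev ev_pts by blast
qed

lemma tangent_iff: "v : tsp n V (ph x) <-> v : Kn n & (ALL f:pols n. peval e f c = 0 --> dpol n f (ph x) v = 0)"
 unfolding tangent_space_dpol vanishing_ideal_def using ccoordsD(4)[OF co] by auto

text \<open>Applying \<open>D\<close> to the relations among the coordinates yields the linear
  equations of the tangent space.\<close>

lemma dern_tangent:
 assumes D: "derivation e D" and v: "v : Kn n" "!!k. k < n ==> ev X th x (D (c k)) (v k)"
 shows "v : tsp n V (ph x)" unfolding tangent_iff
proof (intro conjI ballI impI v(1))
 fix f assume f: "f : pols n" "peval e f c = 0"
 have "ev X th x (D (peval e f c)) (dpol n f (ph x) v)"
  by (rule dern_peval_value[OF chart_place D f(1) ccoordsD(1)[OF co x(1)] v(2)])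
 thus "dpol n f (ph x) v = 0"
  using place_unique[OF chart_place _ place_0[OF chart_place]] by (simp add: f(2) dern_0[OF D])
qed

text \<open>The differential of \<open>q\<close> vanishes at the tangent vector \<open>u\<close>.\<close>

definition flat :: "(nat => 'k) => 'r => bool" where
 "flat u q <-> (EX g:pols n. EX h:pols n. pev h (ph x) ~= 0 & q * peval e h c = peval e g c &
  dpol n g (ph x) u * pev h (ph x) = pev g (ph x) * dpol n h (ph x) u)"

text \<open>Vanishing of the differential along \<open>u\<close> is preserved by the ring operations
  and by inverses of units.\<close>

lemma flat_pgen:
 assumes G: "!!g. g : G ==> flat u g" and q: "q : pgen e G (ev X th x)"
 shows "flat u q" using q
proof induction
 case (const a)
 show ?case unfolding flat_def by (rule bexI[where x = "pconst a"], rule bexI[where x = "pconst 1"]) auto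
next
 case (gen g)
 thus ?case by (rule G)
next
 case (add q r)
 obtain g h where 1: "g : pols n" "h : pols n" "pev h (ph x) ~= 0" "q * peval e h c = peval e g c"
  "dpol n g (ph x) u * pev h (ph x) = pev g (ph x) * dpol n h (ph x) u" using add(3) unfolding flat_def by blast
 obtain g' h' where 2: "g' : pols n" "h' : pols n" "pev h' (ph x) ~= 0" "r * peval e h' c = peval e g' c"
  "dpol n g' (ph x) u * pev h' (ph x) = pev g' (ph x) * dpol n h' (ph x) u" using add(4) unfolding flat_def by blast
 have a: "(q + r) * (peval e h c * peval e h' c) = peval e g c * peval e h' c + peval e g' c * peval e h c"
  unfolding 1(4)[symmetric] 2(4)[symmetric] by (simp add: algebra_simps)
 have b: "(dg * H' + G * dH' + (dg' * H + G' * dH)) * (H * H') = (G * H' + G' * H) * (dH * H' + H * dH')"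
  if "dg * H = G * dH" "dg' * H' = G' * dH'" for dg H G dH dg' H' G' dH' :: 'k using that by algebra
 show ?case unfolding flat_def by (rule bexI[where x = "g * h' + g' * h"], rule bexI[where x = "h * h'"])
   (insert 1(1-3) 2(1-3) a b[OF 1(5) 2(5)], simp_all)
next
 case (mult q r)
 obtain g h where 1: "g : pols n" "h : pols n" "pev h (ph x) ~= 0" "q * peval e h c = peval e g c"
  "dpol n g (ph x) u * pev h (ph x) = pev g (ph x) * dpol n h (ph x) u" using mult(3) unfolding flat_def by blast
 obtain g' h' where 2: "g' : pols n" "h' : pols n" "pev h' (ph x) ~= 0" "r * peval e h' c = peval e g' c"
  "dpol n g' (ph x) u * pev h' (ph x) = pev g' (ph x) * dpol n h' (ph x) u" using mult(4) unfolding flat_def by blast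
 have a: "(q * r) * (peval e h c * peval e h' c) = peval e g c * peval e g' c"
  unfolding 1(4)[symmetric] 2(4)[symmetric] by (simp add: algebra_simps)
 have b: "(dg * G' + G * dg') * (H * H') = (G * G') * (dH * H' + H * dH')"
  if "dg * H = G * dH" "dg' * H' = G' * dH'" for dg H G dH dg' H' G' dH' :: 'k using that by algebra
 show ?case unfolding flat_def by (rule bexI[where x = "g * g'"], rule bexI[where x = "h * h'"])
   (insert 1(1-3) 2(1-3) a b[OF 1(5) 2(5)], simp_all)
next
 case (inverse q a)
 obtain g h where 1: "g : pols n" "h : pols n" "pev h (ph x) ~= 0" "q * peval e h c = peval e g c"
  "dpol n g (ph x) u * pev h (ph x) = pev g (ph x) * dpol n h (ph x) u" using inverse(4) unfolding flat_def by blast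
 have q0: "q ~= 0" using place_nonzero[OF chart_place inverse(2,3)] .
 have "ev X th x (q * peval e h c) (a * pev h (ph x))"
  by (rule place_mult[OF chart_place inverse(2) ccoordsD(2)[OF co x(1) 1(2)]])
 hence "pev g (ph x) = a * pev h (ph x)" using place_unique[OF chart_place ccoordsD(2)[OF co x(1) 1(1)]] 1(4) by simp
 hence "pev g (ph x) ~= 0" using inverse(3) 1(3) by simp
 moreover have "inverse q * peval e g c = peval e h c" using q0 by (simp add: 1(4)[symmetric])
 ultimately show ?case unfolding flat_def
  by (intro bexI[where x = h] bexI[where x = g] conjI) (insert 1, simp_all add: mult.commute)
qed

lemma flat_coordinate:
 assumes u: "u : tsp n V (ph x)" and k: "k < n" and f: "flat u (c k)"
 shows "u k = 0"
proof -
 obtain g h where 1: "g : pols n" "h : pols n" "pev h (ph x) ~= 0" "c k * peval e h c = peval e g c"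
  "dpol n g (ph x) u * pev h (ph x) = pev g (ph x) * dpol n h (ph x) u" using f unfolding flat_def by blast
 have z: "pvar k * h - g : pols n" "peval e (pvar k * h - g) c = 0" using 1 k by simp_all
 hence "dpol n (pvar k * h - g) (ph x) u = 0" using u unfolding tangent_iff by blast
 hence d: "u k * pev h (ph x) + ph x k * dpol n h (ph x) u = dpol n g (ph x) u" using k by simp
 have "ev X th x 0 (pev (pvar k * h - g) (ph x))" using ccoordsD(2)[OF co x(1) z(1)] unfolding z(2) .
 hence "pev (pvar k * h - g) (ph x) = 0" using place_unique[OF chart_place place_0[OF chart_place]] by metis
 hence g: "pev g (ph x) = ph x k * pev h (ph x)" by simp
 have "u k * pev h (ph x) * pev h (ph x) = 0" using 1(5) unfolding d[symmetric] g by (simp add: algebra_simps)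
 thus ?thesis using 1(3) by simp
qed

text \<open>\<open>A\<close> and \<open>B\<close> are parameters with dual derivations
  \<open>E1\<close> and \<open>E2\<close>. A tangent vector is determined by the differentials of
  \<open>A\<close> and \<open>B\<close> on it, because these elements generate all coordinates;
  \<open>d1\<close> and \<open>d2\<close> realize independent values.\<close>

lemma tangent_plane:
 assumes A: "ev X th x A aal" and B: "ev X th x B be"
  and c: "!!k. k < n ==> c k : pgen e {A, B} (ev X th x)"
  and E: "derivation e E1" "derivation e E2" "E1 B = 0" "E2 A = 0"
  and a: "ev X th x (E1 A) a" "a ~= 0" and b: "ev X th x (E2 B) b" "b ~= 0"
  and d: "d1 : Kn n" "d2 : Kn n" "!!k. k < n ==> ev X th x (E1 (c k)) (d1 k)" "!!k. k < n ==> ev X th x (E2 (c k)) (d2 k)"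
 shows "tsp n V (ph x) = lin2 d1 d2 & (EX k l. plu d1 d2 k l ~= 0)"
proof -
 let ?p = "ph x" and ?T = "tsp n V (ph x)"
 have dT: "d1 : ?T" "d2 : ?T"
  by (rule dern_tangent[OF E(1) d(1)], erule d(3), rule dern_tangent[OF E(2) d(2)], erule d(4))
 obtain g h where 1: "g : pols n" "h : pols n" "pev h ?p ~= 0" "A * peval e h c = peval e g c"
  using ccoordsD(3)[OF co x(1) A] by blast
 obtain g' h' where 2: "g' : pols n" "h' : pols n" "pev h' ?p ~= 0" "B * peval e h' c = peval e g' c"
  using ccoordsD(3)[OF co x(1) B] by blast
 \<comment> \<open>Up to the square of \<open>pev h ?p\<close> this is the differential of
   \<open>A\<close>, written as the quotient of \<open>g\<close> by \<open>h\<close>, on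
   \<open>v\<close>.\<close>
 define LA where "LA v = dpol n g ?p v * pev h ?p - pev g ?p * dpol n h ?p v" for v
 define LB where "LB v = dpol n g' ?p v * pev h' ?p - pev g' ?p * dpol n h' ?p v" for v
 have jet: "dpol n g ?p d * pev h ?p - pev g ?p * dpol n h ?p d = s * pev h ?p * pev h ?p"
  if gh: "g : pols n" "h : pols n" "q * peval e h c = peval e g c" and q: "ev X th x q ka"
   and D: "derivation e D" "ev X th x (D q) s" "!!k. k < n ==> ev X th x (D (c k)) (d k)" for g h q ka D s d
 proof -
  note pl = chart_place and co2 = ccoordsD(2)[OF co x(1)]
  have v: "ev X th x (D (peval e f c)) (dpol n f ?p d)" if "f : pols n" for f
   by (rule dern_peval_value[OF pl D(1) that ccoordsD(1)[OF co x(1)] D(3)])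
  have "ev X th x (D (peval e g c)) (s * pev h ?p + ka * dpol n h ?p d)" unfolding gh(3)[symmetric] dern_mult[OF D(1)]
   by (rule place_add[OF pl place_mult[OF pl D(2) co2[OF gh(2)]] place_mult[OF pl q v[OF gh(2)]]])
  hence 1: "dpol n g ?p d = s * pev h ?p + ka * dpol n h ?p d" using place_unique[OF pl v[OF gh(1)]] by metis
  have "ev X th x (peval e g c) (ka * pev h ?p)" unfolding gh(3)[symmetric] by (rule place_mult[OF pl q co2[OF gh(2)]])
  hence "pev g ?p = ka * pev h ?p" using place_unique[OF pl co2[OF gh(1)]] by metis
  thus ?thesis unfolding 1 by (simp add: algebra_simps)
 qed
 have z: "ev X th x (E1 B) 0" "ev X th x (E2 A) 0" using E(3,4) place_0[OF chart_place] by simp_all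
 have LA: "LA d1 = a * pev h ?p * pev h ?p" "LA d2 = 0"
  using jet[OF 1(1,2,4) A E(1) a(1) d(3)] jet[OF 1(1,2,4) A E(2) z(2) d(4)] by (simp_all add: LA_def)
 have LB: "LB d2 = b * pev h' ?p * pev h' ?p" "LB d1 = 0"
  using jet[OF 2(1,2,4) B E(2) b(1) d(4)] jet[OF 2(1,2,4) B E(1) z(1) d(3)] by (simp_all add: LB_def)
 have LA0: "LA d1 ~= 0" and LB0: "LB d2 ~= 0" using LA LB a b 1(3) 2(3) by simp_all
 have linA: "LA (%i. s * v i + t * w i) = s * LA v + t * LA w" for s t v w
  unfolding LA_def dpol_linear by (simp add: algebra_simps)
 have linB: "LB (%i. s * v i + t * w i) = s * LB v + t * LB w" for s t v w
  unfolding LB_def dpol_linear by (simp add: algebra_simps)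
 have sub: "(%i. s * v i + t * w i) : ?T" if "v : ?T" "w : ?T" for s t v w
  using that unfolding tangent_iff by (auto simp: Kn_def dpol_linear)
 have up: "v : lin2 d1 d2" if v: "v : ?T" for v
 proof -
  define s where "s = LA v / LA d1"
  define t where "t = LB v / LB d2"
  define w where "w = (%i. s * d1 i + t * d2 i)"
  \<comment> \<open>After subtraction of a combination of \<open>d1\<close> and \<open>d2\<close>
    both differentials vanish on the remainder, hence so do all its coordinates.\<close>
  define u where "u = (%i. 1 * v i + (- 1) * w i)"
  have uT: "u : ?T" unfolding u_def by (rule sub[OF v]) (unfold w_def, rule sub[OF dT])
  have LAw: "LA w = LA v" unfolding w_def linA using LA0 LA(2) by (simp add: s_def)
  have LBw: "LB w = LB v" unfolding w_def linB using LB0 LB(2) by (simp add: t_def)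
  have "LA u = 0" "LB u = 0" unfolding u_def linA linB using LAw LBw by simp_all
  hence "flat u A" "flat u B" unfolding flat_def LA_def LB_def using 1 2 by auto
  hence "flat u (c k)" if "k < n" for k using flat_pgen[OF _ c[OF that], of u] by blast
  hence "u k = 0" if "k < n" for k using flat_coordinate[OF uT that] that by blast
  moreover have "u : Kn n" using uT by (simp add: tangent_iff)
  ultimately have "u i = 0" for i by (cases "i < n") (auto simp: Kn_def)
  hence "v i = s * d1 i + t * d2 i" for i unfolding u_def w_def by (metis add_eq_0_iff mult_1 mult_minus1 minus_minus)
  thus ?thesis by (rule lin2I)
 qed
 have "lin2 d1 d2 <= ?T" unfolding lin2_def using sub[OF dT] by blast
 moreover have "EX k l. plu d1 d2 k l ~= 0"
 proof (rule ccontr)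
  assume "\<nexists>k l. plu d1 d2 k l ~= 0"
  hence p: "d2 l * d1 k = d1 l * d2 k" for k l unfolding plu_def by (metis eq_iff_diff_eq_0 mult.commute)
  have "d2 l * LA d1 = 0" for l
  proof -
   have "d2 l * LA d1 = LA (%k. d2 l * d1 k + 0 * d1 k)" unfolding linA by simp
   also have "(%k. d2 l * d1 k + 0 * d1 k) = (%k. d1 l * d2 k + 0 * d1 k)" using p by simp
   also have "LA ... = 0" unfolding linA by (simp add: LA(2))
   finally show ?thesis .
  qed
  hence "d2 l = 0" for l using LA0 by simp
  hence "d2 = (%i. 0 * d1 i + 0 * d1 i)" by auto
  hence "LB d2 = 0" using linB[of 0 d1 0 d1] by simp
  thus False using LB0 by simp
 qed
 ultimately show ?thesis using up by blast
qed

end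

end

subsection \<open>Tangent planes at toric places\<close>

definition cone_place :: "('k::field rat2 => 'k => bool) => int \<times> int => int \<times> int => bool" where
 "cone_place E u v <-> primitive u & primitive v & 0 < det2 u v & toric_place E (cone2 u v)"

text \<open>For a lattice basis \<open>e\<close>, \<open>f\<close> these derivations include the
  partial derivatives with respect to the torus coordinates \<open>mon e\<close> and
  \<open>mon f\<close>; see \<open>mon_deriv_dual\<close>.\<close>

definition mon_deriv :: "int => int => int \<times> int => 'k::field rat2 => 'k rat2" where
 "mon_deriv a b m q = mon m * (of_int a * D1 q + of_int b * D2 q)"

lemma mon_deriv_derivation: "derivation fconst (mon_deriv a b m)" unfolding derivation_def mon_deriv_def
 by (simp add: dern_add[OF D1_derivation] dern_add[OF D2_derivation] dern_mult[OF D1_derivation]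
   dern_mult[OF D2_derivation] dern_const[OF D1_derivation] dern_const[OF D2_derivation] algebra_simps)

lemma mon_deriv_mon: "mon_deriv a b (- m) (mon m) = (of_int (a * fst m + b * snd m) :: 'k::field rat2)"
proof -
 have i: "inverse (mon m) * mon m = (1 :: 'k rat2)" by simp
 have "mon_deriv a b (- m) (mon m) = (of_int a * of_int (fst m) + of_int b * of_int (snd m)) * (inverse (mon m) * (mon m :: 'k rat2))"
  by (simp only: mon_deriv_def D1_mon D2_mon mon_uminus distrib_left distrib_right mult_ac)
 thus ?thesis unfolding i by simp
qed

lemma mon_deriv_mon_0: "a * fst m' + b * snd m' = 0 ==> mon_deriv a b m (mon m') = (0 :: 'k::field rat2)"
proof -
 assume "a * fst m' + b * snd m' = 0"
 hence "of_int (a * fst m' + b * snd m') = (0 :: 'k rat2)" by (simp only: of_int_0)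
 thus ?thesis by (simp add: mon_deriv_def D1_mon D2_mon distrib_right[symmetric] mult.assoc[symmetric])
qed

lemma mon_deriv_dual:
 assumes "det2 e f = 1"
 shows "mon_deriv (snd f) (- fst f) (- e) (mon e) = (1 :: 'k::field rat2)"
  "mon_deriv (snd f) (- fst f) (- e) (mon f) = (0 :: 'k::field rat2)"
  "mon_deriv (- snd e) (fst e) (- f) (mon f) = (1 :: 'k::field rat2)"
  "mon_deriv (- snd e) (fst e) (- f) (mon e) = (0 :: 'k::field rat2)"
proof -
 have "snd f * fst e + - fst f * snd e = 1" "- snd e * fst f + fst e * snd f = 1"
  using assms by (simp_all add: det2_def mult.commute)
 thus "mon_deriv (snd f) (- fst f) (- e) (mon e) = (1 :: 'k::field rat2)"
  "mon_deriv (- snd e) (fst e) (- f) (mon f) = (1 :: 'k::field rat2)"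
  unfolding mon_deriv_mon by (simp_all only: of_int_1)
 show "mon_deriv (snd f) (- fst f) (- e) (mon f) = (0 :: 'k::field rat2)"
  "mon_deriv (- snd e) (fst e) (- f) (mon e) = (0 :: 'k::field rat2)" by (rule mon_deriv_mon_0; simp)+
qed

lemma mon_scale_pgen:
 fixes E :: "'k::field rat2 => 'k => bool"
 assumes a: "E (mon e) a" "a ~= 0" and G: "mon e : G" and E: "place fconst E"
 shows "mon (scale k e) : pgen fconst G E"
proof (cases k rule: int_cases2)
 case (nonneg j)
 thus ?thesis using fconst.pgen_power[OF pgen.gen[OF G]] by (simp add: mon_scale)
next
 case (nonpos j)
 have "inverse (mon e) ^ j : pgen fconst G E"
  by (rule fconst.pgen_power, rule pgen.inverse[where E = E, OF pgen.gen[OF G] a])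
 moreover have "mon (scale k e) = inverse (mon (scale (int j) e) :: 'k rat2)"
  unfolding nonpos mon_uminus[symmetric] by (simp add: scale_def)
 ultimately show ?thesis by (simp add: mon_scale power_inverse)
qed

text \<open>If \<open>mon e\<close> and \<open>mon f\<close> are units, the point lies in the open
  torus, whose ring is generated by these monomials and their inverses.\<close>

lemma KS_pgen_units:
 assumes E: "place fconst E" and a: "E (mon e) a" "a ~= 0" and b: "E (mon f) b" "b ~= 0" and ef: "det2 e f = 1"
  and P: "P : KS S"
 shows "P : pgen fconst {mon e, mon f} E" using P
proof (induction rule: KS_induct)
 case zero
 show ?case using pgen.const[of fconst 0] by simp
next
 case (mon m c)
 have m: "m = scale (det2 m f) e + scale (det2 e m) f" using cramer[of e f m] ef by (simp add: prod_eq_iff scale_simps)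
 have "mon (scale (det2 m f) e + scale (det2 e m) f) : pgen fconst {mon e, mon f} E" unfolding mon_add
  by (intro pgen.mult mon_scale_pgen[OF a _ E] mon_scale_pgen[OF b _ E]) auto
 thus ?case using m by (intro pgen.mult pgen.const) simp
qed (rule pgen.add)

locale toric_field = ffield "fconst :: 'k::field => 'k rat2" X th for X :: "('a, 'k::field) kspace" and th +
 assumes toric: "x : pts X ==> EX u v. cone_place (ev X th x) u v"
begin

text \<open>Logarithmic derivations preserve every semigroup ring and its localizations, so they
  introduce no poles.\<close>

lemma rdom_D: "rdom q <= rdom (D1 q)" "rdom q <= rdom (D2 q)"
proof -
 have "x : rdom (D1 q) & x : rdom (D2 q)" if x: "x : rdom q" for x
 proof -
  have xp: "x : pts X" using x rdom_subset by blast
  obtain u v where "toric_place (ev X th x) (cone2 u v)" using toric[OF xp] by (auto simp: cone_place_def)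
  moreover have "q : pdom (ev X th x)" using pdomI[of "ev X th x", OF ev_rval[OF x]] .
  ultimately have "D1 q : pdom (ev X th x)" "D2 q : pdom (ev X th x)" using toric_place_derivation by blast+
  thus ?thesis by (auto simp: pdom_def rdom_def)
 qed
 thus "rdom q <= rdom (D1 q)" "rdom q <= rdom (D2 q)" by auto
qed

definition dvec :: "nat => (nat => 'k rat2) => ('k rat2 => 'k rat2) => 'a => nat => 'k" where
 "dvec n c D x = (%k. if k < n then rval (D (c k)) x else 0)"

lemma dvec_Kn: "dvec n c D x : Kn n" by (simp add: dvec_def Kn_def)

context
 fixes U n V ph c
 assumes co: "ccoords U n V ph c" and K: "!!x. x : U ==> ph x : Kn n"
begin

lemma coordinate_rdom: "k < n ==> U <= rdom (c k)" using ccoordsD(1)[OF co] by (auto simp: rdom_def)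

lemma ev_dvec:
 assumes "x : U" "k < n"
 shows "ev X th x (D1 (c k)) (dvec n c D1 x k)" "ev X th x (D2 (c k)) (dvec n c D2 x k)"
 using coordinate_rdom[OF assms(2)] rdom_D[of "c k"] assms by (auto simp: dvec_def intro!: ev_rval)

lemma dvec_tangent:
 assumes x: "x : U"
 shows "dvec n c D1 x : tsp n V (ph x)" "dvec n c D2 x : tsp n V (ph x)"
 by (rule dern_tangent[OF co x K[OF x] D1_derivation dvec_Kn], erule ev_dvec[OF x],
   rule dern_tangent[OF co x K[OF x] D2_derivation dvec_Kn], erule ev_dvec[OF x])

text \<open>For a regular cone the local ring is generated by the two parameters
  \<open>mon u\<close> and \<open>mon v\<close>, and the partial derivatives with respect to them
  yield the tangent plane.\<close>

lemma smooth_tangent: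
 assumes x: "x : U" and T: "toric_place (ev X th x) (cone2 u v)" and uv: "det2 u v = 1"
 shows "EX d1:Kn n. EX d2:Kn n. tsp n V (ph x) = lin2 d1 d2 & (EX k l. plu d1 d2 k l ~= 0)"
proof -
 let ?E = "ev X th x"
 note E = chart_place[OF co x K[OF x]]
 define gga where "gga i = (if i = (0::nat) then u else v)" for i
 have hj: "hj u v 0 gga" using uv by (simp add: hj_def gga_def)
 have G: "mon ` gga ` {..Suc 0} = {mon u, mon v :: 'k rat2}" by (auto simp: gga_def atMost_Suc)
 have c: "c k : pgen fconst {mon u, mon v} ?E" if "k < n" for k
  using toric_pgen[OF E T hj, of "c k"] ccoordsD(1)[OF co x that] unfolding G by (auto simp: pdom_def)
 have "u : cone2 u v" "v : cone2 u v" using uv by (auto simp: cone2_def)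
 hence d: "mon u : pdom ?E" "mon v : pdom ?E" using T by (auto simp: toric_place_def)
 obtain aal where aal: "?E (mon u) aal" using d(1) by (rule pdomE)
 obtain be where be: "?E (mon v) be" using d(2) by (rule pdomE)
 let ?E1 = "mon_deriv (snd v) (- fst v) (- u) :: 'k rat2 => _" and ?E2 = "mon_deriv (- snd u) (fst u) (- v) :: 'k rat2 => _"
 note dual = mon_deriv_dual[OF uv, where 'k = 'k]
 have 01: "0 : pdom ?E" "1 : pdom ?E" by (rule fconst.pdom_0[OF E], rule fconst.pdom_1[OF E])
 have "?E1 (c k) : pdom ?E" "?E2 (c k) : pdom ?E" if "k < n" for k
  by (rule fconst.dern_pgen[OF E mon_deriv_derivation _ _ c[OF that]]; use d dual 01 in simp)+
 then obtain e1 e2 where e: "!!k. k < n ==> ?E (?E1 (c k)) (e1 k)" "!!k. k < n ==> ?E (?E2 (c k)) (e2 k)"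
  unfolding pdom_def by (simp add: Collect_conj_eq) metis
 define d1 where "d1 k = (if k < n then e1 k else 0)" for k
 define d2 where "d2 k = (if k < n then e2 k else 0)" for k
 have K12: "d1 : Kn n" "d2 : Kn n" by (simp_all add: d1_def d2_def Kn_def)
 have 1: "?E (?E1 (mon u)) 1" "?E (?E2 (mon v)) 1" unfolding dual by (rule fconst.place_1[OF E])+
 have "tsp n V (ph x) = lin2 d1 d2 & (EX k l. plu d1 d2 k l ~= 0)"
  by (rule tangent_plane[OF co x K[OF x] aal be c mon_deriv_derivation mon_deriv_derivation dual(2,4) 1(1) _ 1(2) _ K12])
   (insert e, simp_all add: d1_def d2_def)
 thus ?thesis using K12 by blast
qed

text \<open>At torus points \<open>mon e\<close> and \<open>mon f\<close> are parameters, and the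
  partial derivatives with respect to them are combinations of \<open>D1\<close> and
  \<open>D2\<close> up to unit factors.\<close>

lemma generic_tangent:
 assumes U: "opn X U" "U ~= {}"
 obtains W where "opn X W" "W ~= {}" "W <= U" "!!x. x : W ==> tsp n V (ph x) = lin2 (dvec n c D1 x) (dvec n c D2 x)"
  "!!x. x : W ==> EX k l. plu (dvec n c D1 x) (dvec n c D2 x) k l ~= 0"
proof -
 obtain x0 where x0: "x0 : U" using U(2) by blast
 have x0p: "x0 : pts X" using U(1) x0 openin_subset by blast
 obtain u v where uv: "primitive u" "primitive v" "0 < det2 u v" and T: "toric_place (ev X th x0) (cone2 u v)"
  using toric[OF x0p] by (auto simp: cone_place_def)
 obtain r gga where hj: "hj u v r gga" using hj_exists[OF uv] by blast
 define e where "e = gga 0"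
 define f where "f = gga 1"
 have ef: "det2 e f = 1" using hj_adj[OF hj, of 0] by (simp add: e_def f_def)
 have efc: "e : cone2 u v" "f : cone2 u v" using hj_in_cone[OF hj, of 0] hj_in_cone[OF hj, of 1] by (auto simp: e_def f_def)
 obtain d where d: "d ~= 0" "d : KS (cone2 u v)" "ALL b:c ` {..<n}. d * b : KS (cone2 u v)"
  using cone_common_denominator[OF uv(3), of "c ` {..<n}"] by auto
 \<comment> \<open>On \<open>W0\<close> both monomials and the common denominator \<open>d\<close>
   of the coordinates are regular; where their product \<open>q\<close> does not vanish, all three
   are units.\<close>
 define W0 where "W0 = U Int rdom (mon e) Int rdom (mon f) Int rdom d"
 have W0: "opn X W0" unfolding W0_def using U(1) openin_rdom by auto
 have "mon e : pdom (ev X th x0)" "mon f : pdom (ev X th x0)" using T efc by (auto simp: toric_place_def)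
 moreover have "d : pdom (ev X th x0)" by (rule KS_pdom[OF _ _ d(2)]) (insert T, auto simp: toric_place_def)
 ultimately have "x0 : W0" using x0 by (auto simp: W0_def pdom_def rdom_def)
 hence ne: "W0 ~= {}" by blast
 define q where "q = mon e * mon f * d"
 have q0: "q ~= 0" using d(1) by (simp add: q_def)
 have qv: "x : rdom q & rval q x = rval (mon e) x * rval (mon f) x * rval d x" if "x : W0" for x
 proof -
  have xp: "x : pts X" using that W0 openin_subset by blast
  have "ev X th x q (rval (mon e) x * rval (mon f) x * rval d x)"
   unfolding q_def by (intro place_mult[OF place_ev[OF xp]] ev_rval) (insert that, auto simp: W0_def)
  thus ?thesis unfolding ev_iff .
 qed
 hence sub: "W0 <= rdom q" by blast
 define W where "W = {x : W0. rval q x ~= 0}"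
 have W: "opn X W" "W ~= {}" unfolding W_def by (rule rdom_nonzero[OF q0 W0 sub ne])+
 have main: "tsp n V (ph x) = lin2 (dvec n c D1 x) (dvec n c D2 x) &
   (EX k l. plu (dvec n c D1 x) (dvec n c D2 x) k l ~= 0)" if xW: "x : W" for x
 proof -
  have xW0: "x : W0" and nz: "rval (mon e) x ~= 0" "rval (mon f) x ~= 0" "rval d x ~= 0"
   using xW qv[of x] by (auto simp: W_def)
  have x: "x : U" using xW0 by (simp add: W0_def)
  let ?E = "ev X th x"
  note E = chart_place[OF co x K[OF x]]
  have ev: "?E (mon e) (rval (mon e) x)" "?E (mon f) (rval (mon f) x)" "?E d (rval d x)"
   using xW0 by (auto simp: W0_def intro!: ev_rval)
  note KS = KS_pgen_units[OF E ev(1) nz(1) ev(2) nz(2) ef]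
  have c: "c k : pgen fconst {mon e, mon f} ?E" if k: "k < n" for k
  proof -
   have "d * c k : KS (cone2 u v)" using d(3) k by auto
   from pgen.mult[OF KS[OF this] pgen.inverse[where E = ?E, OF KS[OF d(2)] ev(3) nz(3)]]
   have "d * c k * inverse d : pgen fconst {mon e, mon f} ?E" .
   moreover have "d * c k * inverse d = c k" using d(1) by simp
   ultimately show ?thesis by (simp only:)
  qed
  let ?E1 = "mon_deriv (snd f) (- fst f) (- e) :: 'k rat2 => _" and ?E2 = "mon_deriv (- snd e) (fst e) (- f) :: 'k rat2 => _"
  note dual = mon_deriv_dual[OF ef, where 'k = 'k]
  let ?v1 = "dvec n c D1 x" and ?v2 = "dvec n c D2 x"
  define d1 where "d1 k = inverse (rval (mon e) x) * (of_int (snd f) * ?v1 k + of_int (- fst f) * ?v2 k)" for k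
  define d2 where "d2 k = inverse (rval (mon f) x) * (of_int (- snd e) * ?v1 k + of_int (fst e) * ?v2 k)" for k
  have K12: "d1 : Kn n" "d2 : Kn n" using dvec_Kn[of n c _ x] by (auto simp: d1_def d2_def Kn_def)
  have I: "?E (of_int i) (of_int i)" for i using place_const[OF E, of "of_int i"] by (simp add: fconst.e_of_int)
  have e1: "?E (?E1 (c k)) (d1 k)" and e2: "?E (?E2 (c k)) (d2 k)" if "k < n" for k
   unfolding mon_deriv_def d1_def d2_def mon_uminus
   by (rule place_mult[OF E place_inverse[OF E ev(1) nz(1)] place_add[OF E place_mult[OF E I ev_dvec(1)[OF x that]] place_mult[OF E I ev_dvec(2)[OF x that]]]],
     rule place_mult[OF E place_inverse[OF E ev(2) nz(2)] place_add[OF E place_mult[OF E I ev_dvec(1)[OF x that]] place_mult[OF E I ev_dvec(2)[OF x that]]]])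
  have 1: "?E (?E1 (mon e)) 1" "?E (?E2 (mon f)) 1" unfolding dual by (rule fconst.place_1[OF E])+
  have t: "tsp n V (ph x) = lin2 d1 d2 & (EX k l. plu d1 d2 k l ~= 0)"
   by (rule tangent_plane[OF co x K[OF x] ev(1,2) c mon_deriv_derivation mon_deriv_derivation dual(2,4) 1(1) one_neq_zero 1(2) one_neq_zero K12 e1 e2])
  then obtain k l where kl: "plu d1 d2 k l ~= 0" by blast
  have "d1 : lin2 ?v1 ?v2"
   by (rule lin2I[of _ "inverse (rval (mon e) x) * of_int (snd f)" _ "inverse (rval (mon e) x) * of_int (- fst f)"])
    (simp add: d1_def algebra_simps)
  moreover have "d2 : lin2 ?v1 ?v2"
   by (rule lin2I[of _ "inverse (rval (mon f) x) * of_int (- snd e)" _ "inverse (rval (mon f) x) * of_int (fst e)"])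
    (simp add: d2_def algebra_simps)
  ultimately show ?thesis using lin2_eq[OF _ _ kl] t by metis
 qed
 show ?thesis by (rule that[OF W]) (insert main, auto simp: W_def W0_def)
qed

end

end

subsection \<open>The function field of a Nash blowup\<close>

lemma plc_eqI_Gr:
 assumes W: "W : plc k l" "W : Gr 2 n" and W': "W' : plc k l" "W' : Gr 2 n"
  and eq: "!!i j. i < n ==> j < n ==> plr k l W i j = plr k l W' i j" and kl: "k < n" "l < n"
 shows "W = W'"
proof -
 note 1 = plc_normal_frame[OF W] and 2 = plc_normal_frame[OF W']
 have "plr k l W i l = plr k l W' i l" for i using eq[of i l] kl 1(3) 2(3) by (cases "i < n") (auto simp: Kn_def)
 moreover have "plr k l W k i = plr k l W' k i" for i
  using eq[of k i] kl 1(4) 2(4) by (cases "i < n") (auto simp: Kn_def)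
 ultimately show ?thesis using 1(2) 2(2) by simp
qed

locale toric_variety = variety_field "fconst :: 'k::alg_closed_field => 'k rat2" X th
 for X :: "('a, 'k::alg_closed_field) kspace" and th +
 assumes sep: "separated" and toric_hat: "x : pts X ==> EX u v. cone_place (evh X th x) u v"
begin

sublocale toric_field "hat X" th by unfold_locales (use toric_hat in simp)

end

locale nash_step = toric_variety X th for X :: "('a, 'k::alg_closed_field) kspace" and th +
 fixes Z :: "('b, 'k) kspace" and nu :: "'b => 'a"
 assumes varZ: "variety Z" and mor: "morphism Z X nu"
begin

lemma ringed_Z: "ringed (hat Z)" by (rule ringed_hat[OF varZ])

lemma mor_hat: "morphism (hat Z) (hat X) nu" by (rule morphism_hat[OF mor sheaf variety_sheaf[OF varZ]])

lemma nu_pts: "z : pts Z ==> nu z : pts X" by (rule morphism_maps[OF mor])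

section \<open>Pluecker coordinates and brackets on a chart of the Nash blowup\<close>

definition nash_chart :: "'a set => nat => (nat => 'k) set => ('a => nat => 'k) =>
  ('b => (nat => 'k) \<times> (nat => 'k) set) => (nat => 'k rat2) => bool" where
 "nash_chart U n V ph ps c <-> affine_chart X U n V ph & isomorphism (induced Z (preim Z nu U)) (affine_nash 2 n V) ps &
  (ALL z:preim Z nu U. fst (ps z) = ph (nu z)) & U ~= {} & ccoords U n V ph c"

context
 fixes U n V ph ps c
 assumes nc: "nash_chart U n V ph ps c"
begin

abbreviation "P \<equiv> preim Z nu U"
abbreviation "pl x \<equiv> snd (ps x)"
abbreviation "cl \<equiv> ktop (Kn_Gr 2 n) closure_of gauss_graph 2 n V"
abbreviation "de i j \<equiv> bracket (c i) (c j)"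

lemma ch: "affine_chart (hat X) U n V ph" and U_ne: "U ~= {}" and co: "ccoords U n V ph c"
 and fst_ps: "z : P ==> fst (ps z) = ph (nu z)" using nc affine_chart_hat[OF variety] by (auto simp: nash_chart_def)

lemma U_open: "opn X U" and U_Kn: "x : U ==> ph x : Kn n" and U_inj: "inj_on ph U" and U_image: "ph ` U = V"
 using affine_chart_open[OF ringed ch] affine_chart_Kn[OF ringed ch] affine_chart_inj[OF ringed ch] affine_chart_image[OF ringed ch]
 by simp_all

lemma chart_dvec: "x : U ==> k < n ==> evh X th x (D1 (c k)) (dvec n c D1 x k)"
  "x : U ==> k < n ==> evh X th x (D2 (c k)) (dvec n c D2 x k)"
 and chart_dvec_tangent: "x : U ==> dvec n c D1 x : tsp n V (ph x)" "x : U ==> dvec n c D2 x : tsp n V (ph x)"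
 and chart_rdom: "k < n ==> U <= rdom (c k)"
 using ev_dvec[OF co] dvec_tangent[OF co] coordinate_rdom[OF co] U_Kn by blast+

lemma P_open: "opn Z P" using morphism_open[OF mor U_open] by (simp add: preim_def)

lemma P_pts: "z : P ==> z : pts Z" and P_U: "z : P ==> nu z : U" by (auto simp: preim_def)

lemma iso: "isomorphism (induced (hat Z) P) (affine_nash 2 n V) ps"
 by (rule iso_induced_hat[OF varZ P_open _ ringed_affine_nash]) (insert nc, simp add: nash_chart_def)

lemma pts_P: "pts (induced (hat Z) P) = P" using openin_subset[OF P_open] by auto

lemma graph_Gr: "gauss_graph 2 n V <= Kn n \<times> Gr 2 n"
proof -
 have "V <= Kn n" using U_image U_Kn by blast
 thus ?thesis using tangent_space_subspace[of n V] by (auto simp: gauss_graph_def Sing_def Gr_def tangent_space_dpol)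
qed

lemma pts_nash: "pts (affine_nash 2 n V) = cl"
 using closure_of_subset_topspace[of "ktop (Kn_Gr 2 n)"] by (auto simp: affine_nash_def)

lemma cl_Gr: "cl <= Kn n \<times> Gr 2 n" using closure_of_subset_topspace[of "ktop (Kn_Gr 2 n)"] unfolding pts_Kn_Gr .

lemma graph_cl: "gauss_graph 2 n V <= cl" by (rule closure_of_subset) (insert graph_Gr, simp add: pts_Kn_Gr)

lemma ps_image: "ps ` P = cl" and ps_inj: "inj_on ps P" using iso_inj[OF iso] unfolding pts_P pts_nash by auto

lemma ps_pair: "z : P ==> ps z = (ph (nu z), pl z)" using fst_ps[of z] by (metis prod.collapse)

lemma ps_cl:
 assumes "z : P"
 shows "ps z : cl" "ps z : Kn n \<times> Gr 2 n"
proof -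
 show "ps z : cl" using imageI[OF assms, of ps] unfolding ps_image .
 thus "ps z : Kn n \<times> Gr 2 n" by (rule subsetD[OF cl_Gr])
qed

lemma pl_Gr: "z : P ==> pl z : Gr 2 n" using ps_cl(2)[of z] by (simp add: mem_Times_iff)

lemma kreg_pl:
 assumes "k < n" "l < n" "i < n" "j < n"
 shows "kreg (hat Z) {z : P. pl z : plc k l} (%z. plr k l (pl z) i j)"
proof -
 let ?U = "{x : Kn n \<times> Gr 2 n. snd x : (plc k l :: (nat => 'k) set set)}"
 note kr = kreg_plr[OF assms, where 'k = 'k]
 have o: "opn (Kn_Gr 2 n) ?U" using kr by (simp add: kreg_Kn_Gr)
 have k: "kreg (affine_nash 2 n V) (?U Int cl) (%x. plr k l (snd x) i j)"
  unfolding affine_nash_def by (rule kreg_induced_subset[OF kr o])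
 have "opn (affine_nash 2 n V) (?U Int cl)" by (rule ringed_open[OF ringed_affine_nash k])
 from iso_kreg_preim[OF iso k this]
 have "kreg (induced (hat Z) P) (preim (induced (hat Z) P) ps (?U Int cl)) (%z. plr k l (pl z) i j)" .
 moreover have "preim (induced (hat Z) P) ps (?U Int cl) = {z : P. pl z : plc k l}"
 proof (rule set_eqI)
  fix z
  show "z : preim (induced (hat Z) P) ps (?U Int cl) <-> z : {z : P. pl z : plc k l}"
   using ps_cl[of z] unfolding preim_def[of "induced (hat Z) P"] pts_P by (cases "z : P") simp_all
 qed
 ultimately show ?thesis using kreg_induced_open[OF ringed_Z, of P] P_open by simp
qed

lemma open_plc: "k < n ==> l < n ==> opn Z {z : P. pl z : plc k l}"
 using ringed_open[OF ringed_Z kreg_pl[of k l k l]] by simp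

lemma graph_dense:
 assumes G: "opn Z G" "G Int P ~= {}"
 obtains z where "z : G" "z : P" "pl z = tsp n V (ph (nu z))" "ps z : gauss_graph 2 n V"
proof -
 have "opn (induced (hat Z) P) (G Int P)" using G(1) by (auto simp: openin_subtopology)
 from iso_open_image[OF iso this] obtain N where N: "opn (Kn_Gr 2 n) N" "ps ` (G Int P) = N Int cl"
  by (auto simp: affine_nash_def openin_subtopology)
 obtain z0 where "z0 : G Int P" using G(2) by blast
 hence "ps z0 : N" "ps z0 : cl" using N(2) by auto
 then obtain y where y: "y : gauss_graph 2 n V" "y : N" using N(1) unfolding in_closure_of by blast
 hence "y : ps ` (G Int P)" using N(2) graph_cl by blast
 then obtain z where z: "z : G" "z : P" "y = ps z" by blast
 have "pl z = tsp n V (fst (ps z))" using y(1) unfolding z(3) gauss_graph_def by auto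
 thus ?thesis using that[OF z(1,2)] y(1) z(3) fst_ps[OF z(2)] by simp
qed

lemma de_ev:
 assumes "x : U" "i < n" "j < n"
 shows "evh X th x (de i j) (plu (dvec n c D1 x) (dvec n c D2 x) i j)"
proof -
 note E = chart_place[OF co assms(1) U_Kn[OF assms(1)]]
 note d = chart_dvec[OF assms(1)]
 show ?thesis unfolding bracket_def plu_def
  using fconst.place_diff[OF E place_mult[OF E d(1)[OF assms(2)] d(2)[OF assms(3)]] place_mult[OF E d(1)[OF assms(3)] d(2)[OF assms(2)]]]
  by (simp only: mult.commute)
qed

lemma de_rdom: "i < n ==> j < n ==> U <= rdom (de i j)"
 and de_rval: "x : U ==> i < n ==> j < n ==> rval (de i j) x = plu (dvec n c D1 x) (dvec n c D2 x) i j"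
 using de_ev by (auto simp: ev_iff)

text \<open>The relation between Pluecker coordinates and brackets holds on the graph of the Gauss map, hence on its closure.\<close>

lemma plr_de:
 assumes z: "z : P" "pl z : plc k l" and kl: "k < n" "l < n" "i < n" "j < n"
 shows "plr k l (pl z) i j * rval (de k l) (nu z) = rval (de i j) (nu z)"
proof (rule ccontr)
 assume neq: "plr k l (pl z) i j * rval (de k l) (nu z) ~= rval (de i j) (nu z)"
 let ?Z = "{z : P. pl z : plc k l}"
 have oU: "opn (hat X) U" using U_open by simp
 have r: "kreg (hat Z) ?Z (%z. rval (de i j) (nu z))" if "i < n" "j < n" for i j
 proof -
  have "kreg (hat Z) {z : pts (hat Z). nu z : U} (%z. rval (de i j) (nu z))"
   by (rule morphism_kreg[OF mor_hat kreg_rval_subset[OF oU de_rdom[OF that]]])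
  thus ?thesis by (rule ringed_restrict[OF ringed_Z]) (insert open_plc[OF kl(1,2)], auto simp: preim_def)
 qed
 let ?F = "%z. plr k l (pl z) i j * rval (de k l) (nu z) + (- 1) * rval (de i j) (nu z)"
 have oZ: "opn (hat Z) ?Z" using open_plc[OF kl(1,2)] by simp
 have F: "kreg (hat Z) ?Z ?F"
  by (intro ringed_add[OF ringed_Z] ringed_mult[OF ringed_Z] kreg_pl r kl ringed_const[OF ringed_Z] oZ)
 have "opn Z {z : ?Z. ?F z ~= 0}" using ringed_nonzero[OF ringed_Z F] by simp
 moreover have "z : {z : ?Z. ?F z ~= 0} Int P" using z neq by simp
 ultimately obtain y where y: "y : {z : ?Z. ?F z ~= 0}" "y : P" "pl y = tsp n V (ph (nu y))" using graph_dense by blast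
 have x: "nu y : U" by (rule P_U[OF y(2)])
 obtain a b where ab: "pl y = lin2 a b" "plu a b k l ~= 0" using y(1) by (auto simp: plc_def)
 have "dvec n c D1 (nu y) : lin2 a b" "dvec n c D2 (nu y) : lin2 a b"
  using chart_dvec_tangent[OF x] y(3) ab(1) by simp_all
 then obtain ka where "!!i j. plu (dvec n c D1 (nu y)) (dvec n c D2 (nu y)) i j = ka * plu a b i j" using plu_lin2 by blast
 hence "?F y = 0" using ab(2) by (simp add: ab(1) plr_lin2 de_rval[OF x] kl)
 thus False using y(1) by simp
qed

text \<open>Here the logarithmic derivations span the tangent plane. Over such a set the Nash blowup
  has a unique section, which carries the function field.\<close>

definition gen_open :: "'a set => bool" where "gen_open W <-> opn X W & W ~= {} & W <= U &
  (ALL x:W. tsp n V (ph x) = lin2 (dvec n c D1 x) (dvec n c D2 x)) &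
  (ALL x:W. EX k l. plu (dvec n c D1 x) (dvec n c D2 x) k l ~= 0)"

lemma gen_open_exists: "EX W. gen_open W"
proof -
 have oU: "opn (hat X) U" using U_open by simp
 obtain W where W: "opn (hat X) W" "W ~= {}" "W <= U"
  "!!x. x : W ==> tsp n V (ph x) = lin2 (dvec n c D1 x) (dvec n c D2 x)"
  "!!x. x : W ==> EX k l. plu (dvec n c D1 x) (dvec n c D2 x) k l ~= 0"
  using generic_tangent[OF co _ oU U_ne] U_Kn by blast
 hence "gen_open W" unfolding gen_open_def by simp
 thus ?thesis ..
qed

context
 fixes W
 assumes W: "gen_open W"
begin

lemma W_open: "opn X W" and W_ne: "W ~= {}" and W_U: "W <= U"
 and W_tan: "x : W ==> tsp n V (ph x) = lin2 (dvec n c D1 x) (dvec n c D2 x)"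
 and W_plu: "x : W ==> EX k l. plu (dvec n c D1 x) (dvec n c D2 x) k l ~= 0" using W by (auto simp: gen_open_def)

lemma W_Gr: "x : W ==> lin2 (dvec n c D1 x) (dvec n c D2 x) : Gr 2 n" using lin2_Gr[OF dvec_Kn dvec_Kn] W_plu by blast

text \<open>By \<open>plr_de\<close> the Pluecker coordinates of the plane are proportional to the
  brackets at the point, and these do not all vanish on \<open>W\<close>.\<close>

lemma fibre:
 assumes z: "z : P" "nu z : W"
 shows "pl z = tsp n V (ph (nu z))"
proof -
 let ?d = "plu (dvec n c D1 (nu z)) (dvec n c D2 (nu z))"
 have x: "nu z : U" by (rule P_U[OF z(1)])
 obtain k l where kl: "k < n" "l < n" "pl z : plc k l" using Gr2_plc[OF pl_Gr[OF z(1)]] .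
 have rel: "plr k l (pl z) i j * ?d k l = ?d i j" if "i < n" "j < n" for i j
  using plr_de[OF z(1) kl(3,1,2) that] kl that by (simp add: de_rval[OF x])
 obtain i j where ij: "?d i j ~= 0" using W_plu[OF z(2)] by blast
 hence "i < n" "j < n" using plu_Kn[OF dvec_Kn dvec_Kn] by blast+
 hence dkl: "?d k l ~= 0" using rel[of i j] ij by auto
 show ?thesis
 proof (rule plc_eqI_Gr[OF kl(3) pl_Gr[OF z(1)] _ _ _ kl(1,2)])
  show "tsp n V (ph (nu z)) : plc k l" "tsp n V (ph (nu z)) : Gr 2 n"
   using dkl W_Gr[OF z(2)] unfolding W_tan[OF z(2)] lin2_in_plc by simp_all
  show "plr k l (pl z) i j = plr k l (tsp n V (ph (nu z))) i j" if "i < n" "j < n" for i j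
   unfolding W_tan[OF z(2)] plr_lin2[OF dkl] rel[OF that, symmetric] using dkl by simp
 qed
qed

lemma section_point:
 assumes x: "x : W"
 shows "(ph x, lin2 (dvec n c D1 x) (dvec n c D2 x)) : cl"
proof -
 have "lin2 (dvec n c D1 x) (dvec n c D2 x) : Gr 2 n" by (rule W_Gr[OF x])
 moreover have "ph x : V" using U_image W_U x by blast
 ultimately have "(ph x, tsp n V (ph x)) : gauss_graph 2 n V"
  unfolding gauss_graph_def Sing_def Gr_def W_tan[OF x, symmetric] by blast
 thus ?thesis using graph_cl W_tan[OF x] by auto
qed

lemma point_over:
 assumes z: "z : P" and e: "ps z = (ph x, S)" and x: "x : U"
 shows "nu z = x" using inj_onD[OF U_inj _ P_U[OF z] x] fst_ps[OF z] e by simp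

text \<open>The Gauss graph contains the planes at all nonsingular points, not only those over
  \<open>W\<close>, so density of the part over \<open>W\<close> needs an argument: a polynomial
  frame moves a graph point to nearby points, and by irreducibility some of them lie in both
  \<open>D\<close> and \<open>W\<close>, where the frame spans the tangent plane.\<close>

lemma generic_dense:
 assumes G: "opn Z G" "G Int P ~= {}" and D: "opn X D" "D ~= {}"
 obtains z where "z : G" "z : P" "nu z : D"
proof -
 obtain z0 where z0: "z0 : G" "z0 : P" "pl z0 = tsp n V (ph (nu z0))" by (rule graph_dense[OF G])
 let ?p = "ph (nu z0)"
 have T: "tsp n V ?p : Gr 2 n" using pl_Gr[OF z0(2)] z0(3) by simp
 obtain h A B where h: "h : pols n" "pev h ?p ~= 0" and AB: "!!t. t < n ==> A t : pols n" "!!t. t < n ==> B t : pols n"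
  and T0: "tsp n V ?p = lin2 (pvec n A ?p) (pvec n B ?p)"
  and sub: "!!x. x : V ==> pev h x ~= 0 ==> tsp n V x <= lin2 (pvec n A x) (pvec n B x)"
  using tangent_frames[OF T] by blast
 define m where "m x = mkframe n (ph x) (pvec n A (ph x)) (pvec n B (ph x))" for x
 have mf: "m x : pts (frames 2 n)" "frame_proj 2 n (m x) = (ph x, lin2 (pvec n A (ph x)) (pvec n B (ph x)))"
  if "x : U" "lin2 (pvec n A (ph x)) (pvec n B (ph x)) : Gr 2 n" for x using that U_Kn[OF that(1)]
  by (simp_all add: m_def pts_frames mkframe_Kn frame_span_lin2 frame_proj_def mkframe_simps pvec_Kn)
 have "opn (induced (hat Z) P) (G Int P)" using G(1) by (auto simp: openin_subtopology)
 from iso_open_image[OF iso this] obtain N where N: "opn (Kn_Gr 2 n) N" "ps ` (G Int P) = N Int cl"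
  by (auto simp: affine_nash_def openin_subtopology)
 have m0: "m (nu z0) : pts (frames 2 n)" "frame_proj 2 n (m (nu z0)) = (?p, tsp n V ?p)"
  using mf[OF P_U[OF z0(2)]] T T0 by simp_all
 have "ps z0 : N" using N(2) z0 by blast
 hence "frame_proj 2 n (m (nu z0)) : N" using ps_pair[OF z0(2)] z0(3) m0(2) by simp
 hence m0N: "m (nu z0) : preim (frames 2 n) (frame_proj 2 n) N" using m0(1) by (simp add: preim_def)
 have oN: "opn (frames 2 n) (preim (frames 2 n) (frame_proj 2 n) N)" using N(1) by (simp add: openin_Kn_Gr)
 obtain f where f: "f : pols (3 * n)" "pev f (m (nu z0)) ~= 0"
  "!!z. z : pts (frames 2 n) ==> pev f z ~= 0 ==> z : preim (frames 2 n) (frame_proj 2 n) N"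
  by (rule open_frames_principal[OF oN m0N]) blast
 have oU: "opn (hat X) U" using U_open by simp
 have co': "kreg (hat X) U (%x. ph x k)" if "k < n" for k by (rule affine_chart_coordinate[OF ringed ch that])
 have pe: "kreg (hat X) U (%x. pev g (ph x))" if "g : pols n" for g by (rule ringed_pol_eval[OF ringed that oU co'])
 have mk: "kreg (hat X) U (%x. m x t)" if t3: "t < 3 * n" for t
 proof -
  consider "t < n" | "~ t < n" "t < 2 * n" "t - n < n" | "~ t < n" "~ t < 2 * n" "t - 2 * n < n" using t3 by linarith
  thus ?thesis
   by cases (insert t3 co'[of t] pe[OF AB(1), of "t - n"] pe[OF AB(2), of "t - 2 * n"], simp_all add: m_def mkframe_def pvec_def)
 qed
 have kf: "kreg (hat X) U (%x. pev f (m x))" by (rule ringed_pol_eval[OF ringed f(1) oU mk])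
 have "kreg (hat X) U (%x. pev f (m x) * pev h (ph x))" by (rule r_mult[OF kf pe[OF h(1)]])
 hence o: "opn (hat X) {x : U. pev f (m x) * pev h (ph x) ~= 0}" by (rule r_open_nonzero)
 have "nu z0 : {x : U. pev f (m x) * pev h (ph x) ~= 0}" using P_U[OF z0(2)] f(2) h(2) by simp
 hence ne: "{x : U. pev f (m x) * pev h (ph x) ~= 0} ~= {}" by blast
 have DW: "opn (hat X) (D Int W)" "D Int W ~= {}" using D W_open W_ne irred[of D W] by auto
 obtain x where x: "x : D" "x : W" "x : U" "pev f (m x) ~= 0" "pev h (ph x) ~= 0"
  using irred[OF o DW(1) ne DW(2)] by auto
 have xV: "ph x : V" using U_image x(3) by blast
 obtain k l where kl: "plu (dvec n c D1 x) (dvec n c D2 x) k l ~= 0" using W_plu[OF x(2)] by blast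
 \<comment> \<open>The tangent space contains two independent vectors and lies in the span of the
   frame, so the two planes coincide.\<close>
 have e: "lin2 (dvec n c D1 x) (dvec n c D2 x) = lin2 (pvec n A (ph x)) (pvec n B (ph x))"
  by (rule lin2_eq(1)[OF _ _ kl]) (use sub[OF xV x(5)] chart_dvec_tangent[OF x(3)] in blast)+
 have fr: "m x : pts (frames 2 n)" "frame_proj 2 n (m x) = (ph x, lin2 (dvec n c D1 x) (dvec n c D2 x))"
  using mf[OF x(3)] W_Gr[OF x(2)] unfolding e by simp_all
 have "frame_proj 2 n (m x) : N" using f(3)[OF fr(1) x(4)] by (simp add: preim_def)
 hence "(ph x, lin2 (dvec n c D1 x) (dvec n c D2 x)) : ps ` (G Int P)" using fr(2) N(2) section_point[OF x(2)] by simp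
 then obtain z where z: "z : G" "z : P" "ps z = (ph x, lin2 (dvec n c D1 x) (dvec n c D2 x))" by auto
 have "nu z = x" by (rule point_over[OF z(2,3) x(3)])
 thus ?thesis using that[OF z(1,2)] x(1) by simp
qed

definition sect :: "'a => 'b" where "sect x = inv_into P ps (ph x, lin2 (dvec n c D1 x) (dvec n c D2 x))"

lemma sect:
 assumes x: "x : W"
 shows "sect x : P" "nu (sect x) = x" "ps (sect x) = (ph x, lin2 (dvec n c D1 x) (dvec n c D2 x))"
proof -
 have "(ph x, lin2 (dvec n c D1 x) (dvec n c D2 x)) : ps ` P" using section_point[OF x] ps_image by simp
 from inv_into_into[OF this] f_inv_into_f[OF this]
 show 1: "sect x : P" "ps (sect x) = (ph x, lin2 (dvec n c D1 x) (dvec n c D2 x))" by (simp_all add: sect_def)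
 show "nu (sect x) = x" using point_over[OF 1] W_U x by blast
qed

lemma sect_unique:
 assumes z: "z : pts Z" "nu z : W"
 shows "z = sect (nu z)"
proof -
 have zP: "z : P" using z W_U by (auto simp: preim_def)
 have "ps z = ps (sect (nu z))" using sect(3)[OF z(2)] ps_pair[OF zP] fibre[OF zP z(2)] W_tan[OF z(2)] by simp
 thus ?thesis using inj_onD[OF ps_inj _ zP sect(1)[OF z(2)]] by blast
qed

lemma sect_morphism: "morphism (induced (hat X) W) (hat Z) sect"
proof -
 have R: "ringed (induced (hat X) W)" by (rule ringed_induced[OF ringed])
 have oW: "opn (hat X) W" using W_open by simp
 have pts: "pts (induced (hat X) W) = W" using openin_subset[OF W_open] by auto
 have kr: "kreg (induced (hat X) W) W f" if "kreg (hat X) U f" for f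
  unfolding kreg_induced_open[OF ringed oW] using r_restrict[OF that oW W_U] by simp
 have dv: "kreg (induced (hat X) W) W (%x. dvec n c D x i)" if D: "D = D1 | D = D2" and i: "i < n" for D i
 proof -
  have "U <= rdom (D (c i))" using D chart_rdom[OF i] rdom_D[of "c i"] by blast
  moreover have "opn (hat X) U" using U_open by simp
  ultimately have "kreg (hat X) U (rval (D (c i)))" by (intro kreg_rval_subset)
  thus ?thesis using i kr by (simp add: dvec_def)
 qed
 have 1: "morphism (induced (hat X) W) (Kn_Gr 2 n) (%x. (ph x, lin2 (dvec n c D1 x) (dvec n c D2 x)))"
  by (rule morphism_Kn_Gr[OF R], unfold pts)
   (use U_Kn W_U dvec_Kn W_Gr dv kr[OF affine_chart_coordinate[OF ringed ch]] in auto)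
 have 2: "morphism (induced (hat X) W) (affine_nash 2 n V) (%x. (ph x, lin2 (dvec n c D1 x) (dvec n c D2 x)))"
  unfolding affine_nash_def by (rule morphism_into_induced[OF 1 R]) (use section_point pts in auto)
 have RP: "ringed (induced (hat Z) P)" by (rule ringed_induced[OF ringed_Z])
 have "morphism (induced (hat X) W) (induced (hat Z) P)
   (%x. inv_into (pts (induced (hat Z) P)) ps (ph x, lin2 (dvec n c D1 x) (dvec n c D2 x)))"
  by (rule morphism_comp[OF 2 morphism_inv_into[OF iso RP]])
 hence "morphism (induced (hat X) W) (induced (hat Z) P) sect" unfolding pts_P by (simp add: sect_def[abs_def])
 from morphism_comp[OF this morphism_inclusion[OF ringed_open[OF ringed_Z]]] show ?thesis .
qed

end

end

end

lemma (in variety_field) chart_pgen: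
 assumes co: "ccoords U n V ph c" and x: "x : U" "x : pts X"
 shows "pdom (evh X th x) <= pgen e (c ` {..<n}) (evh X th x)"
proof
 fix q assume "q : pdom (evh X th x)"
 then obtain a where q: "evh X th x q a" by (rule pdomE)
 obtain g h where gh: "g : pols n" "h : pols n" "pev h (ph x) ~= 0" "q * peval e h c = peval e g c"
  using ccoordsD(3)[OF co x(1) q] by blast
 show "q : pgen e (c ` {..<n}) (evh X th x)"
  by (rule pgen_pol[OF gh(2,1) _ pts_place[OF x(2)] ccoordsD(1)[OF co x(1)] gh(3,4)]) auto
qed

section \<open>Local rings and separatedness of the Nash blowup\<close>

context nash_step
begin

context
 fixes U0 n0 V0 ph0 ps0 c0 D
 assumes nc0: "nash_chart U0 n0 V0 ph0 ps0 c0" and D: "gen_open U0 n0 V0 ph0 c0 D"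
  and cover: "z : pts Z ==> EX U n V ph ps c. nash_chart U n V ph ps c & z : preim Z nu U"
begin

abbreviation "s0 \<equiv> sect U0 n0 ph0 ps0 c0"

text \<open>A function on \<open>Z\<close> is read in the function field of \<open>X\<close> through
  the section over one fixed chart; \<open>s0_dense\<close> makes this faithful on all of
  \<open>Z\<close>.\<close>

definition thZ :: "'b set => ('b => 'k) => 'k rat2" where "thZ W f = th {x : D. s0 x : W} (%x. f (s0 x))"

lemma D_open: "opn (hat X) D" and D_ne: "D ~= {}" using W_open[OF nc0 D] W_ne[OF nc0 D] by simp_all

text \<open>In every chart of \<open>Z\<close> the points over \<open>D\<close> are dense by
  \<open>generic_dense\<close>, and over \<open>D\<close> the section is the only point.\<close>

lemma s0_dense:
 assumes G: "opn (hat Z) G" "G ~= {}"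
 shows "EX x:D. s0 x : G"
proof -
 have oG: "opn Z G" using G(1) by simp
 obtain z where z: "z : G" using G(2) by blast
 hence "z : pts Z" using openin_subset[OF oG] by blast
 then obtain U n V ph ps c where nc: "nash_chart U n V ph ps c" "z : preim Z nu U" using cover by blast
 obtain W where W: "gen_open U n V ph c W" using gen_open_exists[OF nc(1)] by blast
 have GP: "G Int preim Z nu U ~= {}" using z nc(2) by blast
 have oD: "opn X D" using D_open by simp
 obtain z' where z': "z' : G" "z' : preim Z nu U" "nu z' : D" by (rule generic_dense[OF nc(1) W oG GP oD D_ne])
 have "z' : pts Z" using z'(1) openin_subset[OF oG] by blast
 from sect_unique[OF nc0 D this z'(3)] have "s0 (nu z') = z'" by simp
 thus ?thesis using z' by (intro bexI[of _ "nu z'"]) simp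
qed

lemma Z_ffield: "ffield fconst (hat Z) thZ" unfolding thZ_def[abs_def]
 by (rule pull_ffield[OF ringed_Z D_open D_ne sect_morphism[OF nc0 D] s0_dense])

interpretation Zf: ffield fconst "hat Z" thZ by (rule Z_ffield)

interpretation Zv: variety_field fconst Z thZ by unfold_locales (rule varZ)

lemma ev_up:
 assumes z: "z : pts Z" and q: "evh X th (nu z) q a"
 shows "evh Z thZ z q a" unfolding thZ_def[abs_def]
 by (rule pull_ev[OF D_open D_ne mor_hat _ _ q]) (insert sect[OF nc0 D] z, auto simp: preim_def)

context
 fixes U n V ph ps c
 assumes nc: "nash_chart U n V ph ps c"
begin

abbreviation "pl' z \<equiv> snd (ps z)"
abbreviation "dl i j \<equiv> bracket (c i) (c j)"

text \<open>A bracket that is zero in the function field would vanish at generic points, but there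
  it is a nonzero Pluecker coordinate of a plane in the chart \<open>k\<close>,
  \<open>l\<close>.\<close>

lemma dl_nonzero:
 assumes z: "z : preim Z nu U" "pl' z : plc k l" and kl: "k < n" "l < n"
 shows "dl k l ~= 0"
proof
 assume 0: "dl k l = 0"
 obtain W where W: "gen_open U n V ph c W" using gen_open_exists[OF nc] by blast
 have ne: "{z : preim Z nu U. pl' z : plc k l} Int preim Z nu U ~= {}" using z by blast
 obtain y where y: "y : {z : preim Z nu U. pl' z : plc k l}" "y : preim Z nu U" "nu y : W"
  by (rule generic_dense[OF nc W open_plc[OF nc kl] ne W_open[OF nc W] W_ne[OF nc W]])
 have x: "nu y : U" by (rule P_U[OF nc y(2)])
 have "lin2 (dvec n c D1 (nu y)) (dvec n c D2 (nu y)) : plc k l"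
  using fibre[OF nc W y(2,3)] W_tan[OF nc W y(3)] y(1) by simp
 hence "plu (dvec n c D1 (nu y)) (dvec n c D2 (nu y)) k l ~= 0" by (simp add: lin2_in_plc)
 moreover have "evh X th (nu y) 0 (plu (dvec n c D1 (nu y)) (dvec n c D2 (nu y)) k l)"
  using de_ev[OF nc x kl] unfolding 0 .
 moreover have "nu y : pts X" by (rule nu_pts[OF P_pts[OF nc y(2)]])
 ultimately show False using place_unique[OF pts_place fconst.place_0[OF pts_place]] by metis
qed

text \<open>The normalized Pluecker coordinate is a regular function on \<open>Z\<close>; multiplied
  by \<open>dl k l\<close> it agrees pointwise with \<open>dl i j\<close> by \<open>plr_de\<close>,
  hence also in the function field.\<close>

lemma ev_ratio:
 assumes z: "z : preim Z nu U" "pl' z : plc k l" and kl: "k < n" "l < n" and ij: "i < n" "j < n"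
 shows "evh Z thZ z (dl i j / dl k l) (plr k l (pl' z) i j)"
proof -
 let ?Z = "{z : preim Z nu U. pl' z : plc k l}"
 define q where "q = thZ ?Z (%z. plr k l (pl' z) i j)"
 have q: "evh Z thZ y q (plr k l (pl' y) i j)" if "y : ?Z" for y
  unfolding q_def by (rule Zf.evI[OF kreg_pl[OF nc kl ij] that])
 have oZ: "opn (hat Z) ?Z" using open_plc[OF nc kl] by simp
 have zero: "evh Z thZ y (q * dl k l - dl i j) 0" if y: "y : ?Z" for y
 proof -
  have yP: "y : preim Z nu U" "pl' y : plc k l" using y by auto
  have yp: "y : pts Z" and x: "nu y : U" using P_pts[OF nc yP(1)] P_U[OF nc yP(1)] .
  note E = Zv.pts_place[OF yp]
  have d: "evh Z thZ y (dl i j) (rval (dl i j) (nu y))" if "i < n" "j < n" for i j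
   using ev_up[OF yp de_ev[OF nc x that]] unfolding de_rval[OF nc x that] .
  have "evh Z thZ y (q * dl k l - dl i j) (plr k l (pl' y) i j * rval (dl k l) (nu y) - rval (dl i j) (nu y))"
   by (rule fconst.place_diff[OF E place_mult[OF E q[OF y] d[OF kl]] d[OF ij]])
  thus ?thesis using plr_de[OF nc yP kl ij] by simp
 qed
 have "q * dl k l - dl i j = 0"
 proof (rule Zf.rval_zero_imp[OF oZ])
  show "?Z <= Zf.rdom (q * dl k l - dl i j)" "?Z ~= {}" using zero z unfolding Zf.ev_iff by auto
  show "Zf.rval (q * dl k l - dl i j) x = 0" if "x : ?Z" for x using zero[OF that] unfolding Zf.ev_iff by simp
 qed
 hence "dl i j / dl k l = q" using dl_nonzero[OF z kl] by (simp add: field_simps)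
 thus ?thesis using q z by simp
qed

text \<open>The echelon basis of the plane lifts the chart to frames, and the entries of the lift
  are coordinates \<open>c\<close> and ratios of brackets. A regular function, locally a quotient of
  polynomials in frame entries, is thus a quotient of polynomials in these.\<close>

lemma nash_pgen:
 assumes z: "z : preim Z nu U" "pl' z : plc k l" and kl: "k < n" "l < n" and q: "evh Z thZ z q a"
 shows "q : pgen fconst (c ` {..<n} Un {dl i j / dl k l | i j. i < n & j < n}) (evh Z thZ z)"
proof -
 let ?P = "preim Z nu U" and ?cl = "ktop (Kn_Gr 2 n) closure_of gauss_graph 2 n V"
 obtain N f where f: "z : N" "kreg (hat Z) N f" "thZ N f = q" using q unfolding ev_def by blast
 have oP: "opn (hat Z) ?P" using P_open[OF nc] by simp
 have oN: "opn (hat Z) N" by (rule ringed_open[OF ringed_Z f(2)])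
 have oNP: "opn (hat Z) (N Int ?P)" using oN oP by (rule openin_Int)
 have "kreg (hat Z) (N Int ?P) f" by (rule ringed_restrict[OF ringed_Z f(2) oNP]) blast
 hence k1: "kreg (induced (hat Z) ?P) (N Int ?P) f" using kreg_induced_open[OF ringed_Z oP] by simp
 have RP: "ringed (induced (hat Z) ?P)" by (rule ringed_induced[OF ringed_Z])
 define g where "g = (%y. f (inv_into ?P ps y))"
 have k2: "kreg (induced (Kn_Gr 2 n) ?cl) (ps ` (N Int ?P)) g"
  using iso_kreg_image[OF iso[OF nc] RP k1] unfolding affine_nash_def pts_P[OF nc] g_def .
 define fr where "fr y = mkframe n (ph (nu y)) (%i. plr k l (pl' y) i l) (%i. plr k l (pl' y) k i)" for y
 have fr: "fr y : pts (frames 2 n)" "frame_proj 2 n (fr y) = ps y" if y: "y : ?P" "pl' y : plc k l" for y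
 proof -
  note nf = plc_normal_frame[OF y(2) pl_Gr[OF nc y(1)]]
  have 1: "frame_point n (fr y) = ph (nu y)" "frame_span 2 n (fr y) = pl' y"
   using nf U_Kn[OF nc P_U[OF nc y(1)]] by (simp_all add: fr_def frame_span_lin2 mkframe_simps)
  thus "fr y : pts (frames 2 n)" using pl_Gr[OF nc y(1)] by (simp add: pts_frames fr_def mkframe_Kn)
  show "frame_proj 2 n (fr y) = ps y" using 1 ps_pair[OF nc y(1)] by (simp add: frame_proj_def)
 qed
 have zN: "frame_proj 2 n (fr z) : ps ` (N Int ?P)" using fr(2)[OF z] f(1) z(1) by simp
 obtain G H where GH: "G : pols (3 * n)" "H : pols (3 * n)" "pev H (fr z) ~= 0"
  and GHv: "!!y. y : pts (frames 2 n) ==> pev H y ~= 0 ==> frame_proj 2 n y : ?cl ==>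
   frame_proj 2 n y : ps ` (N Int ?P) & g (frame_proj 2 n y) = pev G y / pev H y"
  by (rule kreg_nash_local[OF k2 fr(1)[OF z] zN]) blast
 \<comment> \<open>The field elements whose values are the entries of the lifted frame
   \<open>fr\<close>.\<close>
 define C where "C t = (if t < n then c t else if t < 2 * n then dl (t - n) l / dl k l else dl k (t - 2 * n) / dl k l)" for t
 let ?A = "c ` {..<n} Un {dl i j / dl k l | i j. i < n & j < n}"
 have CA: "C t : ?A" if "t < 3 * n" for t
 proof -
  consider "t < n" | "~ t < n" "t < 2 * n" "t - n < n" | "~ t < n" "~ t < 2 * n" "t - 2 * n < n" using `t < 3 * n` by linarith
  thus ?thesis by cases (insert kl, auto simp: C_def)
 qed
 have Cev: "evh Z thZ y (C t) (fr y t)" if y: "y : ?P" "pl' y : plc k l" and t: "t < 3 * n" for y t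
 proof -
  consider "t < n" | "~ t < n" "t < 2 * n" "t - n < n" | "~ t < n" "~ t < 2 * n" "t - 2 * n < n" using t by linarith
  thus ?thesis
  proof cases
   case 1
   have "evh Z thZ y (c t) (ph (nu y) t)"
    by (rule ev_up[OF P_pts[OF nc y(1)] ccoordsD(1)[OF co[OF nc] P_U[OF nc y(1)] 1]])
   thus ?thesis using 1 by (simp add: C_def fr_def mkframe_def)
  next
   case 2
   thus ?thesis using ev_ratio[OF y kl 2(3) kl(2)] by (simp add: C_def fr_def mkframe_def)
  next
   case 3
   thus ?thesis using ev_ratio[OF y kl kl(1) 3(3)] t by (simp add: C_def fr_def mkframe_def)
  qed
 qed
 let ?h = "peval fconst H C"
 let ?Z = "{z : ?P. pl' z : plc k l}"
 have hev: "evh Z thZ y (peval fconst F C) (pev F (fr y))" if "F : pols (3 * n)" "y : ?Z" for F y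
  by (rule fconst.place_peval[OF Zv.pts_place that(1) Cev]) (use that P_pts[OF nc] in auto)
 define O' where "O' = {y : N Int ?Z. Zf.rval ?h y ~= 0}"
 have sub: "?Z <= Zf.rdom ?h" and hval: "!!y. y : ?Z ==> Zf.rval ?h y = pev H (fr y)"
  using hev[OF GH(2)] unfolding Zf.ev_iff by auto
 have oNZ: "opn (hat Z) (N Int ?Z)" using oN open_plc[OF nc kl] by auto
 have "kreg (hat Z) (N Int ?Z) (Zf.rval ?h)" by (rule Zf.kreg_rval_subset[OF oNZ]) (use sub in blast)
 hence oO: "opn (hat Z) O'" unfolding O'_def by (rule ringed_nonzero[OF ringed_Z])
 have zO: "z : O'" using z f(1) hval[of z] GH(3) by (simp add: O'_def)
 have zero: "evh Z thZ y (q * ?h - peval fconst G C) 0" if y: "y : O'" for y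
 proof -
  have yZ: "y : ?Z" "y : ?P" "pl' y : plc k l" "y : N" and H: "pev H (fr y) ~= 0"
   using y hval[of y] by (auto simp: O'_def)
  have "ps y : ?cl" by (rule ps_cl(1)[OF nc yZ(2)])
  hence "g (ps y) = pev G (fr y) / pev H (fr y)" using GHv[OF fr(1)[OF yZ(2,3)] H] fr(2)[OF yZ(2,3)] by simp
  moreover have "g (ps y) = f y" unfolding g_def using inv_into_f_f[OF ps_inj[OF nc] yZ(2)] by simp
  ultimately have v: "f y * pev H (fr y) - pev G (fr y) = 0" using H by simp
  note E = Zv.pts_place[OF P_pts[OF nc yZ(2)]]
  have "evh Z thZ y q (f y)" using Zf.evI[OF f(2) yZ(4)] unfolding f(3) .
  from fconst.place_diff[OF E place_mult[OF E this hev[OF GH(2) yZ(1)]] hev[OF GH(1) yZ(1)]]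
  show ?thesis unfolding v .
 qed
 have "q * ?h - peval fconst G C = 0"
 proof (rule Zf.rval_zero_imp[OF oO])
  show "O' <= Zf.rdom (q * ?h - peval fconst G C)" "O' ~= {}" using zero zO unfolding Zf.ev_iff by auto
  show "Zf.rval (q * ?h - peval fconst G C) x = 0" if "x : O'" for x using zero[OF that] unfolding Zf.ev_iff by simp
 qed
 hence qe: "q * ?h = peval fconst G C" by simp
 show ?thesis by (rule fconst.pgen_pol[OF GH(2,1) CA Zv.pts_place[OF P_pts[OF nc z(1)]] Cev[OF z] GH(3) qe])
qed

end

text \<open>The points below agree since \<open>X\<close> is separated. The common place assigns
  residues to the ratios of brackets of both charts; the two ratios of the reference brackets are
  inverse to each other, so both planes lie in one chart of the Grassmannian and have equal
  coordinates there.\<close>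

lemma Z_separated: "Zv.separated" unfolding Zv.separated_def
proof (intro allI impI)
 fix z z' E'
 assume z: "z : pts Z" "z' : pts Z" and E': "place fconst E'"
  and zE: "ALL q a. evh Z thZ z q a --> E' q a" and zE': "ALL q a. evh Z thZ z' q a --> E' q a"
 have "nu z = nu z'"
 proof (rule sep[unfolded separated_def, rule_format, OF nu_pts[OF z(1)] nu_pts[OF z(2)] E'])
  show "E' q a" if "evh X th (nu z) q a" for q a using ev_up[OF z(1) that] zE by blast
  show "E' q a" if "evh X th (nu z') q a" for q a using ev_up[OF z(2) that] zE' by blast
 qed
 obtain U n V ph ps c where nc: "nash_chart U n V ph ps c" and zP: "z : preim Z nu U" using cover[OF z(1)] by blast
 have zP': "z' : preim Z nu U" using zP z(2) `nu z = nu z'` by (simp add: preim_def)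
 let ?W = "snd (ps z)" and ?W' = "snd (ps z')" and ?d = "%i j. bracket (c i) (c j)"
 have Gr: "?W : Gr 2 n" "?W' : Gr 2 n" using pl_Gr[OF nc] zP zP' by auto
 obtain k l where kl: "k < n" "l < n" "?W : plc k l" using Gr2_plc[OF Gr(1)] .
 obtain k' l' where kl': "k' < n" "l' < n" "?W' : plc k' l'" using Gr2_plc[OF Gr(2)] .
 have d0: "?d k l ~= 0" "?d k' l' ~= 0" using dl_nonzero[OF nc zP kl(3,1,2)] dl_nonzero[OF nc zP' kl'(3,1,2)] .
 have e: "E' (?d i j / ?d k l) (plr k l ?W i j)" if "i < n" "j < n" for i j
  using ev_ratio[OF nc zP kl(3,1,2) that] zE by blast
 have e': "E' (?d i j / ?d k' l') (plr k' l' ?W' i j)" if "i < n" "j < n" for i j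
  using ev_ratio[OF nc zP' kl'(3,1,2) that] zE' by blast
 define a where "a = plr k' l' ?W' k l"
 have "E' (?d k' l' / ?d k l * (?d k l / ?d k' l')) (plr k l ?W k' l' * a)"
  unfolding a_def by (rule place_mult[OF E' e[OF kl'(1,2)] e'[OF kl(1,2)]])
 hence "E' 1 (plr k l ?W k' l' * a)" using d0 by simp
 hence "plr k l ?W k' l' * a = 1" using place_unique[OF E' _ fconst.place_1[OF E']] by blast
 hence a0: "a ~= 0" by auto
 have W': "?W' : plc k l" using plc_change(1)[OF kl'(3)] a0 unfolding a_def by blast
 have "?W = ?W'"
 proof (rule plc_eqI_Gr[OF kl(3) Gr(1) W' Gr(2) _ kl(1,2)])
  fix i j assume ij: "i < n" "j < n"
  have "E' ((?d i j / ?d k' l') / (?d k l / ?d k' l')) (plr k' l' ?W' i j / a)"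
   unfolding a_def by (rule fconst.place_divide[OF E' e'[OF ij] e'[OF kl(1,2)]]) (insert a0, simp add: a_def)
  hence "E' (?d i j / ?d k l) (plr k' l' ?W' i j / a)" using d0 by simp
  hence "plr k l ?W i j = plr k' l' ?W' i j / a" using place_unique[OF E' e[OF ij]] by blast
  also have "... = plr k l ?W' i j" unfolding a_def by (rule plc_change(2)[OF kl'(3), symmetric]) (insert a0, simp add: a_def)
  finally show "plr k l ?W i j = plr k l ?W' i j" .
 qed
 hence "ps z = ps z'" using ps_pair[OF nc zP] ps_pair[OF nc zP'] `nu z = nu z'` by simp
 thus "z = z'" using inj_onD[OF ps_inj[OF nc] _ zP zP'] by blast
qed

lemma Z_generators:
 assumes z: "z : pts Z"
 shows "EX n c k l. nash_generators (evh X th (nu z)) (evh Z thZ z) n c k l"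
proof -
 obtain U n V ph ps c where nc: "nash_chart U n V ph ps c" and zP: "z : preim Z nu U" using cover[OF z] by blast
 obtain k l where kl: "k < n" "l < n" "snd (ps z) : plc k l" using Gr2_plc[OF pl_Gr[OF nc zP]] .
 have x: "nu z : U" by (rule P_U[OF nc zP])
 note cc = ccoordsD[OF co[OF nc]]
 have 1: "c ` {..<n} <= pdom (evh X th (nu z))" using cc(1)[OF x] by (auto simp: pdom_def)
 have 2: "pdom (evh X th (nu z)) <= pgen fconst (c ` {..<n}) (evh X th (nu z))"
  by (rule chart_pgen[OF co[OF nc] x nu_pts[OF z]])
 have 3: "bracket (c i) (c j) / bracket (c k) (c l) : pdom (evh Z thZ z)" if "i < n" "j < n" for i j
  by (rule pdomI[of "evh Z thZ z", OF ev_ratio[OF nc zP kl(3,1,2) that]])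
 have 4: "pdom (evh Z thZ z) <=
   pgen fconst (c ` {..<n} Un {bracket (c i) (c j) / bracket (c k) (c l) | i j. i < n & j < n}) (evh Z thZ z)"
  using nash_pgen[OF nc zP kl(3,1,2)] by (auto elim!: pdomE)
 show ?thesis unfolding nash_generators_def by (rule exI[of _ n], rule exI[of _ c], rule exI[of _ k], rule exI[of _ l])
   (intro conjI allI impI 1 2 3 4 kl(1,2) dl_nonzero[OF nc zP kl(3,1,2)])
qed

lemma Z_variety_field: "variety_field fconst Z thZ" by unfold_locales

end

end

subsection \<open>The function field of a normalization\<close>

lemma kreg_induced_cong:
 assumes "kreg (induced X S) W f" "!!x. x : W ==> f x = g x"
 shows "kreg (induced X S) W g" using assms unfolding kreg_induced by (metis IntD2)

text \<open>The residues of the coordinate functions determine a point of an affine chart.\<close>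

lemma (in variety_field) common_place_affine:
 assumes c: "affine_chart X U n V ph" and xy: "x : U" "y : U" and E': "place e E'"
  and x: "!!q a. evh X th x q a ==> E' q a" and y: "!!q a. evh X th y q a ==> E' q a"
 shows "x = y"
proof -
 note ch = affine_chart_hat[OF variety c]
 obtain c where co: "ccoords U n V ph c" using ccoordinates[OF ch] xy by blast
 have "ph x k = ph y k" if "k < n" for k
  using place_unique[OF E' x[OF ccoordsD(1)[OF co xy(1) that]] y[OF ccoordsD(1)[OF co xy(2) that]]] .
 moreover have "ph x : Kn n" "ph y : Kn n" using affine_chart_Kn[OF ringed ch] xy by auto
 ultimately have "ph x i = ph y i" for i by (cases "i < n") (auto simp: Kn_def)
 thus ?thesis using inj_onD[OF affine_chart_inj[OF ringed ch] _ xy] by blast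
qed

lemma (in variety_field) root_closed_ev:
 assumes sep: separated and normal: "normal_at X y" and y: "y : pts X"
 shows "root_closed (evh X th y)"
proof -
 have r: "q : pdom (evh X th y) <-> y : rdom q" for q by (auto simp: pdom_def rdom_def)
 show ?thesis unfolding root_closed_def r using normal_root[OF sep normal y] by blast
qed

locale normalization_step = variety_field "fconst :: 'k::alg_closed_field => 'k rat2" Z th
 for Z :: "('b, 'k::alg_closed_field) kspace" and th +
 fixes Y :: "('a, 'k) kspace" and et :: "'a => 'b" and U
 assumes norm: "normalization Z Y et" and sepZ: "separated" and Y_ne: "pts Y ~= {}"
  and U_open: "opn Z U" and U_dense: "ktop Y closure_of preim Y et U = pts Y"
  and U_iso: "isomorphism (induced Y (preim Y et U)) (induced Z U) et"
begin

lemma mor: "morphism Y Z et" and fin: "finite_morphism Y Z et" and varY: "variety Y"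
 and normalY: "y : pts Y ==> normal_at Y y"
 using norm by (auto simp: normalization_def finite_morphism_def normal_variety_def)

abbreviation "Q \<equiv> preim Y et U"

lemma ringed_Y: "ringed (hat Y)" by (rule ringed_hat[OF varY])

lemma mor_hat: "morphism (hat Y) (hat Z) et" by (rule morphism_hat[OF mor sheaf variety_sheaf[OF varY]])

lemma Q_open: "opn Y Q" using morphism_open[OF mor U_open] by (simp add: preim_def)

lemma pts_Q: "pts (induced Y Q) = Q" and pts_U: "pts (induced (hat Z) U) = U"
 using openin_subset[OF Q_open] openin_subset[OF U_open] by auto

definition t :: "'b => 'a" where "t = inv_into Q et"

lemma et_inj: "inj_on et Q" and et_image: "et ` Q = U"
 using iso_inj[OF U_iso] openin_subset[OF U_open] unfolding pts_Q by auto

lemma t_et: "y : Q ==> t (et y) = y" unfolding t_def by (rule inv_into_f_f[OF et_inj])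

lemma t_Q: "z : U ==> t z : Q" and et_t: "z : U ==> et (t z) = z"
 unfolding t_def using inv_into_into[of z et Q] f_inv_into_f[of z et Q] et_image by auto

lemma t_preimage: "{z : U. t z : G} = et ` (G Int Q)"
proof (intro equalityI subsetI)
 fix z assume "z : {z : U. t z : G}"
 thus "z : et ` (G Int Q)" using t_Q et_t by (intro image_eqI[of _ _ "t z"]) auto
next
 fix z assume "z : et ` (G Int Q)"
 then obtain y where "y : G" "y : Q" "z = et y" by blast
 thus "z : {z : U. t z : G}" using t_et et_image by auto
qed

lemma image_open: "opn Y G ==> opn Z (et ` (G Int Q))"
proof -
 assume "opn Y G"
 hence "opn (induced Y Q) (G Int Q)" by (auto simp: openin_subtopology)
 from iso_open_image[OF U_iso this] show ?thesis using openin_open_subtopology[OF U_open] by simp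
qed

lemma kreg_t:
 assumes g: "kreg Y W g"
 shows "kreg (hat Z) (et ` (W Int Q)) (%z. g (t z))"
proof -
 have oW: "opn Y W" by (rule function_sheaf_open[OF variety_sheaf[OF varY] g])
 have 1: "kreg (induced Y Q) (W Int Q) g" by (rule kreg_induced_subset[OF g oW])
 have p: "preim (induced Y Q) et (et ` (W Int Q)) = W Int Q" by (rule iso_preim_image[OF U_iso]) (use pts_Q in auto)
 have o: "opn (induced Z U) (et ` (W Int Q))"
  using image_open[OF oW] et_image openin_open_subtopology[OF U_open] by auto
 have "kreg (induced Y Q) (W Int Q) ((%z. g (t z)) \<circ> et)" by (rule kreg_induced_cong[OF 1]) (use t_et in auto)
 hence "kreg (induced Z U) (et ` (W Int Q)) (%z. g (t z))" using U_iso o p unfolding isomorphism_def by metis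
 thus ?thesis by (rule kreg_induced_imp_hat[OF sheaf U_open])
qed

lemma t_morphism: "morphism (induced (hat Z) U) (hat Y) t"
proof (rule morphismI, unfold pts_U)
 show "t z : pts (hat Y)" if "z : U" for z using t_Q[OF that] by (simp add: preim_def)
 show op: "opn (induced (hat Z) U) {z : U. t z : W}" if "opn (hat Y) W" for W
  unfolding t_preimage using image_open[of W] that openin_open_subtopology[OF U_open] et_image by auto
 show "kreg (induced (hat Z) U) {z : U. t z : W} (%z. f (t z))" if f: "kreg (hat Y) W f" for W f
 proof -
  have oW: "opn (hat Y) W" by (rule ringed_open[OF ringed_Y f])
  have "kreg (hat Z) {z : U. t z : W} (%z. f (t z))"
  proof (rule kreg_hat_glue)
   show "opn Z {z : U. t z : W}" unfolding t_preimage using image_open[of W] oW by simp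
   fix z assume z: "z : {z : U. t z : W}"
   then obtain N W' g where N: "opn Y N" "t z : N" "N <= W'" "kreg Y W' g" "ALL y:N. f y = g y"
    using f unfolding kreg_hat by blast
   have "kreg (hat Z) (et ` (N Int Q)) (%z. g (t z))"
    by (rule ringed_restrict[OF ringed kreg_t[OF N(4)]]) (use image_open[OF N(1)] N(3) in auto)
   hence "kreg (hat Z) (et ` (N Int Q)) (%z. f (t z))" by (rule ringed_cong[OF ringed]) (use N(5) t_et in auto)
   moreover have "z : et ` (N Int Q)" using z N(2) unfolding t_preimage[symmetric] by simp
   ultimately show "EX N. z : N & kreg (hat Z) N (%z. f (t z))" by (intro exI[of _ "et ` (N Int Q)"] conjI)
  qed
  thus ?thesis using kreg_induced_open[OF ringed, of U] U_open by auto
 qed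
qed

lemma t_dense:
 assumes G: "opn (hat Y) G" "G ~= {}"
 shows "EX z:U. t z : G"
proof -
 have oG: "opn Y G" using G(1) by simp
 obtain y where y: "y : G" using G(2) by blast
 have "y : ktop Y closure_of Q" using U_dense y openin_subset[OF oG] by blast
 then obtain y' where y': "y' : Q" "y' : G" using oG y unfolding in_closure_of by blast
 thus ?thesis using t_et et_image by (intro bexI[of _ "et y'"]) auto
qed

lemma U_ne: "U ~= {}" using t_dense[of "pts (hat Y)"] Y_ne by auto

definition thY :: "'a set => ('a => 'k) => 'k rat2" where "thY W f = th {z : U. t z : W} (%z. f (t z))"

lemma U_open_hat: "opn (hat Z) U" using U_open by simp

lemma Y_ffield: "ffield fconst (hat Y) thY" unfolding thY_def[abs_def]
 by (rule pull_ffield[OF ringed_Y U_open_hat U_ne t_morphism t_dense])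

interpretation Yf: ffield fconst "hat Y" thY by (rule Y_ffield)

interpretation Yv: variety_field fconst Y thY by unfold_locales (rule varY)

lemma Y_variety_field: "variety_field fconst Y thY" by unfold_locales

lemma ev_up:
 assumes y: "y : pts Y" and q: "evh Z th (et y) q a"
 shows "evh Y thY y q a" unfolding thY_def[abs_def]
 by (rule pull_ev[OF U_open_hat U_ne mor_hat _ _ q]) (insert t_Q et_t y, auto simp: preim_def)

text \<open>The images in \<open>Z\<close> agree by separatedness there, and both points lie in the
  preimage of an affine open set, which is affine because the morphism is finite.\<close>

lemma Y_separated: "Yv.separated" unfolding Yv.separated_def
proof (intro allI impI)
 fix y y' E'
 assume y: "y : pts Y" "y' : pts Y" and E': "place fconst E'"
  and e: "ALL q a. evh Y thY y q a --> E' q a" "ALL q a. evh Y thY y' q a --> E' q a"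
 have et: "et y : pts Z" "et y' : pts Z" using morphism_maps[OF mor] y by auto
 have eq: "et y = et y'"
 proof (rule sepZ[unfolded separated_def, rule_format, OF et E'])
  show "E' q a" if "evh Z th (et y) q a" for q a using ev_up[OF y(1) that] e(1) by blast
  show "E' q a" if "evh Z th (et y') q a" for q a using ev_up[OF y(2) that] e(2) by blast
 qed
 obtain Z' where Z': "affine_open Z Z'" "et y : Z'" using variety_cover[OF variety et(1)] by blast
 have "affine_open Y (preim Y et Z')" using fin Z'(1) unfolding finite_morphism_def by blast
 then obtain n V ph where c: "affine_chart Y (preim Y et Z') n V ph" unfolding affine_open_def by blast
 have "y : preim Y et Z'" "y' : preim Y et Z'" using y Z'(2) eq by (auto simp: preim_def)
 from Yv.common_place_affine[OF c this E'] show "y = y'" using e by blast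
qed

lemma Y_root_closed: "y : pts Y ==> root_closed (evh Y thY y)" using Yv.root_closed_ev[OF Y_separated normalY] by blast

text \<open>The module generators of the finite morphism over an affine neighbourhood become the
  \<open>b j\<close>, and the coordinates of its affine preimage become \<open>G\<close>.\<close>

lemma Y_finite:
 assumes y: "y : pts Y"
 shows "EX N b G. finite_generators (evh Z th (et y)) (evh Y thY y) N b G"
proof -
 have ety: "et y : pts Z" by (rule morphism_maps[OF mor y])
 obtain Z' where Z': "affine_open Z Z'" "et y : Z'" using variety_cover[OF variety ety] by blast
 let ?P = "preim Y et Z'"
 note fin' = fin[unfolded finite_morphism_def, THEN conjunct2, rule_format, OF Z'(1)]
 have aP: "affine_open Y ?P" by (rule fin'[THEN conjunct1])
 obtain B where B0: "finite B & (ALL b:B. kreg Y ?P b) & (ALL f. kreg Y ?P f -->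
   (EX a. (ALL b:B. kreg Z Z' (a b)) & (ALL y:?P. f y = (SUM b:B. a b (et y) * b y))))" using fin'[THEN conjunct2] ..
 note B = B0[THEN conjunct1] B0[THEN conjunct2, THEN conjunct1] B0[THEN conjunct2, THEN conjunct2, rule_format]
 obtain n V ph where c: "affine_chart Y ?P n V ph" using aP unfolding affine_open_def by blast
 note ch = affine_chart_hat[OF varY c]
 have yP: "y : ?P" using y Z'(2) by (simp add: preim_def)
 hence ne: "?P ~= {}" by blast
 obtain C where co: "Yf.ccoords ?P n V ph C" using Yf.ccoordinates[OF ch ne] by blast
 have P1: "?P = {x : ?P. pev (pconst 1) (ph x) ~= 0}" by simp
 obtain cc m where al: "Yv.afflike ?P cc m" using Yv.afflike_chart[OF Y_separated ch pols_pconst P1 ne co] by blast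
 have oP: "opn (hat Y) ?P" by (rule affine_chart_open[OF ringed_Y ch])
 obtain h where h: "bij_betw h {0..<card B} B" using ex_bij_betw_nat_finite[OF B(1)] by blast
 let ?N = "card B"
 define b where "b j = thY ?P (h j)" for j
 have hB: "h j : B" if "j < ?N" for j using bij_betwE[OF h] that by auto
 have bev: "evh Y thY x (b j) (h j x)" if "j < ?N" "x : ?P" for j x
  unfolding b_def by (rule Yf.evI[OF kreg_imp_hat[OF variety_sheaf[OF varY] B(2)[rule_format, OF hB[OF that(1)]]] that(2)])
 \<comment> \<open>\<open>finite_morphism\<close> speaks of sections in the original structure, so
   it is applied to elements with domain exactly \<open>?P\<close>.\<close>
 have exact: "EX a. (ALL l<?N. a l : pdom (evh Z th (et y))) & q = (SUM l<?N. a l * b l)" if q: "Yf.rdom q = ?P" for q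
 proof -
  have "kreg Y ?P (Yf.rval q)" using Yv.kreg_original[of q] q by simp
  from B(3)[OF this] obtain a where a: "ALL b:B. kreg Z Z' (a b)" "ALL x:?P. Yf.rval q x = (SUM b:B. a b (et x) * b x)" by blast
  define A where "A l = th Z' (a (h l))" for l
  have Aev: "evh Z th z (A l) (a (h l) z)" if "l < ?N" "z : Z'" for l z
   unfolding A_def by (rule evI[OF kreg_imp_hat[OF sheaf a(1)[rule_format, OF hB[OF that(1)]]] that(2)])
  have zero: "evh Y thY x (q - (SUM l<?N. A l * b l)) 0" if x: "x : ?P" for x
  proof -
   have xp: "x : pts Y" and xZ: "et x : Z'" using x by (auto simp: preim_def)
   note E = Yv.pts_place[OF xp]
   have "evh Y thY x (A l * b l) (a (h l) (et x) * h l x)" if "l < ?N" for l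
    by (rule place_mult[OF E ev_up[OF xp Aev[OF that xZ]] bev[OF that x]])
   hence s: "evh Y thY x (SUM l<?N. A l * b l) (SUM l<?N. a (h l) (et x) * h l x)"
    by (intro fconst.place_sum[OF E]) simp
   have "evh Y thY x q (Yf.rval q x)" using q x by (intro Yf.ev_rval) simp
   from fconst.place_diff[OF E this s] have "evh Y thY x (q - (SUM l<?N. A l * b l)) (Yf.rval q x - (SUM l<?N. a (h l) (et x) * h l x))" .
   moreover have "(SUM l<?N. a (h l) (et x) * h l x) = (SUM b:B. a b (et x) * b x)"
    using sum.reindex_bij_betw[OF h, of "%b. a b (et x) * b x"] by (simp add: atLeast0LessThan)
   ultimately show ?thesis using a(2) x by simp
  qed
  have "q - (SUM l<?N. A l * b l) = 0"
  proof (rule Yf.rval_zero_imp[OF oP _ ne])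
   show "?P <= Yf.rdom (q - (SUM l<?N. A l * b l))" using zero unfolding Yf.ev_iff by blast
   show "Yf.rval (q - (SUM l<?N. A l * b l)) x = 0" if "x : ?P" for x using zero[OF that] unfolding Yf.ev_iff by simp
  qed
  moreover have "A l : pdom (evh Z th (et y))" if "l < ?N" for l
   by (rule pdomI[of "evh Z th (et y)", OF Aev[OF that Z'(2)]])
  ultimately show ?thesis by (intro exI[of _ A]) simp
 qed
 \<comment> \<open>The general case is a difference of two such elements.\<close>
 have mod: "EX a. (ALL l<?N. a l : pdom (evh Z th (et y))) & q = (SUM l<?N. a l * b l)" if q: "?P <= Yf.rdom q" for q
 proof -
  obtain q1 q2 where q12: "q = q1 - q2" "Yf.rdom q1 = ?P" "Yf.rdom q2 = ?P" by (rule Yv.exact_split[OF al q])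
  obtain a1 where a1: "ALL l<?N. a1 l : pdom (evh Z th (et y))" "q1 = (SUM l<?N. a1 l * b l)" using exact[OF q12(2)] by blast
  obtain a2 where a2: "ALL l<?N. a2 l : pdom (evh Z th (et y))" "q2 = (SUM l<?N. a2 l * b l)" using exact[OF q12(3)] by blast
  have "q = (SUM l<?N. (a1 l - a2 l) * b l)" unfolding q12(1) a1(2) a2(2) by (simp add: left_diff_distrib sum_subtractf)
  thus ?thesis using a1(1) a2(1) fconst.pdom_diff[OF pts_place[OF ety]] by (intro exI[of _ "%l. a1 l - a2 l"]) auto
 qed
 \<comment> \<open>Not all generators are zero, since 1 is a combination of them.\<close>
 have b0: "EX j<?N. b j ~= 0"
 proof (rule ccontr)
  assume "~ ?thesis"
  hence z: "b j = 0" if "j < ?N" for j using that by blast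
  have "?P <= Yf.rdom 1" using Yv.rdom_1 by (auto simp: preim_def)
  then obtain a where "1 = (SUM l<?N. a l * b l)" using mod by blast
  thus False using z by simp
 qed
 have Crd: "x : Yf.rdom (C k)" if "x : ?P" "k < n" for x k using Yf.ccoordsD(1)[OF co that] by (auto simp: Yf.ev_iff)
 have brd: "x : Yf.rdom (b j)" if "x : ?P" "j < ?N" for x j using bev[OF that(2,1)] by (auto simp: Yf.ev_iff)
 have G: "EX a. (ALL l<?N. a l : pdom (evh Z th (et y))) & g * b j = (SUM l<?N. a l * b l)"
  if "g : C ` {..<n}" "j < ?N" for g j by (rule mod) (use that Yv.rdom_mult[OF Crd brd] in blast)
 have gen: "pdom (evh Y thY y) <= pgen fconst (C ` {..<n}) (evh Y thY y)" by (rule Yv.chart_pgen[OF co yP y])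
 show ?thesis unfolding finite_generators_def
  by (rule exI[of _ ?N], rule exI[of _ b], rule exI[of _ "C ` {..<n}"]) (intro conjI b0 gen ballI allI impI G)
qed

end

text \<open>The bound \<open>M\<close> drops by 1 with each step; points with a regular cone are
  exempt from it and lead to regular cones again.\<close>

theorem nash_normalization_step:
 fixes X :: "('a, 'k::alg_closed_field) kspace" and Z :: "('b, 'k) kspace" and Y :: "('c, 'k) kspace"
 assumes X: "toric_variety X th" and nash: "nash_blowup 2 X Z nu" and norm: "normalization Z Y et" and ne: "pts Y ~= {}"
  and M: "!!x. x : pts X ==> EX u v. cone_place (evh X th x) u v & (det2 u v = 1 | cmeas u v <= M)"
 shows "EX th'. toric_variety Y th' &
  (ALL y:pts Y. EX u v. cone_place (evh Y th' y) u v & (det2 u v = 1 | cmeas u v <= M - 1))"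
proof -
 interpret X: toric_variety X th by (rule X)
 have varZ: "variety Z" and morZ: "morphism Z X nu" using nash by (auto simp: nash_blowup_def)
 interpret N: nash_step X th Z nu by unfold_locales (rule varZ, rule morZ)
 have morY: "morphism Y Z et" using norm by (auto simp: normalization_def finite_morphism_def)
 have cover: "EX U n V ph ps c. N.nash_chart U n V ph ps c & z : preim Z nu U" if z: "z : pts Z" for z
 proof -
  obtain \<U> where \<U>: "\<Union>\<U> = pts X" "ALL U:\<U>. EX n V ph ps. affine_chart X U n V ph &
     isomorphism (induced Z (preim Z nu U)) (affine_nash 2 n V) ps &
     (ALL z:preim Z nu U. fst (ps z) = ph (nu z))" using nash unfolding nash_blowup_def by blast
  have "nu z : \<Union>\<U>" unfolding \<U>(1) by (rule N.nu_pts[OF z])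
  then obtain U where U: "U : \<U>" "nu z : U" by blast
  obtain n V ph ps where 1: "affine_chart X U n V ph" "isomorphism (induced Z (preim Z nu U)) (affine_nash 2 n V) ps"
   "ALL z:preim Z nu U. fst (ps z) = ph (nu z)" using \<U>(2) U(1) by blast
  have Une: "U ~= {}" using U by blast
  obtain c where c: "X.ccoords U n V ph c" using X.ccoordinates[OF affine_chart_hat[OF X.variety 1(1)] Une] by blast
  have "N.nash_chart U n V ph ps c" unfolding N.nash_chart_def using 1 Une c by blast
  moreover have "z : preim Z nu U" using U(2) z by (simp add: preim_def)
  ultimately show ?thesis by blast
 qed
 obtain y0 where "y0 : pts Y" using ne by blast
 hence "et y0 : pts Z" by (rule morphism_maps[OF morY])
 from cover[OF this] obtain U0 n0 V0 ph0 ps0 c0 where nc0: "N.nash_chart U0 n0 V0 ph0 ps0 c0" by blast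
 obtain D where D: "N.gen_open U0 n0 V0 ph0 c0 D" using N.gen_open_exists[OF nc0] by blast
 define thZ where "thZ = N.thZ U0 n0 ph0 ps0 c0 D"
 interpret Zv: variety_field fconst Z thZ unfolding thZ_def by (rule N.Z_variety_field[OF nc0 D cover])
 have sepZ: "Zv.separated" unfolding thZ_def by (rule N.Z_separated[OF nc0 D cover])
 note upZ = N.ev_up[OF nc0 D cover, folded thZ_def]
 note genZ = N.Z_generators[OF nc0 D cover, folded thZ_def]
 obtain U where U: "opn Z U" "ktop Y closure_of preim Y et U = pts Y"
  "isomorphism (induced Y (preim Y et U)) (induced Z U) et"
  using norm unfolding normalization_def birational_morphism_def by blast
 interpret Y: normalization_step Z thZ Y et U
  by unfold_locales (rule norm, rule sepZ, rule ne, rule U(1), rule U(2), rule U(3))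
 interpret Yv: variety_field fconst Y Y.thY by (rule Y.Y_variety_field)
 have point: "EX u' v'. cone_place (evh Y Y.thY y) u' v' & (det2 u' v' = 1 | cmeas u' v' <= M - 1)"
  if y: "y : pts Y" for y
 proof -
  let ?z = "et y" and ?x = "nu (et y)"
  have z: "?z : pts Z" by (rule morphism_maps[OF morY y])
  have x: "?x : pts X" by (rule N.nu_pts[OF z])
  obtain u v where uv: "cone_place (evh X th ?x) u v" "det2 u v = 1 | cmeas u v <= M" using M[OF x] by blast
  hence uv': "primitive u" "primitive v" "0 < det2 u v" "toric_place (evh X th ?x) (cone2 u v)" by (auto simp: cone_place_def)
  obtain n c k l where gen: "nash_generators (evh X th ?x) (evh Z thZ ?z) n c k l" using genZ[OF _ z] by blast
  obtain N b G where fin: "finite_generators (evh Z thZ ?z) (evh Y Y.thY y) N b G" using Y.Y_finite[OF y] by blast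
  have "EX u' v'. primitive u' & primitive v' & 0 < det2 u' v' & toric_place (evh Y Y.thY y) (cone2 u' v') &
   (det2 u' v' = 1 | cmeas u' v' < cmeas u v)"
  proof (rule toric_nash_step[OF uv' Zv.pts_place[OF z] _ Yv.pts_place[OF y] Y.ev_up[OF y] gen Y.Y_root_closed[OF y] fin])
   show "evh Z thZ ?z q a" if "evh X th ?x q a" for q a using upZ[OF _ z that] by blast
  qed
  then obtain u' v' where u': "cone_place (evh Y Y.thY y) u' v'" "det2 u' v' = 1 | cmeas u' v' < cmeas u v"
   by (auto simp: cone_place_def)
  have "det2 u' v' = 1 | cmeas u' v' <= M - 1" using uv(2)
  proof
   assume "det2 u v = 1"
   \<comment> \<open>A regular cone has measure at most 3, so a smaller measure leaves only
     determinant 1.\<close>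
   hence "det2 u' v' = 1 | det2 u' v' <= 1" using u'(2) cmeas_bounds[of u v] cmeas_bounds[of u' v'] by auto
   thus ?thesis using u'(1) by (auto simp: cone_place_def)
  next
   assume "cmeas u v <= M"
   thus ?thesis using u'(2) by linarith
  qed
  thus ?thesis using u'(1) by blast
 qed
 have "toric_variety Y Y.thY" by unfold_locales (rule Y.Y_separated, use point in blast)
 thus ?thesis using point by blast
qed

subsection \<open>The function field of an affine toric surface\<close>

lemma hat_ringed:
 assumes X: "ringed X"
 shows "hat X = X"
proof -
 have "kreg (hat X) W f <-> kreg X W f" for W f
 proof
  assume f: "kreg (hat X) W f"
  show "kreg X W f"
  proof (rule ringed_glue[OF X])
   show "opn X W" using f by (simp add: kreg_hat)
   fix x assume "x : W"
   then obtain N W' g where N: "opn X N" "x : N" "N <= W'" "kreg X W' g" "ALL y:N. f y = g y"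
    using f unfolding kreg_hat by blast
   have "kreg X N f" by (rule ringed_cong[OF X ringed_restrict[OF X N(4,1,3)]]) (use N(5) in simp)
   thus "EX N. x : N & kreg X N f" using N(2) by blast
  qed
 next
  assume f: "kreg X W f"
  have o: "opn X W" by (rule ringed_open[OF X f])
  show "kreg (hat X) W f" unfolding kreg_hat using f o by blast
 qed
 thus ?thesis by (intro kspace.equality) (auto simp: fun_eq_iff)
qed

text \<open>An irreducible variety given by its generic point \<open>c\<close> in a field: its ideal
  is the kernel of evaluation at \<open>c\<close>. This takes the place of constructing a fraction
  field of the coordinate ring.\<close>

locale parametrized_variety = field_hom e for e :: "'k::field => 'r::field" +
 fixes n :: nat and V :: "(nat => 'k) set" and c :: "nat => 'r"
 assumes V_Kn: "V <= Kn n"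
  and vanish: "g : pols n ==> (ALL y:V. pev g y = 0) <-> peval e g c = 0"
begin

abbreviation "A \<equiv> affine_variety n V"

lemma RA: "ringed A" by (rule ringed_affine_variety)

lemma pts_A: "pts A = V" using V_Kn by (auto simp: affine_variety_def)

lemma open_A: "opn A W ==> x : W ==> EX f:pols n. pev f x ~= 0 & {y : V. pev f y ~= 0} <= W"
proof -
 assume W: "opn A W" and x: "x : W"
 obtain N where N: "zopn n N" "W = N Int V" using W by (auto simp: affine_variety_def openin_subtopology)
 obtain f where "f : pols n" "pev f x ~= 0" "{y : Kn n. pev f y ~= 0} <= N"
  using zariski_base[OF N(1), of x] x N(2) by blast
 thus ?thesis using V_Kn N(2) by blast
qed

lemma vanish_open:
 assumes W: "opn A W" "W ~= {}" and g: "g : pols n" and z: "!!y. y : W ==> pev g y = 0"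
 shows "peval e g c = 0"
proof -
 obtain x where x: "x : W" using W(2) by blast
 obtain f where f: "f : pols n" "pev f x ~= 0" "{y : V. pev f y ~= 0} <= W" using open_A[OF W(1) x] by blast
 have xV: "x : V" using x openin_subset[OF W(1)] pts_A by blast
 have "ALL y:V. pev (f * g) y = 0" using f(3) z by auto
 hence "peval e f c * peval e g c = 0" using vanish[of "f * g"] f(1) g by simp
 moreover have "peval e f c ~= 0" using vanish[OF f(1)] f(2) xV by blast
 ultimately show ?thesis by simp
qed

lemma irred_A:
 assumes "opn A B" "opn A C" "B ~= {}" "C ~= {}"
 shows "B Int C ~= {}"
proof
 assume BC: "B Int C = {}"
 obtain x where x: "x : B" using assms(3) by blast
 obtain f where f: "f : pols n" "pev f x ~= 0" "{y : V. pev f y ~= 0} <= B" using open_A[OF assms(1) x] by blast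
 have xV: "x : V" using x openin_subset[OF assms(1)] pts_A by blast
 have "pev f y = 0" if "y : C" for y using that f(3) BC openin_subset[OF assms(2)] pts_A by blast
 hence "peval e f c = 0" by (rule vanish_open[OF assms(2,4) f(1)])
 thus False using vanish[OF f(1)] f(2) xV by blast
qed

text \<open>A fraction on some nonempty open part of \<open>W\<close> determines \<open>q\<close>;
  irreducibility makes all such fractions equal in the field.\<close>

definition germ_rep :: "(nat => 'k) set => ((nat => 'k) => 'k) => 'r => bool" where
 "germ_rep W f q <-> (EX N g h. opn A N & N ~= {} & N <= W & g : pols n & h : pols n &
  (ALL y:N. pev h y ~= 0 & f y = pev g y / pev h y) & q * peval e h c = peval e g c)"

lemma nonvanish:
 assumes "h : pols n" "opn A N" "x : N" "pev h x ~= 0"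
 shows "peval e h c ~= 0" using vanish[OF assms(1)] assms(3,4) openin_subset[OF assms(2)] pts_A by blast

lemma germ_rep_at:
 assumes f: "kreg A W f" and x: "x : W"
 obtains N g h where "opn A N" "x : N" "N <= W" "g : pols n" "h : pols n"
  "!!y. y : N ==> pev h y ~= 0 & f y = pev g y / pev h y"
proof -
 have oW: "opn A W" by (rule ringed_open[OF RA f])
 obtain W' f' where W': "x : W'" "kreg (affine_space n) W' f'" "ALL y:W' Int W. f y = f' y"
  using f x unfolding affine_variety_def kreg_induced by blast
 obtain N g h where N: "zopn n N" "x : N" "g : pols n" "h : pols n"
  "ALL y:N. pev h y ~= 0 & (y : W' --> f' y = pev g y / pev h y)" using W'(1,2) unfolding kreg_asp_local by blast
 have oW': "zopn n W'" using W'(2) by (simp add: kreg_affine_space)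
 have "opn A (N Int W' Int V)" using openin_Int[OF N(1) oW'] by (auto simp: affine_variety_def openin_subtopology)
 hence o: "opn A (N Int W' Int V Int W)" using oW by (rule openin_Int)
 have "x : V" using x openin_subset[OF oW] pts_A by blast
 thus ?thesis by (intro that[OF o _ _ N(3,4)]) (use x W' N in auto)
qed

lemma germ_rep_exists:
 assumes f: "kreg A W f" and ne: "W ~= {}"
 shows "EX q. germ_rep W f q"
proof -
 obtain x where x: "x : W" using ne by blast
 obtain N g h where N: "opn A N" "x : N" "N <= W" "g : pols n" "h : pols n"
  "!!y. y : N ==> pev h y ~= 0 & f y = pev g y / pev h y" by (rule germ_rep_at[OF f x]) blast
 have "peval e h c ~= 0" by (rule nonvanish[OF N(5,1,2)]) (use N(2,6) in blast)
 hence "germ_rep W f (peval e g c / peval e h c)"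
  unfolding germ_rep_def using N by (intro exI[of _ N] exI[of _ g] exI[of _ h]) auto
 thus ?thesis ..
qed

lemma germ_rep_value:
 assumes q: "germ_rep W f q" and N': "opn A N'" "N' ~= {}" "N' <= W" and gh: "g' : pols n" "h' : pols n"
  and v: "!!y. y : N' ==> f y * pev h' y = pev g' y"
 shows "q * peval e h' c = peval e g' c"
proof -
 obtain N g h where N: "opn A N" "N ~= {}" "N <= W" "g : pols n" "h : pols n"
  "ALL y:N. pev h y ~= 0 & f y = pev g y / pev h y" "q * peval e h c = peval e g c"
  using q unfolding germ_rep_def by blast
 have ne: "N Int N' ~= {}" by (rule irred_A[OF N(1) N'(1) N(2) N'(2)])
 have "peval e (g * h' - g' * h) c = 0"
 proof (rule vanish_open[OF openin_Int[OF N(1) N'(1)] ne])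
  show "g * h' - g' * h : pols n" using N(4,5) gh by simp
  fix y assume y: "y : N Int N'"
  hence "pev g y = f y * pev h y" using N(6) by simp
  thus "pev (g * h' - g' * h) y = 0" using v[of y] y by (simp add: algebra_simps)
 qed
 hence e: "peval e g c * peval e h' c = peval e g' c * peval e h c" by simp
 obtain x where "x : N" using N(2) by blast
 hence h0: "peval e h c ~= 0" using nonvanish[OF N(5,1)] N(6) by blast
 have "(q * peval e h' c) * peval e h c = peval e g' c * peval e h c"
  unfolding e[symmetric] N(7)[symmetric] by (simp add: mult_ac)
 thus ?thesis using h0 by simp
qed

lemma germ_rep_unique:
 assumes "germ_rep W f q" "germ_rep W f q'"
 shows "q = q'"
proof -
 obtain N g h where N: "opn A N" "N ~= {}" "N <= W" "g : pols n" "h : pols n"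
  "ALL y:N. pev h y ~= 0 & f y = pev g y / pev h y" "q' * peval e h c = peval e g c"
  using assms(2) unfolding germ_rep_def by blast
 have "q * peval e h c = peval e g c" by (rule germ_rep_value[OF assms(1) N(1-5)]) (use N(6) in simp)
 moreover obtain x where "x : N" using N(2) by blast
 hence "peval e h c ~= 0" using nonvanish[OF N(5,1)] N(6) by blast
 ultimately show ?thesis using N(7) by (metis mult_right_cancel)
qed

definition germ :: "(nat => 'k) set => ((nat => 'k) => 'k) => 'r" where "germ W f = (SOME q. germ_rep W f q)"

lemma germ_rep_germ:
 assumes "kreg A W f" "W ~= {}"
 shows "germ_rep W f (germ W f)" unfolding germ_def by (rule someI_ex[OF germ_rep_exists[OF assms]])

lemma germ_eqI: "germ_rep W f q ==> germ W f = q"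
 unfolding germ_def by (rule some_equality) (auto intro: germ_rep_unique)

lemma germ_pair:
 assumes f: "kreg A W f" and f': "kreg A W f'" and ne: "W ~= {}"
 obtains N g h g' where "opn A N" "N ~= {}" "N <= W" "g : pols n" "g' : pols n" "h : pols n"
  "!!y. y : N ==> pev h y ~= 0 & f y = pev g y / pev h y & f' y = pev g' y / pev h y"
  "germ W f * peval e h c = peval e g c" "germ W f' * peval e h c = peval e g' c" "peval e h c ~= 0"
proof -
 obtain x where x: "x : W" using ne by blast
 obtain N g h where N: "opn A N" "x : N" "N <= W" "g : pols n" "h : pols n"
  "!!y. y : N ==> pev h y ~= 0 & f y = pev g y / pev h y" by (rule germ_rep_at[OF f x]) blast
 obtain N' g' h' where N': "opn A N'" "x : N'" "N' <= W" "g' : pols n" "h' : pols n"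
  "!!y. y : N' ==> pev h' y ~= 0 & f' y = pev g' y / pev h' y" by (rule germ_rep_at[OF f' x]) blast
 have o: "opn A (N Int N')" by (rule openin_Int[OF N(1) N'(1)])
 have ne': "N Int N' ~= {}" using N(2) N'(2) by blast
 have sub: "N Int N' <= W" using N(3) by blast
 have v: "pev (h * h') y ~= 0 & f y = pev (g * h') y / pev (h * h') y & f' y = pev (g' * h) y / pev (h * h') y"
  if "y : N Int N'" for y using N(6)[of y] N'(6)[of y] that by simp
 have p: "g * h' : pols n" "g' * h : pols n" "h * h' : pols n" using N(4,5) N'(4,5) by simp_all
 have vx: "pev (h * h') x ~= 0" and xN: "x : N Int N'" using v[of x] N(2) N'(2) by blast+
 show ?thesis
 proof (rule that[OF o ne' sub p v _ _ nonvanish[OF p(3) o xN vx]])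
  show "germ W f * peval e (h * h') c = peval e (g * h') c"
   by (rule germ_rep_value[OF germ_rep_germ[OF f ne] o ne' sub p(1,3)]) (use v in simp)
  show "germ W f' * peval e (h * h') c = peval e (g' * h) c"
   by (rule germ_rep_value[OF germ_rep_germ[OF f' ne] o ne' sub p(2,3)]) (use v in simp)
 qed
qed

lemma ffield_A: "ffield e A germ"
proof
 show "ringed A" by (rule RA)
 have "~ (ALL y:V. pev (pconst 1) y = 0)" using vanish[of "pconst 1"] by simp
 thus "pts A ~= {}" unfolding pts_A by auto
 show "B Int C ~= {}" if "opn A B" "opn A C" "B ~= {}" "C ~= {}" for B C by (rule irred_A) fact+
 show "germ W (%_. a) = e a" if "opn A W" "W ~= {}" for W a
  by (rule germ_eqI, unfold germ_rep_def, rule exI[of _ W], rule exI[of _ "pconst a"], rule exI[of _ "pconst 1"])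
   (use that in auto)
 have "germ W (%x. f x + f' x) = germ W f + germ W f' & germ W (%x. f x * f' x) = germ W f * germ W f'"
  if f: "kreg A W f" "kreg A W f'" "W ~= {}" for W f f'
 proof -
  obtain N g h g' where N: "opn A N" "N ~= {}" "N <= W" "g : pols n" "g' : pols n" "h : pols n"
   "!!y. y : N ==> pev h y ~= 0 & f y = pev g y / pev h y & f' y = pev g' y / pev h y"
   "germ W f * peval e h c = peval e g c" "germ W f' * peval e h c = peval e g' c" "peval e h c ~= 0"
   by (rule germ_pair[OF f]) blast
  have "germ_rep W (%x. f x + f' x) (germ W f + germ W f')"
   unfolding germ_rep_def by (rule exI[of _ N], rule exI[of _ "g + g'"], rule exI[of _ h])
    (insert N, simp add: add_divide_distrib distrib_right)
  moreover have "(germ W f * germ W f') * (peval e h c * peval e h c) = peval e g c * peval e g' c"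
   unfolding N(8,9)[symmetric] by (simp add: mult_ac)
  hence "germ_rep W (%x. f x * f' x) (germ W f * germ W f')"
   unfolding germ_rep_def by (intro exI[of _ N] exI[of _ "g * g'"] exI[of _ "h * h"]) (use N in simp)
  ultimately show ?thesis using germ_eqI by blast
 qed
 thus "kreg A W f ==> kreg A W f' ==> W ~= {} ==> germ W (%x. f x + f' x) = germ W f + germ W f'"
  "kreg A W f ==> kreg A W f' ==> W ~= {} ==> germ W (%x. f x * f' x) = germ W f * germ W f'" for W f f' by auto
 show "germ W' f = germ W f" if f: "kreg A W f" and W': "opn A W'" "W' <= W" "W' ~= {}" for W W' f
 proof (rule sym, rule germ_eqI)
  have "kreg A W' f" by (rule ringed_restrict[OF RA f W'(1,2)])
  from germ_rep_germ[OF this W'(3)] show "germ_rep W f (germ W' f)" unfolding germ_rep_def using W'(2) by blast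
 qed
 show "germ W f = germ W g" if "kreg A W f" "!!x. x : W ==> f x = g x" for W f g
 proof -
  have imp: "germ_rep W g' q" if e: "!!x. x : W ==> f' x = g' x" and r: "germ_rep W f' q" for f' g' q
  proof -
   obtain N a b where N: "opn A N" "N ~= {}" "N <= W" "a : pols n" "b : pols n"
    "ALL y:N. pev b y ~= 0 & f' y = pev a y / pev b y" "q * peval e b c = peval e a c"
    using r unfolding germ_rep_def by blast
   have "ALL y:N. pev b y ~= 0 & g' y = pev a y / pev b y" using N(3,6) e by (auto simp: subset_iff)
   with N show ?thesis unfolding germ_rep_def by (intro exI[of _ N] exI[of _ a] exI[of _ b] conjI)
  qed
  have "germ_rep W f q <-> germ_rep W g q" for q using imp[of f g q] imp[of g f q] that(2) by fastforce
  thus ?thesis by (simp add: germ_def)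
 qed
 show "f x = 0" if f: "kreg A W f" "germ W f = 0" "x : W" for W f x
 proof -
  obtain N g h where N: "opn A N" "x : N" "N <= W" "g : pols n" "h : pols n"
   "!!y. y : N ==> pev h y ~= 0 & f y = pev g y / pev h y" by (rule germ_rep_at[OF f(1,3)]) blast
  have ne: "W ~= {}" "N ~= {}" using f(3) N(2) by auto
  have "germ W f * peval e h c = peval e g c"
   by (rule germ_rep_value[OF germ_rep_germ[OF f(1) ne(1)] N(1) ne(2) N(3-5)]) (use N(6) in simp)
  hence "peval e g c = 0" using f(2) by simp
  hence "pev g x = 0" using vanish[OF N(4)] N(2) openin_subset[OF N(1)] pts_A by blast
  thus "f x = 0" using N(6)[OF N(2)] by simp
 qed
qed

lemma ev_A:
 assumes y: "y : V"
 shows "k < n ==> ev A germ y (c k) (y k)"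
  and "ev A germ y q a ==> q : pgen e (c ` {..<n}) (ev A germ y)"
proof -
 interpret F: ffield e A germ by (rule ffield_A)
 have yA: "y : pts A" using y pts_A by simp
 have ne: "V ~= {}" using y by blast
 have o: "opn A V" using openin_topspace[of "ktop A"] unfolding pts_A .
 show 1: "ev A germ y (c k) (y k)" if k: "k < n" for k
 proof -
  have "germ_rep V (%y. y k) (c k)"
   unfolding germ_rep_def using o ne k by (intro exI[of _ V] exI[of _ "pvar k"] exI[of _ "pconst 1"]) simp
  hence "germ V (%y. y k) = c k" by (rule germ_eqI)
  thus ?thesis using F.evI[OF kreg_coordinate[OF k V_Kn] y] by simp
 qed
 show "q : pgen e (c ` {..<n}) (ev A germ y)" if q: "ev A germ y q a" for q a
 proof -
  obtain W f where f: "y : W" "kreg A W f" "germ W f = q" using q unfolding ev_def by blast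
  obtain N g h where N: "opn A N" "y : N" "N <= W" "g : pols n" "h : pols n"
   "!!x. x : N ==> pev h x ~= 0 & f x = pev g x / pev h x" by (rule germ_rep_at[OF f(2,1)]) blast
  have ne': "W ~= {}" "N ~= {}" using f(1) N(2) by auto
  have "germ W f * peval e h c = peval e g c"
   by (rule germ_rep_value[OF germ_rep_germ[OF f(2) ne'(1)] N(1) ne'(2) N(3-5)]) (use N(6) in simp)
  hence e: "q * peval e h c = peval e g c" using f(3) by simp
  have h: "pev h y ~= 0" using N(6)[OF N(2)] by blast
  show ?thesis by (rule pgen_pol[OF N(5,4) _ F.place_ev[OF yA] 1 h e]) auto
 qed
qed

end

lemma peval_mon:
 assumes g: "g : pols n"
 shows "peval fconst g (%k. mon (gga k)) = (tor (toric_hom n gga g) :: 'k::field rat2)"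
proof -
 have zero: "lattice_comb n gga (%i. int (lookup m i)) = (SUM i:keys m. scale (int (lookup m i)) (gga i))"
  if "keys m <= {..<n}" for m unfolding lattice_comb_def scale_def
  by (rule sum.mono_neutral_right) (insert that, auto simp: in_keys_iff zero_prod_def)
 have mon_sum: "mon (sum f I) = (PROD i:I. mon (f i) :: 'k rat2)" for f :: "nat => int \<times> int" and I
  by (induction I rule: infinite_finite_induct) (auto simp: mon_add)
 have tor_sum: "tor (sum f I) = (SUM i:I. tor (f i) :: 'k rat2)" for f :: "(nat \<Rightarrow>\<^sub>0 nat) => _" and I
  by (induction I rule: infinite_finite_induct) (auto simp: tor_add)
 have "(PROD i:keys m. mon (gga i) ^ lookup m i) = (mon (lattice_comb n gga (%i. int (lookup m i))) :: 'k rat2)"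
  if "m : keys g" for m
 proof -
  have "keys m <= {..<n}" using g that by (auto simp: pols_def)
  thus ?thesis by (simp add: zero mon_sum mon_scale)
 qed
 thus ?thesis by (simp add: peval_def toric_hom_def tor_sum tor_single)
qed

lemma infinite_alg_closed: "infinite (UNIV :: 'k::alg_closed_field set)" by (rule alg_closed_infinite)

text \<open>One direction is the definition of the toric ideal. For the other, the torus points lie
  on the variety, and a Laurent polynomial that vanishes on the torus over an infinite field is
  zero.\<close>

lemma toric_surface_parametrized:
 fixes gga :: "nat => int \<times> int"
 shows "parametrized_variety (fconst :: 'k::alg_closed_field => 'k rat2) n (zero_locus n (toric_ideal n gga)) (%k. mon (gga k))"
proof
 show "zero_locus n (toric_ideal n gga) <= (Kn n :: (nat => 'k) set)" by (auto simp: zero_locus_def)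
 fix g :: "'k pol" assume g: "g : pols n"
 show "(ALL y:zero_locus n (toric_ideal n gga). pev g y = 0) <-> peval fconst g (%k. mon (gga k)) = 0"
  unfolding peval_mon[OF g] tor_eq_0_iff
 proof
  assume "toric_hom n gga g = 0"
  hence "g : toric_ideal n gga" using g by (simp add: toric_ideal_def)
  thus "ALL y:zero_locus n (toric_ideal n gga). pev g y = 0" by (simp add: zero_locus_def)
 next
  assume z: "ALL y:zero_locus n (toric_ideal n gga). pev g y = 0"
  define val where "val x y a = (SUM m:keys a. lookup a m * (x powi fst m * y powi snd m))"
   for x y :: 'k and a :: "(int \<times> int) \<Rightarrow>\<^sub>0 'k"
  have val_super: "val x y a = (SUM m:M. lookup a m * (x powi fst m * y powi snd m))"
   if "finite M" "keys a <= M" for x y a M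
   unfolding val_def by (rule sum.mono_neutral_left) (insert that, auto simp: in_keys_iff)
  have val_add: "val x y (a + b) = val x y a + val x y b" for x y a b
  proof -
   let ?M = "keys a Un keys b"
   have "keys (a + b) <= ?M" by (rule keys_add)
   thus ?thesis by (simp add: val_super[of ?M] lookup_add distrib_right sum.distrib)
  qed
  have val_0: "val x y 0 = 0" for x y by (simp add: val_def)
  have val_sum: "val x y (sum f I) = (SUM i:I. val x y (f i))" for x y and f :: "(nat \<Rightarrow>\<^sub>0 nat) => _" and I
   by (induction I rule: infinite_finite_induct) (auto simp: val_add val_0)
  have val_single: "val x y (single m a) = a * (x powi fst m * y powi snd m)" for x y m a by (simp add: val_def)
  \<comment> \<open>Evaluation at the torus point given by \<open>x\<close>, \<open>y\<close>
    factors through the Laurent ring, where it becomes \<open>val x y\<close>.\<close>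
  have pt: "pev f (%k. if k < n then x powi fst (gga k) * y powi snd (gga k) else 0) = val x y (toric_hom n gga f)"
   if xy: "x ~= 0" "y ~= 0" and f: "f : pols n" for x y f
  proof -
   have hom: "x powi fst (sum h I) * y powi snd (sum h I) = (PROD i:I. x powi fst (h i) * y powi snd (h i))"
    for h :: "nat => int \<times> int" and I
    by (induction I rule: infinite_finite_induct) (auto simp: power_int_add xy mult_ac)
   have "(PROD i:keys m. (if i < n then x powi fst (gga i) * y powi snd (gga i) else 0) ^ lookup m i) =
     x powi fst (lattice_comb n gga (%i. int (lookup m i))) * y powi snd (lattice_comb n gga (%i. int (lookup m i)))"
    if m: "m : keys f" for m
   proof -
    have sub: "keys m <= {..<n}" using f m by (auto simp: pols_def)
    have "x powi fst (lattice_comb n gga (%i. int (lookup m i))) * y powi snd (lattice_comb n gga (%i. int (lookup m i)))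
      = (PROD i<n. x powi (int (lookup m i) * fst (gga i)) * y powi (int (lookup m i) * snd (gga i)))"
     unfolding lattice_comb_def hom by simp
    also have "... = (PROD i:keys m. x powi (int (lookup m i) * fst (gga i)) * y powi (int (lookup m i) * snd (gga i)))"
     by (rule prod.mono_neutral_right) (insert sub, auto simp: in_keys_iff)
    also have "... = (PROD i:keys m. (if i < n then x powi fst (gga i) * y powi snd (gga i) else 0) ^ lookup m i)"
     by (rule prod.cong) (insert sub, auto simp: power_mult_distrib power_int_power' mult.commute[of "int _"])
    finally show ?thesis ..
   qed
   thus ?thesis by (simp add: pol_eval_def toric_hom_def val_sum val_single)
  qed
  show "toric_hom n gga g = 0"
  proof (rule laurent_zeroI[OF infinite_alg_closed])
   fix x y :: 'k assume xy: "x ~= 0" "y ~= 0"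
   let ?p = "%k. if k < n then x powi fst (gga k) * y powi snd (gga k) else 0"
   have "?p : zero_locus n (toric_ideal n gga)"
    unfolding zero_locus_def using pt[OF xy] val_0 by (auto simp: Kn_def toric_ideal_def)
   hence "val x y (toric_hom n gga g) = 0" using z pt[OF xy g] by simp
   thus "(SUM m:keys (toric_hom n gga g). lookup (toric_hom n gga g) m * (x powi fst m * y powi snd m)) = 0"
    by (simp add: val_def)
  qed
 qed
qed

subsection \<open>The initial cone\<close>

lemma primitive_part:
 assumes "m ~= (0 :: int \<times> int)"
 obtains g u where "0 < g" "m = scale g u" "primitive u"
proof -
 let ?g = "gcd (fst m) (snd m)"
 have g: "0 < ?g" using assms by (auto simp: prod_eq_iff)
 define u where "u = (fst m div ?g, snd m div ?g)"
 have m: "m = scale ?g u" by (simp add: u_def scale_def prod_eq_iff)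
 obtain x y where "x * fst m + y * snd m = ?g" using bezout_int by blast
 hence "?g * (x * fst u + y * snd u) = ?g * 1" using m by (simp add: prod_eq_iff scale_simps algebra_simps)
 moreover have "?g ~= 0" using g by linarith
 ultimately have "x * fst u + y * snd u = 1" using mult_left_cancel by blast
 hence "det2 u (- y, x) = 1" by (simp add: det2_def algebra_simps)
 hence "primitive u" unfolding primitive_def by blast
 thus ?thesis by (rule that[OF g m])
qed

lemma det2_lattice_comb: "det2 (lattice_comb n gga c) w = (SUM i<n. c i * det2 (gga i) w)"
proof -
 have "det2 (sum h I) w = (SUM i:I. det2 (h i) w)" for h :: "nat => int \<times> int" and I
  by (induction I rule: infinite_finite_induct) (auto simp: det2_add_left)
 thus ?thesis by (simp add: lattice_comb_def det2_def algebra_simps)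
qed

text \<open>If all determinants of generators vanished, so would that of \<open>(1, 0)\<close> and
  \<open>(0, 1)\<close>.\<close>

lemma independent_generators:
 assumes L: "generates_lattice n gga"
 obtains i j where "i < n" "j < n" "0 < det2 (gga i) (gga j)"
proof -
 obtain c where c: "(1, 0) = lattice_comb n gga c" using L unfolding generates_lattice_def by metis
 obtain d where d: "(0, 1) = lattice_comb n gga d" using L unfolding generates_lattice_def by metis
 have "EX i<n. EX j<n. det2 (gga i) (gga j) ~= 0"
 proof (rule ccontr)
  assume no: "~ ?thesis"
  have 1: "det2 (gga i) (0, 1) = 0" if "i < n" for i
   unfolding d det2_swap[of "gga i"] det2_lattice_comb using no that by simp
  have "det2 (1, 0) (0, 1) = 0" unfolding c det2_lattice_comb using 1 by simp
  thus False by (simp add: det2_def)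
 qed
 then obtain i j where ij: "i < n" "j < n" "det2 (gga i) (gga j) ~= 0" by blast
 thus ?thesis using that[of i j] that[of j i] det2_swap[of "gga i" "gga j"] by linarith
qed

lemma cone2_scale: "0 < g ==> 0 < h ==> cone2 (scale g u) (scale h v) = cone2 u v"
 by (auto simp: cone2_def det2_scale_left det2_scale_right zero_le_mult_iff)

text \<open>Take a cone spanned by two generators that contains the maximal number of generators.\<close>

lemma initial_cone:
 assumes L: "generates_lattice n gga"
 obtains u v i j g h where "primitive u" "primitive v" "0 < det2 u v" "i < n" "j < n" "0 < g" "0 < h"
  "gga i = scale g u" "gga j = scale h v" "!!k. k < n ==> gga k : cone2 u v | - gga k : cone2 u v"
proof -
 define S where "S = {(i, j). i < n & j < n & 0 < det2 (gga i) (gga j)}"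
 define N where "N p = card {k. k < n & gga k : cone2 (gga (fst p)) (gga (snd p))}" for p
 have "S <= {..<n} \<times> {..<n}" by (auto simp: S_def)
 hence fin: "finite S" by (rule finite_subset) simp
 obtain i0 j0 where "i0 < n" "j0 < n" "0 < det2 (gga i0) (gga j0)" by (rule independent_generators[OF L])
 hence ne: "S ~= {}" by (auto simp: S_def)
 have "Max (N ` S) : N ` S" by (rule Max_in) (use fin ne in auto)
 then obtain p where p: "p : S" "Max (N ` S) = N p" by auto
 have max: "N q <= N p" if "q : S" for q using Max_ge[of "N ` S" "N q"] fin that p(2) by auto
 obtain i j where ij: "p = (i, j)" by (cases p) auto
 have S: "i < n" "j < n" "0 < det2 (gga i) (gga j)" using p(1) by (auto simp: S_def ij)
 have "gga i ~= 0" "gga j ~= 0" using S(3) by auto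
 obtain g u where u: "0 < g" "gga i = scale g u" "primitive u" by (rule primitive_part[OF `gga i ~= 0`])
 obtain h v where v: "0 < h" "gga j = scale h v" "primitive v" by (rule primitive_part[OF `gga j ~= 0`])
 have uv: "0 < det2 u v"
  using S(3) u(1) v(1) by (simp add: u(2) v(2) det2_scale_left det2_scale_right zero_less_mult_iff)
 have cone: "cone2 (gga i) (gga j) = cone2 u v" unfolding u(2) v(2) by (rule cone2_scale[OF u(1) v(1)])
 have bad: False if q: "(a, b) : S" "cone2 u v <= cone2 (gga a) (gga b)" "k < n" "gga k : cone2 (gga a) (gga b)" "gga k ~: cone2 u v" for a b k
 proof -
  have "{k. k < n & gga k : cone2 u v} \<subset> {k. k < n & gga k : cone2 (gga a) (gga b)}" using q by blast
  hence "N p < N (a, b)" unfolding N_def ij fst_conv snd_conv cone by (intro psubset_card_mono) auto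
  thus False using max[OF q(1)] by simp
 qed
 have dich: "gga k : cone2 u v | - gga k : cone2 u v" if k: "k < n" for k
 proof (rule ccontr)
  assume no: "~ ?thesis"
  let ?w = "gga k"
  have neg: "det2 u (- ?w) = - det2 u ?w" "det2 (- ?w) v = - det2 ?w v" by (simp_all add: det2_def algebra_simps)
  \<comment> \<open>Outside the cone and its negative, \<open>?w\<close> lies beyond exactly one of
    the two edges; replacing this edge by \<open>?w\<close> enlarges the cone.\<close>
  have "(det2 u ?w < 0 & 0 < det2 ?w v) | (0 < det2 u ?w & det2 ?w v < 0)"
   using no unfolding cone2_def by (simp add: neg) linarith
  thus False
  proof (elim disjE conjE)
   assume w: "det2 u ?w < 0" "0 < det2 ?w v"
   have "(k, j) : S" using k S(2) w(2) v(1) by (simp add: S_def v(2) det2_scale_right)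
   moreover have c: "cone2 (gga k) (gga j) = cone2 ?w v" using cone2_scale[of 1 h ?w v] v by (simp add: scale_def)
   moreover have "cone2 u v <= cone2 ?w v"
   proof
    fix m assume m: "m : cone2 u v"
    have "det2 u v * det2 ?w m = det2 m v * det2 ?w u + det2 u m * det2 ?w v"
     using arg_cong[OF cramer[of u v m], of "det2 ?w"] by (simp add: det2_add_right det2_scale_right)
    also have "... >= 0"
     by (intro add_nonneg_nonneg mult_nonneg_nonneg) (insert m w det2_swap[of ?w u], auto simp: cone2_def)
    finally show "m : cone2 ?w v" using m uv by (simp add: cone2_def zero_le_mult_iff)
   qed
   moreover have "?w : cone2 ?w v" using w by (simp add: cone2_def)
   ultimately show False using bad[of k j k] k no by simp
  next
   assume w: "0 < det2 u ?w" "det2 ?w v < 0"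
   have "(i, k) : S" using k S(1) w(1) u(1) by (simp add: S_def u(2) det2_scale_left)
   moreover have c: "cone2 (gga i) (gga k) = cone2 u ?w" using cone2_scale[of g 1 u ?w] u by (simp add: scale_def)
   moreover have "cone2 u v <= cone2 u ?w"
   proof
    fix m assume m: "m : cone2 u v"
    have "det2 u v * det2 m ?w = det2 m v * det2 u ?w + det2 u m * det2 v ?w"
     using arg_cong[OF cramer[of u v m], of "%x. det2 x ?w"] by (simp add: det2_add_left det2_scale_left)
    also have "... >= 0"
     by (intro add_nonneg_nonneg mult_nonneg_nonneg) (insert m w det2_swap[of v ?w], auto simp: cone2_def)
    finally show "m : cone2 u ?w" using m uv by (simp add: cone2_def zero_le_mult_iff)
   qed
   moreover have "?w : cone2 u ?w" using w by (simp add: cone2_def)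
   ultimately show False using bad[of i k k] k no by simp
  qed
 qed
 show ?thesis by (rule that[OF u(3) v(3) uv S(1,2) u(1) v(1) u(2) v(2) dich])
qed

text \<open>The semigroup may contain lines, namely when the surface has a torus factor. Then some
  generators lie in the negative of the chosen cone; they and their inverses are regular, so they
  are units and lie in the localization.\<close>

lemma initial_cone_place:
 fixes E :: "'k::field rat2 => 'k => bool"
 assumes L: "generates_lattice n gga" and E: "place fconst E" and root: "root_closed E"
  and gga: "!!k. k < n ==> mon (gga k) : pdom E"
  and gen: "pdom E <= pgen fconst ((%k. mon (gga k)) ` {..<n}) E"
  and uv: "primitive u" "primitive v" "0 < det2 u v" "i < n" "j < n" "0 < g" "0 < h" "gga i = scale g u" "gga j = scale h v"
   "!!k. k < n ==> gga k : cone2 u v | - gga k : cone2 u v"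
 shows "cone_place E u v"
proof -
 let ?R = "{m. (mon m :: 'k rat2) : pdom E}"
 have pos: "mon (lattice_comb n gga c) : pdom E" if c: "!!i. 0 <= c i" for c
 proof -
  have "mon (SUM i:I. (c i * fst (gga i), c i * snd (gga i))) : pdom E" if "finite I" "I <= {..<n}" for I using that
  proof induction
   case empty
   show ?case using fconst.pdom_1[OF E] by simp
  next
   case (insert k I)
   obtain a where a: "c k = int a" using c[of k] by (rule nonneg_int_cases)
   have "mon (gga k) ^ a : pdom E"
    by (induction a) (use fconst.pdom_1[OF E] fconst.pdom_mult[OF E gga] insert(4) in auto)
   hence "mon (c k * fst (gga k), c k * snd (gga k)) : pdom E"
    using mon_scale[of a "gga k", where 'k = 'k] by (simp add: a scale_def)
   thus ?case using insert fconst.pdom_mult[OF E] by (simp add: mon_add)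
  qed
  from this[of "{..<n}"] show ?thesis by (simp add: lattice_comb_def)
 qed
 have shift: "EX m0. (mon m0 :: 'k rat2) : pdom E & (mon (m + m0) :: 'k rat2) : pdom E" for m
 proof -
  obtain c where c: "m = lattice_comb n gga c" using L unfolding generates_lattice_def by metis
  \<comment> \<open>Positive and negative parts of the coefficients write every monomial as a
    quotient of regular ones.\<close>
  have "m + lattice_comb n gga (%i. max 0 (- c i)) = lattice_comb n gga (%i. max 0 (c i))"
   unfolding c lattice_comb_def sum.distrib[symmetric] by (rule sum.cong) (auto simp: max_def algebra_simps)
  thus ?thesis using pos[of "%i. max 0 (- c i)"] pos[of "%i. max 0 (c i)"] by (intro exI conjI) auto
 qed
 have R: "sat ?R" by (rule sat_pdom[OF E root shift])
 have "u : ?R" by (rule sat_div[OF R uv(6)]) (use gga[OF uv(4)] uv(8) in simp)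
 moreover have "v : ?R" by (rule sat_div[OF R uv(7)]) (use gga[OF uv(5)] uv(9) in simp)
 ultimately have S: "cone2 u v <= ?R" using sat_cone[OF R _ _ uv(3)] by blast
 have "mon (gga k) : cloc (cone2 u v) E" if k: "k < n" for k using uv(10)[OF k]
 proof
  assume "gga k : cone2 u v"
  thus ?thesis by (intro KS_in_localization[OF E] KS_mon)
 next
  assume m: "- gga k : cone2 u v"
  obtain a where a: "E (mon (gga k)) a" using gga[OF k] by (rule pdomE)
  have "mon (- gga k) : pdom E" using S m by blast
  then obtain b where b: "E (mon (- gga k)) b" by (rule pdomE)
  have "(mon (gga k) * mon (- gga k) :: 'k rat2) = 1" by (simp add: mon_add[symmetric])
  hence "E 1 (a * b)" using place_mult[OF E a b] by simp
  hence b0: "b ~= 0" using place_unique[OF E _ fconst.place_1[OF E]] by fastforce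
  show ?thesis
   by (rule clocI[where E = E, OF KS_const[of "cone2 u v" 1] KS_mon[OF m] b b0]) (simp_all add: mon_uminus divide_inverse)
 qed
 hence G: "(%k. mon (gga k)) ` {..<n} <= cloc (cone2 u v) E" by auto
 have "pdom E <= cloc (cone2 u v) E"
 proof
  fix q assume "q : pdom E"
  from pgen_localization[OF E _ G subsetD[OF gen this]] show "q : cloc (cone2 u v) E" by blast
 qed
 hence "toric_place E (cone2 u v)" unfolding toric_place_def using E S by auto
 thus ?thesis unfolding cone_place_def using uv(1-3) by blast
qed

lemma toric_variety_iso:
 fixes A :: "('a, 'k::alg_closed_field) kspace" and X :: "('b, 'k) kspace"
 assumes A: "toric_variety A th" and RA: "ringed A" and iso: "isomorphism X A ph" and X: "variety X"
 obtains th' where "toric_variety X th'" "!!x. x : pts X ==> ph x : pts A & evh X th' x = evh A th (ph x)"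
proof -
 interpret A: toric_variety A th by (rule A)
 note sh = variety_sheaf[OF X]
 have RX: "ringed X"
  by (rule ringed_isomorphism[OF iso RA]) (use function_sheaf_open[OF sh] function_sheaf_cong[OF sh] in blast)+
 define s where "s = inv_into (pts X) ph"
 have inj: "inj_on ph (pts X)" "ph ` pts X = pts A" using iso_inj[OF iso] by auto
 have sph: "s (ph x) = x" if "x : pts X" for x unfolding s_def by (rule inv_into_f_f[OF inj(1) that])
 have s_pts: "s z : pts X" and phs: "ph (s z) = z" if "z : pts A" for z
  using inv_into_into[of z ph "pts X"] f_inv_into_f[of z ph "pts X"] inj(2) that unfolding s_def by auto
 have ms: "morphism (hat A) (hat X) s"
  unfolding s_def by (rule morphism_hat[OF morphism_inv_into[OF iso RX] sh A.sheaf])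
 have "continuous_map (ktop X) (ktop A) ph"
  using iso unfolding isomorphism_def by (auto dest: homeomorphic_imp_continuous_map)
 hence "morphism X A ph" using iso ringed_open[OF RA] unfolding morphism_def isomorphism_def by blast
 hence mph: "morphism (hat X) (hat A) ph" by (rule morphism_hat[OF _ A.sheaf sh])
 let ?D = "pts A"
 have D: "opn (hat A) ?D" "?D ~= {}" using A.nonempty by simp_all
 define th' where "th' W f = th {x : ?D. s x : W} (%x. f (s x))" for W f
 have msD: "morphism (induced (hat A) ?D) (hat X) s" by (rule morphism_comp[OF morphism_inclusion ms]) (rule A.r_open)
 have dense: "EX x:?D. s x : G" if G: "opn (hat X) G" "G ~= {}" for G
 proof -
  obtain y where y: "y : G" using G(2) by blast
  hence "y : pts X" using openin_subset[OF G(1)] by auto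
  thus ?thesis using y sph inj(2) by (intro bexI[of _ "ph y"]) auto
 qed
 have F: "ffield fconst (hat X) th'" unfolding th'_def[abs_def] by (rule A.pull_ffield[OF ringed_hat[OF X] D msD dense])
 interpret F: ffield fconst "hat X" th' by (rule F)
 interpret Xv: variety_field fconst X th' by unfold_locales (rule X)
 have evs: "ph x : pts A & evh X th' x = evh A th (ph x)" if x: "x : pts X" for x
 proof -
  have xA: "ph x : pts A" using inj(2) x by blast
  have "evh X th' x q a <-> evh A th (ph x) q a" for q a
  proof
   assume "evh A th (ph x) q a"
   thus "evh X th' x q a" unfolding th'_def[abs_def] by (rule A.pull_ev[OF D mph, rotated -1]) (use s_pts phs x in auto)
  next
   assume "evh X th' x q a"
   then obtain W f where f: "x : W" "kreg (hat X) W f" "th' W f = q" "f x = a" unfolding ev_def by blast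
   have k: "kreg (hat A) {z : ?D. s z : W} (%z. f (s z))" using morphism_kreg[OF ms f(2)] by simp
   from A.evI[OF k, of "ph x"] show "evh A th (ph x) q a" using f xA sph[OF x] by (simp add: th'_def)
  qed
  thus ?thesis using xA by (simp add: fun_eq_iff)
 qed
 have sep: "Xv.separated" unfolding Xv.separated_def
 proof (intro allI impI)
  fix x y E' assume xy: "x : pts X" "y : pts X" and E': "place fconst E'"
   and e: "ALL q a. evh X th' x q a --> E' q a" "ALL q a. evh X th' y q a --> E' q a"
  have "ph x = ph y"
   by (rule A.sep[unfolded A.separated_def, rule_format, of _ _ E']) (use evs[OF xy(1)] evs[OF xy(2)] E' e in auto)
  thus "x = y" using inj_onD[OF inj(1)] xy by blast
 qed
 have "toric_variety X th'" by unfold_locales (rule sep, use A.toric_hat evs in auto)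
 thus ?thesis using that evs by blast
qed

text \<open>Normality enters as closedness under roots, which saturates the exponents regular at a
  point. Therefore the cone found by \<open>initial_cone\<close>, which is independent of the point,
  describes every local ring.\<close>

theorem toric_surface_model:
 fixes gga :: "nat => int \<times> int" and X :: "('a, 'k::alg_closed_field) kspace"
 assumes L: "generates_lattice n gga"
  and norm: "normal_variety (toric_surface n gga :: (nat => 'k, 'k) kspace)"
  and iso: "isomorphic X (toric_surface n gga)" and X: "variety X"
 shows "EX th u v. toric_variety X th & (ALL x:pts X. cone_place (evh X th x) u v)"
proof -
 let ?V = "zero_locus n (toric_ideal n gga) :: (nat => 'k) set"
 interpret A: parametrized_variety "fconst :: 'k => 'k rat2" n ?V "%k. mon (gga k)" by (rule toric_surface_parametrized)
 let ?A = "affine_variety n ?V"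
 have RA: "ringed ?A" by (rule A.RA)
 have hatA: "hat ?A = ?A" by (rule hat_ringed[OF RA])
 have varA: "variety ?A" and normalA: "!!y. y : pts ?A ==> normal_at ?A y"
  using norm by (auto simp: toric_surface_def normal_variety_def)
 have F: "ffield fconst (hat ?A) A.germ" unfolding hatA by (rule A.ffield_A)
 interpret F: ffield fconst "hat ?A" A.germ by (rule F)
 interpret Av: variety_field fconst ?A A.germ by unfold_locales (rule varA)
 have evA: "evh ?A A.germ y (mon (gga k)) (y k)" if "y : pts ?A" "k < n" for y k
  unfolding hatA by (rule A.ev_A(1)) (use that A.pts_A in auto)
 have sep: "Av.separated" unfolding Av.separated_def
 proof (intro allI impI)
  fix x y E' assume xy: "x : pts ?A" "y : pts ?A" and E': "place fconst E'"
   and e: "ALL q a. evh ?A A.germ x q a --> E' q a" "ALL q a. evh ?A A.germ y q a --> E' q a"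
  have "x k = y k" if "k < n" for k
   using place_unique[OF E'] e(1)[rule_format, OF evA[OF xy(1) that]] e(2)[rule_format, OF evA[OF xy(2) that]] by blast
  moreover have "x : Kn n" "y : Kn n" using xy A.pts_A A.V_Kn by auto
  ultimately have "x k = y k" for k by (cases "k < n") (auto simp: Kn_def)
  thus "x = y" by blast
 qed
 obtain u v i j g h where uv: "primitive u" "primitive v" "0 < det2 u v" "i < n" "j < n" "0 < g" "0 < h"
  "gga i = scale g u" "gga j = scale h v" "!!k. k < n ==> gga k : cone2 u v | - gga k : cone2 u v"
  by (rule initial_cone[OF L]) blast
 have cp: "cone_place (evh ?A A.germ y) u v" if y: "y : pts ?A" for y
 proof (rule initial_cone_place[OF L Av.pts_place[OF y] _ _ _ uv])
  show "root_closed (evh ?A A.germ y)" by (rule Av.root_closed_ev[OF sep normalA[OF y] y])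
  show "mon (gga k) : pdom (evh ?A A.germ y)" if "k < n" for k by (rule pdomI[of "evh ?A A.germ y", OF evA[OF y that]])
  show "pdom (evh ?A A.germ y) <= pgen fconst ((%k. mon (gga k)) ` {..<n}) (evh ?A A.germ y)"
   unfolding hatA using A.ev_A(2) y unfolding A.pts_A by (auto elim!: pdomE)
 qed
 have TA: "toric_variety ?A A.germ" by unfold_locales (rule sep, use cp in blast)
 obtain ph where ph: "isomorphism X ?A ph" using iso by (auto simp: isomorphic_def toric_surface_def)
 obtain th' where th': "toric_variety X th'" "!!x. x : pts X ==> ph x : pts ?A & evh X th' x = evh ?A A.germ (ph x)"
  by (rule toric_variety_iso[OF TA RA ph X]) blast
 have "cone_place (evh X th' x) u v" if "x : pts X" for x using th'(2)[OF that] cp by simp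
 thus ?thesis using th'(1) by blast
qed

theorem theorem2:
  fixes p n :: nat
    and \<gamma> :: "nat \<Rightarrow> int \<times> int"
    and X :: "nat \<Rightarrow> ('a, 'k::alg_closed_field) kspace"
    and Z :: "nat \<Rightarrow> ('b, 'k) kspace"
    and \<nu> :: "nat \<Rightarrow> 'b \<Rightarrow> 'a"
    and \<eta> :: "nat \<Rightarrow> 'a \<Rightarrow> 'b"
  assumes "CHAR('k) = p" and "p > 0"
    and "generates_lattice n \<gamma>"
    and "normal_variety (toric_surface n \<gamma> :: (nat \<Rightarrow> 'k, 'k) kspace)"
    and "isomorphic (X 0) (toric_surface n \<gamma>)"
    and "\<And>i. nash_blowup 2 (X i) (Z i) (\<nu> i)"
    and "\<And>i. normalization (Z i) (X (Suc i)) (\<eta> i)"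
  shows "\<exists>m. nonsingular_variety 2 (X m)"
proof -
 have var: "variety (X i)" and equi: "equidimensional 2 (X i)" for i
  using assms(6)[of i] by (auto simp: nash_blowup_def)
 obtain th0 u0 v0 where base: "toric_variety (X 0) th0" "ALL x:pts (X 0). cone_place (ev (hat (X 0)) th0 x) u0 v0"
  using toric_surface_model[OF assms(3,4,5) var] by blast
 define M where "M = cmeas u0 v0"
 \<comment> \<open>The empty space is kept as an alternative because the step theorem needs a point
   to construct the function field.\<close>
 have main: "pts (X i) = {} | (EX th. toric_variety (X i) th &
   (ALL x:pts (X i). EX u v. cone_place (ev (hat (X i)) th x) u v & (det2 u v = 1 | cmeas u v <= M - int i)))" for i
 proof (induction i)
  case 0
  have "EX u v. cone_place (ev (hat (X 0)) th0 x) u v & (det2 u v = 1 | cmeas u v <= M - int 0)"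
   if "x : pts (X 0)" for x by (rule exI[of _ u0], rule exI[of _ v0]) (insert base that, simp add: M_def)
  thus ?case using base(1) by blast
 next
  case (Suc i)
  show ?case
  proof (cases "pts (X (Suc i)) = {}")
   case False
   have mZ: "morphism (Z i) (X i) (\<nu> i)" using assms(6)[of i] by (simp add: nash_blowup_def)
   have mY: "morphism (X (Suc i)) (Z i) (\<eta> i)" using assms(7)[of i] by (simp add: normalization_def finite_morphism_def)
   obtain y where "y : pts (X (Suc i))" using False by blast
   hence "pts (X i) ~= {}" using morphism_maps[OF mZ morphism_maps[OF mY]] by blast
   then obtain th where th: "toric_variety (X i) th"
    "ALL x:pts (X i). EX u v. cone_place (ev (hat (X i)) th x) u v & (det2 u v = 1 | cmeas u v <= M - int i)"
    using Suc.IH by blast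
   from nash_normalization_step[OF th(1) assms(6,7) False th(2)[rule_format]]
   obtain th' where "toric_variety (X (Suc i)) th'"
    "ALL y:pts (X (Suc i)). EX u v. cone_place (ev (hat (X (Suc i))) th' y) u v & (det2 u v = 1 | cmeas u v <= M - int i - 1)"
    by blast
   moreover have "M - int i - 1 = M - int (Suc i)" by simp
   ultimately show ?thesis by metis
  qed simp
 qed
 \<comment> \<open>Then \<open>M - int m <= 0\<close>, whereas every measure is at least twice a
   positive determinant; so all cones of \<open>X m\<close> are regular.\<close>
 define m where "m = nat M"
 have "EX U n V ph. x : U & affine_chart (X m) U n V ph & ph x ~: Sing 2 n V" if x: "x : pts (X m)" for x
 proof -
  obtain th where th: "toric_variety (X m) th"
   "ALL x:pts (X m). EX u v. cone_place (ev (hat (X m)) th x) u v & (det2 u v = 1 | cmeas u v <= M - int m)"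
   using main[of m] x by blast
  interpret T: toric_variety "X m" th by (rule th(1))
  obtain u v where uv: "cone_place (ev (hat (X m)) th x) u v" "det2 u v = 1 | cmeas u v <= M - int m"
   using th(2) x by blast
  have "M - int m <= 0" by (simp add: m_def)
  hence d1: "det2 u v = 1" and tp: "toric_place (ev (hat (X m)) th x) (cone2 u v)"
   using uv cmeas_bounds(1)[of u v] by (auto simp: cone_place_def)
  obtain U where U: "affine_open (X m) U" "x : U" using variety_cover[OF var x] by blast
  obtain n V ph where c: "affine_chart (X m) U n V ph" using U(1) by (auto simp: affine_open_def)
  note ch = affine_chart_hat[OF var c]
  obtain cc where co: "T.ccoords U n V ph cc" using T.ccoordinates[OF ch] U(2) by blast
  have "EX d1:Kn n. EX d2:Kn n. tsp n V (ph x) = lin2 d1 d2 & (EX k l. plu d1 d2 k l ~= 0)"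
   by (rule T.smooth_tangent[OF co _ U(2) tp d1]) (rule affine_chart_Kn[OF T.ringed ch])
  hence "kvec.dim (tsp n V (ph x)) = 2" using dim_lin2 by metis
  thus ?thesis using U(2) c by (auto simp: Sing_def)
 qed
 hence "nonsingular_variety 2 (X m)" unfolding nonsingular_variety_def using var equi by blast
 thus ?thesis ..
qed

end
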